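(* Let $\nu\in(-\frac12,\frac12)$. There exists a constant $C_\nu>0$ such that the following holds. Let $T>0$, $I:=(0,T)$, $K\in L^2(I^2;\mathbb{C})$ and let $C_K$ be such that, for all $u,v\in L^2((0,T);\mathbb{C})\cap\widetilde H^\nu((0,T);\mathbb{C})$, $$\left|\int_{I^2}K(s,t)u(s)\overline v(t)\,\mathrm{d}s\,\mathrm{d}t\right|\leq C_K\|u\|_{\widetilde H^\nu}\|v\|_{\widetilde H^\nu}.$$ Let $\chi\in W^{1,\infty}(I^2;\mathbb{C})$ vanish on the diagonal $\{s=t\}$, and assume that $\chi\in W^{2,\infty}(\Delta_+;\mathbb{C})$ and $\chi\in W^{2,\infty}(\Delta_-;\mathbb{C})$ (but not necessarily across the diagonal). Then, for all $u,v\in L^2((0,T);\mathbb{C})\cap\widetilde H^\nu((0,T);\mathbb{C})$, $$\left|\int_{I^2}\chi(s,t)K(s,t)u(s)\overline v(t)\,\mathrm{d}s\,\mathrm{d}t\right|\leq TC_KC_\nu\left(M_\chi+T\|\partial_{12}\chi\|_{L^\infty}\right)\|u\|_{\widetilde H^\nu}\|v\|_{\widetilde H^\nu},$$ where $M_\chi:=\sup_{t\in[0,T]}|\partial_2\chi(t-0,t)|+\sup_{t\in[0,T]}|\partial_1\chi(t+0,t)|$.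
   Context: $\Delta_\pm:=\{(s,t)\in(0,T)^2:\pm(t-s)>0\}$. $\partial_1,\partial_2$ are derivatives with respect to the first variable $s$ and second variable $t$; $\partial_2\chi(t-0,t)$ denotes the trace at the diagonal point $(t,t)$ of $\partial_2\chi$ taken from inside $\Delta_+$ (first variable tending to $t$ from below) and $\partial_1\chi(t+0,t)$ the trace of $\partial_1\chi$ taken from inside $\Delta_-$. $\|\partial_{12}\chi\|_{L^\infty}$ is the $L^\infty$ norm on $\Delta_+\cup\Delta_-$. $\widehat f(\omega):=\int_{\mathbb{R}}f(t)e^{-i\omega t}\mathrm{d}t$ and $\|f\|_{H^\nu(\mathbb{R})}:=\left(\frac1{2\pi}\int_{\mathbb{R}}(1+\omega^2)^{\nu}|\widehat f(\omega)|^2\mathrm{d}\omega\right)^{1/2}$. $\widetilde H^\nu((0,T);\mathbb{C})$ is the closure of $C^\infty_c((0,T);\mathbb{C})$ (extended by $0$) in $H^\nu(\mathbb{R};\mathbb{C})$; for $u\in L^2((0,T);\mathbb{C})\cap\widetilde H^\nu((0,T);\mathbb{C})$, $\|u\|_{\widetilde H^\nu}$ is the $H^\nu(\mathbb{R})$ norm of the extension of $u$ by $0$ to $\mathbb{R}$. *)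

theory Defs
  imports "HOL-Probability.Essential_Supremum"
begin

section \<open>Lebesgue spaces\<close>

text \<open>Elements of \<open>L\<^sup>2\<close> and \<open>L\<^sup>\<infinity>\<close> are represented by arbitrary Lebesgue measurable functions; their
  values off \<open>S\<close> are irrelevant.\<close>

definition L2 :: "'a::euclidean_space set \<Rightarrow> ('a \<Rightarrow> complex) set" where
  "L2 S = {f \<in> borel_measurable (lebesgue_on S). integrable (lebesgue_on S) (\<lambda>x. (cmod (f x))\<^sup>2)}"

definition Linf :: "'a::euclidean_space set \<Rightarrow> ('a \<Rightarrow> complex) set" where
  "Linf S = {f \<in> borel_measurable (lebesgue_on S).
     esssup (lebesgue_on S) (\<lambda>x. ereal (cmod (f x))) < \<infinity>}"

definition Linf_norm :: "'a::euclidean_space set \<Rightarrow> ('a \<Rightarrow> complex) \<Rightarrow> real" where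
  "Linf_norm S f = real_of_ereal (esssup (lebesgue_on S) (\<lambda>x. ereal (cmod (f x))))"

definition L1_loc :: "'a::euclidean_space set \<Rightarrow> ('a \<Rightarrow> complex) set" where
  "L1_loc S = {f. \<forall>C. compact C \<and> C \<subseteq> S \<longrightarrow> f absolutely_integrable_on C}"

section \<open>Test functions\<close>

primrec times_cont_diff :: "nat \<Rightarrow> ('a::real_normed_vector \<Rightarrow> 'b::real_normed_vector) \<Rightarrow> bool" where
  "times_cont_diff 0 f \<longleftrightarrow> continuous_on UNIV f"
| "times_cont_diff (Suc k) f \<longleftrightarrow>
     (\<forall>x. f differentiable at x) \<and> (\<forall>v. times_cont_diff k (\<lambda>x. frechet_derivative f (at x) v))"

text \<open>\<open>C\<^sub>c\<^sup>\<infinity>(S)\<close>, each function being already extended by \<open>0\<close> to the whole space.\<close>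

definition Cc_smooth :: "'a::euclidean_space set \<Rightarrow> ('a \<Rightarrow> 'b::real_normed_vector) set" where
  "Cc_smooth S = {\<phi>. (\<forall>k. times_cont_diff k \<phi>) \<and>
     compact (closure {x. \<phi> x \<noteq> 0}) \<and> closure {x. \<phi> x \<noteq> 0} \<subseteq> S}"

section \<open>Weak derivatives and the spaces \<open>W\<^bsup>k,\<infinity>\<^esup>\<close>\<close>

text \<open>\<open>g\<close> is the weak derivative of \<open>f\<close> in the direction \<open>v\<close> on the open set \<open>S\<close>. Real-valued test
  functions suffice by linearity.\<close>

definition has_weak_deriv ::
  "'a::euclidean_space set \<Rightarrow> 'a \<Rightarrow> ('a \<Rightarrow> complex) \<Rightarrow> ('a \<Rightarrow> complex) \<Rightarrow> bool" where
  "has_weak_deriv S v f g \<longleftrightarrow> f \<in> L1_loc S \<and> g \<in> L1_loc S \<and>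
     (\<forall>\<phi>::'a \<Rightarrow> real. \<phi> \<in> Cc_smooth S \<longrightarrow>
        (LINT x|lebesgue_on S. frechet_derivative \<phi> (at x) v *\<^sub>R f x) =
        - (LINT x|lebesgue_on S. \<phi> x *\<^sub>R g x))"

text \<open>The weak derivative is unique only up to a null set. Everything below (\<open>Linf_norm\<close>, \<open>bdry_trace\<close>,
  and \<open>weak_deriv\<close> itself) is insensitive to this choice.\<close>

definition weak_deriv ::
  "'a::euclidean_space set \<Rightarrow> 'a \<Rightarrow> ('a \<Rightarrow> complex) \<Rightarrow> ('a \<Rightarrow> complex)" where
  "weak_deriv S v f = (SOME g. has_weak_deriv S v f g)"

primrec Wkinf :: "nat \<Rightarrow> 'a::euclidean_space set \<Rightarrow> ('a \<Rightarrow> complex) set" where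
  "Wkinf 0 S = Linf S"
| "Wkinf (Suc k) S = {f \<in> Linf S. \<forall>v\<in>Basis. \<exists>g \<in> Wkinf k S. has_weak_deriv S v f g}"

text \<open>The value at \<open>p \<in> closure S\<close> of the continuous extension of (the class of) \<open>f\<close> to \<open>closure S\<close>.
  For open \<open>S\<close> the extension is unique if it exists; for open bounded convex \<open>S\<close> it exists for every
  \<open>f \<in> Wkinf 1 S\<close>, which has a Lipschitz representative.\<close>

definition bdry_trace :: "'a::euclidean_space set \<Rightarrow> ('a \<Rightarrow> complex) \<Rightarrow> 'a \<Rightarrow> complex" where
  "bdry_trace S f p = (THE z. \<exists>g. continuous_on (closure S) g \<and> (AE x in lebesgue_on S. g x = f x) \<and> g p = z)"

section \<open>Fractional Sobolev spaces on the line\<close>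

definition fourier :: "(real \<Rightarrow> complex) \<Rightarrow> real \<Rightarrow> complex" where
  "fourier f \<omega> = (LINT t|lebesgue. f t * exp (- \<i> * of_real (\<omega> * t)))"

text \<open>Only functions in \<open>L\<^sup>1(\<real>)\<close> are covered: for \<open>u \<in> L\<^sup>2((0,T))\<close> the extension by \<open>0\<close> is
  integrable, so the Fourier integral converges absolutely.\<close>

definition H_fun :: "real \<Rightarrow> (real \<Rightarrow> complex) set" where
  "H_fun \<nu> = {f. integrable lebesgue f \<and>
     integrable lebesgue (\<lambda>\<omega>. (1 + \<omega>\<^sup>2) powr \<nu> * (cmod (fourier f \<omega>))\<^sup>2)}"

definition H_norm :: "real \<Rightarrow> (real \<Rightarrow> complex) \<Rightarrow> real" where
  "H_norm \<nu> f =
     sqrt (1 / (2 * pi) * (LINT \<omega>|lebesgue. (1 + \<omega>\<^sup>2) powr \<nu> * (cmod (fourier f \<omega>))\<^sup>2))"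

definition ext_zero :: "real \<Rightarrow> (real \<Rightarrow> complex) \<Rightarrow> real \<Rightarrow> complex" where
  "ext_zero T u t = (if t \<in> {0<..<T} then u t else 0)"

text \<open>\<open>L\<^sup>2((0,T)) \<inter> H\<^sup>~\<^sup>\<nu>((0,T))\<close>, where the second space is the closure of \<open>C\<^sub>c\<^sup>\<infinity>((0,T))\<close> in the
  \<open>H\<^sup>\<nu>(\<real>)\<close> norm.\<close>

definition L2_Htilde :: "real \<Rightarrow> real \<Rightarrow> (real \<Rightarrow> complex) set" where
  "L2_Htilde \<nu> T = {u \<in> L2 {0<..<T}. ext_zero T u \<in> H_fun \<nu> \<and>
     (\<forall>\<epsilon>>0. \<exists>\<phi> \<in> Cc_smooth {0<..<T}. H_norm \<nu> (\<lambda>t. ext_zero T u t - \<phi> t) < \<epsilon>)}"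

definition Htilde_norm :: "real \<Rightarrow> real \<Rightarrow> (real \<Rightarrow> complex) \<Rightarrow> real" where
  "Htilde_norm \<nu> T u = H_norm \<nu> (ext_zero T u)"

section \<open>The square, its two triangles, and the quantities attached to the multiplier\<close>

definition square :: "real \<Rightarrow> (real \<times> real) set" where
  "square T = {0<..<T} \<times> {0<..<T}"

definition Delta_plus :: "real \<Rightarrow> (real \<times> real) set" where
  "Delta_plus T = {(s, t) \<in> square T. t - s > 0}"

definition Delta_minus :: "real \<Rightarrow> (real \<times> real) set" where
  "Delta_minus T = {(s, t) \<in> square T. - (t - s) > 0}"

definition kernel_form ::
  "real \<Rightarrow> (real \<times> real \<Rightarrow> complex) \<Rightarrow> (real \<Rightarrow> complex) \<Rightarrow> (real \<Rightarrow> complex) \<Rightarrow> complex" where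
  "kernel_form T K u v = (LINT (s, t)|lebesgue_on (square T). K (s, t) * u s * cnj (v t))"

abbreviation d1 :: "(real \<times> real) set \<Rightarrow> (real \<times> real \<Rightarrow> complex) \<Rightarrow> real \<times> real \<Rightarrow> complex" where
  "d1 S \<equiv> weak_deriv S (1, 0)"

abbreviation d2 :: "(real \<times> real) set \<Rightarrow> (real \<times> real \<Rightarrow> complex) \<Rightarrow> real \<times> real \<Rightarrow> complex" where
  "d2 S \<equiv> weak_deriv S (0, 1)"

definition M_chi :: "real \<Rightarrow> (real \<times> real \<Rightarrow> complex) \<Rightarrow> real" where
  "M_chi T chi =
     (SUP t\<in>{0..T}. cmod (bdry_trace (Delta_plus T) (d2 (Delta_plus T) chi) (t, t))) +
     (SUP t\<in>{0..T}. cmod (bdry_trace (Delta_minus T) (d1 (Delta_minus T) chi) (t, t)))"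

text \<open>The mixed derivative is taken in the open set \<open>\<Delta>\<^sub>+ \<union> \<Delta>\<^sub>-\<close>, so a possible singular part on the
  diagonal plays no role.\<close>

definition d12_norm :: "real \<Rightarrow> (real \<times> real \<Rightarrow> complex) \<Rightarrow> real" where
  "d12_norm T chi = (let S = Delta_plus T \<union> Delta_minus T in Linf_norm S (d1 S (d2 S chi)))"

end

theory Submission
  imports Defs "HOL-Probability.Characteristic_Functions" "HOL-Complex_Analysis.Great_Picard"
begin

text \<open>On \<open>\<Delta>\<^sub>+\<close> the multiplier is a superposition of products of half-line indicators,
  \<open>\<chi>(s,t) = \<integral> 1[s \<le> \<tau> < t] \<partial>\<^sub>2\<chi>(\<tau>-0,\<tau>) d\<tau> - \<integral>\<integral> 1[s \<le> \<sigma> \<le> \<tau> < t] \<partial>\<^sub>1\<^sub>2\<chi>(\<sigma>,\<tau>) d\<sigma> d\<tau>\<close>,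
  and similarly on \<open>\<Delta>\<^sub>-\<close>; so by Fubini it suffices that cutting off at a point is bounded on
  \<open>H\<^sup>\<nu>(\<real>)\<close> uniformly in the point. On the Fourier side the cut-off is convolution with
  \<open>1/(\<epsilon> + i\<omega>)\<close>. Conjugating it with the weight \<open>(1+|\<omega>|)\<^sup>\<nu>\<close> changes it by an operator whose kernel is
  bounded by \<open>max(X,Y)\<^bsup>|\<nu>|-1\<^esup> min(X,Y)\<^bsup>-|\<nu>|\<^esup>\<close>, \<open>X = 1+|\<omega>|\<close>, \<open>Y = 1+|\<eta>|\<close>; for
  \<open>|\<nu>| < 1/2\<close> this is bounded on \<open>L\<^sup>2\<close> by Schur's test. The representation of \<open>\<chi>\<close> is proved for
  mollifications that average over points pulled into the interior of the (convex) triangle, and passes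
  to the limit in the form.\<close>

section \<open>Fourier transform and Plancherel inequality\<close>

text \<open>\<open>fourier\<close> is an absolutely convergent integral, but the half-line indicator
  is not integrable, nor need the transform of an integrable function be. So the indicator is damped
  by an exponential and the transform by a Gaussian; the estimates are uniform in both parameters,
  and Fatou's lemma removes them together. In the conjugated cut-off the main term is multiplication
  by a function bounded by 1 between two Fourier transforms, and a one-sided Plancherel inequality
  applied twice controls it; only the commutator with the weight goes to Schur's test. As for
  \<chi>, its second derivatives are known up to null sets and inside open triangles, whereas the
  representation integrates along lines that reach the boundary. Mollification makes these integrals
  classical, but does not preserve the zeros on the diagonal, so the diagonal value is carried as a
  subtracted term until the limit. The factors T and T^2 are the length of the range of \<tau> and
  the area of a square containing all (\<sigma>,\<tau>). The final factor 8 is 2 times 2 for two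
  cut-offs and 2 for two triangles, each charged with the full mixed derivative.\<close>

lemma cnj_measurable[measurable]: "cnj \<in> borel_measurable borel"
  by (intro borel_measurable_continuous_onI continuous_intros)

lemma iexp_measurable[measurable]: "iexp \<in> borel_measurable borel"
  by (intro borel_measurable_continuous_onI continuous_intros)

text \<open>Integrals over \<open>lebesgue\<close> and \<open>lborel\<close> agree on Borel
  functions. All exchanges of integrals below take place over \<open>lborel\<close>, where the pair
  measure lemmas apply.\<close>

lemma fourier_lborel:
  assumes [measurable]: "f \<in> borel_measurable borel"
  shows "fourier f \<omega> = (LINT t|lborel. f t * iexp (- (\<omega> * t)))"
proof -
  have "fourier f \<omega> = (LINT t|lebesgue. f t * iexp (- (\<omega> * t)))"
    by (simp add: fourier_def)
  also have "\<dots> = (LINT t|lborel. f t * iexp (- (\<omega> * t)))"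
    by (rule integral_completion) measurable
  finally show ?thesis .
qed

lemma fourier_measurable[measurable]:
  assumes [measurable]: "f \<in> borel_measurable borel"
  shows "fourier f \<in> borel_measurable borel"
  unfolding fourier_lborel[OF assms] by measurable

lemma fourier_bound:
  assumes "f \<in> borel_measurable borel"
  shows "cmod (fourier f \<omega>) \<le> (LINT t|lborel. cmod (f t))"
  unfolding fourier_lborel[OF assms]
  by (rule order_trans[OF integral_norm_bound]) (simp add: norm_mult)

lemma gauss_integrable:
  assumes "s > 0"
  shows "integrable lborel (\<lambda>\<eta>::real. exp (- (s * \<eta>)\<^sup>2 / 2))"
proof -
  have "integrable lborel (\<lambda>\<eta>. (sqrt (2 * pi) / s) *  normal_density 0 (1/s) \<eta>)"
    using assms by simp
  moreover have "(sqrt (2 * pi) / s) * normal_density 0 (1/s) \<eta> = exp (- (s * \<eta>)\<^sup>2 / 2)" for \<eta>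
    using assms by (simp add: normal_density_def real_sqrt_divide power_divide real_sqrt_mult power_mult_distrib)
  ultimately show ?thesis by simp
qed

text \<open>This is the characteristic function of the standard normal law at y/s, after the
  substitution x = s \<eta>. The right side is 2\<pi> times a density because the integral is an
  inverse transform without its 1/(2\<pi>).\<close>

lemma gauss_fourier:
  assumes "s > 0"
  shows "(LINT \<eta>|lborel. of_real (exp (- (s * \<eta>)\<^sup>2 / 2)) * iexp (\<eta> * y)) = of_real (2 * pi * normal_density 0 s y)"
proof -
  have "of_real (exp (- (y/s)\<^sup>2 / 2)) = char std_normal_distribution (y/s)"
    by (simp add: char_std_normal_distribution)
  also have "\<dots> = (LINT x|lborel. std_normal_density x *\<^sub>R iexp (y/s * x))"
    unfolding char_def by (subst integral_density) auto
  also have "\<dots> = \<bar>s\<bar> *\<^sub>R (LINT x|lborel. std_normal_density (0 + s * x) *\<^sub>R iexp (y/s * (0 + s * x)))"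
    using assms by (intro lborel_integral_real_affine) simp
  also have "(\<lambda>x. std_normal_density (0 + s * x) *\<^sub>R iexp (y/s * (0 + s * x)))
     = (\<lambda>x. of_real (1 / sqrt (2 * pi)) * (of_real (exp (- (s * x)\<^sup>2 / 2)) * iexp (x * y)))"
    using assms by (auto simp: std_normal_density_def scaleR_conv_of_real mult.commute)
  finally have *: "of_real (exp (- (y/s)\<^sup>2 / 2)) = of_real (s / sqrt (2 * pi)) * (LINT \<eta>|lborel. of_real (exp (- (s * \<eta>)\<^sup>2 / 2)) * iexp (\<eta> * y))"
    using assms by (simp add: scaleR_conv_of_real)
  have "of_real (sqrt (2*pi) / s) * of_real (exp (- (y/s)\<^sup>2 / 2)) = (LINT \<eta>|lborel. of_real (exp (- (s * \<eta>)\<^sup>2 / 2)) * iexp (\<eta> * y))"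
    unfolding * using assms by simp
  moreover have "sqrt (2*pi) / s * exp (- (y/s)\<^sup>2 / 2) = 2 * pi * normal_density 0 s y"
    using assms unfolding normal_density_def 
    by (simp add: real_sqrt_mult field_simps)
  ultimately show ?thesis by (metis of_real_mult)
qed

lemma integrable_pair_mult:
  fixes f g :: "real \<Rightarrow> complex" and k :: "real \<times> real \<Rightarrow> complex"
  assumes f: "integrable lborel f" and g: "integrable lborel g"
    and [measurable]: "k \<in> borel_measurable (lborel \<Otimes>\<^sub>M lborel)" and k: "\<And>p. cmod (k p) \<le> B"
  shows "integrable (lborel \<Otimes>\<^sub>M lborel) (\<lambda>(x, y). f x * g y * k (x, y))"
proof -
  have [measurable]: "f \<in> borel_measurable borel" "g \<in> borel_measurable borel" using f g by auto
  have "integrable (lborel \<Otimes>\<^sub>M lborel) (\<lambda>(x, y). f x * g y)"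
    using f g by (intro lborel_pair.Fubini_integrable)
      (auto simp: norm_mult)
  then have "integrable (lborel \<Otimes>\<^sub>M lborel) (\<lambda>p. (case p of (x, y) \<Rightarrow> f x * g y) * of_real B)"
    by simp
  then show ?thesis
  proof (rule Bochner_Integration.integrable_bound)
    show "AE p in lborel \<Otimes>\<^sub>M lborel. norm (case p of (x, y) \<Rightarrow> f x * g y * k (x, y)) \<le> norm ((case p of (x, y) \<Rightarrow> f x * g y) * complex_of_real B)"
    proof (rule AE_I2)
      fix p :: "real \<times> real"
      show "norm (case p of (x, y) \<Rightarrow> f x * g y * k (x, y)) \<le> norm ((case p of (x, y) \<Rightarrow> f x * g y) * complex_of_real B)"
        using order_trans[OF k abs_ge_self, of p] by (cases p) (auto simp: norm_mult intro!: mult_left_mono)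
    qed
  qed simp
qed

text \<open>The one form of Fubini used on the Fourier side: f and g carry the integrability, while
  the kernel k, a phase or a Gaussian, is merely bounded.\<close>

lemma fubini_mult:
  fixes f g :: "real \<Rightarrow> complex" and k :: "real \<times> real \<Rightarrow> complex"
  assumes f: "integrable lborel f" and g: "integrable lborel g"
    and k: "k \<in> borel_measurable (lborel \<Otimes>\<^sub>M lborel)" "\<And>p. cmod (k p) \<le> B"
  shows "(LINT x|lborel. f x * (LINT y|lborel. g y * k (x, y))) = (LINT y|lborel. g y * (LINT x|lborel. f x * k (x, y)))"
proof -
  have "(LINT y|lborel. (LINT x|lborel. f x * g y * k (x, y))) = (LINT x|lborel. (LINT y|lborel. f x * g y * k (x, y)))"
    by (rule lborel_pair.Fubini_integral) (rule integrable_pair_mult[OF assms])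
  moreover have "(LINT x|lborel. f x * g y * k (x, y)) = g y * (LINT x|lborel. f x * k (x, y))" for y
    by (subst integral_mult_right_zero[symmetric]) (simp add: mult_ac)
  moreover have "(LINT y|lborel. f x * g y * k (x, y)) = f x * (LINT y|lborel. g y * k (x, y))" for x
    by (subst integral_mult_right_zero[symmetric]) (simp add: mult_ac)
  ultimately show ?thesis by simp
qed

lemma fourier_gauss_integrable:
  assumes "integrable lborel f" "s > 0"
  shows "integrable lborel (\<lambda>\<eta>. fourier f \<eta> * of_real (exp (- (s * \<eta>)\<^sup>2 / 2)))"
proof (rule Bochner_Integration.integrable_bound)
  have [measurable]: "f \<in> borel_measurable borel" using assms by auto
  show "integrable lborel (\<lambda>\<eta>. (LINT t|lborel. cmod (f t)) * exp (- (s * \<eta>)\<^sup>2 / 2))"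
    using gauss_integrable[OF assms(2)] by simp
  show "AE x in lborel. cmod (fourier f x * complex_of_real (exp (- (s * x)\<^sup>2 / 2)))
        \<le> norm ((LINT t|lborel. cmod (f t)) * exp (- (s * x)\<^sup>2 / 2))"
    using fourier_bound[of f] by (auto simp: norm_mult intro!: mult_right_mono order_trans[OF _ abs_ge_self])
qed (use assms in auto)

text \<open>The transform of f is bounded, so the Gaussian makes it integrable, and inversion is an
  exchange of integrals followed by \<open>gauss_fourier\<close>. Instead of f(t) it returns f
  averaged with a normal density of deviation s.\<close>

lemma fourier_gauss_inversion:
  fixes f :: "real \<Rightarrow> complex"
  assumes f: "integrable lborel f" and s: "s > 0"
  shows "(LINT \<eta>|lborel. fourier f \<eta> * of_real (exp (- (s * \<eta>)\<^sup>2 / 2)) * iexp (\<eta> * t))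
     = 2 * pi * (LINT x|lborel. f x * of_real (normal_density 0 s (t - x)))"
proof -
  have fm[measurable]: "f \<in> borel_measurable borel" using f by auto
  let ?E = "\<lambda>\<eta>::real. complex_of_real (exp (- (s * \<eta>)\<^sup>2 / 2))"
  have E: "integrable lborel ?E" using gauss_integrable[OF s] by (subst complex_of_real_integrable_eq)
  have "(LINT \<eta>|lborel. fourier f \<eta> * ?E \<eta> * iexp (\<eta> * t)) = 
     (LINT \<eta>|lborel. ?E \<eta> * (LINT x|lborel. f x * (case (\<eta>, x) of (\<eta>, x) \<Rightarrow> iexp (\<eta> * (t - x)))))"
    unfolding fourier_lborel[OF fm]
    apply (intro Bochner_Integration.integral_cong refl)
    apply (subst mult.commute[of _ "?E _"])
    apply (subst mult.assoc)
    apply (subst integral_mult_left_zero[symmetric])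
    apply (simp add: mult.assoc exp_add[symmetric] algebra_simps)
    done
  also have "\<dots> = (LINT x|lborel. f x * (LINT \<eta>|lborel. ?E \<eta> * (case (\<eta>, x) of (\<eta>, x) \<Rightarrow> iexp (\<eta> * (t - x)))))"
    by (rule fubini_mult[OF E f, where B=1]) auto
  also have "\<dots> = (LINT x|lborel. f x * of_real (2 * pi * normal_density 0 s (t - x)))"
    by (simp only: prod.case gauss_fourier[OF s])
  also have "\<dots> = (LINT x|lborel. (2 * pi) * (f x * of_real (normal_density 0 s (t - x))))"
    by (simp add: algebra_simps)
  finally show ?thesis by (subst integral_mult_right_zero[symmetric])
qed

text \<open>Fatou's lemma. Regularised estimates pass to the limit without a dominating function,
  which is how both the Plancherel inequality and the cut-off bound lose their parameters.\<close>

lemma nn_integral_limit_bound: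
  fixes u :: "nat \<Rightarrow> 'a \<Rightarrow> ennreal"
  assumes [measurable]: "\<And>n. u n \<in> borel_measurable M" and lim: "\<And>x. (\<lambda>n. u n x) \<longlonglongrightarrow> v x"
    and B: "\<And>n. (\<integral>\<^sup>+x. u n x \<partial>M) \<le> B"
  shows "(\<integral>\<^sup>+x. v x \<partial>M) \<le> B"
proof -
  have "v x = liminf (\<lambda>n. u n x)" for x
    using lim[of x] by (simp add: lim_imp_Liminf)
  then have "(\<integral>\<^sup>+x. v x \<partial>M) = (\<integral>\<^sup>+x. liminf (\<lambda>n. u n x) \<partial>M)" by simp
  also have "\<dots> \<le> liminf (\<lambda>n. \<integral>\<^sup>+x. u n x \<partial>M)" by (rule nn_integral_liminf) auto
  also have "\<dots> \<le> liminf (\<lambda>n. B)" using B by (intro Liminf_mono) auto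
  also have "\<dots> = B" by (simp add: Liminf_const)
  finally show ?thesis .
qed

text \<open>Holds without integrability of f, because the Bochner integral of a non-integrable
  function is 0.\<close>

lemma norm_integral_le_nn_integral:
  "ennreal (norm (integral\<^sup>L M f)) \<le> (\<integral>\<^sup>+x. norm (f x) \<partial>M)"
  by (cases "integrable M f") (simp_all add: integral_norm_bound_ennreal not_integrable_integral_eq)

lemma normal_density_nn: fixes s y :: real shows "s > 0 \<Longrightarrow> (\<integral>\<^sup>+x. ennreal (normal_density 0 s (x - y)) \<partial>lborel) = 1"
  "s > 0 \<Longrightarrow> (\<integral>\<^sup>+x. ennreal (normal_density 0 s (y - x)) \<partial>lborel) = 1"
proof -
  assume s: "s > 0"
  have *: "normal_density 0 s (x - y) = normal_density y s x" "normal_density 0 s (y - x) = normal_density y s x" for x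
    by (simp_all add: normal_density_def power2_commute)
  have "(\<integral>\<^sup>+x. ennreal (normal_density y s x) \<partial>lborel) = 1"
    using s by (subst nn_integral_eq_integral) (auto simp: integrable_normal_density)
  then show "(\<integral>\<^sup>+x. ennreal (normal_density 0 s (x - y)) \<partial>lborel) = 1"
   "(\<integral>\<^sup>+x. ennreal (normal_density 0 s (y - x)) \<partial>lborel) = 1" unfolding * by auto
qed

text \<open>With one transform of f written out, the damped energy becomes 2\<pi> times the double
  integral of conj f(x) f(y) against a normal density in x - y. That density has mass 1 in either
  variable, so the bound does not depend on s.\<close>

lemma plancherel_gauss:
  assumes f: "integrable lborel f" and s: "s > 0"
  shows "(\<integral>\<^sup>+\<omega>. ennreal ((cmod (fourier f \<omega>))\<^sup>2 * exp (- (s * \<omega>)\<^sup>2 / 2)) \<partial>lborel)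
    \<le> ennreal (2 * pi) * (\<integral>\<^sup>+x. ennreal ((cmod (f x))\<^sup>2) \<partial>lborel)"
proof -
  have fm[measurable]: "f \<in> borel_measurable borel" using f by auto
  let ?E = "\<lambda>\<eta>::real. complex_of_real (exp (- (s * \<eta>)\<^sup>2 / 2))"
  let ?g = "\<lambda>\<eta>. fourier f \<eta> * ?E \<eta>"
  have g: "integrable lborel ?g" by (rule fourier_gauss_integrable[OF f s])
  have int: "integrable lborel (\<lambda>\<omega>. cnj (fourier f \<omega>) * ?g \<omega>)"
  proof (rule Bochner_Integration.integrable_bound)
    show "integrable lborel (\<lambda>\<omega>. (LINT t|lborel. cmod (f t)) * cmod (?g \<omega>))"
      using g by simp
    show "AE x in lborel. cmod (cnj (fourier f x) * ?g x) \<le> norm ((LINT t|lborel. cmod (f t)) * cmod (?g x))"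
      using fourier_bound[of f] by (auto simp: norm_mult abs_mult intro!: mult_right_mono order_trans[OF _ abs_ge_self])
  qed measurable
  have eq: "cnj (fourier f \<omega>) * ?g \<omega> = of_real ((cmod (fourier f \<omega>))\<^sup>2 * exp (- (s * \<omega>)\<^sup>2 / 2))" for \<omega>
    using complex_norm_square[of "fourier f \<omega>"] by (simp add: mult_ac)
  have int': "integrable lborel (\<lambda>\<omega>. (cmod (fourier f \<omega>))\<^sup>2 * exp (- (s * \<omega>)\<^sup>2 / 2))"
    using int unfolding eq complex_of_real_integrable_eq .
  have cnjf: "integrable lborel (\<lambda>x. cnj (f x))" using f by simp
  have cf: "cnj (fourier f \<omega>) = (LINT x|lborel. cnj (f x) * iexp (\<omega> * x))" for \<omega>
    unfolding fourier_lborel[OF fm]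
    by (subst Bochner_Integration.integral_cnj[symmetric]) (simp add: exp_cnj)
  have "complex_of_real (LINT \<omega>|lborel. (cmod (fourier f \<omega>))\<^sup>2 * exp (- (s * \<omega>)\<^sup>2 / 2))
      = (LINT \<omega>|lborel. cnj (fourier f \<omega>) * ?g \<omega>)"
    unfolding eq by (rule integral_complex_of_real[symmetric])
  also have "\<dots> = (LINT \<omega>|lborel. ?g \<omega> * (LINT x|lborel. cnj (f x) * (case (\<omega>, x) of (\<omega>, x) \<Rightarrow> iexp (\<omega> * x))))"
    unfolding cf by (simp add: mult.commute)
  also have "\<dots> = (LINT x|lborel. cnj (f x) * (LINT \<omega>|lborel. ?g \<omega> * (case (\<omega>, x) of (\<omega>, x) \<Rightarrow> iexp (\<omega> * x))))"
    by (rule fubini_mult[OF g cnjf, where B=1]) auto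
  also have "\<dots> = (LINT x|lborel. cnj (f x) * (2 * pi * (LINT y|lborel. f y * of_real (normal_density 0 s (x - y)))))"
    by (simp only: prod.case fourier_gauss_inversion[OF f s])
  finally have *: "complex_of_real (LINT \<omega>|lborel. (cmod (fourier f \<omega>))\<^sup>2 * exp (- (s * \<omega>)\<^sup>2 / 2)) =
    (LINT x|lborel. cnj (f x) * (2 * pi * (LINT y|lborel. f y * of_real (normal_density 0 s (x - y)))))" .
  have "ennreal (LINT \<omega>|lborel. (cmod (fourier f \<omega>))\<^sup>2 * exp (- (s * \<omega>)\<^sup>2 / 2))
     = ennreal (cmod (LINT x|lborel. cnj (f x) * (2 * pi * (LINT y|lborel. f y * of_real (normal_density 0 s (x - y))))))"
    unfolding *[symmetric] norm_of_real by (intro arg_cong[where f=ennreal] abs_of_nonneg[symmetric] integral_nonneg_AE) simp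
  also have "\<dots> \<le> (\<integral>\<^sup>+x. ennreal (cmod (cnj (f x) * (2 * pi * (LINT y|lborel. f y * of_real (normal_density 0 s (x - y)))))) \<partial>lborel)"
    by (rule norm_integral_le_nn_integral)
  also have "\<dots> \<le> (\<integral>\<^sup>+x. (\<integral>\<^sup>+y. ennreal (2 * pi) * ennreal (cmod (f x) * cmod (f y) * normal_density 0 s (x - y)) \<partial>lborel) \<partial>lborel)"
  proof (rule nn_integral_mono)
    fix x
    have "ennreal (cmod (cnj (f x) * (2 * pi * (LINT y|lborel. f y * of_real (normal_density 0 s (x - y))))))
      = ennreal (cmod (LINT y|lborel. (2 * pi) * cnj (f x) * (f y * of_real (normal_density 0 s (x - y)))))"
      by (subst integral_mult_right_zero) (simp add: norm_mult mult_ac)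
    also have "\<dots> \<le> (\<integral>\<^sup>+y. cmod ((2 * pi) * cnj (f x) * (f y * of_real (normal_density 0 s (x - y)))) \<partial>lborel)"
      by (rule norm_integral_le_nn_integral)
    also have "\<dots> = (\<integral>\<^sup>+y. ennreal (2 * pi) * ennreal (cmod (f x) * cmod (f y) * normal_density 0 s (x - y)) \<partial>lborel)"
      by (intro nn_integral_cong) (simp add: norm_mult ennreal_mult[symmetric] mult_ac)
    finally show "ennreal (cmod (cnj (f x) * (2 * pi * (LINT y|lborel. f y * of_real (normal_density 0 s (x - y))))))
       \<le> \<dots>" .
  qed
  also have "\<dots> = ennreal (2 * pi) * (\<integral>\<^sup>+x. (\<integral>\<^sup>+y. ennreal (cmod (f x) * cmod (f y) * normal_density 0 s (x - y)) \<partial>lborel) \<partial>lborel)"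
    by (simp add: nn_integral_cmult)
  \<comment> \<open>Pointwise 2ab \<le> a^2 + b^2 separates the two variables; in each half the
    density then integrates to 1.\<close>
  also have "(\<integral>\<^sup>+x. (\<integral>\<^sup>+y. ennreal (cmod (f x) * cmod (f y) * normal_density 0 s (x - y)) \<partial>lborel) \<partial>lborel)
     \<le> (\<integral>\<^sup>+x. (\<integral>\<^sup>+y. ennreal ((cmod (f x))\<^sup>2 / 2) * ennreal (normal_density 0 s (x - y))
           + ennreal ((cmod (f y))\<^sup>2 / 2) * ennreal (normal_density 0 s (x - y)) \<partial>lborel) \<partial>lborel)"
  proof (intro nn_integral_mono)
    fix x y
    have "cmod (f x) * cmod (f y) \<le> (cmod (f x))\<^sup>2 / 2 + (cmod (f y))\<^sup>2 / 2"
      using sum_squares_bound[of "cmod (f x)" "cmod (f y)"] by simp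
    then have "cmod (f x) * cmod (f y) * normal_density 0 s (x - y) \<le> ((cmod (f x))\<^sup>2 / 2 + (cmod (f y))\<^sup>2 / 2) * normal_density 0 s (x - y)"
      by (rule mult_right_mono) simp
    then show "ennreal (cmod (f x) * cmod (f y) * normal_density 0 s (x - y)) \<le> 
       ennreal ((cmod (f x))\<^sup>2 / 2) * ennreal (normal_density 0 s (x - y))
           + ennreal ((cmod (f y))\<^sup>2 / 2) * ennreal (normal_density 0 s (x - y))"
      by (simp add: ennreal_mult[symmetric] ennreal_plus[symmetric] algebra_simps del: ennreal_plus)
  qed
  also have "\<dots> = (\<integral>\<^sup>+x. ennreal ((cmod (f x))\<^sup>2 / 2) * (\<integral>\<^sup>+y. ennreal (normal_density 0 s (x - y)) \<partial>lborel) \<partial>lborel)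
           + (\<integral>\<^sup>+x. (\<integral>\<^sup>+y. ennreal ((cmod (f y))\<^sup>2 / 2) * ennreal (normal_density 0 s (x - y)) \<partial>lborel) \<partial>lborel)"
    by (simp add: nn_integral_add nn_integral_cmult)
  also have "(\<integral>\<^sup>+x. (\<integral>\<^sup>+y. ennreal ((cmod (f y))\<^sup>2 / 2) * ennreal (normal_density 0 s (x - y)) \<partial>lborel) \<partial>lborel)
     = (\<integral>\<^sup>+y. (\<integral>\<^sup>+x. ennreal ((cmod (f y))\<^sup>2 / 2) * ennreal (normal_density 0 s (x - y)) \<partial>lborel) \<partial>lborel)"
    by (rule lborel_pair.Fubini') measurable
  also have "\<dots> = (\<integral>\<^sup>+y. ennreal ((cmod (f y))\<^sup>2 / 2) \<partial>lborel)"
    using s by (simp add: nn_integral_cmult normal_density_nn)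
  also have "(\<integral>\<^sup>+x. ennreal ((cmod (f x))\<^sup>2 / 2) * (\<integral>\<^sup>+y. ennreal (normal_density 0 s (x - y)) \<partial>lborel) \<partial>lborel)
     = (\<integral>\<^sup>+y. ennreal ((cmod (f y))\<^sup>2 / 2) \<partial>lborel)"
    using s by (simp add: normal_density_nn)
  also have "(\<integral>\<^sup>+y. ennreal ((cmod (f y))\<^sup>2 / 2) \<partial>lborel) + (\<integral>\<^sup>+y. ennreal ((cmod (f y))\<^sup>2 / 2) \<partial>lborel)
    = (\<integral>\<^sup>+y. ennreal ((cmod (f y))\<^sup>2) \<partial>lborel)"
    by (subst nn_integral_add[symmetric]) (simp_all add: ennreal_plus[symmetric] del: ennreal_plus)
  finally have "ennreal (LINT \<omega>|lborel. (cmod (fourier f \<omega>))\<^sup>2 * exp (- (s * \<omega>)\<^sup>2 / 2)) \<le>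
      ennreal (2 * pi) * (\<integral>\<^sup>+y. ennreal ((cmod (f y))\<^sup>2) \<partial>lborel)"
    by (simp add: mult_left_mono)
  then show ?thesis
    using int' by (subst nn_integral_eq_integral) auto
qed

text \<open>Fatou's lemma as s tends to 0. Applied to functions of \<omega> as well as of t, this
  one inequality serves both directions.\<close>

lemma plancherel_le:
  assumes f: "integrable lborel f"
  shows "(\<integral>\<^sup>+\<omega>. ennreal ((cmod (fourier f \<omega>))\<^sup>2) \<partial>lborel)
    \<le> ennreal (2 * pi) * (\<integral>\<^sup>+x. ennreal ((cmod (f x))\<^sup>2) \<partial>lborel)"
proof (rule nn_integral_limit_bound)
  have fm[measurable]: "f \<in> borel_measurable borel" using f by auto
  let ?s = "\<lambda>n::nat. 1 / real (Suc n)"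
  show "(\<lambda>\<omega>. ennreal ((cmod (fourier f \<omega>))\<^sup>2 * exp (- (?s n * \<omega>)\<^sup>2 / 2))) \<in> borel_measurable lborel" for n
    by measurable
  show "(\<integral>\<^sup>+\<omega>. ennreal ((cmod (fourier f \<omega>))\<^sup>2 * exp (- (?s n * \<omega>)\<^sup>2 / 2)) \<partial>lborel)
    \<le> ennreal (2 * pi) * (\<integral>\<^sup>+x. ennreal ((cmod (f x))\<^sup>2) \<partial>lborel)" for n
    by (rule plancherel_gauss[OF f]) simp
  show "(\<lambda>n. ennreal ((cmod (fourier f \<omega>))\<^sup>2 * exp (- (?s n * \<omega>)\<^sup>2 / 2))) \<longlonglongrightarrow> ennreal ((cmod (fourier f \<omega>))\<^sup>2)" for \<omega>
  proof (rule tendsto_ennrealI)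
    have "(\<lambda>n. (cmod (fourier f \<omega>))\<^sup>2 * exp (- (?s n * \<omega>)\<^sup>2 / 2)) \<longlonglongrightarrow> (cmod (fourier f \<omega>))\<^sup>2 * exp (- (0 * \<omega>)\<^sup>2 / 2)"
      by (intro tendsto_intros LIMSEQ_Suc[OF lim_1_over_n]) auto
    then show "(\<lambda>n. (cmod (fourier f \<omega>))\<^sup>2 * exp (- (?s n * \<omega>)\<^sup>2 / 2)) \<longlonglongrightarrow> (cmod (fourier f \<omega>))\<^sup>2" by simp
  qed
qed

section \<open>Schur test\<close>

text \<open>The convolution theorem read backwards: \<open>fourier h (- t)\<close> is 2\<pi> times
  the inverse transform of h, so convolving h with the transform of g amounts to multiplying by g on
  the physical side.\<close>

lemma integral_fourier_shift:
  assumes h: "integrable lborel h" and g: "integrable lborel g"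
  shows "(LINT \<eta>|lborel. h \<eta> * fourier g (\<omega> - \<eta>)) = fourier (\<lambda>t. g t * fourier h (- t)) \<omega>"
proof -
  have [measurable]: "h \<in> borel_measurable borel" "g \<in> borel_measurable borel" using h g by auto
  have "(LINT \<eta>|lborel. h \<eta> * fourier g (\<omega> - \<eta>))
    = (LINT \<eta>|lborel. h \<eta> * (LINT t|lborel. g t * (case (\<eta>, t) of (\<eta>, t) \<Rightarrow> iexp (- ((\<omega> - \<eta>) * t)))))"
    by (simp add: fourier_lborel)
  also have "\<dots> = (LINT t|lborel. g t * (LINT \<eta>|lborel. h \<eta> * (case (\<eta>, t) of (\<eta>, t) \<Rightarrow> iexp (- ((\<omega> - \<eta>) * t)))))"
    by (rule fubini_mult[OF h g, where B=1]) auto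
  also have "\<dots> = (LINT t|lborel. g t * (LINT \<eta>|lborel. h \<eta> * iexp (- (- t * \<eta>)) * iexp (- (\<omega> * t))))"
    by (simp add: mult.assoc exp_add[symmetric] algebra_simps)
  also have "\<dots> = fourier (\<lambda>t. g t * fourier h (- t)) \<omega>"
    unfolding integral_mult_left_zero by (simp add: fourier_lborel mult.assoc)
  finally show ?thesis .
qed

section \<open>A damped half-line indicator and its Fourier transform\<close>

definition halfexp :: "real \<Rightarrow> real \<Rightarrow> real \<Rightarrow> complex" where
  "halfexp \<epsilon> \<tau> t = (if \<tau> < t then of_real (exp (- \<epsilon> * (t - \<tau>))) else 0)"

lemma halfexp_measurable[measurable]: "halfexp \<epsilon> \<tau> \<in> borel_measurable borel"
  unfolding halfexp_def by measurable

lemma norm_halfexp_le: "\<epsilon> > 0 \<Longrightarrow> cmod (halfexp \<epsilon> \<tau> t) \<le> 1"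
  by (simp add: halfexp_def)

lemma halfexp_integrable:
  assumes "\<epsilon> > 0"
  shows "integrable lborel (halfexp \<epsilon> \<tau>)"
proof -
  let ?F = "\<lambda>t. - exp (- \<epsilon> * (t - \<tau>)) / \<epsilon>"
  have lim_top: "(?F \<longlongrightarrow> 0) at_top"
    using assms by real_asymp
  have lim_\<tau>: "(?F \<longlongrightarrow> ?F \<tau>) (at_right \<tau>)"
    using assms by (intro tendsto_intros) auto
  have "set_integrable lborel (einterval \<tau> \<infinity>) (\<lambda>t. exp (- \<epsilon> * (t - \<tau>)))"
  proof (rule interval_integral_FTC_nonneg(1))
    show "((?F \<circ> real_of_ereal) \<longlongrightarrow> ?F \<tau>) (at_right (ereal \<tau>))"
      unfolding ereal_tendsto_simps by (rule lim_\<tau>)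
    show "((?F \<circ> real_of_ereal) \<longlongrightarrow> 0) (at_left \<infinity>)"
      unfolding ereal_tendsto_simps by (rule lim_top)
    show "DERIV ?F t :> exp (- \<epsilon> * (t - \<tau>))" for t
      using assms by (auto intro!: derivative_eq_intros)
  qed (auto intro!: continuous_intros)
  then have "integrable lborel (\<lambda>t. complex_of_real (indicator (einterval \<tau> \<infinity>) t * exp (- \<epsilon> * (t - \<tau>))))"
    unfolding set_integrable_def complex_of_real_integrable_eq by simp
  also have "(\<lambda>t. complex_of_real (indicator (einterval \<tau> \<infinity>) t * exp (- \<epsilon> * (t - \<tau>)))) = halfexp \<epsilon> \<tau>"
    by (auto simp: halfexp_def einterval_def indicator_def)
  finally show ?thesis .
qed

text \<open>The transform is exactly e^(-i\<omega>\<tau>) / (\<epsilon> + i\<omega>), by the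
  fundamental theorem of calculus on (\<tau>, \<infinity>). The damping makes \<open>halfexp\<close>
  integrable; what matters is that the bound 1/|\<omega>| depends neither on \<epsilon> nor on
  \<tau>.\<close>

lemma norm_fourier_halfexp_le:
  assumes e: "\<epsilon> > 0" and \<omega>: "\<omega> \<noteq> 0"
  shows "cmod (fourier (halfexp \<epsilon> \<tau>) \<omega>) \<le> 1 / \<bar>\<omega>\<bar>"
proof -
  define c where "c = Complex \<epsilon> \<omega>"
  have c: "c \<noteq> 0" using e by (simp add: c_def complex_eq_iff)
  have c_eq: "c = of_real \<epsilon> + \<i> * of_real \<omega>" by (simp add: c_def complex_eq_iff)
  define \<Phi> where "\<Phi> t = exp (- (of_real t * c) + of_real (\<epsilon> * \<tau>))" for t :: real
  have \<Phi>: "\<Phi> t = of_real (exp (- \<epsilon> * (t - \<tau>))) * iexp (- (\<omega> * t))" for t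
    unfolding \<Phi>_def c_eq by (simp add: exp_of_real[symmetric] exp_add[symmetric] algebra_simps del: exp_of_real)
  have ind: "indicator (einterval \<tau> \<infinity>) t *\<^sub>R \<Phi> t = halfexp \<epsilon> \<tau> t * iexp (- (\<omega> * t))" for t
    unfolding \<Phi> halfexp_def einterval_def indicator_def by auto
  have int: "integrable lborel (\<lambda>t. halfexp \<epsilon> \<tau> t * iexp (- (\<omega> * t)))"
    by (rule Bochner_Integration.integrable_bound[OF halfexp_integrable[OF e, of \<tau>]]) (auto simp: norm_mult)
  have norm\<Phi>: "cmod (\<Phi> t) = exp (- \<epsilon> * (t - \<tau>))" for t
    unfolding \<Phi> by (simp add: norm_mult)
  have deriv: "((\<lambda>t. - \<Phi> t / c) has_vector_derivative \<Phi> t) (at t)" for t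
  proof -
    have "((\<lambda>z. - exp (- (z * c) + of_real (\<epsilon> * \<tau>)) / c) has_field_derivative exp (- (of_real t * c) + of_real (\<epsilon> * \<tau>))) (at (of_real t))"
      using c by (auto intro!: derivative_eq_intros)
    from has_vector_derivative_real_field[OF this] show ?thesis by (simp add: \<Phi>_def)
  qed
  have cont: "isCont (\<lambda>t. - \<Phi> t / c) t" "isCont \<Phi> t" for t
    unfolding \<Phi>_def by (rule continuous_intros c | rule c)+
  have "((\<lambda>t. cmod (\<Phi> t)) \<longlongrightarrow> 0) at_top"
    unfolding norm\<Phi> using e by real_asymp
  then have "(\<Phi> \<longlongrightarrow> 0) at_top" by (rule tendsto_norm_zero_cancel)
  then have "((\<lambda>t. - \<Phi> t / c) \<longlongrightarrow> - 0 / c) at_top" using c by (intro tendsto_intros) auto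
  then have lim_top: "((\<lambda>t. - \<Phi> t / c) \<longlongrightarrow> 0) at_top" by simp
  have lim_\<tau>: "((\<lambda>t. - \<Phi> t / c) \<longlongrightarrow> - \<Phi> \<tau> / c) (at_right \<tau>)"
    using isContD[OF cont(1), of \<tau>] by (rule tendsto_within_subset) auto
  have "(LBINT t=\<tau>..\<infinity>. \<Phi> t) = 0 - (- \<Phi> \<tau> / c)"
  proof (rule interval_integral_FTC_integrable)
    show "set_integrable lborel (einterval \<tau> \<infinity>) \<Phi>"
      unfolding set_integrable_def ind by (rule int)
    show "(((\<lambda>t. - \<Phi> t / c) \<circ> real_of_ereal) \<longlongrightarrow> - \<Phi> \<tau> / c) (at_right (ereal \<tau>))"
      unfolding ereal_tendsto_simps by (rule lim_\<tau>)
    show "(((\<lambda>t. - \<Phi> t / c) \<circ> real_of_ereal) \<longlongrightarrow> 0) (at_left \<infinity>)"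
      unfolding ereal_tendsto_simps by (rule lim_top)
  qed (use deriv cont in auto)
  moreover have "(LBINT t=\<tau>..\<infinity>. \<Phi> t) = (LINT t|lborel. indicator (einterval \<tau> \<infinity>) t *\<^sub>R \<Phi> t)"
    unfolding interval_lebesgue_integral_def set_lebesgue_integral_def by simp
  ultimately have "fourier (halfexp \<epsilon> \<tau>) \<omega> = \<Phi> \<tau> / c"
    unfolding fourier_lborel[OF halfexp_measurable] ind by simp
  then have "cmod (fourier (halfexp \<epsilon> \<tau>) \<omega>) = 1 / cmod c"
    by (simp add: norm_divide norm\<Phi>)
  moreover have "\<bar>\<omega>\<bar> \<le> cmod c" using abs_Im_le_cmod[of c] by (simp add: c_def)
  ultimately show ?thesis using \<omega> by (simp add: frac_le)
qed

section \<open>The commutator kernel and Schur's test\<close>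

definition kmax :: "real \<Rightarrow> real \<Rightarrow> real \<Rightarrow> real" where
  "kmax a x y = max (1 + \<bar>x\<bar>) (1 + \<bar>y\<bar>) powr (a - 1) * min (1 + \<bar>x\<bar>) (1 + \<bar>y\<bar>) powr (- a)"

lemma kmax_measurable[measurable]: "(\<lambda>p. kmax a (fst p) (snd p)) \<in> borel_measurable (borel \<Otimes>\<^sub>M borel)"
  unfolding kmax_def by measurable

lemma kmax_nonneg: "kmax a x y \<ge> 0"
  unfolding kmax_def by simp

lemma kmax_commute: "kmax a x y = kmax a y x"
  unfolding kmax_def by (simp add: max.commute min.commute)

text \<open>Since a - 1 < 0, the 1 in the numerator may be replaced by the smaller r^(a-1), where r
  = M/m, and r^a - r^(a-1) contains the factor M - m exactly.\<close>

lemma powr_ratio_bound: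
  fixes m M :: real
  assumes "0 < m" "m < M" "0 \<le> a" "a < 1"
  shows "((M / m) powr a - 1) / (M - m) \<le> M powr (a - 1) * m powr (- a)"
proof -
  have "(M / m) powr a - 1 \<le> (M / m) powr a - (M/m) powr (a - 1)"
    using assms powr_mono[of "a - 1" 0 "M/m"] by simp
  also have "\<dots> = (M - m) * (M powr (a - 1) * m powr (- a))"
    using assms by (simp add: powr_divide powr_diff powr_minus field_simps)
  finally show ?thesis using assms by (simp add: field_simps)
qed

text \<open>The ratio of weights is r or 1/r with r = (M/m)^|\<nu>| \<ge> 1, and 1 - 1/r \<le> r - 1
  reduces both signs of \<nu> to one. The denominator |x - y| may shrink to M - m, which is the
  distance of |x| and |y|.\<close>

lemma weight_ratio_bound:
  assumes "\<bar>\<nu>\<bar> < 1"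
  shows "\<bar>(1 + \<bar>x\<bar>) powr \<nu> / (1 + \<bar>y\<bar>) powr \<nu> - 1\<bar> / \<bar>x - y\<bar> \<le> kmax \<bar>\<nu>\<bar> x y"
proof (cases "\<bar>x\<bar> = \<bar>y\<bar>")
  \<comment> \<open>Here the numerator vanishes, so the division by 0 at x = y is harmless.\<close>
  case True
  then have "\<bar>(1 + \<bar>x\<bar>) powr \<nu> / (1 + \<bar>y\<bar>) powr \<nu> - 1\<bar> = 0" by simp
  then show ?thesis by (simp only: kmax_nonneg div_0)
next
  case False
  define X Y where "X = 1 + \<bar>x\<bar>" and "Y = 1 + \<bar>y\<bar>"
  define m M where "m = min X Y" and "M = max X Y"
  have XY: "X > 0" "Y > 0" "X \<noteq> Y" using False by (auto simp: X_def Y_def)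
  have m: "0 < m" "m < M" using XY by (auto simp: m_def M_def)
  have Mm: "M - m \<le> \<bar>x - y\<bar>" by (auto simp: m_def M_def X_def Y_def)
  let ?r = "(M / m) powr \<bar>\<nu>\<bar>"
  have r1: "?r \<ge> 1" using m by (simp add: ge_one_powr_ge_zero)
  have "X powr \<nu> / Y powr \<nu> = ?r \<or> X powr \<nu> / Y powr \<nu> = 1 / ?r"
    using XY by (cases "X \<le> Y"; cases "\<nu> \<ge> 0") (auto simp: m_def M_def powr_divide powr_minus max_def min_def field_simps)
  moreover have "1 - 1 / r \<le> r - 1" if "r \<ge> 1" for r :: real
  proof -
    have "(r - 1) / r \<le> (r - 1) / 1" using that by (intro divide_left_mono) auto
    then show ?thesis using that by (simp add: diff_divide_distrib)
  qed
  from this[OF r1] have "1 - 1 / ?r \<le> ?r - 1" .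
  moreover have "1 / r \<le> 1" if "r \<ge> 1" for r :: real
    using that by simp
  from this[OF r1] have "1 / ?r \<le> 1" .
  ultimately have "\<bar>X powr \<nu> / Y powr \<nu> - 1\<bar> \<le> ?r - 1"
    using r1 by (auto simp: abs_le_iff)
  then have "\<bar>X powr \<nu> / Y powr \<nu> - 1\<bar> / \<bar>x - y\<bar> \<le> (?r - 1) / (M - m)"
    using Mm m by (intro frac_le) auto
  also have "\<dots> \<le> M powr (\<bar>\<nu>\<bar> - 1) * m powr (- \<bar>\<nu>\<bar>)"
    using m assms by (intro powr_ratio_bound) auto
  finally show ?thesis by (simp add: kmax_def X_def Y_def m_def M_def)
qed

lemma nn_integral_even_le:
  fixes f :: "real \<Rightarrow> ennreal"
  assumes [measurable]: "f \<in> borel_measurable borel" and even: "\<And>x. f (- x) = f x"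
  shows "(\<integral>\<^sup>+x. f x \<partial>lborel) \<le> 2 * (\<integral>\<^sup>+x. f x * indicator {0..} x \<partial>lborel)"
proof -
  have "(\<integral>\<^sup>+x. f x \<partial>lborel) \<le> (\<integral>\<^sup>+x. f x * indicator {0..} x + f x * indicator {..0} x \<partial>lborel)"
    by (intro nn_integral_mono) (auto simp: indicator_def)
  also have "\<dots> = (\<integral>\<^sup>+x. f x * indicator {0..} x \<partial>lborel) + (\<integral>\<^sup>+x. f x * indicator {..0} x \<partial>lborel)"
    by (rule nn_integral_add) auto
  also have "(\<integral>\<^sup>+x. f x * indicator {..0} x \<partial>lborel) = (\<integral>\<^sup>+x. f (0 + (-1) * x) * indicator {..0} (0 + (-1) * x) \<partial>lborel)"
    by (subst nn_integral_real_affine[where c="-1" and t=0]) auto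
  also have "\<dots> = (\<integral>\<^sup>+x. f x * indicator {0..} x \<partial>lborel)"
    by (intro nn_integral_cong) (auto simp: even indicator_def)
  finally show ?thesis by (simp add: mult_2)
qed

text \<open>\<open>kmax\<close> is homogeneous of degree -1 in X = 1 + |x| and Y = 1 + |y|, which
  suggests the power -1/2 as trial weight. Splitting at |y| = |x| leaves the powers c - 1 and -c - 1
  of 1 + y with c = 1/2 - a > 0. Each part is at most X^(-1/2) / c, and evenness in y doubles the
  sum to 4 / c.\<close>

lemma kmax_schur:
  assumes a: "0 \<le> a" "a < 1/2"
  shows "(\<integral>\<^sup>+y. ennreal (kmax a x y * (1 + \<bar>y\<bar>) powr (- (1/2))) \<partial>lborel) \<le> ennreal (4 / (1/2 - a) * (1 + \<bar>x\<bar>) powr (- (1/2)))"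
proof -
  define X where "X = 1 + \<bar>x\<bar>"
  have X: "X \<ge> 1" by (simp add: X_def)
  define c where "c = 1/2 - a"
  have c: "c > 0" using a by (simp add: c_def)
  let ?k = "\<lambda>y. kmax a x y * (1 + \<bar>y\<bar>) powr (- (1/2))"
  let ?f1 = "\<lambda>y. X powr (a - 1) * (1 + y) powr (c - 1)"
  let ?f2 = "\<lambda>y. X powr (- a) * (1 + y) powr (- c - 1)"
  have "(\<integral>\<^sup>+y. ennreal (?k y) \<partial>lborel) \<le> 2 * (\<integral>\<^sup>+y. ennreal (?k y) * indicator {0..} y \<partial>lborel)"
  proof (rule nn_integral_even_le)
    show "(\<lambda>y. ennreal (?k y)) \<in> borel_measurable borel" unfolding kmax_def by measurable
    show "ennreal (?k (- y)) = ennreal (?k y)" for y by (simp add: kmax_def)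
  qed
  also have "(\<integral>\<^sup>+y. ennreal (?k y) * indicator {0..} y \<partial>lborel)
    \<le> (\<integral>\<^sup>+y. ennreal (?f1 y) * indicator {0..\<bar>x\<bar>} y + ennreal (?f2 y) * indicator {\<bar>x\<bar>..} y \<partial>lborel)"
  proof (intro nn_integral_mono)
    fix y :: real
    consider "y < 0" | "0 \<le> y" "y \<le> \<bar>x\<bar>" | "0 \<le> y" "\<bar>x\<bar> < y" by linarith
    then show "ennreal (?k y) * indicator {0..} y \<le> ennreal (?f1 y) * indicator {0..\<bar>x\<bar>} y + ennreal (?f2 y) * indicator {\<bar>x\<bar>..} y"
    proof cases
      case 2
      then have "max (1 + \<bar>x\<bar>) (1 + \<bar>y\<bar>) = X" "min (1 + \<bar>x\<bar>) (1 + \<bar>y\<bar>) = 1 + y" "\<bar>y\<bar> = y"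
        by (auto simp: X_def)
      then have "?k y = ?f1 y"
        using X 2 by (simp add: kmax_def c_def mult_ac powr_add[symmetric]) (rule arg_cong2[where f="(powr)"]; simp)
      then show ?thesis using 2 by simp
    next
      case 3
      then have "max (1 + \<bar>x\<bar>) (1 + \<bar>y\<bar>) = 1 + y" "min (1 + \<bar>x\<bar>) (1 + \<bar>y\<bar>) = X" "\<bar>y\<bar> = y"
        by (auto simp: X_def)
      then have "?k y = ?f2 y"
        using X 3 by (simp add: kmax_def c_def mult_ac powr_add[symmetric])
      then show ?thesis using 3 by simp
    qed simp
  qed
  also have "\<dots> = (\<integral>\<^sup>+y. ennreal (?f1 y) * indicator {0..\<bar>x\<bar>} y \<partial>lborel) + (\<integral>\<^sup>+y. ennreal (?f2 y) * indicator {\<bar>x\<bar>..} y \<partial>lborel)"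
    by (rule nn_integral_add) measurable
  also have "(\<integral>\<^sup>+y. ennreal (?f1 y) * indicator {0..\<bar>x\<bar>} y \<partial>lborel)
     = ennreal (X powr (a - 1) * (1 + \<bar>x\<bar>) powr c / c - X powr (a - 1) * (1 + 0) powr c / c)"
  proof (rule nn_integral_FTC_Icc[where F="\<lambda>y. X powr (a - 1) * (1 + y) powr c / c"])
    fix t assume "t \<in> {0..\<bar>x\<bar>}"
    then show "((\<lambda>y. X powr (a - 1) * (1 + y) powr c / c) has_real_derivative ?f1 t) (at t)"
      using c X by (auto intro!: derivative_eq_intros simp: powr_diff mult_ac)
  qed auto
  also have "\<dots> \<le> ennreal (X powr (- (1/2)) / c)"
  proof (rule ennreal_leI)
    have "X powr (a - 1) * X powr c = X powr (- (1/2))"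
      by (simp add: powr_add[symmetric] c_def)
    then show "X powr (a - 1) * (1 + \<bar>x\<bar>) powr c / c - X powr (a - 1) * (1 + 0) powr c / c \<le> X powr (- (1/2)) / c"
      using c by (simp add: X_def[symmetric])
  qed
  also have "(\<integral>\<^sup>+y. ennreal (?f2 y) * indicator {\<bar>x\<bar>..} y \<partial>lborel) = ennreal (0 - X powr (- a) * (1 + \<bar>x\<bar>) powr (- c) / (- c))"
  proof (rule nn_integral_FTC_atLeast)
    fix t assume "\<bar>x\<bar> \<le> t"
    then show "((\<lambda>y. X powr (- a) * (1 + y) powr (- c) / (- c)) has_real_derivative ?f2 t) (at t)"
      using c by (auto intro!: derivative_eq_intros simp: powr_diff powr_minus)
  next
    show "((\<lambda>y. X powr (- a) * (1 + y) powr (- c) / (- c)) \<longlongrightarrow> 0) at_top"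
      using c by real_asymp
  qed auto
  also have "0 - X powr (- a) * (1 + \<bar>x\<bar>) powr (- c) / (- c) = X powr (- (1/2)) / c"
  proof -
    have "X powr (- a) * X powr (- c) = X powr (- (1/2))"
      by (simp add: powr_add[symmetric] c_def)
    then show ?thesis by (simp add: X_def[symmetric])
  qed
  finally have "(\<integral>\<^sup>+y. ennreal (?k y) \<partial>lborel) \<le> 2 * (ennreal (X powr (- (1/2)) / c) + ennreal (X powr (- (1/2)) / c))"
    by (simp add: mult_left_mono)
  also have "\<dots> = ennreal 2 * ennreal (X powr (- (1/2)) / c + X powr (- (1/2)) / c)"
    using c by (simp add: ennreal_plus[symmetric] del: ennreal_plus)
  also have "\<dots> = ennreal (4 / (1/2 - a) * (1 + \<bar>x\<bar>) powr (- (1/2)))"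
    unfolding c_def[symmetric] X_def[symmetric] using c by (subst ennreal_mult'[symmetric]) auto
  finally show ?thesis .
qed

text \<open>Cauchy-Schwarz for the splitting k h = sqrt(k p) sqrt(k / p) h, then Tonelli. Symmetry
  of k lets the bound on rows serve for columns too, so the same constant C enters twice.\<close>

lemma schur_test:
  fixes k :: "real \<Rightarrow> real \<Rightarrow> real" and p h :: "real \<Rightarrow> real"
  assumes [measurable]: "(\<lambda>q. k (fst q) (snd q)) \<in> borel_measurable (borel \<Otimes>\<^sub>M borel)"
    "p \<in> borel_measurable borel" "h \<in> borel_measurable borel"
    and k: "\<And>x y. k x y \<ge> 0" and k_sym: "\<And>x y. k x y = k y x" and p: "\<And>x. p x > 0" and h: "\<And>x. h x \<ge> 0" and C: "C \<ge> 0"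
    and schur: "\<And>x. (\<integral>\<^sup>+y. ennreal (k x y * p y) \<partial>lborel) \<le> ennreal (C * p x)"
  shows "(\<integral>\<^sup>+x. (\<integral>\<^sup>+y. ennreal (k x y * h y) \<partial>lborel)\<^sup>2 \<partial>lborel) \<le> ennreal (C\<^sup>2) * (\<integral>\<^sup>+x. ennreal ((h x)\<^sup>2) \<partial>lborel)"
proof -
  have [measurable]: "(\<lambda>y. k x y) \<in> borel_measurable borel" "(\<lambda>y. k y x) \<in> borel_measurable borel" for x
    using measurable_compose[OF measurable_Pair1'[of x borel borel] assms(1)]
      measurable_compose[OF measurable_Pair2'[of x borel borel] assms(1)] by auto
  have [measurable]: "(\<lambda>q. k (snd q) (fst q)) \<in> borel_measurable (borel \<Otimes>\<^sub>M borel)"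
    by (subst k_sym) measurable
  have "(\<integral>\<^sup>+x. (\<integral>\<^sup>+y. ennreal (k x y * h y) \<partial>lborel)\<^sup>2 \<partial>lborel)
     \<le> (\<integral>\<^sup>+x. (\<integral>\<^sup>+y. ennreal (C * p x) * ennreal (k x y * (h y)\<^sup>2 / p y) \<partial>lborel) \<partial>lborel)"
  proof (rule nn_integral_mono)
    fix x
    have "(\<integral>\<^sup>+y. ennreal (k x y * h y) \<partial>lborel) = (\<integral>\<^sup>+y. ennreal (sqrt (k x y * p y)) * ennreal (sqrt (k x y / p y) * h y) \<partial>lborel)"
    proof (intro nn_integral_cong)
      fix y
      have "sqrt (k x y * p y) * sqrt (k x y / p y) = k x y"
        using p[of y] k[of x y] by (simp add: real_sqrt_mult real_sqrt_divide)
      then have "k x y * h y = sqrt (k x y * p y) * (sqrt (k x y / p y) * h y)"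
        by simp
      then show "ennreal (k x y * h y) = ennreal (sqrt (k x y * p y)) * ennreal (sqrt (k x y / p y) * h y)"
        using p[of y] k[of x y] h[of y] by (subst ennreal_mult[symmetric]) auto
    qed
    then have "(\<integral>\<^sup>+y. ennreal (k x y * h y) \<partial>lborel)\<^sup>2
      \<le> (\<integral>\<^sup>+y. (ennreal (sqrt (k x y * p y)))\<^sup>2 \<partial>lborel) * (\<integral>\<^sup>+y. (ennreal (sqrt (k x y / p y) * h y))\<^sup>2 \<partial>lborel)"
      by (simp only:) (rule Cauchy_Schwarz_nn_integral; measurable)
    also have "(\<integral>\<^sup>+y. (ennreal (sqrt (k x y * p y)))\<^sup>2 \<partial>lborel) = (\<integral>\<^sup>+y. ennreal (k x y * p y) \<partial>lborel)"
      using k p by (simp add: ennreal_power less_imp_le)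
    also have "\<dots> \<le> ennreal (C * p x)" by (rule schur)
    also have "(\<integral>\<^sup>+y. (ennreal (sqrt (k x y / p y) * h y))\<^sup>2 \<partial>lborel) = (\<integral>\<^sup>+y. ennreal (k x y * (h y)\<^sup>2 / p y) \<partial>lborel)"
      using k p h by (simp add: ennreal_power less_imp_le power_mult_distrib)
    also have "ennreal (C * p x) * \<dots> = (\<integral>\<^sup>+y. ennreal (C * p x) * ennreal (k x y * (h y)\<^sup>2 / p y) \<partial>lborel)"
      by (rule nn_integral_cmult[symmetric]) measurable
    finally show "(\<integral>\<^sup>+y. ennreal (k x y * h y) \<partial>lborel)\<^sup>2 \<le> \<dots>"
      by (simp add: mult_right_mono)
  qed
  also have "\<dots> = (\<integral>\<^sup>+y. (\<integral>\<^sup>+x. ennreal (C * p x) * ennreal (k x y * (h y)\<^sup>2 / p y) \<partial>lborel) \<partial>lborel)"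
    by (rule lborel_pair.Fubini') measurable
  also have "\<dots> = (\<integral>\<^sup>+y. ennreal (C * (h y)\<^sup>2 / p y) * (\<integral>\<^sup>+x. ennreal (k y x * p x) \<partial>lborel) \<partial>lborel)"
  proof (intro nn_integral_cong)
    fix y
    have "ennreal (C * p x) * ennreal (k x y * (h y)\<^sup>2 / p y) = ennreal (C * (h y)\<^sup>2 / p y) * ennreal (k y x * p x)" for x
      using k[of x y] p[of x] p[of y] C
      by (simp add: ennreal_mult[symmetric] k_sym[of y x] algebra_simps)
    then show "(\<integral>\<^sup>+x. ennreal (C * p x) * ennreal (k x y * (h y)\<^sup>2 / p y) \<partial>lborel)
       = ennreal (C * (h y)\<^sup>2 / p y) * (\<integral>\<^sup>+x. ennreal (k y x * p x) \<partial>lborel)"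
      by (simp add: nn_integral_cmult)
  qed
  also have "\<dots> \<le> (\<integral>\<^sup>+y. ennreal (C * (h y)\<^sup>2 / p y) * ennreal (C * p y) \<partial>lborel)"
    by (intro nn_integral_mono mult_left_mono schur) simp
  also have "\<dots> = (\<integral>\<^sup>+y. ennreal (C\<^sup>2) * ennreal ((h y)\<^sup>2) \<partial>lborel)"
  proof (intro nn_integral_cong)
    fix y show "ennreal (C * (h y)\<^sup>2 / p y) * ennreal (C * p y) = ennreal (C\<^sup>2) * ennreal ((h y)\<^sup>2)"
      using p[of y] C by (simp add: ennreal_mult[symmetric] power2_eq_square mult_ac)
  qed
  also have "\<dots> = ennreal (C\<^sup>2) * (\<integral>\<^sup>+y. ennreal ((h y)\<^sup>2) \<partial>lborel)"
    by (rule nn_integral_cmult) measurable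
  finally show ?thesis .
qed

section \<open>Half-line cut-offs in weighted Fourier spaces\<close>

lemma ennreal_sum_power2_le: "(a + b)\<^sup>2 \<le> 2 * a\<^sup>2 + 2 * b\<^sup>2" for a b :: ennreal
proof (cases a; cases b)
  fix x y :: real assume "a = ennreal x" "0 \<le> x" "b = ennreal y" "0 \<le> y"
  moreover have "(x + y)\<^sup>2 \<le> 2 * x\<^sup>2 + 2 * y\<^sup>2"
    using sum_squares_bound[of x y] by (simp add: power2_sum)
  moreover have "2 * ennreal (x\<^sup>2) = ennreal (2 * x\<^sup>2)" for x
    by (simp add: ennreal_mult)
  ultimately show ?thesis
    by (simp add: ennreal_power ennreal_plus[symmetric] del: ennreal_plus)
qed (auto simp: power2_eq_square ennreal_top_mult ennreal_mult_top)

lemma one_plus_abs_gauss_integrable: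
  assumes "s > 0"
  shows "integrable lborel (\<lambda>\<eta>::real. (1 + \<bar>\<eta>\<bar>) * exp (- (s * \<eta>)\<^sup>2 / 2))"
proof (rule Bochner_Integration.integrable_bound)
  show "integrable lborel (\<lambda>\<eta>. exp (1 / s\<^sup>2) * exp (- (s / sqrt 2 * \<eta>)\<^sup>2 / 2))"
    using assms by (intro integrable_mult_right gauss_integrable) simp
  have "(1 + \<bar>\<eta>\<bar>) * exp (- (s * \<eta>)\<^sup>2 / 2) \<le> exp (1 / s\<^sup>2) * exp (- (s / sqrt 2 * \<eta>)\<^sup>2 / 2)" for \<eta>
  proof -
    \<comment> \<open>The square is chosen so that |\<eta>| is at most 1/s^2 plus half of the
      Gaussian's exponent; the other half remains as the dominating Gaussian.\<close>
    have "0 \<le> (s * \<bar>\<eta>\<bar> / 2 - 1 / s)\<^sup>2" by simp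
    also have "\<dots> = (s * \<eta>)\<^sup>2 / 4 - \<bar>\<eta>\<bar> + 1 / s\<^sup>2"
      using assms by (simp add: power2_diff power_mult_distrib power_divide)
    finally have "\<bar>\<eta>\<bar> \<le> 1 / s\<^sup>2 + (s * \<eta>)\<^sup>2 / 4" by simp
    then have "1 + \<bar>\<eta>\<bar> \<le> exp (1 / s\<^sup>2 + (s * \<eta>)\<^sup>2 / 4)"
      by (intro order_trans[OF exp_ge_add_one_self]) simp
    then have "(1 + \<bar>\<eta>\<bar>) * exp (- (s * \<eta>)\<^sup>2 / 2) \<le> exp (1 / s\<^sup>2 + (s * \<eta>)\<^sup>2 / 4) * exp (- (s * \<eta>)\<^sup>2 / 2)"
      by (rule mult_right_mono) simp
    also have "\<dots> = exp (1 / s\<^sup>2) * exp (- (s / sqrt 2 * \<eta>)\<^sup>2 / 2)"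
      by (simp add: exp_add[symmetric] power_mult_distrib power_divide)
    finally show ?thesis .
  qed
  then show "AE \<eta> in lborel. norm ((1 + \<bar>\<eta>\<bar>) * exp (- (s * \<eta>)\<^sup>2 / 2)) \<le> norm (exp (1 / s\<^sup>2) * exp (- (s / sqrt 2 * \<eta>)\<^sup>2 / 2))"
    by simp
qed measurable

text \<open>With W the weight and R the convolution with the transform of the damped step, W R
  equals Q, where the weight sits inside the integral, plus a commutator. Q costs two Plancherel
  inequalities, that is (2\<pi>)^2, because the step is bounded by 1; the commutator costs S^2.
  Squaring the sum doubles both, which gives 8\<pi>^2 + 2S^2. The constant depends neither on s nor
  on \<epsilon> nor on \<tau>.\<close>

lemma weighted_conv_bound:
  assumes f: "integrable lborel f" and \<nu>: "\<bar>\<nu>\<bar> < 1/2" and s: "s > 0" and e: "\<epsilon> > 0"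
  defines "S \<equiv> 4 / (1/2 - \<bar>\<nu>\<bar>)"
  shows "(\<integral>\<^sup>+\<omega>. ennreal (((1 + \<bar>\<omega>\<bar>) powr \<nu> * cmod (LINT \<eta>|lborel. fourier f \<eta> * of_real (exp (- (s * \<eta>)\<^sup>2 / 2)) * fourier (halfexp \<epsilon> \<tau>) (\<omega> - \<eta>)))\<^sup>2) \<partial>lborel)
    \<le> ennreal (8 * pi\<^sup>2 + 2 * S\<^sup>2) * (\<integral>\<^sup>+\<omega>. ennreal (((1 + \<bar>\<omega>\<bar>) powr \<nu> * cmod (fourier f \<omega>))\<^sup>2) \<partial>lborel)"
proof -
  have fm[measurable]: "f \<in> borel_measurable borel" using f by auto
  define W where "W x = (1 + \<bar>x\<bar>) powr \<nu>" for x
  have W: "W x > 0" "W x \<le> 1 + \<bar>x\<bar>" for x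
    using powr_mono[of \<nu> 1 "1 + \<bar>x\<bar>"] \<nu> by (auto simp: W_def)
  have [measurable]: "W \<in> borel_measurable borel" unfolding W_def by measurable
  define E where "E = (\<lambda>\<eta>::real. exp (- (s * \<eta>)\<^sup>2 / 2))"
  have E: "0 \<le> E \<eta>" "E \<eta> \<le> 1" for \<eta> by (auto simp: E_def)
  have [measurable]: "E \<in> borel_measurable borel" unfolding E_def by measurable
  define fE where "fE = (\<lambda>\<eta>. fourier f \<eta> * of_real (E \<eta>))"
  define h where "h = (\<lambda>\<eta>. of_real (W \<eta>) * fE \<eta>)"
  define g where "g = halfexp \<epsilon> \<tau>"
  have g: "integrable lborel g" unfolding g_def by (rule halfexp_integrable[OF e])
  have [measurable]: "g \<in> borel_measurable borel" unfolding g_def by measurable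
  have [measurable]: "fE \<in> borel_measurable borel" "h \<in> borel_measurable borel" unfolding fE_def h_def by measurable
  have fE: "integrable lborel fE" unfolding fE_def E_def by (rule fourier_gauss_integrable[OF f s])
  \<comment> \<open>h must be integrable for its own Fourier transform to make sense; the Gaussian
    absorbs the weight, which grows at most linearly.\<close>
  have h: "integrable lborel h"
  proof (rule Bochner_Integration.integrable_bound)
    show "integrable lborel (\<lambda>\<eta>. (LINT t|lborel. cmod (f t)) * ((1 + \<bar>\<eta>\<bar>) * E \<eta>))"
      unfolding E_def using one_plus_abs_gauss_integrable[OF s] by simp
    have "cmod (h \<eta>) \<le> (LINT t|lborel. cmod (f t)) * ((1 + \<bar>\<eta>\<bar>) * E \<eta>)" for \<eta>
    proof -
      have "cmod (h \<eta>) = cmod (fourier f \<eta>) * (W \<eta> * E \<eta>)"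
        using W(1)[of \<eta>] E[of \<eta>] by (simp add: h_def fE_def norm_mult)
      also have "\<dots> \<le> (LINT t|lborel. cmod (f t)) * ((1 + \<bar>\<eta>\<bar>) * E \<eta>)"
        using fourier_bound[OF fm, of \<eta>] W[of \<eta>] E[of \<eta>]
        by (intro mult_mono) (auto simp: less_imp_le)
      finally show ?thesis .
    qed
    then show "AE \<eta> in lborel. norm (h \<eta>) \<le> norm ((LINT t|lborel. cmod (f t)) * ((1 + \<bar>\<eta>\<bar>) * E \<eta>))"
      by (auto intro: order_trans[OF _ abs_ge_self])
  qed measurable
  have q: "cmod (fourier g \<omega>) \<le> (LINT t|lborel. cmod (g t))" for \<omega>
    by (rule fourier_bound) measurable
  have intq: "integrable lborel (\<lambda>\<eta>. u \<eta> * fourier g (\<omega> - \<eta>))" if u: "integrable lborel u" for u :: "real \<Rightarrow> complex" and \<omega>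
  proof (rule Bochner_Integration.integrable_bound)
    have [measurable]: "u \<in> borel_measurable borel" using u by auto
    show "(\<lambda>\<eta>. u \<eta> * fourier g (\<omega> - \<eta>)) \<in> borel_measurable lborel" by measurable
    show "integrable lborel (\<lambda>\<eta>. u \<eta> * of_real (LINT t|lborel. cmod (g t)))" using u by simp
    show "AE \<eta> in lborel. norm (u \<eta> * fourier g (\<omega> - \<eta>)) \<le> norm (u \<eta> * of_real (LINT t|lborel. cmod (g t)))"
      using q by (auto simp: norm_mult intro!: mult_left_mono order_trans[OF _ abs_ge_self])
  qed
  define R where "R \<omega> = (LINT \<eta>|lborel. fE \<eta> * fourier g (\<omega> - \<eta>))" for \<omega>
  \<comment> \<open>The principal part. As the Fourier transform of \<open>g\<close> times another
    transform it is accessible to Plancherel.\<close>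
  define Q where "Q = fourier (\<lambda>t. g t * fourier h (- t))"
  have Q: "Q \<omega> = (LINT \<eta>|lborel. h \<eta> * fourier g (\<omega> - \<eta>))" for \<omega>
    unfolding Q_def by (rule integral_fourier_shift[OF h g, symmetric])
  have [measurable]: "Q \<in> borel_measurable borel" unfolding Q_def by measurable
  define K where "K \<omega> = (\<integral>\<^sup>+\<eta>. ennreal (kmax \<bar>\<nu>\<bar> \<omega> \<eta> * cmod (h \<eta>)) \<partial>lborel)" for \<omega>
  have [measurable]: "(\<lambda>p. kmax \<bar>\<nu>\<bar> (fst p) (snd p)) \<in> borel_measurable (borel \<Otimes>\<^sub>M borel)"
    by (rule kmax_measurable)
  have [measurable]: "K \<in> borel_measurable borel" 
    unfolding K_def kmax_def by measurable
  have RQK: "ennreal (W \<omega> * cmod (R \<omega>)) \<le> ennreal (cmod (Q \<omega>)) + K \<omega>" for \<omega>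
  proof -
    have "of_real (W \<omega>) * R \<omega> = (LINT \<eta>|lborel. of_real (W \<omega>) * (fE \<eta> * fourier g (\<omega> - \<eta>)))"
      unfolding R_def by simp
    then have "of_real (W \<omega>) * R \<omega> - Q \<omega> = (LINT \<eta>|lborel. of_real (W \<omega>) * (fE \<eta> * fourier g (\<omega> - \<eta>)) - h \<eta> * fourier g (\<omega> - \<eta>))"
      unfolding Q using intq[OF fE, of \<omega>] intq[OF h, of \<omega>] by (subst Bochner_Integration.integral_diff) auto
    then have "ennreal (cmod (of_real (W \<omega>) * R \<omega> - Q \<omega>)) \<le>
       (\<integral>\<^sup>+\<eta>. ennreal (cmod (of_real (W \<omega>) * (fE \<eta> * fourier g (\<omega> - \<eta>)) - h \<eta> * fourier g (\<omega> - \<eta>))) \<partial>lborel)"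
      by (simp only: norm_integral_le_nn_integral)
    also have "\<dots> \<le> K \<omega>" unfolding K_def
    proof (intro nn_integral_mono ennreal_leI)
      fix \<eta>
      \<comment> \<open>In the commutator only the ratio of weights minus 1 survives. It vanishes at
        \<omega> = \<eta>, where the transform of the step is as large as 1 / \<epsilon>.\<close>
      have "of_real (W \<omega>) * (fE \<eta> * fourier g (\<omega> - \<eta>)) - h \<eta> * fourier g (\<omega> - \<eta>)
        = of_real (W \<omega> / W \<eta> - 1) * fourier g (\<omega> - \<eta>) * h \<eta>"
        using W(1)[of \<eta>] by (simp add: h_def field_simps)
      then have "cmod (of_real (W \<omega>) * (fE \<eta> * fourier g (\<omega> - \<eta>)) - h \<eta> * fourier g (\<omega> - \<eta>))
        = \<bar>W \<omega> / W \<eta> - 1\<bar> * cmod (fourier g (\<omega> - \<eta>)) * cmod (h \<eta>)"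
        by (simp only: norm_mult norm_of_real)
      also have "\<bar>W \<omega> / W \<eta> - 1\<bar> * cmod (fourier g (\<omega> - \<eta>)) \<le> kmax \<bar>\<nu>\<bar> \<omega> \<eta>"
      proof (cases "\<omega> = \<eta>")
        case True
        then show ?thesis using W(1)[of \<eta>] by (simp add: kmax_nonneg)
      next
        case False
        then have "\<bar>W \<omega> / W \<eta> - 1\<bar> * cmod (fourier g (\<omega> - \<eta>)) \<le> \<bar>W \<omega> / W \<eta> - 1\<bar> * (1 / \<bar>\<omega> - \<eta>\<bar>)"
          unfolding g_def by (intro mult_left_mono norm_fourier_halfexp_le e) auto
        also have "\<dots> \<le> kmax \<bar>\<nu>\<bar> \<omega> \<eta>"
          using weight_ratio_bound[of \<nu> \<omega> \<eta>] \<nu> by (simp add: W_def)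
        finally show ?thesis .
      qed
      finally show "cmod (of_real (W \<omega>) * (fE \<eta> * fourier g (\<omega> - \<eta>)) - h \<eta> * fourier g (\<omega> - \<eta>))
         \<le> kmax \<bar>\<nu>\<bar> \<omega> \<eta> * cmod (h \<eta>)" by (simp add: mult_right_mono)
    qed
    finally have "ennreal (cmod (of_real (W \<omega>) * R \<omega> - Q \<omega>)) \<le> K \<omega>" .
    moreover have "W \<omega> * cmod (R \<omega>) = cmod (of_real (W \<omega>) * R \<omega>)"
      using W(1)[of \<omega>] by (simp add: norm_mult)
    then have "W \<omega> * cmod (R \<omega>) \<le> cmod (Q \<omega>) + cmod (of_real (W \<omega>) * R \<omega> - Q \<omega>)"
      using norm_triangle_sub[of "of_real (W \<omega>) * R \<omega>" "Q \<omega>"] by (simp add: add.commute)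
    then have "ennreal (W \<omega> * cmod (R \<omega>)) \<le> ennreal (cmod (Q \<omega>)) + ennreal (cmod (of_real (W \<omega>) * R \<omega> - Q \<omega>))"
      by (subst ennreal_plus[symmetric]) (auto intro!: ennreal_leI simp del: ennreal_plus)
    ultimately show ?thesis by (meson add_left_mono order_trans)
  qed
  define N where "N = (\<integral>\<^sup>+\<omega>. ennreal ((W \<omega> * cmod (fourier f \<omega>))\<^sup>2) \<partial>lborel)"
  have hN: "(\<integral>\<^sup>+\<omega>. ennreal ((cmod (h \<omega>))\<^sup>2) \<partial>lborel) \<le> N"
    unfolding N_def
  proof (intro nn_integral_mono ennreal_leI power_mono)
    show "cmod (h \<omega>) \<le> W \<omega> * cmod (fourier f \<omega>)" for \<omega>
      using W(1)[of \<omega>] E[of \<omega>] mult_left_le[of "E \<omega>" "W \<omega> * cmod (fourier f \<omega>)"]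
      by (simp add: h_def fE_def norm_mult mult.assoc)
  qed simp
  have "(\<integral>\<^sup>+\<omega>. ennreal ((W \<omega> * cmod (R \<omega>))\<^sup>2) \<partial>lborel)
     \<le> (\<integral>\<^sup>+\<omega>. 2 * (ennreal ((cmod (Q \<omega>))\<^sup>2)) + 2 * (K \<omega>)\<^sup>2 \<partial>lborel)"
  proof (intro nn_integral_mono)
    fix \<omega>
    have "ennreal ((W \<omega> * cmod (R \<omega>))\<^sup>2) = (ennreal (W \<omega> * cmod (R \<omega>)))\<^sup>2"
      using W(1)[of \<omega>] by (simp add: ennreal_power)
    also have "\<dots> \<le> (ennreal (cmod (Q \<omega>)) + K \<omega>)\<^sup>2"
      by (rule power_mono[OF RQK]) simp
    also have "\<dots> \<le> 2 * (ennreal (cmod (Q \<omega>)))\<^sup>2 + 2 * (K \<omega>)\<^sup>2" by (rule ennreal_sum_power2_le)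
    finally show "ennreal ((W \<omega> * cmod (R \<omega>))\<^sup>2) \<le> 2 * (ennreal ((cmod (Q \<omega>))\<^sup>2)) + 2 * (K \<omega>)\<^sup>2"
      by (simp add: ennreal_power)
  qed
  also have "\<dots> = 2 * (\<integral>\<^sup>+\<omega>. ennreal ((cmod (Q \<omega>))\<^sup>2) \<partial>lborel) + 2 * (\<integral>\<^sup>+\<omega>. (K \<omega>)\<^sup>2 \<partial>lborel)"
    by (simp add: nn_integral_add nn_integral_cmult)
  also have "(\<integral>\<^sup>+\<omega>. (K \<omega>)\<^sup>2 \<partial>lborel) \<le> ennreal (S\<^sup>2) * (\<integral>\<^sup>+\<omega>. ennreal ((cmod (h \<omega>))\<^sup>2) \<partial>lborel)"
    unfolding K_def
  proof (rule schur_test[where p="\<lambda>x. (1 + \<bar>x\<bar>) powr (- (1/2))"])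
    show "(\<integral>\<^sup>+ y. ennreal (kmax \<bar>\<nu>\<bar> x y * (1 + \<bar>y\<bar>) powr - (1 / 2)) \<partial>lborel) \<le> ennreal (S * (1 + \<bar>x\<bar>) powr - (1 / 2))" for x
      unfolding S_def using \<nu> by (intro kmax_schur) auto
    show "0 \<le> S" using \<nu> by (simp add: S_def)
    show "(1 + \<bar>x\<bar>) powr - (1 / 2) > 0" for x :: real by (simp add: add_pos_nonneg)
  qed (auto simp: kmax_nonneg kmax_commute)
  also have "ennreal (S\<^sup>2) * (\<integral>\<^sup>+\<omega>. ennreal ((cmod (h \<omega>))\<^sup>2) \<partial>lborel) \<le> ennreal (S\<^sup>2) * N"
    by (rule mult_left_mono[OF hN]) simp
  also have "(\<integral>\<^sup>+\<omega>. ennreal ((cmod (Q \<omega>))\<^sup>2) \<partial>lborel) \<le> ennreal (2 * pi) * (\<integral>\<^sup>+t. ennreal ((cmod (g t * fourier h (- t)))\<^sup>2) \<partial>lborel)"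
    unfolding Q_def
  proof (rule plancherel_le, rule Bochner_Integration.integrable_bound)
    show "integrable lborel (\<lambda>t. g t * of_real (LINT t|lborel. cmod (h t)))" using g by simp
    show "AE t in lborel. norm (g t * fourier h (- t)) \<le> norm (g t * of_real (LINT t|lborel. cmod (h t)))"
      using fourier_bound[of h] by (auto simp: norm_mult intro!: mult_left_mono order_trans[OF _ abs_ge_self])
  qed measurable
  also have "(\<integral>\<^sup>+t. ennreal ((cmod (g t * fourier h (- t)))\<^sup>2) \<partial>lborel) \<le> (\<integral>\<^sup>+t. ennreal ((cmod (fourier h (0 + (-1) * t)))\<^sup>2) \<partial>lborel)"
  proof (intro nn_integral_mono ennreal_leI power_mono)
    show "cmod (g t * fourier h (- t)) \<le> cmod (fourier h (0 + (-1) * t))" for t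
      using norm_halfexp_le[OF e, of \<tau> t] mult_left_le_one_le[of "cmod (fourier h (- t))" "cmod (g t)"]
      by (simp add: norm_mult g_def)
  qed simp
  also have "\<dots> = (\<integral>\<^sup>+t. ennreal ((cmod (fourier h t))\<^sup>2) \<partial>lborel)"
    by (subst nn_integral_real_affine[where c="-1" and t=0 and f="\<lambda>t. ennreal ((cmod (fourier h t))\<^sup>2)"]) auto
  also have "\<dots> \<le> ennreal (2 * pi) * (\<integral>\<^sup>+\<omega>. ennreal ((cmod (h \<omega>))\<^sup>2) \<partial>lborel)"
    by (rule plancherel_le[OF h])
  also have "\<dots> \<le> ennreal (2 * pi) * N"
    by (rule mult_left_mono[OF hN]) simp
  finally have "(\<integral>\<^sup>+\<omega>. ennreal ((W \<omega> * cmod (R \<omega>))\<^sup>2) \<partial>lborel) \<le>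
     2 * (ennreal (2 * pi) * (ennreal (2 * pi) * N)) + 2 * (ennreal (S\<^sup>2) * N)"
    by (simp add: mult_left_mono add_mono)
  also have "\<dots> = ennreal (8 * pi\<^sup>2 + 2 * S\<^sup>2) * N"
  proof -
    have "ennreal (8 * pi\<^sup>2 + 2 * S\<^sup>2) = ennreal 2 * (ennreal (2 * pi) * ennreal (2 * pi)) + ennreal 2 * ennreal (S\<^sup>2)"
      by (simp add: ennreal_mult[symmetric] ennreal_plus[symmetric] power2_eq_square del: ennreal_plus ennreal_numeral)
    then show ?thesis by (simp add: distrib_right mult.assoc)
  qed
  finally show ?thesis unfolding W_def R_def N_def fE_def E_def g_def .
qed

section \<open>Removal of the regularisation\<close>

definition cut_above :: "real \<Rightarrow> (real \<Rightarrow> complex) \<Rightarrow> real \<Rightarrow> complex" where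
  "cut_above \<tau> f t = (if \<tau> < t then f t else 0)"

lemma cut_above_measurable[measurable]:
  assumes [measurable]: "f \<in> borel_measurable borel"
  shows "cut_above \<tau> f \<in> borel_measurable borel"
  unfolding cut_above_def by measurable

lemma cut_above_integrable:
  "integrable lborel f \<Longrightarrow> integrable lborel (cut_above \<tau> f)"
  by (rule Bochner_Integration.integrable_bound[where f=f]) (auto simp: cut_above_def)

text \<open>The substitution t = x + s z turns this into an average over a fixed normal law, whose
  integrand converges for almost every z. At x = \<tau> half of the mass would remain in the limit,
  which is why that point is excluded.\<close>

lemma halfexp_normal_average_tendsto:
  assumes "x \<noteq> \<tau>"
  defines "s \<equiv> \<lambda>n. 1 / real (Suc n)"
  shows "(\<lambda>n. LINT t|lborel. halfexp (s n) \<tau> t * (iexp (- (\<omega> * t)) * of_real (normal_density 0 (s n) (t - x))))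
     \<longlonglongrightarrow> cut_above \<tau> (\<lambda>t. iexp (- (\<omega> * t))) x"
proof -
  have s: "s n > 0" for n by (simp add: s_def)
  have s0: "s \<longlonglongrightarrow> 0" unfolding s_def by (rule LIMSEQ_Suc[OF lim_1_over_n])
  let ?G = "\<lambda>n z. halfexp (s n) \<tau> (x + s n * z) * (iexp (- (\<omega> * (x + s n * z))) * of_real (std_normal_density z))"
  have eq: "(LINT t|lborel. halfexp (s n) \<tau> t * (iexp (- (\<omega> * t)) * of_real (normal_density 0 (s n) (t - x))))
     = (LINT z|lborel. ?G n z)" for n
  proof -
    have "(LINT t|lborel. halfexp (s n) \<tau> t * (iexp (- (\<omega> * t)) * of_real (normal_density 0 (s n) (t - x))))
      = \<bar>s n\<bar> *\<^sub>R (LINT z|lborel. halfexp (s n) \<tau> (x + s n * z) * (iexp (- (\<omega> * (x + s n * z))) * of_real (normal_density 0 (s n) (x + s n * z - x))))"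
      using s[of n] by (intro lborel_integral_real_affine) simp
    also have "\<dots> = (LINT z|lborel. \<bar>s n\<bar> *\<^sub>R (halfexp (s n) \<tau> (x + s n * z) * (iexp (- (\<omega> * (x + s n * z))) * of_real (normal_density 0 (s n) (x + s n * z - x)))))"
      by simp
    also have "\<dots> = (LINT z|lborel. ?G n z)"
    proof (intro Bochner_Integration.integral_cong refl)
      fix z
      have "s n * normal_density 0 (s n) (x + s n * z - x) = std_normal_density z"
        using s[of n] by (simp add: normal_density_def real_sqrt_mult power_mult_distrib)
      then have "complex_of_real (std_normal_density z) = of_real (s n) * of_real (normal_density 0 (s n) (x + s n * z - x))"
        by (metis of_real_mult)
      then show "\<bar>s n\<bar> *\<^sub>R (halfexp (s n) \<tau> (x + s n * z) * (iexp (- (\<omega> * (x + s n * z))) * of_real (normal_density 0 (s n) (x + s n * z - x)))) = ?G n z"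
        using s[of n] by (simp add: scaleR_conv_of_real mult_ac)
    qed
    finally show ?thesis .
  qed
  have "(\<lambda>n. LINT z|lborel. ?G n z) \<longlonglongrightarrow> (LINT z|lborel. cut_above \<tau> (\<lambda>t. iexp (- (\<omega> * t))) x * of_real (std_normal_density z))"
  proof (rule integral_dominated_convergence[where w=std_normal_density])
    show "integrable lborel std_normal_density" by (rule integrable_normal_density) simp
    show "AE z in lborel. (\<lambda>n. ?G n z) \<longlonglongrightarrow> cut_above \<tau> (\<lambda>t. iexp (- (\<omega> * t))) x * of_real (std_normal_density z)"
    proof (rule AE_I2)
      fix z
      have lim: "(\<lambda>n. x + s n * z) \<longlonglongrightarrow> x" using tendsto_add[OF tendsto_const tendsto_mult[OF s0 tendsto_const]] by simp
      have e: "(\<lambda>n. iexp (- (\<omega> * (x + s n * z)))) \<longlonglongrightarrow> iexp (- (\<omega> * x))"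
        by (intro tendsto_intros lim)
      have h: "(\<lambda>n. halfexp (s n) \<tau> (x + s n * z)) \<longlonglongrightarrow> (if \<tau> < x then 1 else 0)"
      proof (cases "\<tau> < x")
        case True
        have "(\<lambda>n. complex_of_real (exp (- s n * (x + s n * z - \<tau>)))) \<longlonglongrightarrow> of_real (exp (- 0 * (x - \<tau>)))"
          by (intro tendsto_intros s0 lim)
        moreover have "\<forall>\<^sub>F n in sequentially. complex_of_real (exp (- s n * (x + s n * z - \<tau>))) = halfexp (s n) \<tau> (x + s n * z)"
          using order_tendstoD(1)[OF lim True] by eventually_elim (simp add: halfexp_def)
        ultimately show ?thesis using True by (auto elim: Lim_transform_eventually)
      next
        case False
        then have "x < \<tau>" using assms by simp
        from order_tendstoD(2)[OF lim this] 
        have "\<forall>\<^sub>F n in sequentially. 0 = halfexp (s n) \<tau> (x + s n * z)"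
          by eventually_elim (simp add: halfexp_def)
        with False show ?thesis by (auto intro: Lim_transform_eventually[OF tendsto_const])
      qed
      have "(\<lambda>n. ?G n z) \<longlonglongrightarrow> (if \<tau> < x then 1 else 0) * (iexp (- (\<omega> * x)) * of_real (std_normal_density z))"
        by (intro tendsto_mult tendsto_const e h)
      then show "(\<lambda>n. ?G n z) \<longlonglongrightarrow> cut_above \<tau> (\<lambda>t. iexp (- (\<omega> * t))) x * of_real (std_normal_density z)"
        by (simp add: cut_above_def split: if_splits)
    qed
    show "AE z in lborel. norm (?G n z) \<le> std_normal_density z" for n
      using norm_halfexp_le[OF s] by (auto simp: norm_mult mult_left_le_one_le)
  qed measurable
  also have "(LINT z|lborel. cut_above \<tau> (\<lambda>t. iexp (- (\<omega> * t))) x * of_real (std_normal_density z)) = cut_above \<tau> (\<lambda>t. iexp (- (\<omega> * t))) x"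
    using integral_normal_density[of 1 0] by (simp del: integral_normal_density)
  finally show ?thesis unfolding eq .
qed

text \<open>On the physical side the Gaussian factor becomes an average with a normal density, and
  the damped step becomes a multiplier. Both parameters are tied to the same s n, so that one
  dominated convergence, with |f| as majorant, removes them together.\<close>

lemma regularised_cut_tendsto:
  assumes f: "integrable lborel f"
  defines "s \<equiv> \<lambda>n. 1 / real (Suc n)"
  shows "(\<lambda>n. LINT \<eta>|lborel. fourier f \<eta> * of_real (exp (- (s n * \<eta>)\<^sup>2 / 2)) * fourier (halfexp (s n) \<tau>) (\<omega> - \<eta>))
    \<longlonglongrightarrow> 2 * pi * fourier (cut_above \<tau> f) \<omega>"
proof -
  have fm[measurable]: "f \<in> borel_measurable borel" using f by auto
  have s: "s n > 0" for n by (simp add: s_def)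
  let ?A = "\<lambda>n x. LINT t|lborel. halfexp (s n) \<tau> t * (iexp (- (\<omega> * t)) * of_real (normal_density 0 (s n) (t - x)))"
  have eq: "(LINT \<eta>|lborel. fourier f \<eta> * of_real (exp (- (s n * \<eta>)\<^sup>2 / 2)) * fourier (halfexp (s n) \<tau>) (\<omega> - \<eta>))
     = 2 * pi * (LINT x|lborel. f x * ?A n x)" for n
  proof -
    let ?fE = "\<lambda>\<eta>. fourier f \<eta> * of_real (exp (- (s n * \<eta>)\<^sup>2 / 2))"
    have fE: "fourier ?fE (- t) = 2 * pi * (LINT x|lborel. f x * of_real (normal_density 0 (s n) (t - x)))" for t
    proof -
      have [measurable]: "?fE \<in> borel_measurable borel" by measurable
      have "fourier ?fE (- t) = (LINT \<eta>|lborel. ?fE \<eta> * iexp (\<eta> * t))"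
        by (subst fourier_lborel) (auto simp: mult.commute[of t])
      then show ?thesis by (simp only: fourier_gauss_inversion[OF f s])
    qed
    have gm: "integrable lborel (\<lambda>t. halfexp (s n) \<tau> t * iexp (- (\<omega> * t)))"
      by (rule Bochner_Integration.integrable_bound[OF halfexp_integrable[OF s, of n \<tau>]]) (auto simp: norm_mult)
    have "(LINT \<eta>|lborel. ?fE \<eta> * fourier (halfexp (s n) \<tau>) (\<omega> - \<eta>))
       = fourier (\<lambda>t. halfexp (s n) \<tau> t * fourier ?fE (- t)) \<omega>"
      by (rule integral_fourier_shift[OF fourier_gauss_integrable[OF f s] halfexp_integrable[OF s]])
    also have "\<dots> = (LINT t|lborel. (2 * pi) * ((halfexp (s n) \<tau> t * iexp (- (\<omega> * t))) * (LINT x|lborel. f x * (case (t, x) of (t, x) \<Rightarrow> of_real (normal_density 0 (s n) (t - x))))))"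
      unfolding fE by (subst fourier_lborel) (auto simp: mult_ac)
    also have "\<dots> = (2 * pi) * (LINT t|lborel. (halfexp (s n) \<tau> t * iexp (- (\<omega> * t))) * (LINT x|lborel. f x * (case (t, x) of (t, x) \<Rightarrow> of_real (normal_density 0 (s n) (t - x)))))"
      by (rule integral_mult_right_zero)
    also have "(LINT t|lborel. (halfexp (s n) \<tau> t * iexp (- (\<omega> * t))) * (LINT x|lborel. f x * (case (t, x) of (t, x) \<Rightarrow> of_real (normal_density 0 (s n) (t - x)))))
      = (LINT x|lborel. f x * (LINT t|lborel. (halfexp (s n) \<tau> t * iexp (- (\<omega> * t))) * (case (t, x) of (t, x) \<Rightarrow> of_real (normal_density 0 (s n) (t - x)))))"
    proof (rule fubini_mult[OF gm f, where B="1 / sqrt (2 * pi * (s n)\<^sup>2)"])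
      fix p :: "real \<times> real"
      show "cmod (case p of (t, x) \<Rightarrow> of_real (normal_density 0 (s n) (t - x))) \<le> 1 / sqrt (2 * pi * (s n)\<^sup>2)"
      proof (cases p)
        case (Pair t x)
        have "cmod (of_real (normal_density 0 (s n) (t - x))) = 1 / sqrt (2 * pi * (s n)\<^sup>2) * exp (- (t - x)\<^sup>2 / (2 * (s n)\<^sup>2))"
          unfolding norm_of_real normal_density_def by (simp add: abs_mult)
        also have "\<dots> \<le> 1 / sqrt (2 * pi * (s n)\<^sup>2)"
          by (rule mult_left_le) auto
        finally show ?thesis by (simp add: Pair)
      qed
    qed measurable
    also have "\<dots> = (LINT x|lborel. f x * ?A n x)" by (simp add: mult.assoc)
    finally show ?thesis .
  qed
  have "(\<lambda>n. LINT x|lborel. f x * ?A n x) \<longlonglongrightarrow> (LINT x|lborel. f x * cut_above \<tau> (\<lambda>t. iexp (- (\<omega> * t))) x)"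
  proof (rule integral_dominated_convergence[where w="\<lambda>x. cmod (f x)"])
    show "integrable lborel (\<lambda>x. cmod (f x))" using f by simp
    have "AE x in lborel. x \<noteq> \<tau>" by (rule AE_lborel_singleton)
    then show "AE x in lborel. (\<lambda>n. f x * ?A n x) \<longlonglongrightarrow> f x * cut_above \<tau> (\<lambda>t. iexp (- (\<omega> * t))) x"
      by eventually_elim (unfold s_def, intro tendsto_mult tendsto_const halfexp_normal_average_tendsto)
    have A: "cmod (?A n x) \<le> 1" for n x
    proof -
      have "ennreal (cmod (?A n x)) \<le> (\<integral>\<^sup>+t. cmod (halfexp (s n) \<tau> t * (iexp (- (\<omega> * t)) * of_real (normal_density 0 (s n) (t - x)))) \<partial>lborel)"
        by (rule norm_integral_le_nn_integral)
      also have "\<dots> \<le> (\<integral>\<^sup>+t. ennreal (normal_density 0 (s n) (t - x)) \<partial>lborel)"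
        using norm_halfexp_le[OF s] by (intro nn_integral_mono ennreal_leI) (auto simp: norm_mult mult_left_le_one_le)
      also have "\<dots> = 1" by (rule normal_density_nn[OF s])
      finally show ?thesis by simp
    qed
    show "AE x in lborel. cmod (f x * ?A n x) \<le> cmod (f x)" for n
      using A by (auto simp: norm_mult mult_left_le)
  qed (auto simp: cut_above_def)
  moreover have "(LINT x|lborel. f x * cut_above \<tau> (\<lambda>t. iexp (- (\<omega> * t))) x) = fourier (cut_above \<tau> f) \<omega>"
    by (subst fourier_lborel) (auto simp: cut_above_def intro!: Bochner_Integration.integral_cong)
  ultimately show ?thesis unfolding eq by (intro tendsto_mult tendsto_const) simp
qed

text \<open>Fatou's lemma for the regularised convolutions. The division by (2\<pi>)^2 compensates
  the factor 2\<pi> that the convolution theorem leaves on the limit.\<close>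

lemma cut_above_weighted_bound:
  assumes f: "integrable lborel f" and \<nu>: "\<bar>\<nu>\<bar> < 1/2"
  defines "C \<equiv> (8 * pi\<^sup>2 + 2 * (4 / (1/2 - \<bar>\<nu>\<bar>))\<^sup>2) / (2 * pi)\<^sup>2"
  shows "(\<integral>\<^sup>+\<omega>. ennreal (((1 + \<bar>\<omega>\<bar>) powr \<nu> * cmod (fourier (cut_above \<tau> f) \<omega>))\<^sup>2) \<partial>lborel)
    \<le> ennreal C * (\<integral>\<^sup>+\<omega>. ennreal (((1 + \<bar>\<omega>\<bar>) powr \<nu> * cmod (fourier f \<omega>))\<^sup>2) \<partial>lborel)"
proof (rule nn_integral_limit_bound)
  have fm[measurable]: "f \<in> borel_measurable borel" using f by auto
  define s where "s = (\<lambda>n. 1 / real (Suc n))"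
  have s: "s n > 0" for n by (simp add: s_def)
  define R where "R n \<omega> = (LINT \<eta>|lborel. fourier f \<eta> * of_real (exp (- (s n * \<eta>)\<^sup>2 / 2)) * fourier (halfexp (s n) \<tau>) (\<omega> - \<eta>))" for n \<omega>
  have [measurable]: "R n \<in> borel_measurable borel" for n
    unfolding R_def by measurable
  let ?u = "\<lambda>n \<omega>. ennreal (((1 + \<bar>\<omega>\<bar>) powr \<nu> * (cmod (R n \<omega>) / (2 * pi)))\<^sup>2)"
  show "?u n \<in> borel_measurable lborel" for n by measurable
  show "(\<lambda>n. ?u n \<omega>) \<longlonglongrightarrow> ennreal (((1 + \<bar>\<omega>\<bar>) powr \<nu> * cmod (fourier (cut_above \<tau> f) \<omega>))\<^sup>2)" for \<omega>
  proof -
    have "(\<lambda>n. cmod (R n \<omega>) / (2 * pi)) \<longlonglongrightarrow> cmod (2 * pi * fourier (cut_above \<tau> f) \<omega>) / (2 * pi)"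
      unfolding R_def s_def by (intro tendsto_intros regularised_cut_tendsto[OF f]) simp
    then have "(\<lambda>n. cmod (R n \<omega>) / (2 * pi)) \<longlonglongrightarrow> cmod (fourier (cut_above \<tau> f) \<omega>)"
      by (simp add: norm_mult)
    then show ?thesis by (intro tendsto_ennrealI tendsto_intros)
  qed
  show "(\<integral>\<^sup>+\<omega>. ?u n \<omega> \<partial>lborel) \<le> ennreal C * (\<integral>\<^sup>+\<omega>. ennreal (((1 + \<bar>\<omega>\<bar>) powr \<nu> * cmod (fourier f \<omega>))\<^sup>2) \<partial>lborel)" for n
  proof -
    have "(\<integral>\<^sup>+\<omega>. ?u n \<omega> \<partial>lborel) = (\<integral>\<^sup>+\<omega>. ennreal (1 / (2 * pi)\<^sup>2) * ennreal (((1 + \<bar>\<omega>\<bar>) powr \<nu> * cmod (R n \<omega>))\<^sup>2) \<partial>lborel)"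
      by (intro nn_integral_cong) (simp add: ennreal_mult[symmetric] power_mult_distrib power_divide)
    also have "\<dots> = ennreal (1 / (2 * pi)\<^sup>2) * (\<integral>\<^sup>+\<omega>. ennreal (((1 + \<bar>\<omega>\<bar>) powr \<nu> * cmod (R n \<omega>))\<^sup>2) \<partial>lborel)"
      by (rule nn_integral_cmult) measurable
    also have "\<dots> \<le> ennreal (1 / (2 * pi)\<^sup>2) * (ennreal (8 * pi\<^sup>2 + 2 * (4 / (1/2 - \<bar>\<nu>\<bar>))\<^sup>2) * (\<integral>\<^sup>+\<omega>. ennreal (((1 + \<bar>\<omega>\<bar>) powr \<nu> * cmod (fourier f \<omega>))\<^sup>2) \<partial>lborel))"
      unfolding R_def by (intro mult_left_mono weighted_conv_bound[OF f \<nu> s s]) simp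
    also have "\<dots> = ennreal C * (\<integral>\<^sup>+\<omega>. ennreal (((1 + \<bar>\<omega>\<bar>) powr \<nu> * cmod (fourier f \<omega>))\<^sup>2) \<partial>lborel)"
      unfolding C_def mult.assoc[symmetric] by (subst ennreal_mult[symmetric]) auto
    finally show ?thesis .
  qed
qed

section \<open>Smooth bump functions\<close>

lemma times_cont_diff_imp_continuous: "times_cont_diff k f \<Longrightarrow> continuous_on UNIV f"
  by (cases k) (auto intro!: continuous_at_imp_continuous_on differentiable_imp_continuous_within)

lemma times_cont_diff_Suc_D: "times_cont_diff (Suc k) f \<Longrightarrow> times_cont_diff k f"
proof (induction k arbitrary: f)
  case 0
  then show ?case using times_cont_diff_imp_continuous by fastforce
next
  case (Suc k)
  then have "f differentiable at x" "times_cont_diff k (\<lambda>x. frechet_derivative f (at x) v)" for x v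
    by (auto simp only: times_cont_diff.simps(2)[of "Suc k"])
  then show ?case by simp
qed

text \<open>A coinductive criterion: differentiable functions whose directional derivatives stay in
  the same class are smooth. Naming the class avoids computing iterated derivatives.\<close>

lemma times_cont_diff_class:
  assumes "f \<in> F" and F: "\<And>f. f \<in> F \<Longrightarrow> (\<forall>x. f differentiable at x) \<and> (\<forall>v. (\<lambda>x. frechet_derivative f (at x) v) \<in> F)"
  shows "times_cont_diff k f"
  using assms(1)
proof (induction k arbitrary: f)
  case 0
  then show ?case using F by (auto intro!: continuous_at_imp_continuous_on differentiable_imp_continuous_within)
next
  case (Suc k)
  then show ?case using F by auto
qed

lemma frechet_derivative_eqI: "(f has_derivative f') (at x) \<Longrightarrow> frechet_derivative f (at x) = f'"
  using frechet_derivative_at by metis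

text \<open>Takes the derivative as an explicit function f' of point and direction, so that the
  inductions below can use the ordinary derivative rules and never manipulate
  \<open>frechet_derivative\<close> of a compound term.\<close>

lemma times_cont_diff_SucI:
  assumes d: "\<And>x. (f has_derivative f' x) (at x)" and "\<And>v. times_cont_diff k (\<lambda>x. f' x v)"
  shows "times_cont_diff (Suc k) f"
  using assms(2) d unfolding times_cont_diff.simps frechet_derivative_eqI[OF d] differentiable_def by blast

lemma times_cont_diff_SucE:
  assumes "times_cont_diff (Suc k) f"
  shows "(f has_derivative frechet_derivative f (at x)) (at x)" "times_cont_diff k (\<lambda>x. frechet_derivative f (at x) v)"
  using assms by (simp_all add: frechet_derivative_works[symmetric])

lemma times_cont_diff_const: "times_cont_diff k (\<lambda>x. c)"
proof (rule times_cont_diff_class[where F="range (\<lambda>c x. c)"])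
  fix f :: "'a \<Rightarrow> 'b" assume "f \<in> range (\<lambda>c x. c)"
  then obtain c where "f = (\<lambda>x. c)" by auto
  then show "(\<forall>x. f differentiable at x) \<and> (\<forall>v. (\<lambda>x. frechet_derivative f (at x) v) \<in> range (\<lambda>c x. c))"
    by auto
qed auto

lemma times_cont_diff_add:
  "times_cont_diff k f \<Longrightarrow> times_cont_diff k g \<Longrightarrow> times_cont_diff k (\<lambda>x. f x + g x)"
proof (induction k arbitrary: f g)
  case 0
  then show ?case by (auto intro: continuous_intros)
next
  case (Suc k)
  note f = times_cont_diff_SucE[OF Suc.prems(1)] and g = times_cont_diff_SucE[OF Suc.prems(2)]
  show ?case
    by (rule times_cont_diff_SucI[OF has_derivative_add[OF f(1) g(1)]]) (rule Suc.IH[OF f(2) g(2)])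
qed

lemma times_cont_diff_scaleR:
  fixes f :: "'a::real_normed_vector \<Rightarrow> real" and g :: "'a \<Rightarrow> 'b::real_normed_vector"
  shows "times_cont_diff k f \<Longrightarrow> times_cont_diff k g \<Longrightarrow> times_cont_diff k (\<lambda>x. f x *\<^sub>R g x)"
proof (induction k arbitrary: f g)
  case 0
  then show ?case by (auto intro: continuous_intros)
next
  case (Suc k)
  note f = times_cont_diff_SucE[OF Suc.prems(1)] and g = times_cont_diff_SucE[OF Suc.prems(2)]
  \<comment> \<open>In the product rule one factor stays undifferentiated, and the induction
    hypothesis is applied to it at order k, one below what is assumed.\<close>
  show ?case
    by (rule times_cont_diff_SucI[OF has_derivative_scaleR[OF f(1) g(1)]])
      (intro times_cont_diff_add Suc.IH f(2) g(2) Suc.prems[THEN times_cont_diff_Suc_D])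
qed

lemma times_cont_diff_compose_affine:
  assumes L: "bounded_linear L"
  shows "times_cont_diff k f \<Longrightarrow> times_cont_diff k (\<lambda>x. f (L x + c))"
proof (induction k arbitrary: f)
  case 0
  then have "continuous_on UNIV f" by simp
  moreover have "continuous_on UNIV (\<lambda>x. L x + c)"
    by (intro continuous_on_add linear_continuous_on[OF L] continuous_on_const)
  ultimately have "continuous_on UNIV (\<lambda>x. f (L x + c))"
    by (rule continuous_on_compose2) auto
  then show ?case by simp
next
  case (Suc k)
  note f = times_cont_diff_SucE[OF Suc.prems]
  have a: "((\<lambda>x. L x + c) has_derivative L) (at x)" for x
    using has_derivative_add[OF bounded_linear_imp_has_derivative[OF L] has_derivative_const[of c]] by simp
  have d: "((\<lambda>x. f (L x + c)) has_derivative (\<lambda>v. frechet_derivative f (at (L x + c)) (L v))) (at x)" for x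
    by (rule has_derivative_compose[OF a f(1)])
  show ?case
  proof (rule times_cont_diff_SucI[OF d])
    show "times_cont_diff k (\<lambda>x. frechet_derivative f (at (L x + c)) (L v))" for v
      by (rule Suc.IH) (rule f(2))
  qed
qed

lemma times_cont_diff_prod:
  fixes f :: "'i \<Rightarrow> 'a::real_normed_vector \<Rightarrow> real"
  assumes "\<And>i. i \<in> I \<Longrightarrow> times_cont_diff k (f i)"
  shows "times_cont_diff k (\<lambda>x. \<Prod>i\<in>I. f i x)"
  using assms
proof (induction I rule: infinite_finite_induct)
  case (insert i I)
  then have "times_cont_diff k (\<lambda>x. f i x *\<^sub>R (\<Prod>i\<in>I. f i x))"
    by (intro times_cont_diff_scaleR) auto
  then show ?case using insert by simp
qed (auto simp: times_cont_diff_const)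

text \<open>The functions p(1/x) e^(-1/x), extended by 0, form a class closed under differentiation.
  Carrying the polynomial p as a parameter makes smoothness, also at 0, an instance of the class
  criterion.\<close>

definition exp_ramp :: "real poly \<Rightarrow> real \<Rightarrow> real" where
  "exp_ramp p x = (if x > 0 then poly p (1/x) * exp (- (1/x)) else 0)"

lemma poly_exp_minus_tendsto_0: "((\<lambda>y. poly p y * exp (- y)) \<longlongrightarrow> 0) at_top" for p :: "real poly"
proof -
  have "((\<lambda>y. \<Sum>i\<le>degree p. coeff p i * (y ^ i / exp y)) \<longlongrightarrow> (\<Sum>i\<le>degree p. coeff p i * 0)) at_top"
    by (intro tendsto_intros tendsto_power_div_exp_0)
  moreover have "(\<Sum>i\<le>degree p. coeff p i * (y ^ i / exp y)) = poly p y * exp (- y)" for y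
    by (simp add: poly_altdef sum_distrib_right exp_minus divide_inverse mult.assoc)
  ultimately show ?thesis by simp
qed

text \<open>With y = 1/x and dy/dx = -y^2, the derivative of p(y) e^(-y) is y^2 (p - p')(y) e^(-y),
  and \<open>[:0,0,1:]\<close> is the polynomial y^2. At 0 the right difference quotient is y p(y)
  e^(-y) with y tending to infinity.\<close>

lemma exp_ramp_deriv:
  "(exp_ramp p has_real_derivative exp_ramp ([:0,0,1:] * (p - pderiv p)) x) (at x)"
proof -
  consider "x > 0" | "x < 0" | "x = 0" by linarith
  then show ?thesis
  proof cases
    case 1
    have "((\<lambda>x. poly p (1/x) * exp (- (1/x))) has_real_derivative exp_ramp ([:0,0,1:] * (p - pderiv p)) x) (at x)"
    proof -
      have r: "((\<lambda>x. 1/x) has_real_derivative - (1/x)\<^sup>2) (at x)"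
        using 1 by (auto intro!: derivative_eq_intros simp: power2_eq_square)
      have "((\<lambda>x. poly p (1/x)) has_real_derivative poly (pderiv p) (1/x) * - (1/x)\<^sup>2) (at x)"
        by (rule DERIV_chain2[OF poly_DERIV r])
      moreover have "((\<lambda>x. exp (- (1/x))) has_real_derivative exp (- (1/x)) * (1/x)\<^sup>2) (at x)"
        using DERIV_fun_exp[OF DERIV_minus[OF r]] by simp
      ultimately have "((\<lambda>x. poly p (1/x) * exp (- (1/x))) has_real_derivative
          poly (pderiv p) (1/x) * - (1/x)\<^sup>2 * exp (- (1/x)) + exp (- (1/x)) * (1/x)\<^sup>2 * poly p (1/x)) (at x)"
        by (rule DERIV_mult)
      then show ?thesis using 1 by (simp add: exp_ramp_def power2_eq_square algebra_simps)
    qed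
    moreover have "\<forall>\<^sub>F y in nhds x. y > 0" using 1 eventually_nhds_in_open[of "{0<..}" x] by simp
    then have "\<forall>\<^sub>F y in nhds x. exp_ramp p y = poly p (1/y) * exp (- (1/y))"
      by eventually_elim (simp add: exp_ramp_def)
    ultimately show ?thesis by (subst DERIV_cong_ev[OF refl _ refl]) auto
  next
    case 2
    then have "\<forall>\<^sub>F y in nhds x. y < 0" using eventually_nhds_in_open[of "{..<0}" x] by simp
    then have "\<forall>\<^sub>F y in nhds x. exp_ramp p y = 0"
      by eventually_elim (simp add: exp_ramp_def)
    moreover have "((\<lambda>y. 0) has_real_derivative exp_ramp ([:0,0,1:] * (p - pderiv p)) x) (at x)"
      using 2 by (simp add: exp_ramp_def)
    ultimately show ?thesis by (subst DERIV_cong_ev[OF refl _ refl]) auto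
  next
    case 3
    have "((\<lambda>h. exp_ramp p h / h) \<longlongrightarrow> 0) (at_right 0)"
    proof -
      have "((\<lambda>h. poly ([:0,1:] * p) (inverse h) * exp (- inverse h)) \<longlongrightarrow> 0) (at_right 0)"
        by (rule filterlim_compose[OF poly_exp_minus_tendsto_0 filterlim_inverse_at_top_right])
      moreover have "\<forall>\<^sub>F h in at_right 0. poly ([:0,1:] * p) (inverse h) * exp (- inverse h) = exp_ramp p h / h"
        using eventually_at_right_less[of 0] by eventually_elim (simp add: exp_ramp_def divide_inverse)
      ultimately show ?thesis by (rule Lim_transform_eventually)
    qed
    moreover have "((\<lambda>h. exp_ramp p h / h) \<longlongrightarrow> 0) (at_left 0)"
    proof -
      have "\<forall>\<^sub>F h in at_left 0. 0 = exp_ramp p h / h"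
        unfolding eventually_at_filter by (rule eventuallyI) (simp add: exp_ramp_def)
      then show ?thesis by (rule Lim_transform_eventually[OF tendsto_const])
    qed
    ultimately have "((\<lambda>h. exp_ramp p h / h) \<longlongrightarrow> 0) (at 0)" by (simp add: filterlim_split_at)
    then show ?thesis using 3 by (simp add: DERIV_def exp_ramp_def)
  qed
qed

lemma exp_ramp_smult: "exp_ramp (smult c p) x = c * exp_ramp p x"
  by (simp add: exp_ramp_def)

lemma times_cont_diff_exp_ramp: "times_cont_diff k (exp_ramp p)"
proof (rule times_cont_diff_class[where F="range exp_ramp"])
  fix f assume "f \<in> range exp_ramp"
  then obtain p where f: "f = exp_ramp p" by auto
  have d: "(f has_derivative (\<lambda>v. exp_ramp ([:0,0,1:] * (p - pderiv p)) x * v)) (at x)" for x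
    using exp_ramp_deriv[of p x] unfolding f has_field_derivative_def .
  \<comment> \<open>The direction v is a scalar factor and is absorbed into the polynomial.\<close>
  have "(\<lambda>x. exp_ramp ([:0,0,1:] * (p - pderiv p)) x * v) = exp_ramp (smult v ([:0,0,1:] * (p - pderiv p)))" for v
    unfolding exp_ramp_smult by (simp add: mult.commute)
  then show "(\<forall>x. f differentiable at x) \<and> (\<forall>v. (\<lambda>x. frechet_derivative f (at x) v) \<in> range exp_ramp)"
    unfolding frechet_derivative_eqI[OF d] using d by (auto simp: differentiable_def)
qed auto

definition smooth_ramp :: "real \<Rightarrow> real" where
  "smooth_ramp x = (if x > 0 then exp (- (1/x)) else 0)"

lemma smooth_ramp_eq: "smooth_ramp = exp_ramp 1"
  by (auto simp: smooth_ramp_def exp_ramp_def)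

lemma times_cont_diff_smooth_ramp: "times_cont_diff k smooth_ramp"
  unfolding smooth_ramp_eq by (rule times_cont_diff_exp_ramp)

lemma smooth_ramp_bounds: "0 \<le> smooth_ramp x" "smooth_ramp x \<le> 1" "smooth_ramp x > 0 \<longleftrightarrow> x > 0"
  "smooth_ramp x = 0 \<longleftrightarrow> x \<le> 0"
  by (auto simp: smooth_ramp_def)

lemma smooth_ramp_deriv:
  obtains d where "\<And>x. (smooth_ramp has_real_derivative d x) (at x)" "continuous_on UNIV d" "\<And>x. d x \<ge> 0"
proof
  show "(smooth_ramp has_real_derivative exp_ramp [:0,0,1:] x) (at x)" for x
    using exp_ramp_deriv[of 1 x] by (simp add: smooth_ramp_eq)
  show "continuous_on UNIV (exp_ramp [:0,0,1:])"
    using times_cont_diff_exp_ramp[of 0] by simp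
  show "exp_ramp [:0,0,1:] x \<ge> 0" for x by (simp add: exp_ramp_def)
qed

text \<open>Dilating a single ramp gives smooth functions with values in [0, 1] that converge at
  every point to the indicator of the open half-line, including the endpoint.\<close>

lemma smooth_ramp_tendsto:
  "(\<lambda>n. smooth_ramp (real (Suc n) * x)) \<longlonglongrightarrow> (if x > 0 then 1 else 0)"
proof (cases "x > 0")
  case True
  have "(\<lambda>n. exp (- (1 / real (Suc n) * (1/x)))) \<longlonglongrightarrow> exp (- (0 * (1/x)))"
    by (intro tendsto_intros LIMSEQ_Suc[OF lim_1_over_n])
  then show ?thesis using True by (simp add: smooth_ramp_def)
next
  case False
  then have "\<not> real (Suc n) * x > 0" for n by (simp add: zero_less_mult_iff)
  then show ?thesis using False by (simp add: smooth_ramp_def)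
qed

section \<open>Test functions and bumps on boxes\<close>

lemma Cc_smoothD:
  assumes "\<phi> \<in> Cc_smooth S"
  shows "times_cont_diff k \<phi>" "continuous_on UNIV \<phi>" "\<phi> differentiable at x"
    "(\<phi> has_derivative frechet_derivative \<phi> (at x)) (at x)" "x \<notin> S \<Longrightarrow> \<phi> x = 0"
proof -
  have t: "times_cont_diff k \<phi>" for k using assms by (simp add: Cc_smooth_def)
  show "times_cont_diff k \<phi>" "continuous_on UNIV \<phi>" using t[of k] t[of 0] by auto
  show "\<phi> differentiable at x" using t[of 1] by simp
  then show "(\<phi> has_derivative frechet_derivative \<phi> (at x)) (at x)" using frechet_derivative_works by blast
  show "x \<notin> S \<Longrightarrow> \<phi> x = 0" using assms closure_subset[of "{x. \<phi> x \<noteq> 0}"] by (auto simp: Cc_smooth_def)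
qed

lemma Cc_smooth_supportI:
  fixes \<phi> :: "'a::euclidean_space \<Rightarrow> 'b::real_normed_vector"
  assumes t: "\<And>k. times_cont_diff k \<phi>" and C: "compact C" "C \<subseteq> S" and 0: "\<And>x. x \<notin> C \<Longrightarrow> \<phi> x = 0"
  shows "\<phi> \<in> Cc_smooth S"
proof -
  have "closure {x. \<phi> x \<noteq> 0} \<subseteq> C"
    using 0 C(1) by (intro closure_minimal) (auto simp: compact_imp_closed)
  moreover then have "compact (closure {x. \<phi> x \<noteq> 0})"
    using compact_Int_closed[OF C(1), of "closure {x. \<phi> x \<noteq> 0}"] by (simp add: Int_absorb1)
  ultimately show ?thesis using t C(2) by (auto simp: Cc_smooth_def)
qed

text \<open>One compact set serves for \<phi> and for all its first derivatives, since \<phi>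
  vanishes on the open complement of its support.\<close>

lemma Cc_smooth_supportE:
  fixes \<phi> :: "'a::euclidean_space \<Rightarrow> 'b::real_normed_vector"
  assumes "\<phi> \<in> Cc_smooth S"
  obtains C where "compact C" "C \<subseteq> S" "\<And>x. x \<notin> C \<Longrightarrow> \<phi> x = 0"
    "\<And>x v. x \<notin> C \<Longrightarrow> frechet_derivative \<phi> (at x) v = 0"
proof -
  let ?C = "closure {x. \<phi> x \<noteq> 0}"
  have 0: "\<phi> x = 0" if "x \<notin> ?C" for x using that closure_subset[of "{x. \<phi> x \<noteq> 0}"] by auto
  have D0: "frechet_derivative \<phi> (at x) v = 0" if x: "x \<notin> ?C" for x v
  proof -
    have "((\<lambda>x. 0) has_derivative (\<lambda>v. 0)) (at x)" by simp
    then have "(\<phi> has_derivative (\<lambda>v. 0)) (at x)"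
    proof (rule has_derivative_transform_within_open)
      show "open (- ?C)" by (rule open_Compl[OF closed_closure])
      show "x \<in> - ?C" using x by blast
      show "0 = \<phi> y" if "y \<in> - ?C" for y by (rule 0[symmetric]) (use that in blast)
    qed
    from frechet_derivative_eqI[OF this] show ?thesis by simp
  qed
  have "compact ?C" "?C \<subseteq> S" using assms by (auto simp: Cc_smooth_def)
  then show thesis using that[of ?C] 0 D0 by blast
qed

lemma Cc_smooth_mono: "S \<subseteq> S' \<Longrightarrow> \<phi> \<in> Cc_smooth S \<Longrightarrow> \<phi> \<in> Cc_smooth S'"
  by (auto simp: Cc_smooth_def)

lemma Cc_smooth_deriv:
  fixes \<phi> :: "'a::euclidean_space \<Rightarrow> 'b::real_normed_vector"
  assumes "\<phi> \<in> Cc_smooth S"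
  shows "(\<lambda>x. frechet_derivative \<phi> (at x) v) \<in> Cc_smooth S"
proof -
  obtain C where C: "compact C" "C \<subseteq> S" and "\<And>x. x \<notin> C \<Longrightarrow> \<phi> x = 0"
    and C0: "\<And>x v. x \<notin> C \<Longrightarrow> frechet_derivative \<phi> (at x) v = 0"
    by (rule Cc_smooth_supportE[OF assms]) blast
  show ?thesis
  proof (rule Cc_smooth_supportI[OF _ C(1,2)])
    show "times_cont_diff k (\<lambda>x. frechet_derivative \<phi> (at x) v)" for k
      using Cc_smoothD(1)[OF assms, of "Suc k"] by simp
  qed (rule C0)
qed

lemma Cc_smooth_scaleR:
  fixes \<phi> :: "'a::euclidean_space \<Rightarrow> 'b::real_normed_vector"
  assumes "\<And>k. times_cont_diff k f" "\<phi> \<in> Cc_smooth S"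
  shows "(\<lambda>x. f x *\<^sub>R \<phi> x) \<in> Cc_smooth S"
proof -
  obtain C where C: "compact C" "C \<subseteq> S" "\<And>x. x \<notin> C \<Longrightarrow> \<phi> x = 0"
    by (rule Cc_smooth_supportE[OF assms(2)]) blast
  show ?thesis
    by (rule Cc_smooth_supportI[OF times_cont_diff_scaleR[OF assms(1) Cc_smoothD(1)[OF assms(2)]] C(1,2)]) (simp add: C(3))
qed

lemma Cc_smooth_bounded:
  fixes \<phi> :: "'a::euclidean_space \<Rightarrow> 'b::real_normed_vector"
  assumes "\<phi> \<in> Cc_smooth S"
  obtains B where "B > 0" "\<And>x. norm (\<phi> x) \<le> B"
proof -
  obtain C where C: "compact C" "\<And>x. x \<notin> C \<Longrightarrow> \<phi> x = 0"
    by (rule Cc_smooth_supportE[OF assms]) blast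
  have "bounded (\<phi> ` C)"
    using Cc_smoothD(2)[OF assms] C(1) by (meson compact_continuous_image compact_imp_bounded continuous_on_subset subset_UNIV)
  then obtain B where "B > 0" "\<And>x. x \<in> C \<Longrightarrow> norm (\<phi> x) \<le> B" by (auto simp: bounded_pos)
  then have "norm (\<phi> x) \<le> B" for x using C(2)[of x] by (cases "x \<in> C") auto
  then show ?thesis using that \<open>B > 0\<close> by blast
qed

lemma Cc_smooth_borel[measurable_dest]:
  fixes \<phi> :: "'a::euclidean_space \<Rightarrow> 'b::euclidean_space"
  assumes "\<phi> \<in> Cc_smooth S"
  shows "\<phi> \<in> borel_measurable borel"
  using Cc_smoothD(2)[OF assms] by (rule borel_measurable_continuous_onI)

text \<open>Positive exactly on the open box and supported in the closed one; as n grows it tends to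
  the indicator of the open box. It provides the mollifiers and also the link from test functions to
  integrals over boxes.\<close>

definition box_bump :: "nat \<Rightarrow> 'a::euclidean_space \<Rightarrow> 'a \<Rightarrow> 'a \<Rightarrow> real" where
  "box_bump n a b x = (\<Prod>i\<in>Basis. smooth_ramp (real (Suc n) * (x \<bullet> i - a \<bullet> i)) * smooth_ramp (real (Suc n) * (b \<bullet> i - x \<bullet> i)))"

lemma times_cont_diff_ramp_affine:
  "times_cont_diff k (\<lambda>x. smooth_ramp (c * (x \<bullet> i - d)))" "times_cont_diff k (\<lambda>x. smooth_ramp (c * (d - x \<bullet> i)))"
  for i :: "'a::euclidean_space"
proof -
  have "bounded_linear (\<lambda>x. c * (x \<bullet> i))" "bounded_linear (\<lambda>x. (- c) * (x \<bullet> i))"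
    by (intro bounded_linear_const_mult bounded_linear_inner_left)+
  from this[THEN times_cont_diff_compose_affine, OF times_cont_diff_smooth_ramp, of k "- c * d"]
    this[THEN times_cont_diff_compose_affine, OF times_cont_diff_smooth_ramp, of k "c * d"]
  show "times_cont_diff k (\<lambda>x. smooth_ramp (c * (x \<bullet> i - d)))" "times_cont_diff k (\<lambda>x. smooth_ramp (c * (d - x \<bullet> i)))"
    by (simp_all add: algebra_simps)
qed

lemma times_cont_diff_box_bump: "times_cont_diff k (box_bump n a b)"
proof -
  have "times_cont_diff k (\<lambda>x. smooth_ramp (real (Suc n) * (x \<bullet> i - a \<bullet> i)) *\<^sub>R smooth_ramp (real (Suc n) * (b \<bullet> i - x \<bullet> i)))" for i
    by (intro times_cont_diff_scaleR times_cont_diff_ramp_affine)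
  then show ?thesis
    unfolding box_bump_def by (intro times_cont_diff_prod) simp
qed

lemma box_bump_bounds: "0 \<le> box_bump n a b x" "box_bump n a b x \<le> 1"
  unfolding box_bump_def
  by (auto intro!: prod_nonneg prod_le_1 mult_nonneg_nonneg mult_le_one smooth_ramp_bounds)

lemma box_bump_pos: "box_bump n a b x > 0 \<longleftrightarrow> x \<in> box a b"
proof
  assume x: "x \<in> box a b"
  show "box_bump n a b x > 0" unfolding box_bump_def
  proof (intro prod_pos mult_pos_pos)
    fix i :: 'a assume "i \<in> Basis"
    then have "real (Suc n) * (x \<bullet> i - a \<bullet> i) > 0" "real (Suc n) * (b \<bullet> i - x \<bullet> i) > 0"
      using x unfolding mem_box by (intro mult_pos_pos; auto)+
    then show "smooth_ramp (real (Suc n) * (x \<bullet> i - a \<bullet> i)) > 0" "smooth_ramp (real (Suc n) * (b \<bullet> i - x \<bullet> i)) > 0"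
      by (simp_all only: smooth_ramp_bounds)
  qed
next
  assume p: "box_bump n a b x > 0"
  have "x \<bullet> i - a \<bullet> i > 0 \<and> b \<bullet> i - x \<bullet> i > 0" if "i \<in> Basis" for i
  proof -
    have "smooth_ramp (real (Suc n) * (x \<bullet> i - a \<bullet> i)) * smooth_ramp (real (Suc n) * (b \<bullet> i - x \<bullet> i)) \<noteq> 0"
    proof
      assume "smooth_ramp (real (Suc n) * (x \<bullet> i - a \<bullet> i)) * smooth_ramp (real (Suc n) * (b \<bullet> i - x \<bullet> i)) = 0"
      then have "box_bump n a b x = 0" unfolding box_bump_def using that by (intro prod_zero finite_Basis bexI)
      then show False using p by simp
    qed
    then have "\<not> real (Suc n) * (x \<bullet> i - a \<bullet> i) \<le> 0" "\<not> real (Suc n) * (b \<bullet> i - x \<bullet> i) \<le> 0"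
      unfolding mult_eq_0_iff smooth_ramp_bounds(4) by blast+
    then show ?thesis
      unfolding not_le by (simp only: zero_less_mult_pos[OF _ of_nat_0_less_iff[THEN iffD2, OF zero_less_Suc]])
  qed
  then show "x \<in> box a b" by (auto simp: mem_box)
qed

lemma box_bump_Cc_smooth: "cbox a b \<subseteq> S \<Longrightarrow> box_bump n a b \<in> Cc_smooth S"
proof (rule Cc_smooth_supportI[OF times_cont_diff_box_bump compact_cbox[of a b]])
  fix x assume "x \<notin> cbox a b"
  then have "\<not> box_bump n a b x > 0" using box_bump_pos[of n a b x] box_subset_cbox[of a b] by auto
  then show "box_bump n a b x = 0" using box_bump_bounds(1)[of n a b x] by simp
qed

lemma box_bump_tendsto: "(\<lambda>n. box_bump n a b x) \<longlonglongrightarrow> indicator (box a b) x"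
proof (cases "x \<in> box a b")
  case True
  have "(\<lambda>n. box_bump n a b x) \<longlonglongrightarrow> (\<Prod>i\<in>Basis. (if x \<bullet> i - a \<bullet> i > 0 then 1 else 0) * (if b \<bullet> i - x \<bullet> i > 0 then 1 else 0))"
    unfolding box_bump_def by (intro tendsto_prod tendsto_mult smooth_ramp_tendsto)
  also have "(\<Prod>i\<in>Basis. (if x \<bullet> i - a \<bullet> i > 0 then 1 else 0) * (if b \<bullet> i - x \<bullet> i > 0 then 1 else 0)) = (1::real)"
    using True by (intro prod.neutral) (auto simp: mem_box)
  finally show ?thesis using True by simp
next
  case False
  then have "box_bump n a b x = 0" for n using box_bump_pos[of n a b x] box_bump_bounds(1)[of n a b x] by simp
  then show ?thesis using False by simp
qed

section \<open>Half-line cut-offs in fractional Sobolev spaces\<close>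

text \<open>Elements of the function spaces are only Lebesgue measurable, whereas Fubini over pairs
  of \<open>lborel\<close> asks for Borel functions. The passage goes through real and imaginary
  parts.\<close>

lemma lebesgue_borel_version:
  fixes f :: "'a::euclidean_space \<Rightarrow> complex"
  assumes "f \<in> borel_measurable lebesgue"
  obtains g where "g \<in> borel_measurable borel" "AE x in lborel. f x = g x"
proof -
  have "(\<lambda>x. Re (f x)) \<in> borel_measurable lebesgue" "(\<lambda>x. Im (f x)) \<in> borel_measurable lebesgue"
    using assms by measurable
  from this[THEN completion_ex_borel_measurable_real]
  obtain r i where [measurable]: "r \<in> borel_measurable borel" "i \<in> borel_measurable borel"
    and AE: "AE x in lborel. Re (f x) = r x" "AE x in lborel. Im (f x) = i x"
    by auto
  show thesis
  proof
    show "(\<lambda>x. of_real (r x) + \<i> * of_real (i x)) \<in> borel_measurable borel" by measurable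
    show "AE x in lborel. f x = of_real (r x) + \<i> * of_real (i x)"
      using AE by eventually_elim (simp add: complex_eq_iff)
  qed
qed

lemma borel_imp_lebesgue_measurable: "f \<in> borel_measurable borel \<Longrightarrow> f \<in> borel_measurable lebesgue"
  by (rule measurable_completion) simp

lemma iexp_mult_lebesgue_measurable:
  assumes "f \<in> borel_measurable lebesgue"
  shows "(\<lambda>t. f t * exp (- \<i> * of_real (\<omega> * t))) \<in> borel_measurable lebesgue"
proof -
  have "(\<lambda>t::real. exp (- \<i> * of_real (\<omega> * t))) \<in> borel_measurable lebesgue"
    by (rule borel_imp_lebesgue_measurable) measurable
  then show ?thesis using assms by (rule borel_measurable_times[rotated])
qed

lemma fourier_cong_AE:
  assumes "f \<in> borel_measurable lebesgue" "g \<in> borel_measurable lebesgue" "AE x in lborel. f x = g x"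
  shows "fourier f = fourier g"
proof
  fix \<omega>
  show "fourier f \<omega> = fourier g \<omega>"
    unfolding fourier_def
  proof (rule integral_cong_AE)
    show "AE x in lebesgue. f x * exp (- \<i> * of_real (\<omega> * x)) = g x * exp (- \<i> * of_real (\<omega> * x))"
      using AE_completion[OF assms(3)] by eventually_elim simp
  qed (use assms iexp_mult_lebesgue_measurable in auto)
qed

lemma integrable_borel_version:
  fixes f :: "real \<Rightarrow> complex"
  assumes "integrable lebesgue f"
  obtains g where "integrable lborel g" "AE x in lborel. f x = g x" "fourier f = fourier g"
proof -
  have fm: "f \<in> borel_measurable lebesgue" using assms by auto
  obtain g where g: "g \<in> borel_measurable borel" "AE x in lborel. f x = g x"
    using lebesgue_borel_version[OF fm] .
  have gm: "g \<in> borel_measurable lebesgue" using g(1) by (rule borel_imp_lebesgue_measurable)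
  have "integrable lebesgue g"
    using integrable_cong_AE_imp[OF assms gm] AE_completion[OF g(2)] by auto
  then have "integrable lborel g" using g(1) by (subst (asm) integrable_completion) auto
  then show thesis using that g(2) fourier_cong_AE[OF fm gm g(2)] by blast
qed

lemma fourier_lebesgue_measurable:
  assumes "integrable lebesgue f"
  shows "fourier f \<in> borel_measurable borel"
proof -
  obtain g where "integrable lborel g" "fourier f = fourier g"
    by (rule integrable_borel_version[OF assms])
  then show ?thesis by simp
qed

text \<open>The squared norm up to the factor 2\<pi>, as an extended nonnegative integral: estimates
  can be stated before integrability is known, and membership in \<open>H_fun\<close> becomes
  finiteness.\<close>

definition H_energy :: "real \<Rightarrow> (real \<Rightarrow> complex) \<Rightarrow> ennreal" where
  "H_energy \<nu> f = (\<integral>\<^sup>+\<omega>. ennreal ((1 + \<omega>\<^sup>2) powr \<nu> * (cmod (fourier f \<omega>))\<^sup>2) \<partial>lborel)"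

lemma H_energy_integrand_measurable:
  assumes "integrable lebesgue f"
  shows "(\<lambda>\<omega>. (1 + \<omega>\<^sup>2) powr \<nu> * (cmod (fourier f \<omega>))\<^sup>2) \<in> borel_measurable borel"
proof -
  have [measurable]: "fourier f \<in> borel_measurable borel" by (rule fourier_lebesgue_measurable[OF assms])
  show ?thesis by measurable
qed

lemma H_fun_iff_energy:
  assumes "integrable lebesgue f"
  shows "f \<in> H_fun \<nu> \<longleftrightarrow> H_energy \<nu> f < \<infinity>"
proof -
  note m = H_energy_integrand_measurable[OF assms, of \<nu>]
  have "integrable lebesgue (\<lambda>\<omega>. (1 + \<omega>\<^sup>2) powr \<nu> * (cmod (fourier f \<omega>))\<^sup>2)
    \<longleftrightarrow> integrable lborel (\<lambda>\<omega>. (1 + \<omega>\<^sup>2) powr \<nu> * (cmod (fourier f \<omega>))\<^sup>2)"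
    by (rule integrable_completion) (use m in simp)
  also have "\<dots> \<longleftrightarrow> H_energy \<nu> f < \<infinity>"
    unfolding H_energy_def using m by (simp add: integrable_iff_bounded)
  finally show ?thesis using assms by (simp add: H_fun_def)
qed

lemma H_norm_nonneg: "H_norm \<nu> f \<ge> 0"
  unfolding H_norm_def by (intro real_sqrt_ge_zero mult_nonneg_nonneg integral_nonneg_AE) auto

lemma H_energy_eq:
  assumes "f \<in> H_fun \<nu>"
  shows "H_energy \<nu> f = ennreal (2 * pi * (H_norm \<nu> f)\<^sup>2)"
proof -
  have f: "integrable lebesgue f" and i: "integrable lebesgue (\<lambda>\<omega>. (1 + \<omega>\<^sup>2) powr \<nu> * (cmod (fourier f \<omega>))\<^sup>2)"
    using assms by (auto simp: H_fun_def)
  note m = H_energy_integrand_measurable[OF f, of \<nu>]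
  have i': "integrable lborel (\<lambda>\<omega>. (1 + \<omega>\<^sup>2) powr \<nu> * (cmod (fourier f \<omega>))\<^sup>2)"
    using i m by (subst (asm) integrable_completion) auto
  have "2 * pi * (H_norm \<nu> f)\<^sup>2 = (LINT \<omega>|lebesgue. (1 + \<omega>\<^sup>2) powr \<nu> * (cmod (fourier f \<omega>))\<^sup>2)"
    unfolding H_norm_def by (subst real_sqrt_pow2) (auto intro!: mult_nonneg_nonneg integral_nonneg_AE)
  also have "\<dots> = (LINT \<omega>|lborel. (1 + \<omega>\<^sup>2) powr \<nu> * (cmod (fourier f \<omega>))\<^sup>2)"
    by (rule integral_completion) (use m in simp)
  finally show ?thesis unfolding H_energy_def using i' by (simp add: nn_integral_eq_integral)
qed

text \<open>Membership of f is part of the conclusion, since the comparison of energies already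
  makes its energy finite.\<close>

lemma H_norm_le_of_energy:
  assumes f: "integrable lebesgue f" and g: "g \<in> H_fun \<nu>" and c: "c \<ge> 0"
    and le: "H_energy \<nu> f \<le> ennreal (c\<^sup>2) * H_energy \<nu> g"
  shows "f \<in> H_fun \<nu>" "H_norm \<nu> f \<le> c * H_norm \<nu> g"
proof -
  have "H_energy \<nu> f \<le> ennreal (c\<^sup>2) * ennreal (2 * pi * (H_norm \<nu> g)\<^sup>2)"
    using le unfolding H_energy_eq[OF g] .
  also have "\<dots> = ennreal (2 * pi * (c * H_norm \<nu> g)\<^sup>2)"
    by (subst ennreal_mult[symmetric]) (auto simp: power_mult_distrib mult_ac)
  finally have le': "H_energy \<nu> f \<le> ennreal (2 * pi * (c * H_norm \<nu> g)\<^sup>2)" .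
  then have "H_energy \<nu> f < \<infinity>" by (rule order_le_less_trans) simp
  then show fH: "f \<in> H_fun \<nu>" using H_fun_iff_energy[OF f] by simp
  have "(H_norm \<nu> f)\<^sup>2 \<le> (c * H_norm \<nu> g)\<^sup>2"
    using le' unfolding H_energy_eq[OF fH] by (subst (asm) ennreal_le_iff) auto
  then show "H_norm \<nu> f \<le> c * H_norm \<nu> g"
    by (rule power2_le_imp_le) (use c H_norm_nonneg in auto)
qed

lemma fourier_diff:
  assumes "integrable lebesgue f" "integrable lebesgue g"
  shows "fourier (\<lambda>t. f t - g t) \<omega> = fourier f \<omega> - fourier g \<omega>"
proof -
  have i: "integrable lebesgue (\<lambda>t. f t * exp (- \<i> * of_real (\<omega> * t)))" if f: "integrable lebesgue f" for f :: "real \<Rightarrow> complex"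
    by (rule Bochner_Integration.integrable_bound[OF f iexp_mult_lebesgue_measurable]) (use f in \<open>auto simp: norm_mult\<close>)
  show ?thesis unfolding fourier_def
    by (subst Bochner_Integration.integral_diff[OF i i, OF assms, symmetric]) (simp add: left_diff_distrib)
qed

lemma H_energy_diff:
  assumes "integrable lebesgue f" "integrable lebesgue g"
  shows "H_energy \<nu> (\<lambda>t. f t - g t) \<le> 2 * H_energy \<nu> f + 2 * H_energy \<nu> g"
proof -
  have "H_energy \<nu> (\<lambda>t. f t - g t) \<le> (\<integral>\<^sup>+\<omega>. 2 * ennreal ((1 + \<omega>\<^sup>2) powr \<nu> * (cmod (fourier f \<omega>))\<^sup>2) +
     2 * ennreal ((1 + \<omega>\<^sup>2) powr \<nu> * (cmod (fourier g \<omega>))\<^sup>2) \<partial>lborel)"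
    unfolding H_energy_def
  proof (intro nn_integral_mono)
    fix \<omega> :: real
    let ?a = "cmod (fourier f \<omega>)" and ?b = "cmod (fourier g \<omega>)" and ?w = "(1 + \<omega>\<^sup>2) powr \<nu>"
    have "(cmod (fourier f \<omega> - fourier g \<omega>))\<^sup>2 \<le> (?a + ?b)\<^sup>2"
      by (rule power_mono[OF norm_triangle_ineq4]) simp
    also have "\<dots> \<le> 2 * ?a\<^sup>2 + 2 * ?b\<^sup>2"
      using sum_squares_bound[of ?a ?b] by (simp add: power2_sum)
    finally have "?w * (cmod (fourier f \<omega> - fourier g \<omega>))\<^sup>2 \<le> ?w * (2 * ?a\<^sup>2 + 2 * ?b\<^sup>2)"
      by (rule mult_left_mono) simp
    then have "ennreal (?w * (cmod (fourier f \<omega> - fourier g \<omega>))\<^sup>2) \<le> ennreal (2 * (?w * ?a\<^sup>2) + 2 * (?w * ?b\<^sup>2))"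
      by (intro ennreal_leI) (simp add: algebra_simps)
    also have "\<dots> = 2 * ennreal (?w * ?a\<^sup>2) + 2 * ennreal (?w * ?b\<^sup>2)"
      by (simp add: ennreal_mult)
    finally show "ennreal (?w * (cmod (fourier (\<lambda>t. f t - g t) \<omega>))\<^sup>2) \<le> 2 * ennreal (?w * ?a\<^sup>2) + 2 * ennreal (?w * ?b\<^sup>2)"
      by (simp only: fourier_diff[OF assms])
  qed
  also have "\<dots> = 2 * H_energy \<nu> f + 2 * H_energy \<nu> g"
    unfolding H_energy_def using H_energy_integrand_measurable[OF assms(1), of \<nu>] H_energy_integrand_measurable[OF assms(2), of \<nu>]
    by (simp add: nn_integral_add nn_integral_cmult)
  finally show ?thesis .
qed

text \<open>The inequality |a - b|^2 \<le> 2|a|^2 + 2|b|^2 under the integral stands in for the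
  triangle inequality of the norm; the loss of a constant is harmless.\<close>

lemma H_fun_diff:
  assumes f: "f \<in> H_fun \<nu>" and g: "g \<in> H_fun \<nu>"
  shows "(\<lambda>t. f t - g t) \<in> H_fun \<nu>"
    "(H_norm \<nu> (\<lambda>t. f t - g t))\<^sup>2 \<le> 2 * (H_norm \<nu> f)\<^sup>2 + 2 * (H_norm \<nu> g)\<^sup>2"
proof -
  have i: "integrable lebesgue f" "integrable lebesgue g" using f g by (auto simp: H_fun_def)
  have i': "integrable lebesgue (\<lambda>t. f t - g t)" using i by simp
  have "H_energy \<nu> (\<lambda>t. f t - g t) \<le> 2 * H_energy \<nu> f + 2 * H_energy \<nu> g"
    by (rule H_energy_diff[OF i])
  also have "\<dots> = ennreal (2 * pi * (2 * (H_norm \<nu> f)\<^sup>2 + 2 * (H_norm \<nu> g)\<^sup>2))"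
  proof -
    have two: "2 * ennreal x = ennreal (2 * x)" for x
      by (simp add: ennreal_mult')
    show ?thesis
      unfolding H_energy_eq[OF f] H_energy_eq[OF g] two
      by (subst ennreal_plus[symmetric]) (auto simp: algebra_simps)
  qed
  finally have le: "H_energy \<nu> (\<lambda>t. f t - g t) \<le> ennreal (2 * pi * (2 * (H_norm \<nu> f)\<^sup>2 + 2 * (H_norm \<nu> g)\<^sup>2))" .
  then have "H_energy \<nu> (\<lambda>t. f t - g t) < \<infinity>" by (rule order_le_less_trans) simp
  then show d: "(\<lambda>t. f t - g t) \<in> H_fun \<nu>" using H_fun_iff_energy[OF i'] by simp
  show "(H_norm \<nu> (\<lambda>t. f t - g t))\<^sup>2 \<le> 2 * (H_norm \<nu> f)\<^sup>2 + 2 * (H_norm \<nu> g)\<^sup>2"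
    using le unfolding H_energy_eq[OF d] by (subst (asm) ennreal_le_iff) auto
qed

text \<open>From 1 + \<omega>^2 \<le> (1 + |\<omega>|)^2 \<le> 2 (1 + \<omega>^2) and an exponent of
  modulus at most 1, the constant 2 results in both directions. The commutator estimate is carried
  out with powers of 1 + |\<omega>|, the norm with powers of 1 + \<omega>^2.\<close>

lemma weight_compare:
  fixes \<omega> \<nu> :: real
  assumes "\<bar>\<nu>\<bar> \<le> 1"
  shows "(1 + \<omega>\<^sup>2) powr \<nu> \<le> 2 * ((1 + \<bar>\<omega>\<bar>) powr \<nu>)\<^sup>2" "((1 + \<bar>\<omega>\<bar>) powr \<nu>)\<^sup>2 \<le> 2 * (1 + \<omega>\<^sup>2) powr \<nu>"
proof -
  let ?A = "1 + \<omega>\<^sup>2" and ?B = "(1 + \<bar>\<omega>\<bar>)\<^sup>2"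
  have A: "?A > 0" by (simp add: add_pos_nonneg)
  have B: "?B > 0" by (simp add: add_pos_nonneg)
  have AB: "?A \<le> ?B" "?B \<le> 2 * ?A"
    using sum_squares_bound[of 1 "\<bar>\<omega>\<bar>"] by (auto simp: power2_sum)
  have eq: "((1 + \<bar>\<omega>\<bar>) powr \<nu>)\<^sup>2 = ?B powr \<nu>"
    by (simp add: power2_eq_square powr_mult)
  have two: "2 powr \<bar>\<nu>\<bar> \<le> (2::real)" using powr_mono[of "\<bar>\<nu>\<bar>" 1 "2::real"] assms by simp
  have mono: "x powr \<nu> \<le> 2 * y powr \<nu>" if xy: "0 < x" "0 < y" "x \<le> 2 * y" "y \<le> 2 * x" for x y :: real
  proof (cases "\<nu> \<ge> 0")
    case True
    have "x powr \<nu> \<le> (2 * y) powr \<nu>" using True xy by (intro powr_mono2) auto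
    also have "\<dots> = 2 powr \<nu> * y powr \<nu>" using xy by (simp add: powr_mult)
    finally show ?thesis using two True mult_right_mono[OF two, of "y powr \<nu>"] by simp
  next
    case False
    have "x powr \<nu> \<le> (y / 2) powr \<nu>" using False xy by (intro powr_mono2') auto
    also have "\<dots> = 2 powr (- \<nu>) * y powr \<nu>" using xy by (simp add: powr_divide powr_minus field_simps)
    finally show ?thesis using False mult_right_mono[OF two, of "y powr \<nu>"] by simp
  qed
  show "?A powr \<nu> \<le> 2 * ((1 + \<bar>\<omega>\<bar>) powr \<nu>)\<^sup>2" unfolding eq using A B AB by (intro mono) auto
  show "((1 + \<bar>\<omega>\<bar>) powr \<nu>)\<^sup>2 \<le> 2 * ?A powr \<nu>" unfolding eq using A B AB by (intro mono) auto
qed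

lemma cut_above_lebesgue_integrable:
  assumes "integrable lebesgue f"
  shows "integrable lebesgue (cut_above \<tau> f)"
proof -
  have "integrable lebesgue (\<lambda>t. indicator {\<tau><..} t *\<^sub>R f t)"
    using assms by (intro integrable_mult_indicator) auto
  also have "(\<lambda>t. indicator {\<tau><..} t *\<^sub>R f t) = cut_above \<tau> f"
    by (auto simp: cut_above_def indicator_def)
  finally show ?thesis .
qed

text \<open>The quotient is the constant of \<open>cut_above_weighted_bound\<close>. The factor 4 is
  2 times 2, from exchanging the weights before and after the cut-off, and the root passes from
  energies to norms.\<close>

definition cut_const :: "real \<Rightarrow> real" where
  "cut_const \<nu> = sqrt (4 * ((8 * pi\<^sup>2 + 2 * (4 / (1/2 - \<bar>\<nu>\<bar>))\<^sup>2) / (2 * pi)\<^sup>2))"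

lemma H_energy_cut_above:
  assumes f: "integrable lebesgue f" and \<nu>: "\<bar>\<nu>\<bar> < 1/2"
  shows "H_energy \<nu> (cut_above \<tau> f) \<le> ennreal ((cut_const \<nu>)\<^sup>2) * H_energy \<nu> f"
proof -
  obtain g where g: "integrable lborel g" "AE x in lborel. f x = g x" "fourier f = fourier g"
    by (rule integrable_borel_version[OF f])
  have gm[measurable]: "g \<in> borel_measurable borel" using g(1) by auto
  have "AE x in lborel. cut_above \<tau> f x = cut_above \<tau> g x"
    using g(2) by eventually_elim (simp add: cut_above_def)
  then have fc: "fourier (cut_above \<tau> f) = fourier (cut_above \<tau> g)"
    by (rule fourier_cong_AE[OF borel_measurable_integrable[OF cut_above_lebesgue_integrable[OF f]]
        borel_imp_lebesgue_measurable[OF cut_above_measurable[OF gm]]])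
  let ?N = "\<lambda>g. \<integral>\<^sup>+\<omega>. ennreal (((1 + \<bar>\<omega>\<bar>) powr \<nu> * cmod (fourier g \<omega>))\<^sup>2) \<partial>lborel"
  let ?C = "(8 * pi\<^sup>2 + 2 * (4 / (1/2 - \<bar>\<nu>\<bar>))\<^sup>2) / (2 * pi)\<^sup>2"
  have two: "2 * ennreal x = ennreal (2 * x)" for x by (simp add: ennreal_mult')
  have [measurable]: "cut_above \<tau> g \<in> borel_measurable borel" by (rule cut_above_measurable[OF gm])
  have "H_energy \<nu> (cut_above \<tau> f) \<le> (\<integral>\<^sup>+\<omega>. 2 * ennreal (((1 + \<bar>\<omega>\<bar>) powr \<nu> * cmod (fourier (cut_above \<tau> g) \<omega>))\<^sup>2) \<partial>lborel)"
    unfolding H_energy_def fc two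
  proof (intro nn_integral_mono ennreal_leI)
    show "(1 + \<omega>\<^sup>2) powr \<nu> * (cmod (fourier (cut_above \<tau> g) \<omega>))\<^sup>2 \<le> 2 * ((1 + \<bar>\<omega>\<bar>) powr \<nu> * cmod (fourier (cut_above \<tau> g) \<omega>))\<^sup>2" for \<omega>
      using mult_right_mono[OF weight_compare(1)[of \<nu> \<omega>], of "(cmod (fourier (cut_above \<tau> g) \<omega>))\<^sup>2"] \<nu>
      by (simp add: power_mult_distrib mult.assoc)
  qed
  also have "\<dots> = 2 * ?N (cut_above \<tau> g)" by (rule nn_integral_cmult) measurable
  also have "\<dots> \<le> 2 * (ennreal ?C * ?N g)"
    by (intro mult_left_mono cut_above_weighted_bound[OF g(1) \<nu>]) simp
  also have "?N g \<le> (\<integral>\<^sup>+\<omega>. 2 * ennreal ((1 + \<omega>\<^sup>2) powr \<nu> * (cmod (fourier g \<omega>))\<^sup>2) \<partial>lborel)"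
    unfolding two
  proof (intro nn_integral_mono ennreal_leI)
    show "((1 + \<bar>\<omega>\<bar>) powr \<nu> * cmod (fourier g \<omega>))\<^sup>2 \<le> 2 * ((1 + \<omega>\<^sup>2) powr \<nu> * (cmod (fourier g \<omega>))\<^sup>2)" for \<omega>
      using mult_right_mono[OF weight_compare(2)[of \<nu> \<omega>], of "(cmod (fourier g \<omega>))\<^sup>2"] \<nu>
      by (simp add: power_mult_distrib mult.assoc)
  qed
  also have "\<dots> = 2 * H_energy \<nu> f"
    unfolding H_energy_def g(3) by (rule nn_integral_cmult) measurable
  finally have "H_energy \<nu> (cut_above \<tau> f) \<le> 2 * (ennreal ?C * (2 * H_energy \<nu> f))"
    by (simp add: mult_left_mono)
  also have "\<dots> = ennreal (4 * ?C) * H_energy \<nu> f"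
    by (subst ennreal_mult) (auto simp: mult_ac)
  also have "4 * ?C = (cut_const \<nu>)\<^sup>2"
    unfolding cut_const_def by (subst real_sqrt_pow2) (auto intro!: divide_nonneg_nonneg add_nonneg_nonneg)
  finally show ?thesis .
qed

lemma cut_const_nonneg: "cut_const \<nu> \<ge> 0"
  unfolding cut_const_def by (intro real_sqrt_ge_zero mult_nonneg_nonneg divide_nonneg_nonneg add_nonneg_nonneg) auto

lemma H_norm_cut_above:
  assumes f: "f \<in> H_fun \<nu>" and \<nu>: "\<bar>\<nu>\<bar> < 1/2"
  shows "cut_above \<tau> f \<in> H_fun \<nu>" "H_norm \<nu> (cut_above \<tau> f) \<le> cut_const \<nu> * H_norm \<nu> f"
proof -
  have i: "integrable lebesgue f" using f by (simp add: H_fun_def)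
  show "cut_above \<tau> f \<in> H_fun \<nu>" "H_norm \<nu> (cut_above \<tau> f) \<le> cut_const \<nu> * H_norm \<nu> f"
    using H_norm_le_of_energy[OF cut_above_lebesgue_integrable[OF i] f cut_const_nonneg H_energy_cut_above[OF i \<nu>]] by auto
qed

text \<open>One integration by parts: i\<omega> times the transform of f is the transform of f',
  without boundary terms because f vanishes at a and b.\<close>

lemma abs_mult_fourier_le:
  fixes f f' :: "real \<Rightarrow> complex"
  assumes d: "\<And>t. (f has_vector_derivative f' t) (at t)" and f': "continuous_on UNIV f'"
    and ab: "a \<le> b" and 0: "\<And>t. t \<notin> {a<..<b} \<Longrightarrow> f t = 0" "\<And>t. t \<notin> {a<..<b} \<Longrightarrow> f' t = 0"
  shows "\<bar>\<omega>\<bar> * cmod (fourier f \<omega>) \<le> (LINT t|lborel. cmod (f' t))"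
proof -
  have f: "continuous_on UNIV f"
    using d by (meson continuous_at_imp_continuous_on has_vector_derivative_continuous)
  have [measurable]: "f \<in> borel_measurable borel" "f' \<in> borel_measurable borel"
    using f f' by (auto intro: borel_measurable_continuous_onI)
  define e where "e = (\<lambda>t. iexp (- (\<omega> * t)))"
  have e: "(e has_vector_derivative - \<i> * of_real \<omega> * e t) (at t)" for t
  proof -
    have "((\<lambda>z. exp (\<i> * - (of_real \<omega> * z))) has_field_derivative - \<i> * of_real \<omega> * exp (\<i> * - (of_real \<omega> * of_real t))) (at (of_real t))"
      by (auto intro!: derivative_eq_intros)
    from has_vector_derivative_real_field[OF this] show ?thesis by (simp add: e_def)
  qed
  let ?F = "\<lambda>t. f t * e t" and ?F' = "\<lambda>t. f t * (- \<i> * of_real \<omega> * e t) + f' t * e t"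
  have F: "(?F has_vector_derivative ?F' t) (at t within {a..b})" for t
    by (rule has_vector_derivative_at_within[OF has_vector_derivative_mult[OF d e]])
  have ec: "continuous_on UNIV e" unfolding e_def by (intro continuous_intros)
  have F'c: "continuous_on UNIV ?F'" by (intro continuous_intros f f' ec)
  have "(LBINT t. indicator {a..b} t *\<^sub>R ?F' t) = ?F b - ?F a"
    by (rule integral_FTC_Icc[OF ab F continuous_on_subset[OF F'c]]) auto
  also have "\<dots> = 0" using 0(1)[of a] 0(1)[of b] by simp
  finally have z: "(LBINT t. indicator {a..b} t *\<^sub>R ?F' t) = 0" .
  have ind: "indicator {a..b} t *\<^sub>R g t = g t" if "\<And>t. t \<notin> {a<..<b} \<Longrightarrow> g t = 0" for g :: "real \<Rightarrow> complex" and t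
    using that[of t] by (auto simp: indicator_def)
  have int: "integrable lborel g" if g: "continuous_on UNIV g" "\<And>t. t \<notin> {a<..<b} \<Longrightarrow> g t = 0" for g :: "real \<Rightarrow> complex"
  proof -
    have "set_integrable lborel {a..b} g"
      by (rule borel_integrable_atLeastAtMost'[OF continuous_on_subset[OF g(1)]]) simp
    moreover have "(\<lambda>t. indicator {a..b} t *\<^sub>R g t) = g" by (rule ext, rule ind, rule g(2))
    ultimately show ?thesis by (simp only: set_integrable_def)
  qed
  have i1: "integrable lborel (\<lambda>t. f t * (- \<i> * of_real \<omega> * e t))"
    by (rule int) (use 0 in \<open>auto intro!: continuous_intros f ec\<close>)
  have i2: "integrable lborel (\<lambda>t. f' t * e t)"
    by (rule int) (use 0 in \<open>auto intro!: continuous_intros f' ec\<close>)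
  have "indicator {a..b} t *\<^sub>R ?F' t = ?F' t" for t
    by (rule ind) (use 0 in auto)
  then have "(LINT t|lborel. ?F' t) = 0" using z by simp
  then have "(LINT t|lborel. f' t * e t) = - (LINT t|lborel. f t * (- \<i> * of_real \<omega> * e t))"
    using i1 i2 by (simp add: eq_neg_iff_add_eq_0 add.commute)
  also have "(LINT t|lborel. f t * (- \<i> * of_real \<omega> * e t)) = (- \<i> * of_real \<omega>) * (LINT t|lborel. f t * e t)"
    by (subst integral_mult_right_zero[symmetric]) (simp add: mult_ac)
  finally have "(LINT t|lborel. f' t * e t) = (\<i> * of_real \<omega>) * fourier f \<omega>"
    by (simp add: fourier_lborel e_def)
  then have "\<bar>\<omega>\<bar> * cmod (fourier f \<omega>) = cmod (LINT t|lborel. f' t * e t)"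
    by (simp add: norm_mult)
  also have "\<dots> \<le> (LINT t|lborel. cmod (f' t * e t))" by (rule integral_norm_bound)
  also have "\<dots> = (LINT t|lborel. cmod (f' t))" by (simp add: norm_mult e_def)
  finally show ?thesis .
qed

text \<open>The weight decays like |\<omega>| to the power 2(\<nu> - 1), which is below -1 exactly
  when \<nu> < 1/2; with c = 1 - 2\<nu> the exponent reads -c - 1.\<close>

lemma weight_nn_integral_finite:
  fixes \<nu> :: real
  assumes "\<nu> < 1/2"
  shows "(\<integral>\<^sup>+\<omega>. ennreal ((1 + \<omega>\<^sup>2) powr (\<nu> - 1)) \<partial>lborel) < \<infinity>"
proof -
  define c where "c = 1 - 2 * \<nu>"
  have c: "c > 0" using assms by (simp add: c_def)
  have "(\<integral>\<^sup>+\<omega>. ennreal ((1 + \<omega>\<^sup>2) powr (\<nu> - 1)) \<partial>lborel) \<le> (\<integral>\<^sup>+\<omega>. ennreal (2 powr (1 - \<nu>)) * ennreal ((1 + \<bar>\<omega>\<bar>) powr (- c - 1)) \<partial>lborel)"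
  proof (intro nn_integral_mono)
    fix \<omega> :: real
    have "(1 + \<bar>\<omega>\<bar>)\<^sup>2 / 2 \<le> 1 + \<omega>\<^sup>2"
      using sum_squares_bound[of 1 "\<bar>\<omega>\<bar>"] by (simp add: power2_sum)
    then have "(1 + \<omega>\<^sup>2) powr (\<nu> - 1) \<le> ((1 + \<bar>\<omega>\<bar>)\<^sup>2 / 2) powr (\<nu> - 1)"
      using assms by (intro powr_mono2') (auto simp: add_pos_nonneg)
    also have "\<dots> = ((1 + \<bar>\<omega>\<bar>) powr (\<nu> - 1) * (1 + \<bar>\<omega>\<bar>) powr (\<nu> - 1)) / 2 powr (\<nu> - 1)"
      by (simp add: powr_divide power2_eq_square powr_mult)
    also have "\<dots> = 2 powr (1 - \<nu>) * (1 + \<bar>\<omega>\<bar>) powr (- c - 1)"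
      unfolding powr_add[symmetric] by (simp add: c_def divide_inverse powr_minus[symmetric] mult.commute)
    finally show "ennreal ((1 + \<omega>\<^sup>2) powr (\<nu> - 1)) \<le> ennreal (2 powr (1 - \<nu>)) * ennreal ((1 + \<bar>\<omega>\<bar>) powr (- c - 1))"
      by (subst ennreal_mult[symmetric]) (auto intro: ennreal_leI)
  qed
  also have "\<dots> = ennreal (2 powr (1 - \<nu>)) * (\<integral>\<^sup>+\<omega>. ennreal ((1 + \<bar>\<omega>\<bar>) powr (- c - 1)) \<partial>lborel)"
    by (rule nn_integral_cmult) measurable
  also have "\<dots> \<le> ennreal (2 powr (1 - \<nu>)) * (2 * (\<integral>\<^sup>+\<omega>. ennreal ((1 + \<bar>\<omega>\<bar>) powr (- c - 1)) * indicator {0..} \<omega> \<partial>lborel))"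
    by (intro mult_left_mono nn_integral_even_le) auto
  also have "(\<integral>\<^sup>+\<omega>. ennreal ((1 + \<bar>\<omega>\<bar>) powr (- c - 1)) * indicator {0..} \<omega> \<partial>lborel)
     = (\<integral>\<^sup>+\<omega>. ennreal ((1 + \<omega>) powr (- c - 1)) * indicator {0..} \<omega> \<partial>lborel)"
    by (intro nn_integral_cong) (auto simp: indicator_def)
  also have "\<dots> = ennreal (0 - (1 + 0) powr (- c) / (- c))"
  proof (rule nn_integral_FTC_atLeast)
    fix t :: real assume "0 \<le> t"
    then show "((\<lambda>y. (1 + y) powr (- c) / (- c)) has_real_derivative (1 + t) powr (- c - 1)) (at t)"
      using c by (auto intro!: derivative_eq_intros simp: powr_diff powr_minus)
  next
    show "((\<lambda>y. (1 + y) powr (- c) / (- c)) \<longlongrightarrow> 0) at_top"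
      using c by real_asymp
  qed auto
  also have "ennreal (2 powr (1 - \<nu>)) * (2 * ennreal (0 - (1 + 0) powr (- c) / (- c))) < \<infinity>"
    by (simp add: ennreal_mult_less_top)
  finally show ?thesis .
qed

text \<open>Merges a bound at small frequencies with a decay 1/|\<omega>| at large ones: their
  squares add up to a bound for (1 + \<omega>^2) w^2.\<close>

lemma weighted_fourier_decay:
  fixes A V w \<omega> \<nu> :: real
  assumes "w \<le> A" "\<bar>\<omega>\<bar> * w \<le> V" "w \<ge> 0"
  shows "(1 + \<omega>\<^sup>2) powr \<nu> * w\<^sup>2 \<le> (A\<^sup>2 + V\<^sup>2) * (1 + \<omega>\<^sup>2) powr (\<nu> - 1)"
proof -
  have "w\<^sup>2 \<le> A\<^sup>2" "(\<bar>\<omega>\<bar> * w)\<^sup>2 \<le> V\<^sup>2"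
    using assms by (auto intro!: power_mono)
  then have "(1 + \<omega>\<^sup>2) * w\<^sup>2 \<le> A\<^sup>2 + V\<^sup>2"
    by (simp add: power_mult_distrib algebra_simps)
  then have "(1 + \<omega>\<^sup>2) powr (\<nu> - 1) * ((1 + \<omega>\<^sup>2) * w\<^sup>2) \<le> (1 + \<omega>\<^sup>2) powr (\<nu> - 1) * (A\<^sup>2 + V\<^sup>2)"
    by (rule mult_left_mono) simp
  moreover have "(1 + \<omega>\<^sup>2) powr \<nu> = (1 + \<omega>\<^sup>2) powr (\<nu> - 1) * (1 + \<omega>\<^sup>2)"
    by (simp add: powr_diff add_nonneg_eq_0_iff)
  ultimately show ?thesis by (simp only: mult.assoc mult.commute[of "A\<^sup>2 + V\<^sup>2"])
qed

lemma Cc_smooth_real_deriv: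
  fixes \<phi> :: "real \<Rightarrow> 'b::euclidean_space"
  assumes "\<phi> \<in> Cc_smooth {0<..<T}"
  obtains \<phi>' where "\<And>t. (\<phi> has_vector_derivative \<phi>' t) (at t)" "continuous_on UNIV \<phi>'"
    "\<And>t. t \<notin> {0<..<T} \<Longrightarrow> \<phi>' t = 0"
proof
  let ?\<phi>' = "\<lambda>t. frechet_derivative \<phi> (at t) 1"
  show "(\<phi> has_vector_derivative ?\<phi>' t) (at t)" for t
  proof -
    have d: "(\<phi> has_derivative frechet_derivative \<phi> (at t)) (at t)" by (rule Cc_smoothD(4)[OF assms])
    show ?thesis unfolding has_vector_derivative_def
    proof (rule has_derivative_eq_rhs[OF d], rule ext)
      show "frechet_derivative \<phi> (at t) h = h *\<^sub>R ?\<phi>' t" for h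
        using linear_scale[OF has_derivative_linear[OF d], of h 1] by simp
    qed
  qed
  note d = Cc_smooth_deriv[OF assms, of 1]
  show "continuous_on UNIV ?\<phi>'" by (rule Cc_smoothD(2)[OF d])
  show "?\<phi>' t = 0" if "t \<notin> {0<..<T}" for t by (rule Cc_smoothD(5)[OF d that])
qed

lemma Cc_smooth_lborel_integrable:
  fixes \<phi> :: "real \<Rightarrow> complex"
  assumes "\<phi> \<in> Cc_smooth {0<..<T}"
  shows "integrable lborel \<phi>"
proof -
  have "set_integrable lborel {0..T} \<phi>"
    by (rule borel_integrable_atLeastAtMost'[OF continuous_on_subset[OF Cc_smoothD(2)[OF assms]]]) simp
  moreover have "indicator {0..T} t *\<^sub>R \<phi> t = \<phi> t" for t
    using Cc_smoothD(5)[OF assms, of t] by (auto simp: indicator_def)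
  ultimately show ?thesis by (simp add: set_integrable_def)
qed

lemma Cc_smooth_lebesgue_integrable:
  fixes \<phi> :: "real \<Rightarrow> complex"
  assumes "\<phi> \<in> Cc_smooth {0<..<T}"
  shows "integrable lebesgue \<phi>"
  using Cc_smooth_lborel_integrable[OF assms] by (subst integrable_completion) auto

text \<open>Boundedness and the decay 1/|\<omega>| from a single derivative are enough, since \<nu>
  < 1/2. This puts the approximating test functions into \<open>H_fun\<close>, where differences can
  be estimated.\<close>

lemma Cc_smooth_H_fun:
  fixes \<phi> :: "real \<Rightarrow> complex"
  assumes \<phi>: "\<phi> \<in> Cc_smooth {0<..<T}" and T: "T > 0" and \<nu>: "\<nu> < 1/2"
  shows "\<phi> \<in> H_fun \<nu>"
proof -
  obtain \<phi>' where \<phi>': "\<And>t. (\<phi> has_vector_derivative \<phi>' t) (at t)" "continuous_on UNIV \<phi>'"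
    "\<And>t. t \<notin> {0<..<T} \<Longrightarrow> \<phi>' t = 0"
    by (rule Cc_smooth_real_deriv[OF \<phi>]) blast
  have [measurable]: "\<phi> \<in> borel_measurable borel" using Cc_smooth_lborel_integrable[OF \<phi>] by auto
  define A V where "A = (LINT t|lborel. cmod (\<phi> t))" and "V = (LINT t|lborel. cmod (\<phi>' t))"
  have "H_energy \<nu> \<phi> \<le> (\<integral>\<^sup>+\<omega>. ennreal (A\<^sup>2 + V\<^sup>2) * ennreal ((1 + \<omega>\<^sup>2) powr (\<nu> - 1)) \<partial>lborel)"
    unfolding H_energy_def
  proof (intro nn_integral_mono)
    fix \<omega>
    have "cmod (fourier \<phi> \<omega>) \<le> A" unfolding A_def by (rule fourier_bound) measurable
    moreover have "\<bar>\<omega>\<bar> * cmod (fourier \<phi> \<omega>) \<le> V"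
      unfolding V_def using T Cc_smoothD(5)[OF \<phi>] \<phi>'(3) by (intro abs_mult_fourier_le[where a=0 and b=T] \<phi>'(1,2)) auto
    ultimately show "ennreal ((1 + \<omega>\<^sup>2) powr \<nu> * (cmod (fourier \<phi> \<omega>))\<^sup>2) \<le> ennreal (A\<^sup>2 + V\<^sup>2) * ennreal ((1 + \<omega>\<^sup>2) powr (\<nu> - 1))"
      by (subst ennreal_mult[symmetric]) (auto intro!: ennreal_leI weighted_fourier_decay)
  qed
  also have "\<dots> = ennreal (A\<^sup>2 + V\<^sup>2) * (\<integral>\<^sup>+\<omega>. ennreal ((1 + \<omega>\<^sup>2) powr (\<nu> - 1)) \<partial>lborel)"
    by (rule nn_integral_cmult) measurable
  also have "\<dots> < \<infinity>"
    using weight_nn_integral_finite[OF \<nu>] by (simp add: ennreal_mult_less_top)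
  finally show ?thesis using H_fun_iff_energy[OF Cc_smooth_lebesgue_integrable[OF \<phi>]] by simp
qed

text \<open>The smoothed cut-offs have uniformly bounded variation, so their Fourier transforms decay like
  \<open>1/|\<omega>|\<close> uniformly; this dominates the energy because \<open>\<nu> < 1/2\<close>.\<close>

lemma cut_above_smooth_approx:
  fixes \<phi> :: "real \<Rightarrow> complex" and \<tau> :: real
  assumes \<phi>: "\<phi> \<in> Cc_smooth {0<..<T}" and T: "T > 0" and \<nu>: "\<nu> < 1/2"
  defines "\<psi> \<equiv> \<lambda>n t. smooth_ramp (real (Suc n) * (t - \<tau>)) *\<^sub>R \<phi> t"
  shows "\<psi> n \<in> Cc_smooth {0<..<T}"
    "(\<lambda>n. H_energy \<nu> (\<lambda>t. cut_above \<tau> \<phi> t - \<psi> n t)) \<longlonglongrightarrow> 0"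
proof -
  have \<psi>: "\<psi> n \<in> Cc_smooth {0<..<T}" for n
    unfolding \<psi>_def using times_cont_diff_ramp_affine(1)[of _ "real (Suc n)" "1::real" \<tau>]
    by (intro Cc_smooth_scaleR[OF _ \<phi>]) (simp only: inner_real_def mult_1_right)
  then show "\<psi> n \<in> Cc_smooth {0<..<T}" .
  obtain \<phi>' where \<phi>': "\<And>t. (\<phi> has_vector_derivative \<phi>' t) (at t)" "continuous_on UNIV \<phi>'"
    "\<And>t. t \<notin> {0<..<T} \<Longrightarrow> \<phi>' t = 0"
    by (rule Cc_smooth_real_deriv[OF \<phi>]) blast
  obtain d where d: "\<And>x. (smooth_ramp has_real_derivative d x) (at x)" "continuous_on UNIV d" "\<And>x. d x \<ge> 0"
    by (rule smooth_ramp_deriv) blast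
  obtain B where B: "B > 0" "\<And>x. cmod (\<phi> x) \<le> B" by (rule Cc_smooth_bounded[OF \<phi>]) blast
  have \<phi>i: "integrable lborel \<phi>" by (rule Cc_smooth_lborel_integrable[OF \<phi>])
  have \<phi>m[measurable]: "\<phi> \<in> borel_measurable borel" using \<phi>i by auto
  have \<psi>m[measurable]: "\<psi> n \<in> borel_measurable borel" for n using Cc_smooth_lborel_integrable[OF \<psi>] by auto
  have \<phi>0: "\<phi> t = 0" if "t \<notin> {0<..<T}" for t by (rule Cc_smoothD(5)[OF \<phi> that])
  have cm[measurable]: "cut_above \<tau> \<phi> \<in> borel_measurable borel" by (rule cut_above_measurable[OF \<phi>m])
  have ci: "integrable lborel (cut_above \<tau> \<phi>)" by (rule cut_above_integrable[OF \<phi>i])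
  let ?r = "\<lambda>n t. real (Suc n) * (t - \<tau>)"
  let ?dr = "\<lambda>n t. real (Suc n) * d (?r n t)"
  have r: "((\<lambda>t. smooth_ramp (?r n t)) has_real_derivative ?dr n t) (at t)" for n t
  proof -
    have "((\<lambda>t. ?r n t) has_real_derivative real (Suc n)) (at t)" by (auto intro!: derivative_eq_intros)
    from DERIV_chain2[OF d(1) this] show ?thesis by (simp add: mult.commute)
  qed
  have drc: "continuous_on UNIV (?dr n)" for n
    by (intro continuous_intros continuous_on_compose2[OF d(2)]) auto
  define A V where "A = (LINT t|lborel. cmod (\<phi> t))" and "V = (LINT t|lborel. cmod (\<phi>' t)) + B"
  have A: "cmod (fourier (\<psi> n) \<omega>) \<le> A" for n \<omega>
  proof -
    have "cmod (fourier (\<psi> n) \<omega>) \<le> (LINT t|lborel. cmod (\<psi> n t))" by (rule fourier_bound) measurable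
    also have "\<dots> \<le> A" unfolding A_def
      by (rule integral_mono[OF integrable_norm[OF Cc_smooth_lborel_integrable[OF \<psi>]] integrable_norm[OF \<phi>i]])
        (simp add: \<psi>_def mult_left_le_one_le smooth_ramp_bounds)
    finally show ?thesis .
  qed
  have \<phi>'i: "integrable lborel \<phi>'"
  proof -
    have "set_integrable lborel {0..T} \<phi>'"
      by (rule borel_integrable_atLeastAtMost'[OF continuous_on_subset[OF \<phi>'(2)]]) simp
    moreover have "indicator {0..T} t *\<^sub>R \<phi>' t = \<phi>' t" for t
      using \<phi>'(3)[of t] by (auto simp: indicator_def)
    ultimately show ?thesis by (simp add: set_integrable_def)
  qed
  have V: "\<bar>\<omega>\<bar> * cmod (fourier (\<psi> n) \<omega>) \<le> V" for n \<omega>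
  proof -
    let ?\<psi>' = "\<lambda>t. smooth_ramp (?r n t) *\<^sub>R \<phi>' t + ?dr n t *\<^sub>R \<phi> t"
    have "(\<psi> n has_vector_derivative ?\<psi>' t) (at t)" for t
      unfolding \<psi>_def by (rule has_vector_derivative_scaleR[OF r \<phi>'(1)])
    moreover have "continuous_on UNIV ?\<psi>'"
    proof -
      have "continuous_on UNIV (\<lambda>t. smooth_ramp (?r n t))"
        using r by (meson DERIV_continuous_on has_field_derivative_at_within)
      then show ?thesis by (intro continuous_intros \<phi>'(2) drc Cc_smoothD(2)[OF \<phi>])
    qed
    ultimately have "\<bar>\<omega>\<bar> * cmod (fourier (\<psi> n) \<omega>) \<le> (LINT t|lborel. cmod (?\<psi>' t))"
      using T \<phi>0 \<phi>'(3) by (intro abs_mult_fourier_le[where a=0 and b=T]) (auto simp: \<psi>_def)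
    also have "\<dots> \<le> (LINT t|lborel. cmod (\<phi>' t) + B * (?dr n t * indicator {0..T} t))"
    proof (rule integral_mono_AE')
      have dri: "integrable lborel (\<lambda>t. ?dr n t * indicator {0..T} t)"
        using borel_integrable_atLeastAtMost'[OF continuous_on_subset[OF drc subset_UNIV], of 0 T n]
        by (simp add: set_integrable_def mult.commute)
      then show "integrable lborel (\<lambda>t. cmod (\<phi>' t) + B * (?dr n t * indicator {0..T} t))"
        using \<phi>'i by (intro Bochner_Integration.integrable_add integrable_mult_right) auto
      show "AE t in lborel. cmod (?\<psi>' t) \<le> cmod (\<phi>' t) + B * (?dr n t * indicator {0..T} t)"
      proof (rule AE_I2)
        fix t
        have "cmod (?\<psi>' t) \<le> smooth_ramp (?r n t) * cmod (\<phi>' t) + ?dr n t * cmod (\<phi> t)"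
          using smooth_ramp_bounds(1)[of "?r n t"] d(3)[of "?r n t"]
          by (intro order_trans[OF norm_triangle_ineq]) (simp add: abs_mult)
        also have "\<dots> \<le> cmod (\<phi>' t) + ?dr n t * (B * indicator {0..T} t)"
          using smooth_ramp_bounds(1,2)[of "?r n t"] d(3)[of "?r n t"] B(2)[of t] \<phi>0[of t] 
          by (intro add_mono mult_left_mono mult_left_le_one_le) (auto simp: indicator_def)
        finally show "cmod (?\<psi>' t) \<le> cmod (\<phi>' t) + B * (?dr n t * indicator {0..T} t)" by (simp add: mult_ac)
      qed
      show "AE t in lborel. 0 \<le> cmod (\<phi>' t) + B * (?dr n t * indicator {0..T} t)"
        using B(1) d(3) by (intro AE_I2 add_nonneg_nonneg mult_nonneg_nonneg) auto
    qed
    also have "\<dots> = (LINT t|lborel. cmod (\<phi>' t)) + B * (LINT t|lborel. ?dr n t * indicator {0..T} t)"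
    proof -
      have dri: "integrable lborel (\<lambda>t. ?dr n t * indicator {0..T} t)"
        using borel_integrable_atLeastAtMost'[OF continuous_on_subset[OF drc subset_UNIV], of 0 T n]
        by (simp add: set_integrable_def mult.commute)
      show ?thesis
        unfolding Bochner_Integration.integral_add[OF integrable_norm[OF \<phi>'i] integrable_mult_right[OF dri]] by simp
    qed
    \<comment> \<open>The derivative of the ramp is nonnegative, so its integral is an increment of
      the ramp and at most 1, whatever n is.\<close>
    also have "(LINT t|lborel. ?dr n t * indicator {0..T} t) = smooth_ramp (?r n T) - smooth_ramp (?r n 0)"
    proof (rule integral_FTC_Icc_nonneg)
      show "?dr n \<in> borel_measurable borel" by (rule borel_measurable_continuous_onI[OF drc])
    qed (use r d(3) T in auto)
    also have "B * \<dots> \<le> B * 1"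
      using B(1) smooth_ramp_bounds(1)[of "?r n 0"] smooth_ramp_bounds(2)[of "?r n T"] by (intro mult_left_mono) auto
    finally show ?thesis by (simp add: V_def)
  qed
  have lim: "(\<lambda>n. fourier (\<psi> n) \<omega>) \<longlonglongrightarrow> fourier (cut_above \<tau> \<phi>) \<omega>" for \<omega>
    unfolding fourier_lborel[OF \<psi>m] fourier_lborel[OF cm]
  proof (rule integral_dominated_convergence[where w="\<lambda>t. cmod (\<phi> t)"])
    show "AE t in lborel. (\<lambda>n. \<psi> n t * iexp (- (\<omega> * t))) \<longlonglongrightarrow> cut_above \<tau> \<phi> t * iexp (- (\<omega> * t))"
    proof (rule AE_I2)
      fix t
      have "(\<lambda>n. \<psi> n t) \<longlonglongrightarrow> (if t - \<tau> > 0 then 1 else 0) *\<^sub>R \<phi> t"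
        unfolding \<psi>_def by (intro tendsto_scaleR tendsto_const smooth_ramp_tendsto)
      then have "(\<lambda>n. \<psi> n t) \<longlonglongrightarrow> cut_above \<tau> \<phi> t" by (simp add: cut_above_def split: if_splits)
      then show "(\<lambda>n. \<psi> n t * iexp (- (\<omega> * t))) \<longlonglongrightarrow> cut_above \<tau> \<phi> t * iexp (- (\<omega> * t))"
        by (intro tendsto_mult tendsto_const)
    qed
    show "AE t in lborel. cmod (\<psi> n t * iexp (- (\<omega> * t))) \<le> cmod (\<phi> t)" for n
      using smooth_ramp_bounds by (auto simp: norm_mult \<psi>_def mult_left_le_one_le)
  qed (use \<phi>i in auto)
  have A': "cmod (fourier (cut_above \<tau> \<phi>) \<omega>) \<le> A" for \<omega>
    by (rule LIMSEQ_le_const2[OF tendsto_norm[OF lim]]) (use A in blast)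
  have V': "\<bar>\<omega>\<bar> * cmod (fourier (cut_above \<tau> \<phi>) \<omega>) \<le> V" for \<omega>
    by (rule LIMSEQ_le_const2[OF tendsto_mult[OF tendsto_const tendsto_norm[OF lim]]]) (use V in blast)
  have fd: "fourier (\<lambda>t. cut_above \<tau> \<phi> t - \<psi> n t) \<omega> = fourier (cut_above \<tau> \<phi>) \<omega> - fourier (\<psi> n) \<omega>" for n \<omega>
    by (rule fourier_diff[OF cut_above_lebesgue_integrable[OF Cc_smooth_lebesgue_integrable[OF \<phi>]] Cc_smooth_lebesgue_integrable[OF \<psi>]])
  let ?u = "\<lambda>n \<omega>. ennreal ((1 + \<omega>\<^sup>2) powr \<nu> * (cmod (fourier (cut_above \<tau> \<phi>) \<omega> - fourier (\<psi> n) \<omega>))\<^sup>2)"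
  have "(\<lambda>n. \<integral>\<^sup>+\<omega>. ?u n \<omega> \<partial>lborel) \<longlonglongrightarrow> (\<integral>\<^sup>+\<omega>. 0 \<partial>(lborel :: real measure))"
  proof (rule nn_integral_dominated_convergence[where w="\<lambda>\<omega>. ennreal ((2 * A)\<^sup>2 + (2 * V)\<^sup>2) * ennreal ((1 + \<omega>\<^sup>2) powr (\<nu> - 1))"])
    show "(\<integral>\<^sup>+\<omega>. ennreal ((2 * A)\<^sup>2 + (2 * V)\<^sup>2) * ennreal ((1 + \<omega>\<^sup>2) powr (\<nu> - 1)) \<partial>lborel) < \<infinity>"
      using weight_nn_integral_finite[OF \<nu>] by (subst nn_integral_cmult) (auto simp: ennreal_mult_less_top)
    show "AE \<omega> in lborel. ?u n \<omega> \<le> ennreal ((2 * A)\<^sup>2 + (2 * V)\<^sup>2) * ennreal ((1 + \<omega>\<^sup>2) powr (\<nu> - 1))" for n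
    proof (rule AE_I2)
      fix \<omega>
      let ?w = "cmod (fourier (cut_above \<tau> \<phi>) \<omega> - fourier (\<psi> n) \<omega>)"
      have tri: "?w \<le> cmod (fourier (cut_above \<tau> \<phi>) \<omega>) + cmod (fourier (\<psi> n) \<omega>)" by (rule norm_triangle_ineq4)
      then have "?w \<le> 2 * A" using A[of n \<omega>] A'[of \<omega>] by linarith
      moreover have "\<bar>\<omega>\<bar> * ?w \<le> 2 * V"
        using mult_left_mono[OF tri, of "\<bar>\<omega>\<bar>"] V[of \<omega> n] V'[of \<omega>] by (simp add: distrib_left)
      ultimately have "(1 + \<omega>\<^sup>2) powr \<nu> * ?w\<^sup>2 \<le> ((2 * A)\<^sup>2 + (2 * V)\<^sup>2) * (1 + \<omega>\<^sup>2) powr (\<nu> - 1)"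
        by (rule weighted_fourier_decay) simp
      then show "?u n \<omega> \<le> ennreal ((2 * A)\<^sup>2 + (2 * V)\<^sup>2) * ennreal ((1 + \<omega>\<^sup>2) powr (\<nu> - 1))"
        by (subst ennreal_mult[symmetric]) (auto intro: ennreal_leI)
    qed
    show "AE \<omega> in lborel. (\<lambda>n. ?u n \<omega>) \<longlonglongrightarrow> 0"
    proof (rule AE_I2)
      fix \<omega>
      have "(\<lambda>n. (1 + \<omega>\<^sup>2) powr \<nu> * (cmod (fourier (cut_above \<tau> \<phi>) \<omega> - fourier (\<psi> n) \<omega>))\<^sup>2) \<longlonglongrightarrow>
         (1 + \<omega>\<^sup>2) powr \<nu> * (cmod (fourier (cut_above \<tau> \<phi>) \<omega> - fourier (cut_above \<tau> \<phi>) \<omega>))\<^sup>2"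
        by (intro tendsto_intros lim)
      then have "(\<lambda>n. ?u n \<omega>) \<longlonglongrightarrow> ennreal ((1 + \<omega>\<^sup>2) powr \<nu> * (cmod (fourier (cut_above \<tau> \<phi>) \<omega> - fourier (cut_above \<tau> \<phi>) \<omega>))\<^sup>2)"
        by (rule tendsto_ennrealI)
      then show "(\<lambda>n. ?u n \<omega>) \<longlonglongrightarrow> 0" by simp
    qed
  qed measurable
  then show "(\<lambda>n. H_energy \<nu> (\<lambda>t. cut_above \<tau> \<phi> t - \<psi> n t)) \<longlonglongrightarrow> 0"
    unfolding H_energy_def fd by simp
qed

section \<open>Stability of the closure of test functions under cut-offs\<close>

definition cut_below :: "real \<Rightarrow> (real \<Rightarrow> complex) \<Rightarrow> real \<Rightarrow> complex" where
  "cut_below \<tau> f t = (if t \<le> \<tau> then f t else 0)"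

lemma Cc_smooth_diff:
  fixes \<phi> \<psi> :: "'a::euclidean_space \<Rightarrow> 'b::real_normed_vector"
  assumes "\<phi> \<in> Cc_smooth S" "\<psi> \<in> Cc_smooth S"
  shows "(\<lambda>x. \<phi> x - \<psi> x) \<in> Cc_smooth S"
proof -
  obtain C where C: "compact C" "C \<subseteq> S" "\<And>x. x \<notin> C \<Longrightarrow> \<phi> x = 0"
    by (rule Cc_smooth_supportE[OF assms(1)]) blast
  obtain D where D: "compact D" "D \<subseteq> S" "\<And>x. x \<notin> D \<Longrightarrow> \<psi> x = 0"
    by (rule Cc_smooth_supportE[OF assms(2)]) blast
  have "times_cont_diff k (\<lambda>x. \<phi> x + (-1) *\<^sub>R \<psi> x)" for k
    by (intro times_cont_diff_add times_cont_diff_scaleR times_cont_diff_const Cc_smoothD(1)[OF assms(1)] Cc_smoothD(1)[OF assms(2)])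
  then show ?thesis
    by (intro Cc_smooth_supportI[OF _ compact_Un[OF C(1) D(1)]]) (use C D in auto)
qed

lemma ext_zero_cut_above: "ext_zero T (cut_above \<tau> u) = cut_above \<tau> (ext_zero T u)"
  by (auto simp: ext_zero_def cut_above_def)

lemma L2_cut_above:
  assumes "u \<in> L2 {0<..<T}"
  shows "cut_above \<tau> u \<in> L2 {0<..<T}"
proof -
  have um: "u \<in> borel_measurable (lebesgue_on {0<..<T})" and ui: "integrable (lebesgue_on {0<..<T}) (\<lambda>x. (cmod (u x))\<^sup>2)"
    using assms by (auto simp: L2_def)
  have set: "{\<tau><..} \<inter> {0<..<T} \<in> sets (lebesgue_on {0<..<T})"
    by (auto simp: sets_restrict_space)
  have eq: "cut_above \<tau> u x = indicat_real ({\<tau><..} \<inter> {0<..<T}) x *\<^sub>R u x" if "x \<in> space (lebesgue_on {0<..<T})" for x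
    using that by (auto simp: cut_above_def indicator_def)
  have m: "cut_above \<tau> u \<in> borel_measurable (lebesgue_on {0<..<T})"
    using borel_measurable_scaleR[OF borel_measurable_indicator[OF set] um]
    by (subst measurable_cong[OF eq]) auto
  have "integrable (lebesgue_on {0<..<T}) (\<lambda>x. (cmod (cut_above \<tau> u x))\<^sup>2)"
  proof (rule Bochner_Integration.integrable_bound[OF ui])
    show "(\<lambda>x. (cmod (cut_above \<tau> u x))\<^sup>2) \<in> borel_measurable (lebesgue_on {0<..<T})"
      using m by measurable
  qed (simp add: cut_above_def)
  with m show ?thesis by (simp add: L2_def)
qed

lemma L2_diff:
  assumes "u \<in> L2 S" "v \<in> L2 S"
  shows "(\<lambda>x. u x - v x) \<in> L2 S"
proof -
  have um: "u \<in> borel_measurable (lebesgue_on S)" "v \<in> borel_measurable (lebesgue_on S)"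
    and ui: "integrable (lebesgue_on S) (\<lambda>x. (cmod (u x))\<^sup>2)" "integrable (lebesgue_on S) (\<lambda>x. (cmod (v x))\<^sup>2)"
    using assms by (auto simp: L2_def)
  have "integrable (lebesgue_on S) (\<lambda>x. (cmod (u x - v x))\<^sup>2)"
  proof (rule Bochner_Integration.integrable_bound)
    show "integrable (lebesgue_on S) (\<lambda>x. 2 * (cmod (u x))\<^sup>2 + 2 * (cmod (v x))\<^sup>2)"
      using ui by (intro Bochner_Integration.integrable_add integrable_mult_right) auto
    show "AE x in lebesgue_on S. norm ((cmod (u x - v x))\<^sup>2) \<le> norm (2 * (cmod (u x))\<^sup>2 + 2 * (cmod (v x))\<^sup>2)"
    proof (rule AE_I2)
      fix x
      have "(cmod (u x - v x))\<^sup>2 \<le> (cmod (u x) + cmod (v x))\<^sup>2"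
        by (rule power_mono[OF norm_triangle_ineq4]) simp
      also have "\<dots> \<le> 2 * (cmod (u x))\<^sup>2 + 2 * (cmod (v x))\<^sup>2"
        using sum_squares_bound[of "cmod (u x)" "cmod (v x)"] by (simp add: power2_sum)
      finally show "norm ((cmod (u x - v x))\<^sup>2) \<le> norm (2 * (cmod (u x))\<^sup>2 + 2 * (cmod (v x))\<^sup>2)" by simp
    qed
  qed (use um in auto)
  with um show ?thesis by (simp add: L2_def)
qed

text \<open>A cut-off test function is in general no longer smooth, so the approximation has two
  stages: u by a test function \<phi>, where boundedness of the cut-off preserves closeness, and
  then the sharp cut-off of \<phi> by a smooth one.\<close>

lemma L2_Htilde_cut_above:
  assumes u: "u \<in> L2_Htilde \<nu> T" and T: "T > 0" and \<nu>: "\<bar>\<nu>\<bar> < 1/2"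
  shows "cut_above \<tau> u \<in> L2_Htilde \<nu> T"
    "Htilde_norm \<nu> T (cut_above \<tau> u) \<le> cut_const \<nu> * Htilde_norm \<nu> T u"
proof -
  define f where "f = ext_zero T u"
  have uL: "u \<in> L2 {0<..<T}" and fH: "f \<in> H_fun \<nu>"
    and ap: "\<And>e. e > 0 \<Longrightarrow> \<exists>\<phi>\<in>Cc_smooth {0<..<T}. H_norm \<nu> (\<lambda>t. f t - \<phi> t) < e"
    using u by (auto simp: L2_Htilde_def f_def)
  note cf = H_norm_cut_above[OF fH \<nu>, of \<tau>]
  show "Htilde_norm \<nu> T (cut_above \<tau> u) \<le> cut_const \<nu> * Htilde_norm \<nu> T u"
    using cf(2) by (simp add: Htilde_norm_def ext_zero_cut_above f_def)
  have "\<exists>\<psi>\<in>Cc_smooth {0<..<T}. H_norm \<nu> (\<lambda>t. cut_above \<tau> f t - \<psi> t) < \<epsilon>" if \<epsilon>: "\<epsilon> > 0" for \<epsilon>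
  proof -
    \<comment> \<open>Chosen so that the cut-off of the error f - \<phi> has norm at most
      \<epsilon>/2; adding 1 keeps the denominator positive. The second stage will cost
      \<epsilon>/4, and 2/4 + 2/16 = 5/8 stays below 1.\<close>
    define e where "e = \<epsilon> / 2 / (cut_const \<nu> + 1)"
    have e: "e > 0" using \<epsilon> cut_const_nonneg[of \<nu>] by (simp add: e_def add_nonneg_pos)
    obtain \<phi> where \<phi>: "\<phi> \<in> Cc_smooth {0<..<T}" and \<phi>e: "H_norm \<nu> (\<lambda>t. f t - \<phi> t) < e"
      using ap[OF e] by blast
    have \<phi>H: "\<phi> \<in> H_fun \<nu>" using Cc_smooth_H_fun[OF \<phi> T] \<nu> by simp
    note c\<phi> = H_norm_cut_above[OF \<phi>H \<nu>, of \<tau>]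
    define g where "g = (\<lambda>t. f t - \<phi> t)"
    have gH: "g \<in> H_fun \<nu>" unfolding g_def by (rule H_fun_diff(1)[OF fH \<phi>H])
    note cg = H_norm_cut_above[OF gH \<nu>, of \<tau>]
    have "H_norm \<nu> (cut_above \<tau> g) \<le> cut_const \<nu> * e"
      using cg(2) \<phi>e mult_left_mono[OF less_imp_le[OF \<phi>e] cut_const_nonneg[of \<nu>]] by (simp add: g_def)
    also have "\<dots> \<le> \<epsilon> / 2"
      using \<epsilon> cut_const_nonneg[of \<nu>] by (simp add: e_def field_simps)
    finally have g2: "(H_norm \<nu> (cut_above \<tau> g))\<^sup>2 \<le> (\<epsilon> / 2)\<^sup>2"
      by (intro power_mono H_norm_nonneg)
    define \<psi> where "\<psi> = (\<lambda>n t. smooth_ramp (real (Suc n) * (t - \<tau>)) *\<^sub>R \<phi> t)"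
    have "\<nu> < 1/2" using \<nu> by simp
    note sa0 = cut_above_smooth_approx[OF \<phi> T this, where \<tau>=\<tau>]
    have sa: "\<psi> n \<in> Cc_smooth {0<..<T}" "(\<lambda>n. H_energy \<nu> (\<lambda>t. cut_above \<tau> \<phi> t - \<psi> n t)) \<longlonglongrightarrow> 0" for n
      unfolding \<psi>_def by (rule sa0(1), rule sa0(2))
    have "\<forall>\<^sub>F n in sequentially. H_energy \<nu> (\<lambda>t. cut_above \<tau> \<phi> t - \<psi> n t) < ennreal (2 * pi * (\<epsilon> / 4)\<^sup>2)"
      by (rule order_tendstoD(2)[OF sa(2)]) (use \<epsilon> in simp)
    then obtain n where n: "H_energy \<nu> (\<lambda>t. cut_above \<tau> \<phi> t - \<psi> n t) < ennreal (2 * pi * (\<epsilon> / 4)\<^sup>2)"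
      by (meson eventually_sequentially order_refl)
    have \<psi>H: "\<psi> n \<in> H_fun \<nu>" using Cc_smooth_H_fun[OF sa(1) T] \<nu> by simp
    \<comment> \<open>The total error, cut-off of f minus \<psi> n, will be the cut-off of g minus
      h, with g the first error and h the second.\<close>
    define h where "h = (\<lambda>t. \<psi> n t - cut_above \<tau> \<phi> t)"
    have hH: "h \<in> H_fun \<nu>" unfolding h_def by (rule H_fun_diff(1)[OF \<psi>H c\<phi>(1)])
    have h'H: "(\<lambda>t. cut_above \<tau> \<phi> t - \<psi> n t) \<in> H_fun \<nu>" by (rule H_fun_diff(1)[OF c\<phi>(1) \<psi>H])
    \<comment> \<open>The energies of a function and of its negative agree, so the order of the
      subtraction can be reversed.\<close>
    have "H_energy \<nu> h = H_energy \<nu> (\<lambda>t. cut_above \<tau> \<phi> t - \<psi> n t)"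
      using fourier_diff[of "\<psi> n" "cut_above \<tau> \<phi>"] fourier_diff[of "cut_above \<tau> \<phi>" "\<psi> n"] \<psi>H c\<phi>(1)
      by (simp add: H_energy_def h_def H_fun_def norm_minus_commute)
    then have "ennreal (2 * pi * (H_norm \<nu> h)\<^sup>2) < ennreal (2 * pi * (\<epsilon> / 4)\<^sup>2)"
      using n unfolding H_energy_eq[OF hH] by simp
    then have "(H_norm \<nu> h)\<^sup>2 < (\<epsilon> / 4)\<^sup>2"
      by (subst (asm) ennreal_less_iff) auto
    moreover have "(H_norm \<nu> (\<lambda>t. cut_above \<tau> g t - h t))\<^sup>2 \<le> 2 * (H_norm \<nu> (cut_above \<tau> g))\<^sup>2 + 2 * (H_norm \<nu> h)\<^sup>2"
      by (rule H_fun_diff(2)[OF cg(1) hH])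
    ultimately have "(H_norm \<nu> (\<lambda>t. cut_above \<tau> g t - h t))\<^sup>2 < 2 * (\<epsilon> / 2)\<^sup>2 + 2 * (\<epsilon> / 4)\<^sup>2"
      using g2 by linarith
    also have "\<dots> \<le> \<epsilon>\<^sup>2" by (simp add: power_divide)
    finally have "H_norm \<nu> (\<lambda>t. cut_above \<tau> g t - h t) < \<epsilon>"
      by (rule power2_less_imp_less) (use \<epsilon> in simp)
    moreover have "cut_above \<tau> g t - h t = cut_above \<tau> f t - \<psi> n t" for t
      by (simp add: cut_above_def g_def h_def)
    ultimately show ?thesis using sa(1) by auto
  qed
  then show "cut_above \<tau> u \<in> L2_Htilde \<nu> T"
    using cf(1) L2_cut_above[OF uL] by (simp add: L2_Htilde_def ext_zero_cut_above f_def)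
qed

lemma L2_Htilde_diff:
  assumes u: "u \<in> L2_Htilde \<nu> T" and v: "v \<in> L2_Htilde \<nu> T" and T: "T > 0" and \<nu>: "\<bar>\<nu>\<bar> < 1/2"
  shows "(\<lambda>t. u t - v t) \<in> L2_Htilde \<nu> T"
    "(Htilde_norm \<nu> T (\<lambda>t. u t - v t))\<^sup>2 \<le> 2 * (Htilde_norm \<nu> T u)\<^sup>2 + 2 * (Htilde_norm \<nu> T v)\<^sup>2"
proof -
  define f g where "f = ext_zero T u" and "g = ext_zero T v"
  have fg: "ext_zero T (\<lambda>t. u t - v t) = (\<lambda>t. f t - g t)"
    by (auto simp: ext_zero_def f_def g_def)
  have uL: "u \<in> L2 {0<..<T}" "v \<in> L2 {0<..<T}" and fH: "f \<in> H_fun \<nu>" "g \<in> H_fun \<nu>"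
    and ap: "\<And>e. e > 0 \<Longrightarrow> \<exists>\<phi>\<in>Cc_smooth {0<..<T}. H_norm \<nu> (\<lambda>t. f t - \<phi> t) < e"
     "\<And>e. e > 0 \<Longrightarrow> \<exists>\<phi>\<in>Cc_smooth {0<..<T}. H_norm \<nu> (\<lambda>t. g t - \<phi> t) < e"
    using u v by (auto simp: L2_Htilde_def f_def g_def)
  show "(Htilde_norm \<nu> T (\<lambda>t. u t - v t))\<^sup>2 \<le> 2 * (Htilde_norm \<nu> T u)\<^sup>2 + 2 * (Htilde_norm \<nu> T v)\<^sup>2"
    using H_fun_diff(2)[OF fH] unfolding Htilde_norm_def fg by (simp add: f_def g_def)
  have "\<exists>\<psi>\<in>Cc_smooth {0<..<T}. H_norm \<nu> (\<lambda>t. f t - g t - \<psi> t) < \<epsilon>" if \<epsilon>: "\<epsilon> > 0" for \<epsilon>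
  proof -
    have e: "\<epsilon> / 2 > 0" using \<epsilon> by simp
    obtain \<phi> where \<phi>: "\<phi> \<in> Cc_smooth {0<..<T}" "H_norm \<nu> (\<lambda>t. f t - \<phi> t) < \<epsilon> / 2" using ap(1)[OF e] by blast
    obtain \<psi> where \<psi>: "\<psi> \<in> Cc_smooth {0<..<T}" "H_norm \<nu> (\<lambda>t. g t - \<psi> t) < \<epsilon> / 2" using ap(2)[OF e] by blast
    have H: "\<phi> \<in> H_fun \<nu>" "\<psi> \<in> H_fun \<nu>" using Cc_smooth_H_fun[OF \<phi>(1) T] Cc_smooth_H_fun[OF \<psi>(1) T] \<nu> by auto
    have "(H_norm \<nu> (\<lambda>t. f t - \<phi> t))\<^sup>2 < (\<epsilon> / 2)\<^sup>2" "(H_norm \<nu> (\<lambda>t. g t - \<psi> t))\<^sup>2 < (\<epsilon> / 2)\<^sup>2"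
      using \<phi>(2) \<psi>(2) H_norm_nonneg by (auto intro!: power_strict_mono)
    moreover have "(H_norm \<nu> (\<lambda>t. (f t - \<phi> t) - (g t - \<psi> t)))\<^sup>2 \<le> 2 * (H_norm \<nu> (\<lambda>t. f t - \<phi> t))\<^sup>2 + 2 * (H_norm \<nu> (\<lambda>t. g t - \<psi> t))\<^sup>2"
      by (rule H_fun_diff(2)[OF H_fun_diff(1)[OF fH(1) H(1)] H_fun_diff(1)[OF fH(2) H(2)]])
    ultimately have "(H_norm \<nu> (\<lambda>t. (f t - \<phi> t) - (g t - \<psi> t)))\<^sup>2 < 2 * (\<epsilon> / 2)\<^sup>2 + 2 * (\<epsilon> / 2)\<^sup>2"
      by linarith
    also have "\<dots> = \<epsilon>\<^sup>2" by (simp add: power_divide)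
    finally have "H_norm \<nu> (\<lambda>t. (f t - \<phi> t) - (g t - \<psi> t)) < \<epsilon>"
      by (rule power2_less_imp_less) (use \<epsilon> in simp)
    moreover have "(\<lambda>t. (f t - \<phi> t) - (g t - \<psi> t)) = (\<lambda>t. f t - g t - (\<phi> t - \<psi> t))" by auto
    ultimately show ?thesis using Cc_smooth_diff[OF \<phi>(1) \<psi>(1)] by auto
  qed
  then show "(\<lambda>t. u t - v t) \<in> L2_Htilde \<nu> T"
    using H_fun_diff(1)[OF fH] L2_diff[OF uL] by (simp add: L2_Htilde_def fg)
qed

text \<open>The lower cut-off is the identity minus the upper one. With c =
  \<open>cut_const \<nu>\<close> the constant comes from 2 + 2c^2 \<le> (2(c + 1))^2, and it is
  generous enough to cover the upper cut-off as well.\<close>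

lemma L2_Htilde_cut_below:
  assumes u: "u \<in> L2_Htilde \<nu> T" and T: "T > 0" and \<nu>: "\<bar>\<nu>\<bar> < 1/2"
  shows "cut_below \<tau> u \<in> L2_Htilde \<nu> T"
    "Htilde_norm \<nu> T (cut_below \<tau> u) \<le> 2 * (cut_const \<nu> + 1) * Htilde_norm \<nu> T u"
proof -
  have eq: "cut_below \<tau> u = (\<lambda>t. u t - cut_above \<tau> u t)"
    by (auto simp: cut_below_def cut_above_def)
  note c = L2_Htilde_cut_above[OF u T \<nu>, of \<tau>]
  note d = L2_Htilde_diff[OF u c(1) T \<nu>]
  show "cut_below \<tau> u \<in> L2_Htilde \<nu> T" unfolding eq by (rule d(1))
  have nn: "Htilde_norm \<nu> T u \<ge> 0" for u by (simp add: Htilde_norm_def H_norm_nonneg)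
  have "(Htilde_norm \<nu> T (cut_below \<tau> u))\<^sup>2 \<le> 2 * (Htilde_norm \<nu> T u)\<^sup>2 + 2 * (Htilde_norm \<nu> T (cut_above \<tau> u))\<^sup>2"
    unfolding eq by (rule d(2))
  also have "\<dots> \<le> 2 * (Htilde_norm \<nu> T u)\<^sup>2 + 2 * (cut_const \<nu> * Htilde_norm \<nu> T u)\<^sup>2"
    using power_mono[OF c(2) nn, of 2] by simp
  also have "\<dots> = (2 + 2 * (cut_const \<nu>)\<^sup>2) * (Htilde_norm \<nu> T u)\<^sup>2"
    by (simp add: power_mult_distrib algebra_simps)
  also have "\<dots> \<le> (2 * (cut_const \<nu> + 1))\<^sup>2 * (Htilde_norm \<nu> T u)\<^sup>2"
    using cut_const_nonneg[of \<nu>] by (intro mult_right_mono) (auto simp: power2_eq_square algebra_simps)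
  finally have "(Htilde_norm \<nu> T (cut_below \<tau> u))\<^sup>2 \<le> (2 * (cut_const \<nu> + 1) * Htilde_norm \<nu> T u)\<^sup>2"
    by (simp only: power_mult_distrib)
  then show "Htilde_norm \<nu> T (cut_below \<tau> u) \<le> 2 * (cut_const \<nu> + 1) * Htilde_norm \<nu> T u"
    by (rule power2_le_imp_le) (use nn cut_const_nonneg[of \<nu>] in simp)
qed

section \<open>Uniqueness of weak derivatives\<close>

text \<open>Trades the measure restricted to S for an indicator on the whole space, where Borel
  versions and the passage to \<open>lborel\<close> are available.\<close>

lemma lebesgue_on_integral_eq:
  fixes f :: "'a::euclidean_space \<Rightarrow> 'b::{banach, second_countable_topology}"
  assumes "open S"
  shows "integral\<^sup>L (lebesgue_on S) f = (LINT x|lebesgue. indicator S x *\<^sub>R f x)"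
    "integrable (lebesgue_on S) f \<longleftrightarrow> integrable lebesgue (\<lambda>x. indicator S x *\<^sub>R f x)"
    "f \<in> borel_measurable (lebesgue_on S) \<longleftrightarrow> (\<lambda>x. indicator S x *\<^sub>R f x) \<in> borel_measurable lebesgue"
    "(AE x in lebesgue_on S. P x) \<longleftrightarrow> (AE x in lebesgue. x \<in> S \<longrightarrow> P x)"
proof -
  have S: "S \<inter> space lebesgue \<in> sets lebesgue" using assms by simp
  show "integral\<^sup>L (lebesgue_on S) f = (LINT x|lebesgue. indicator S x *\<^sub>R f x)"
    by (rule integral_restrict_space[OF S])
  show "integrable (lebesgue_on S) f \<longleftrightarrow> integrable lebesgue (\<lambda>x. indicator S x *\<^sub>R f x)"
    by (rule integrable_restrict_space[OF S])
  show "f \<in> borel_measurable (lebesgue_on S) \<longleftrightarrow> (\<lambda>x. indicator S x *\<^sub>R f x) \<in> borel_measurable lebesgue"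
    by (rule borel_measurable_restrict_space_iff[OF S])
  show "(AE x in lebesgue_on S. P x) \<longleftrightarrow> (AE x in lebesgue. x \<in> S \<longrightarrow> P x)"
    by (rule AE_restrict_space_iff[OF S])
qed

lemma integrable_bounded_mult:
  fixes h :: "'a::euclidean_space \<Rightarrow> complex"
  assumes i: "integrable lebesgue (\<lambda>x. indicator C x *\<^sub>R h x)"
    and \<phi>: "\<phi> \<in> borel_measurable borel" "\<And>x. \<bar>\<phi> x\<bar> \<le> B" "\<And>x. x \<notin> C \<Longrightarrow> \<phi> x = 0"
  shows "integrable lebesgue (\<lambda>x. \<phi> x *\<^sub>R h x)"
proof -
  have eq: "\<phi> x *\<^sub>R h x = \<phi> x *\<^sub>R (indicator C x *\<^sub>R h x)" for x
    using \<phi>(3)[of x] by (auto simp: indicator_def)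
  have m: "(\<lambda>x. \<phi> x *\<^sub>R h x) \<in> borel_measurable lebesgue"
    by (subst eq) (rule borel_measurable_scaleR[OF borel_imp_lebesgue_measurable[OF \<phi>(1)] borel_measurable_integrable[OF i]])
  show ?thesis
  proof (rule Bochner_Integration.integrable_bound[OF _ m])
    show "integrable lebesgue (\<lambda>x. B *\<^sub>R (indicator C x *\<^sub>R h x))" using i by (rule integrable_scaleR_right)
    show "AE x in lebesgue. norm (\<phi> x *\<^sub>R h x) \<le> norm (B *\<^sub>R (indicator C x *\<^sub>R h x))"
      unfolding eq norm_scaleR
      by (rule AE_I2, rule mult_right_mono) (use \<phi>(2) order_trans[OF _ abs_ge_self] in auto)
  qed
qed

lemma Cc_smooth_mult_integrable:
  fixes f :: "'a::euclidean_space \<Rightarrow> complex" and \<phi> :: "'a \<Rightarrow> real"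
  assumes S: "open S" and f: "f \<in> L1_loc S" and \<phi>: "\<phi> \<in> Cc_smooth S"
  shows "integrable (lebesgue_on S) (\<lambda>x. \<phi> x *\<^sub>R f x)"
proof -
  obtain C where C: "compact C" "C \<subseteq> S" "\<And>x. x \<notin> C \<Longrightarrow> \<phi> x = 0"
    by (rule Cc_smooth_supportE[OF \<phi>]) blast
  obtain B where B: "\<And>x. \<bar>\<phi> x\<bar> \<le> B" using Cc_smooth_bounded[OF \<phi>] by (metis real_norm_def)
  have "integrable lebesgue (\<lambda>x. indicator C x *\<^sub>R f x)"
    using f C by (auto simp: L1_loc_def set_integrable_def)
  then have "integrable lebesgue (\<lambda>x. \<phi> x *\<^sub>R f x)"
    by (rule integrable_bounded_mult[OF _ Cc_smooth_borel[OF \<phi>] B C(3)])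
  moreover have "indicator S x *\<^sub>R (\<phi> x *\<^sub>R f x) = \<phi> x *\<^sub>R f x" for x
    using C(2) C(3)[of x] by (auto simp: indicator_def)
  ultimately show ?thesis unfolding lebesgue_on_integral_eq(2)[OF S] by (simp only:)
qed

lemma L1_loc_diff:
  assumes "f \<in> L1_loc S" "g \<in> L1_loc S"
  shows "(\<lambda>x. f x - g x) \<in> L1_loc S"
  using assms unfolding L1_loc_def by (auto intro: set_integral_diff(1))

text \<open>Boxes are stable under intersection and generate the Borel sets, so the vanishing of
  integrals extends by induction over disjoint unions and complements. The vanishing total integral
  is what makes the complement step work.\<close>

lemma integral_boxes_zero_imp_AE_zero:
  fixes g :: "'a::euclidean_space \<Rightarrow> complex"
  assumes g: "integrable lborel g" and UN: "(LINT x|lborel. g x) = 0"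
    and box: "\<And>a b. (LINT x|lborel. indicator (box a b) x *\<^sub>R g x) = 0"
  shows "AE x in lborel. g x = 0"
proof (rule sigma_finite_measure.density_zero[OF sigma_finite_lborel g])
  have ind: "set_integrable lborel A g" if "A \<in> sets borel" for A
    unfolding set_integrable_def using that g by (intro integrable_mult_indicator) auto
  fix A :: "'a set" assume "A \<in> sets lborel"
  then have A: "A \<in> sigma_sets UNIV (range (\<lambda>(a, b). box a b :: 'a set))"
    by (simp add: borel_eq_box)
  have sb: "A \<in> sets borel" if "A \<in> sigma_sets UNIV (range (\<lambda>(a, b). box a b :: 'a set))" for A
    using that by (simp add: borel_eq_box)
  show "set_lebesgue_integral lborel A g = 0"
  proof (rule sigma_sets_induct_disjoint[OF _ _ A])
    show "Int_stable (range (\<lambda>(a, b). box a b :: 'a set))"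
      by (auto simp: Int_stable_def box_Int_box)
    show "set_lebesgue_integral lborel A g = 0" if "A \<in> range (\<lambda>(a, b). box a b)" for A
      using that box by (auto simp: set_lebesgue_integral_def)
    show "set_lebesgue_integral lborel {} g = 0" by (simp add: set_lebesgue_integral_def)
  next
    fix A assume A: "A \<in> sigma_sets UNIV (range (\<lambda>(a, b). box a b :: 'a set))" and IH: "set_lebesgue_integral lborel A g = 0"
    have "(\<lambda>x. indicator (UNIV - A) x *\<^sub>R g x) = (\<lambda>x. g x - indicator A x *\<^sub>R g x)"
      by (auto simp: indicator_def)
    then show "set_lebesgue_integral lborel (UNIV - A) g = 0"
      using UN IH g ind[OF sb[OF A]] by (simp add: set_lebesgue_integral_def set_integrable_def)
  next
    fix A :: "nat \<Rightarrow> 'a set"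
    assume d: "disjoint_family A" and A: "range A \<subseteq> sigma_sets UNIV (range (\<lambda>(a, b). box a b :: 'a set))"
      and IH: "\<And>i. set_lebesgue_integral lborel (A i) g = 0"
    have Ai: "A i \<in> sets lborel" for i using A sb by auto
    have "set_lebesgue_integral lborel (\<Union>i. A i) g = (\<Sum>i. set_lebesgue_integral lborel (A i) g)"
    proof (rule lebesgue_integral_countable_add[OF Ai])
      show "A i \<inter> A j = {}" if "i \<noteq> j" for i j using d that by (auto simp: disjoint_family_on_def)
      show "set_integrable lborel (\<Union>i. A i) g" using Ai by (intro ind) auto
    qed
    then show "set_lebesgue_integral lborel (\<Union>i. A i) g = 0" using IH by simp
  qed auto
qed

text \<open>Bumps converge to indicators of boxes, so f has integral 0 over every box whose closed
  box lies in S. Inside one such box the intersections with arbitrary boxes are again of this kind,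
  and S is a countable union of closed boxes.\<close>

lemma fundamental_lemma:
  fixes f :: "'a::euclidean_space \<Rightarrow> complex"
  assumes S: "open S" and f: "f \<in> L1_loc S"
    and z: "\<And>\<phi>::'a \<Rightarrow> real. \<phi> \<in> Cc_smooth S \<Longrightarrow> (LINT x|lebesgue_on S. \<phi> x *\<^sub>R f x) = 0"
  shows "AE x in lebesgue_on S. f x = 0"
proof -
  have box0: "(LINT x|lebesgue. indicator (box a b) x *\<^sub>R f x) = 0" if ab: "cbox a b \<subseteq> S" for a b
  proof -
    have i: "integrable lebesgue (\<lambda>x. indicator (cbox a b) x *\<^sub>R f x)"
      using f ab by (auto simp: L1_loc_def set_integrable_def)
    have off: "box_bump n a b x = 0" if "x \<notin> cbox a b" for n x
      using that box_bump_pos[of n a b x] box_bump_bounds(1)[of n a b x] box_subset_cbox[of a b] by auto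
    have int: "integrable lebesgue (\<lambda>x. box_bump n a b x *\<^sub>R f x)" for n
    proof (rule integrable_bounded_mult[OF i])
      show "box_bump n a b \<in> borel_measurable borel"
        using Cc_smooth_borel[OF box_bump_Cc_smooth[OF order_refl]] .
      show "\<bar>box_bump n a b x\<bar> \<le> 1" for x using box_bump_bounds[of n a b x] by simp
    qed (rule off)
    have "(\<lambda>n. LINT x|lebesgue. box_bump n a b x *\<^sub>R f x) \<longlonglongrightarrow> (LINT x|lebesgue. indicator (box a b) x *\<^sub>R f x)"
    proof (rule integral_dominated_convergence[where w="\<lambda>x. norm (indicator (cbox a b) x *\<^sub>R f x)"])
      have "indicator (box a b) x *\<^sub>R f x = indicator (box a b) x *\<^sub>R (indicator (cbox a b) x *\<^sub>R f x)" for x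
        using box_subset_cbox[of a b] by (auto simp: indicator_def)
      then have "(\<lambda>x. indicator (box a b) x *\<^sub>R f x) = (\<lambda>x. indicator (box a b) x *\<^sub>R (indicator (cbox a b) x *\<^sub>R f x))"
        by (rule ext)
      then show "(\<lambda>x. indicator (box a b) x *\<^sub>R f x) \<in> borel_measurable lebesgue"
        using borel_measurable_scaleR[OF borel_measurable_indicator borel_measurable_integrable[OF i], of "box a b"]
        by (simp only: lmeasurable_box fmeasurableD)
      show "AE x in lebesgue. (\<lambda>n. box_bump n a b x *\<^sub>R f x) \<longlonglongrightarrow> indicator (box a b) x *\<^sub>R f x"
        by (intro AE_I2 tendsto_scaleR box_bump_tendsto tendsto_const)
      show "AE x in lebesgue. norm (box_bump n a b x *\<^sub>R f x) \<le> norm (indicator (cbox a b) x *\<^sub>R f x)" for n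
      proof (rule AE_I2)
        fix x
        show "norm (box_bump n a b x *\<^sub>R f x) \<le> norm (indicator (cbox a b) x *\<^sub>R f x)"
          using off[of x n] box_bump_bounds[of n a b x] by (cases "x \<in> cbox a b") (auto simp: mult_left_le_one_le)
      qed
    qed (use int integrable_norm[OF i] in \<open>auto simp del: norm_scaleR\<close>)
    moreover have "(LINT x|lebesgue. box_bump n a b x *\<^sub>R f x) = 0" for n
    proof -
      have "indicator S x *\<^sub>R (box_bump n a b x *\<^sub>R f x) = box_bump n a b x *\<^sub>R f x" for x
        using ab off[of x n] by (auto simp: indicator_def)
      then show ?thesis
        using z[OF box_bump_Cc_smooth[OF ab], of n] unfolding lebesgue_on_integral_eq(1)[OF S] by (simp only:)
    qed
    ultimately show ?thesis by (simp add: LIMSEQ_const_iff)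
  qed
  have cbox0: "AE x in lebesgue. x \<in> cbox c d \<longrightarrow> f x = 0" if cd: "cbox c d \<subseteq> S" for c d
  proof -
    define F where "F = (\<lambda>x. indicator (box c d) x *\<^sub>R f x)"
    have i: "integrable lebesgue (\<lambda>x. indicator (cbox c d) x *\<^sub>R f x)"
      using f cd by (auto simp: L1_loc_def set_integrable_def)
    have Feq: "F = (\<lambda>x. indicator (box c d) x *\<^sub>R (indicator (cbox c d) x *\<^sub>R f x))"
      unfolding F_def using box_subset_cbox[of c d] by (intro ext) (auto simp: subset_eq split: split_indicator)
    have Fi: "integrable lebesgue F"
      unfolding Feq by (rule integrable_mult_indicator[OF _ i]) simp
    obtain g where g: "g \<in> borel_measurable borel" "AE x in lborel. F x = g x"
      by (rule lebesgue_borel_version[OF borel_measurable_integrable[OF Fi]])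
    have gi: "integrable lborel g"
      using integrable_cong_AE_imp[OF Fi borel_imp_lebesgue_measurable[OF g(1)]] AE_completion[OF g(2)] g(1)
      by (subst (asm) integrable_completion) auto
    have ind: "(LINT x|lborel. indicator (box a b) x *\<^sub>R g x) = 0" for a b
    proof -
      have "(LINT x|lborel. indicator (box a b) x *\<^sub>R g x) = (LINT x|lebesgue. indicator (box a b) x *\<^sub>R g x)"
        by (rule integral_completion[symmetric]) (use g(1) in auto)
      also have "\<dots> = (LINT x|lebesgue. indicator (box a b) x *\<^sub>R F x)"
      proof (rule integral_cong_AE)
        show "AE x in lebesgue. indicator (box a b) x *\<^sub>R g x = indicator (box a b) x *\<^sub>R F x"
          using AE_completion[OF g(2)] by eventually_elim simp
        show "(\<lambda>x. indicator (box a b) x *\<^sub>R g x) \<in> borel_measurable lebesgue"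
          by (rule borel_imp_lebesgue_measurable) (use g(1) in measurable)
        show "(\<lambda>x. indicator (box a b) x *\<^sub>R F x) \<in> borel_measurable lebesgue"
          using Fi by (intro borel_measurable_scaleR borel_measurable_indicator) auto
      qed
      also have "(\<lambda>x. indicator (box a b) x *\<^sub>R F x) = (\<lambda>x. indicator (box a b \<inter> box c d) x *\<^sub>R f x)"
        unfolding F_def by (intro ext) (auto split: split_indicator)
      also have "(LINT x|lebesgue. indicator (box a b \<inter> box c d) x *\<^sub>R f x) = 0"
        unfolding box_Int_box
      proof (rule box0)
        have "cbox (\<Sum>i\<in>Basis. max (a \<bullet> i) (c \<bullet> i) *\<^sub>R i) (\<Sum>i\<in>Basis. min (b \<bullet> i) (d \<bullet> i) *\<^sub>R i) = cbox a b \<inter> cbox c d"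
          by (rule Int_interval[symmetric])
        then show "cbox (\<Sum>i\<in>Basis. max (a \<bullet> i) (c \<bullet> i) *\<^sub>R i) (\<Sum>i\<in>Basis. min (b \<bullet> i) (d \<bullet> i) *\<^sub>R i) \<subseteq> S"
          using cd by auto
      qed
      finally show ?thesis .
    qed
    have "(LINT x|lborel. g x) = (LINT x|lebesgue. g x)"
      by (rule integral_completion[symmetric]) (use g(1) in auto)
    also have "\<dots> = (LINT x|lebesgue. F x)"
    proof (rule integral_cong_AE[OF borel_imp_lebesgue_measurable[OF g(1)] borel_measurable_integrable[OF Fi]])
      show "AE x in lebesgue. g x = F x" using AE_completion[OF g(2)] by eventually_elim simp
    qed
    also have "\<dots> = 0" unfolding F_def by (rule box0[OF cd])
    finally have "AE x in lborel. g x = 0"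
      by (rule integral_boxes_zero_imp_AE_zero[OF gi _ ind])
    with g(2) have "AE x in lborel. F x = 0" by eventually_elim simp
    then have "AE x in lebesgue. F x = 0" by (rule AE_completion)
    \<comment> \<open>Only the open box was tested; its boundary is a null set.\<close>
    moreover have "AE x in lebesgue. x \<notin> cbox c d - box c d"
      using negligible_frontier_interval[of c d] unfolding negligible_iff_null_sets by (rule AE_not_in)
    ultimately show ?thesis by eventually_elim (auto simp: F_def)
  qed
  obtain D where D: "countable D" "\<Union>D = S" and cb: "\<And>X. X \<in> D \<Longrightarrow> \<exists>a b. X = cbox a b"
    using open_countable_Union_open_cbox[OF S] by metis
  have "AE x in lebesgue. x \<in> X \<longrightarrow> f x = 0" if "X \<in> D" for X
    using cbox0 cb[OF that] D(2) that by (metis Union_upper)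
  then have "AE x in lebesgue. \<forall>X\<in>D. x \<in> X \<longrightarrow> f x = 0"
    using AE_ball_countable[OF D(1), of "\<lambda>x X. x \<in> X \<longrightarrow> f x = 0" lebesgue] by blast
  then have "AE x in lebesgue. x \<in> S \<longrightarrow> f x = 0"
    by eventually_elim (use D(2) in auto)
  then show ?thesis by (simp add: lebesgue_on_integral_eq(4)[OF S])
qed

lemma has_weak_derivD:
  assumes "has_weak_deriv S v f g"
  shows "f \<in> L1_loc S" "g \<in> L1_loc S"
    "\<phi> \<in> Cc_smooth S \<Longrightarrow> (LINT x|lebesgue_on S. frechet_derivative \<phi> (at x) v *\<^sub>R f x) = - (LINT x|lebesgue_on S. \<phi> x *\<^sub>R g x)"
  using assms by (auto simp: has_weak_deriv_def)

text \<open>Integrals against test functions determine the weak derivative, by the fundamental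
  lemma. This ties the representative chosen by \<open>weak_deriv\<close> to any other one at
  hand.\<close>

lemma has_weak_deriv_unique:
  assumes S: "open S" and g: "has_weak_deriv S v f g" and g': "has_weak_deriv S v f' g'" and ff': "AE x in lebesgue_on S. f x = f' x"
  shows "AE x in lebesgue_on S. g x = g' x"
proof -
  have "AE x in lebesgue_on S. g x - g' x = 0"
  proof (rule fundamental_lemma[OF S L1_loc_diff[OF has_weak_derivD(2)[OF g] has_weak_derivD(2)[OF g']]])
    fix \<phi> :: "'a \<Rightarrow> real" assume \<phi>: "\<phi> \<in> Cc_smooth S"
    note d\<phi> = Cc_smooth_deriv[OF \<phi>, of v]
    have "(LINT x|lebesgue_on S. frechet_derivative \<phi> (at x) v *\<^sub>R f x) = (LINT x|lebesgue_on S. frechet_derivative \<phi> (at x) v *\<^sub>R f' x)"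
    proof (rule integral_cong_AE)
      show "(\<lambda>x. frechet_derivative \<phi> (at x) v *\<^sub>R f x) \<in> borel_measurable (lebesgue_on S)"
        using Cc_smooth_mult_integrable[OF S has_weak_derivD(1)[OF g] d\<phi>] by auto
      show "(\<lambda>x. frechet_derivative \<phi> (at x) v *\<^sub>R f' x) \<in> borel_measurable (lebesgue_on S)"
        using Cc_smooth_mult_integrable[OF S has_weak_derivD(1)[OF g'] d\<phi>] by auto
      show "AE x in lebesgue_on S. frechet_derivative \<phi> (at x) v *\<^sub>R f x = frechet_derivative \<phi> (at x) v *\<^sub>R f' x"
        using ff' by eventually_elim simp
    qed
    then show "(LINT x|lebesgue_on S. \<phi> x *\<^sub>R (g x - g' x)) = 0"
      using has_weak_derivD(3)[OF g \<phi>] has_weak_derivD(3)[OF g' \<phi>]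
        Cc_smooth_mult_integrable[OF S has_weak_derivD(2)[OF g] \<phi>] Cc_smooth_mult_integrable[OF S has_weak_derivD(2)[OF g'] \<phi>]
      by (simp add: scaleR_diff_right)
  qed
  then show ?thesis by eventually_elim simp
qed

lemma weak_deriv_works: "has_weak_deriv S v f g \<Longrightarrow> has_weak_deriv S v f (weak_deriv S v f)"
  unfolding weak_deriv_def using someI[of "has_weak_deriv S v f" g] by simp

section \<open>Mollification on convex sets\<close>

text \<open>An essential bound with a named nonnegative constant, so that estimates need not unfold
  the extended-real \<open>esssup\<close>.\<close>

definition LinfB :: "'a::euclidean_space set \<Rightarrow> ('a \<Rightarrow> complex) \<Rightarrow> real \<Rightarrow> bool" where
  "LinfB S f B \<longleftrightarrow> f \<in> borel_measurable (lebesgue_on S) \<and> B \<ge> 0 \<and> (AE x in lebesgue_on S. cmod (f x) \<le> B)"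

text \<open>The maximum with 0 gives nonnegativity without knowing that S has positive
  measure.\<close>

lemma Linf_norm_bound:
  assumes "f \<in> Linf S"
  shows "LinfB S f (max 0 (Linf_norm S f))"
proof -
  have m: "f \<in> borel_measurable (lebesgue_on S)" and fin: "esssup (lebesgue_on S) (\<lambda>x. ereal (cmod (f x))) < \<infinity>"
    using assms by (auto simp: Linf_def)
  have "AE x in lebesgue_on S. ereal (cmod (f x)) \<le> esssup (lebesgue_on S) (\<lambda>x. ereal (cmod (f x)))"
    by (rule esssup_AE)
  then have "AE x in lebesgue_on S. cmod (f x) \<le> max 0 (Linf_norm S f)"
  proof eventually_elim
    case (elim x)
    then show ?case using fin unfolding Linf_norm_def
      by (cases "esssup (lebesgue_on S) (\<lambda>x. ereal (cmod (f x)))") auto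
  qed
  with m show ?thesis by (simp add: LinfB_def)
qed

lemma LinfB_imp_Linf: "LinfB S f B \<Longrightarrow> f \<in> Linf S"
proof -
  assume f: "LinfB S f B"
  have "esssup (lebesgue_on S) (\<lambda>x. ereal (cmod (f x))) \<le> ereal B"
    using f by (intro esssup_I) (auto simp: LinfB_def)
  then show "f \<in> Linf S" using f by (auto simp: Linf_def LinfB_def intro: order_le_less_trans)
qed

lemma LinfB_integrable:
  fixes f :: "'a::euclidean_space \<Rightarrow> complex"
  assumes S: "open S" "bounded S" and f: "LinfB S f B"
  shows "integrable (lebesgue_on S) f"
proof (rule finite_measure.integrable_const_bound)
  have "S \<in> lmeasurable" using S by (simp add: bounded_set_imp_lmeasurable)
  then show "finite_measure (lebesgue_on S)" by (rule finite_measure_lebesgue_on)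
qed (use f in \<open>auto simp: LinfB_def\<close>)

lemma kernel_mult_integrable:
  fixes f :: "'a::euclidean_space \<Rightarrow> complex"
  assumes f: "integrable M f" and k: "k \<in> borel_measurable M" "\<And>y. \<bar>k y\<bar> \<le> (L::real)"
  shows "integrable M (\<lambda>y. k y *\<^sub>R f y)"
proof (rule Bochner_Integration.integrable_bound)
  show "integrable M (\<lambda>y. L *\<^sub>R f y)" using f by (rule integrable_scaleR_right)
  show "(\<lambda>y. k y *\<^sub>R f y) \<in> borel_measurable M" using k(1) f by (intro borel_measurable_scaleR) auto
  show "AE y in M. norm (k y *\<^sub>R f y) \<le> norm (L *\<^sub>R f y)"
    unfolding norm_scaleR
    by (rule AE_I2, rule mult_right_mono) (use k(2) order_trans[OF _ abs_ge_self] in auto)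
qed

text \<open>Differentiation under the integral sign. The mean value theorem bounds all difference
  quotients of the kernel by L, so L |f| dominates along every sequence tending to 0.\<close>

lemma integral_has_vector_derivative:
  fixes f :: "'a \<Rightarrow> complex" and k k' :: "real \<Rightarrow> 'a \<Rightarrow> real"
  assumes f: "integrable M f" and k: "\<And>r. k r \<in> borel_measurable M" "\<And>r y. \<bar>k r y\<bar> \<le> K"
    and d: "\<And>r y. ((\<lambda>r. k r y) has_real_derivative k' r y) (at r)" and L: "\<And>r y. \<bar>k' r y\<bar> \<le> L"
    and k'm: "k' r \<in> borel_measurable M"
  shows "((\<lambda>r. LINT y|M. k r y *\<^sub>R f y) has_vector_derivative (LINT y|M. k' r y *\<^sub>R f y)) (at r)"
proof -
  have fm: "f \<in> borel_measurable M" using f by auto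
  have ki: "integrable M (\<lambda>y. k r y *\<^sub>R f y)" for r
  proof (rule Bochner_Integration.integrable_bound)
    show "integrable M (\<lambda>y. K *\<^sub>R f y)" using f by (rule integrable_scaleR_right)
    show "(\<lambda>y. k r y *\<^sub>R f y) \<in> borel_measurable M" using k(1) fm by (intro borel_measurable_scaleR)
    show "AE y in M. norm (k r y *\<^sub>R f y) \<le> norm (K *\<^sub>R f y)"
      unfolding norm_scaleR
      by (rule AE_I2, rule mult_right_mono) (use k(2) order_trans[OF _ abs_ge_self] in auto)
  qed
  have lip: "\<bar>k (r + h) y - k r y\<bar> \<le> L * \<bar>h\<bar>" for h y
  proof -
    have "norm (k (r + h) y - k r y) \<le> L * norm ((r + h) - r)"
      by (rule field_differentiable_bound[of UNIV "\<lambda>r. k r y" "\<lambda>r. k' r y"]) (use d L in auto)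
    then show ?thesis by simp
  qed
  have "((\<lambda>h. (1 / h) *\<^sub>R ((LINT y|M. k (r + h) y *\<^sub>R f y) - (LINT y|M. k r y *\<^sub>R f y))) \<longlongrightarrow> (LINT y|M. k' r y *\<^sub>R f y)) (at 0)"
    unfolding tendsto_at_iff_sequentially comp_def
  proof (intro allI impI)
    fix X :: "nat \<Rightarrow> real" assume X: "\<forall>i. X i \<in> UNIV - {0}" "X \<longlonglongrightarrow> 0"
    have eq: "(1 / X i) *\<^sub>R ((LINT y|M. k (r + X i) y *\<^sub>R f y) - (LINT y|M. k r y *\<^sub>R f y))
       = (LINT y|M. ((k (r + X i) y - k r y) / X i) *\<^sub>R f y)" for i
    proof -
      have "(LINT y|M. ((k (r + X i) y - k r y) / X i) *\<^sub>R f y) = (LINT y|M. (1 / X i) *\<^sub>R (k (r + X i) y *\<^sub>R f y - k r y *\<^sub>R f y))"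
        by (simp add: scaleR_diff_left[symmetric])
      also have "\<dots> = (1 / X i) *\<^sub>R (LINT y|M. k (r + X i) y *\<^sub>R f y - k r y *\<^sub>R f y)" by (rule integral_scaleR_right)
      also have "(LINT y|M. k (r + X i) y *\<^sub>R f y - k r y *\<^sub>R f y) = (LINT y|M. k (r + X i) y *\<^sub>R f y) - (LINT y|M. k r y *\<^sub>R f y)"
        by (rule Bochner_Integration.integral_diff[OF ki ki])
      finally show ?thesis by simp
    qed
    show "(\<lambda>i. (1 / X i) *\<^sub>R ((LINT y|M. k (r + X i) y *\<^sub>R f y) - (LINT y|M. k r y *\<^sub>R f y))) \<longlonglongrightarrow> (LINT y|M. k' r y *\<^sub>R f y)"
      unfolding eq
    proof (rule integral_dominated_convergence[where w="\<lambda>y. L * cmod (f y)"])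
      show "(\<lambda>y. k' r y *\<^sub>R f y) \<in> borel_measurable M" using k'm fm by (intro borel_measurable_scaleR)
      show "(\<lambda>y. ((k (r + X i) y - k r y) / X i) *\<^sub>R f y) \<in> borel_measurable M" for i
        using k(1) fm by (intro borel_measurable_scaleR borel_measurable_divide borel_measurable_diff) auto
      show "integrable M (\<lambda>y. L * cmod (f y))" using f by simp
      show "AE y in M. (\<lambda>i. ((k (r + X i) y - k r y) / X i) *\<^sub>R f y) \<longlonglongrightarrow> k' r y *\<^sub>R f y"
      proof (rule AE_I2)
        fix y
        have "((\<lambda>h. (k (r + h) y - k r y) / h) \<longlongrightarrow> k' r y) (at 0)"
          using d[of y r] by (simp add: DERIV_def)
        then have "(\<lambda>i. (k (r + X i) y - k r y) / X i) \<longlonglongrightarrow> k' r y"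
          using X unfolding tendsto_at_iff_sequentially comp_def by blast
        then show "(\<lambda>i. ((k (r + X i) y - k r y) / X i) *\<^sub>R f y) \<longlonglongrightarrow> k' r y *\<^sub>R f y"
          by (intro tendsto_scaleR tendsto_const)
      qed
      show "AE y in M. norm (((k (r + X i) y - k r y) / X i) *\<^sub>R f y) \<le> L * cmod (f y)" for i
      proof (rule AE_I2)
        fix y
        have "\<bar>(k (r + X i) y - k r y) / X i\<bar> \<le> L"
          using lip[of "X i" y] X(1) by (simp add: divide_le_eq)
        then show "norm (((k (r + X i) y - k r y) / X i) *\<^sub>R f y) \<le> L * cmod (f y)"
          unfolding norm_scaleR by (rule mult_right_mono) simp
      qed
    qed
  qed
  then have lim: "((\<lambda>h. norm ((1 / h) *\<^sub>R ((LINT y|M. k (r + h) y *\<^sub>R f y) - (LINT y|M. k r y *\<^sub>R f y)) - (LINT y|M. k' r y *\<^sub>R f y))) \<longlongrightarrow> 0) (at 0)"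
    by (simp only: tendsto_norm_zero_iff LIM_zero_iff)
  have "((\<lambda>h. norm ((LINT y|M. k (r + h) y *\<^sub>R f y) - (LINT y|M. k r y *\<^sub>R f y) - h *\<^sub>R (LINT y|M. k' r y *\<^sub>R f y)) / norm h) \<longlongrightarrow> 0) (at 0)"
  proof (rule Lim_transform_eventually[OF lim])
    have eq: "norm ((1 / h) *\<^sub>R A - D) = norm (A - h *\<^sub>R D) / norm h" if "h \<noteq> 0" for h :: real and A D :: complex
    proof -
      have "(1 / h) *\<^sub>R A - D = (1 / h) *\<^sub>R (A - h *\<^sub>R D)" using that by (simp add: scaleR_diff_right)
      then show ?thesis by (simp add: divide_inverse mult.commute)
    qed
    show "\<forall>\<^sub>F h in at 0. norm ((1 / h) *\<^sub>R ((LINT y|M. k (r + h) y *\<^sub>R f y) - (LINT y|M. k r y *\<^sub>R f y)) - (LINT y|M. k' r y *\<^sub>R f y))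
       = norm ((LINT y|M. k (r + h) y *\<^sub>R f y) - (LINT y|M. k r y *\<^sub>R f y) - h *\<^sub>R (LINT y|M. k' r y *\<^sub>R f y)) / norm h"
      unfolding eventually_at_filter by (rule eventuallyI) (use eq in blast)
  qed
  then show ?thesis
    unfolding has_vector_derivative_def has_derivative_at by (simp only: bounded_linear_scaleR_left simp_thms)
qed

lemma lborel_integral_affine:
  fixes g :: "'a::euclidean_space \<Rightarrow> 'b::{banach, second_countable_topology}"
  assumes [measurable]: "g \<in> borel_measurable borel" and c: "c \<noteq> 0"
  shows "integral\<^sup>L lborel g = \<bar>c\<bar> ^ DIM('a) *\<^sub>R (LINT x|lborel. g (t + c *\<^sub>R x))"
proof -
  have "integral\<^sup>L lborel g = integral\<^sup>L (density (distr lborel borel (\<lambda>x. t + c *\<^sub>R x)) (\<lambda>_. ennreal (\<bar>c\<bar> ^ DIM('a)))) g"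
    using lborel_affine[OF c, of t] by simp
  also have "\<dots> = (LINT x|distr lborel borel (\<lambda>x. t + c *\<^sub>R x). \<bar>c\<bar> ^ DIM('a) *\<^sub>R g x)"
    by (subst integral_density) auto
  also have "\<dots> = (LINT x|lborel. \<bar>c\<bar> ^ DIM('a) *\<^sub>R g (t + c *\<^sub>R x))"
    by (subst integral_distr) auto
  finally show ?thesis by simp
qed

text \<open>The profile \<rho> has its support inside S itself and not around the origin: it marks
  the points towards which the arguments are pulled.\<close>

locale mollifier =
  fixes S :: "'a::euclidean_space set" and \<rho> :: "'a \<Rightarrow> real"
  assumes open_S: "open S" and convex_S: "convex S" and bounded_S: "bounded S"
    and \<rho>: "\<rho> \<in> Cc_smooth S" and \<rho>_nonneg: "\<And>x. \<rho> x \<ge> 0" and \<rho>_int: "(LINT x|lborel. \<rho> x) = 1"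
begin

text \<open>Averaging over \<open>(1 - \<delta>) p + \<delta> z\<close>, \<open>z\<close> in the support of \<open>\<rho>\<close>: by convexity these points stay inside \<open>S\<close>
  even for \<open>p\<close> on the boundary.\<close>

definition ker :: "real \<Rightarrow> 'a \<Rightarrow> 'a \<Rightarrow> real" where
  "ker \<delta> p y = \<rho> ((1/\<delta>) *\<^sub>R (y - (1 - \<delta>) *\<^sub>R p)) / \<delta> ^ DIM('a)"

definition mol :: "real \<Rightarrow> ('a \<Rightarrow> complex) \<Rightarrow> 'a \<Rightarrow> complex" where
  "mol \<delta> f p = (LINT y|lebesgue_on S. ker \<delta> p y *\<^sub>R f y)"

lemma ker_nonneg: "\<delta> > 0 \<Longrightarrow> ker \<delta> p y \<ge> 0"
  by (simp add: ker_def \<rho>_nonneg)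

lemma \<rho>_borel[measurable]: "\<rho> \<in> borel_measurable borel"
  by (rule Cc_smooth_borel[OF \<rho>])

lemma ker_measurable[measurable]: "(\<lambda>q. ker \<delta> (fst q) (snd q)) \<in> borel_measurable (borel \<Otimes>\<^sub>M borel)"
  unfolding ker_def by measurable

lemma ker_borel: "ker \<delta> p \<in> borel_measurable borel"
  unfolding ker_def by measurable

lemma ker_lebesgue: "ker \<delta> p \<in> borel_measurable (lebesgue_on S)"
  by (rule measurable_restrict_space1[OF borel_imp_lebesgue_measurable]) (rule ker_borel)

lemma ker_bound:
  assumes "\<delta> > 0"
  obtains B where "B > 0" "\<And>p y. \<bar>ker \<delta> p y\<bar> \<le> B"
proof -
  obtain B where B: "B > 0" "\<And>x. \<bar>\<rho> x\<bar> \<le> B" by (rule Cc_smooth_bounded[OF \<rho>]) auto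
  show thesis
  proof
    show "B / \<delta> ^ DIM('a) > 0" using B assms by simp
    show "\<bar>ker \<delta> p y\<bar> \<le> B / \<delta> ^ DIM('a)" for p y
      using B(2) assms by (auto simp: ker_def abs_divide intro!: divide_right_mono)
  qed
qed

lemma shrink_in_S:
  assumes "p \<in> closure S" "z \<in> S" "0 < \<delta>" "\<delta> \<le> 1"
  shows "(1 - \<delta>) *\<^sub>R p + \<delta> *\<^sub>R z \<in> S"
proof -
  have "p - \<delta> *\<^sub>R (p - z) \<in> interior S"
    using assms open_S by (intro mem_interior_closure_convex_shrink convex_S) (auto simp: interior_open)
  then show ?thesis using open_S by (simp add: interior_open algebra_simps)
qed

lemma ker_Cc_smooth:
  assumes p: "p \<in> closure S" and \<delta>: "0 < \<delta>" "\<delta> \<le> 1"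
  shows "ker \<delta> p \<in> Cc_smooth S"
proof -
  obtain C where C: "compact C" "C \<subseteq> S" "\<And>x. x \<notin> C \<Longrightarrow> \<rho> x = 0"
    by (rule Cc_smooth_supportE[OF \<rho>]) blast
  let ?C = "(\<lambda>z. (1 - \<delta>) *\<^sub>R p + \<delta> *\<^sub>R z) ` C"
  show ?thesis
  proof (rule Cc_smooth_supportI)
    have L: "bounded_linear (\<lambda>y. (1/\<delta>) *\<^sub>R y)" by (rule bounded_linear_scaleR_right)
    have "times_cont_diff k (\<lambda>y. (1 / \<delta> ^ DIM('a)) *\<^sub>R \<rho> ((1/\<delta>) *\<^sub>R y + (- ((1/\<delta>) *\<^sub>R ((1 - \<delta>) *\<^sub>R p)))))" for k
      by (intro times_cont_diff_scaleR times_cont_diff_const times_cont_diff_compose_affine[OF L] Cc_smoothD(1)[OF \<rho>])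
    then show "times_cont_diff k (ker \<delta> p)" for k
      by (simp add: ker_def[abs_def] scaleR_diff_right)
    show "compact ?C" using C(1) by (intro compact_continuous_image continuous_intros)
    show "?C \<subseteq> S" using shrink_in_S[OF p _ \<delta>] C(2) by auto
    show "ker \<delta> p y = 0" if y: "y \<notin> ?C" for y
    proof -
      have "(1/\<delta>) *\<^sub>R (y - (1 - \<delta>) *\<^sub>R p) \<notin> C"
      proof
        assume a: "(1/\<delta>) *\<^sub>R (y - (1 - \<delta>) *\<^sub>R p) \<in> C"
        have "y = (1 - \<delta>) *\<^sub>R p + \<delta> *\<^sub>R ((1/\<delta>) *\<^sub>R (y - (1 - \<delta>) *\<^sub>R p))" using \<delta> by simp
        then show False using a y by blast
      qed
      then show ?thesis using C(3) by (simp add: ker_def)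
    qed
  qed
qed

lemma ker_integral_y:
  assumes \<delta>: "0 < \<delta>"
  shows "(LINT y|lborel. ker \<delta> p y) = 1"
proof -
  have "(LINT y|lborel. ker \<delta> p y) = \<bar>\<delta>\<bar> ^ DIM('a) *\<^sub>R (LINT z|lborel. ker \<delta> p ((1 - \<delta>) *\<^sub>R p + \<delta> *\<^sub>R z))"
    by (rule lborel_integral_affine[OF ker_borel]) (use \<delta> in simp)
  also have "(\<lambda>z. ker \<delta> p ((1 - \<delta>) *\<^sub>R p + \<delta> *\<^sub>R z)) = (\<lambda>z. \<rho> z / \<delta> ^ DIM('a))"
    using \<delta> by (simp add: ker_def)
  finally show ?thesis using \<delta> \<rho>_int by simp
qed

text \<open>The kernel keeps its full mass on S even for p on the boundary, because its support lies
  in S.\<close>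

lemma ker_integral_S:
  assumes p: "p \<in> closure S" and \<delta>: "0 < \<delta>" "\<delta> \<le> 1"
  shows "(LINT y|lebesgue_on S. ker \<delta> p y) = 1" "integrable (lebesgue_on S) (ker \<delta> p)"
proof -
  have "indicator S y *\<^sub>R ker \<delta> p y = ker \<delta> p y" for y
    using Cc_smoothD(5)[OF ker_Cc_smooth[OF p \<delta>], of y] by (auto simp: indicator_def)
  then have "(LINT y|lebesgue_on S. ker \<delta> p y) = (LINT y|lebesgue. ker \<delta> p y)"
    unfolding lebesgue_on_integral_eq(1)[OF open_S] by (simp only:)
  also have "\<dots> = (LINT y|lborel. ker \<delta> p y)" by (rule integral_completion) (simp add: ker_borel)
  finally show 1: "(LINT y|lebesgue_on S. ker \<delta> p y) = 1" using ker_integral_y[OF \<delta>(1)] by simp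
  show "integrable (lebesgue_on S) (ker \<delta> p)"
  proof (rule ccontr)
    assume "\<not> ?thesis"
    then show False using 1 by (simp add: not_integrable_integral_eq)
  qed
qed

lemma mol_cong_AE:
  assumes "f \<in> borel_measurable (lebesgue_on S)" "g \<in> borel_measurable (lebesgue_on S)" "AE x in lebesgue_on S. f x = g x"
  shows "mol \<delta> f p = mol \<delta> g p"
  unfolding mol_def
proof (rule integral_cong_AE)
  show "AE x in lebesgue_on S. ker \<delta> p x *\<^sub>R f x = ker \<delta> p x *\<^sub>R g x"
    using assms(3) by eventually_elim simp
qed (use ker_lebesgue assms in \<open>auto intro!: borel_measurable_scaleR\<close>)

lemma mol_integrand_integrable:
  assumes "LinfB S f B" "0 < \<delta>"
  shows "integrable (lebesgue_on S) (\<lambda>y. ker \<delta> p y *\<^sub>R f y)"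
proof -
  obtain L where L: "\<And>p y. \<bar>ker \<delta> p y\<bar> \<le> L" by (rule ker_bound[OF assms(2)]) blast
  show ?thesis
    by (rule kernel_mult_integrable[OF LinfB_integrable[OF open_S bounded_S assms(1)] ker_lebesgue L])
qed

text \<open>An average differs from c by no more than the integrand does where the kernel lives.
  With c = 0 this preserves essential bounds; with c = f p it gives uniform convergence.\<close>

lemma mol_diff_bound:
  assumes f: "LinfB S f B" and p: "p \<in> closure S" and \<delta>: "0 < \<delta>" "\<delta> \<le> 1"
    and e: "AE y in lebesgue_on S. ker \<delta> p y \<noteq> 0 \<longrightarrow> cmod (f y - c) \<le> e"
  shows "cmod (mol \<delta> f p - c) \<le> e"
proof -
  note i = ker_integral_S[OF p \<delta>]
  note fi = mol_integrand_integrable[OF f \<delta>(1), of p]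
  have ci: "integrable (lebesgue_on S) (\<lambda>y. ker \<delta> p y *\<^sub>R c)" using i(2) by simp
  have "c = (LINT y|lebesgue_on S. ker \<delta> p y *\<^sub>R c)" using i by simp
  then have "mol \<delta> f p - c = (LINT y|lebesgue_on S. ker \<delta> p y *\<^sub>R f y - ker \<delta> p y *\<^sub>R c)"
    unfolding mol_def using Bochner_Integration.integral_diff[OF fi ci] by simp
  also have "cmod \<dots> \<le> (LINT y|lebesgue_on S. cmod (ker \<delta> p y *\<^sub>R f y - ker \<delta> p y *\<^sub>R c))"
    by (rule integral_norm_bound)
  also have "\<dots> \<le> (LINT y|lebesgue_on S. e * ker \<delta> p y)"
  proof (rule integral_mono_AE)
    show "AE y in lebesgue_on S. cmod (ker \<delta> p y *\<^sub>R f y - ker \<delta> p y *\<^sub>R c) \<le> e * ker \<delta> p y"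
      using e
    proof eventually_elim
      case (elim y)
      then show ?case using ker_nonneg[OF \<delta>(1), of p y]
        by (cases "ker \<delta> p y = 0") (auto simp: scaleR_diff_right[symmetric] mult.commute[of e] mult_left_mono)
    qed
  qed (use fi ci i(2) in auto)
  also have "\<dots> = e" using i by simp
  finally show ?thesis .
qed

lemma mol_bound:
  assumes f: "LinfB S f B" and p: "p \<in> closure S" and \<delta>: "0 < \<delta>" "\<delta> \<le> 1"
  shows "cmod (mol \<delta> f p) \<le> B"
proof -
  have "AE y in lebesgue_on S. ker \<delta> p y \<noteq> 0 \<longrightarrow> cmod (f y - 0) \<le> B"
    using f by (auto simp: LinfB_def)
  from mol_diff_bound[OF f p \<delta> this] show ?thesis by simp
qed

text \<open>The averaged points are y = p + \<delta> (z - p) with z in the support of \<rho>, so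
  their distance to p is at most 2 \<delta> R if R bounds the norm on the closure.\<close>

lemma ker_near:
  obtains D where "D > 0" "\<And>\<delta> p y. 0 < \<delta> \<Longrightarrow> p \<in> closure S \<Longrightarrow> ker \<delta> p y \<noteq> 0 \<Longrightarrow> dist y p \<le> \<delta> * D"
proof -
  have "bounded (closure S)" by (rule bounded_closure[OF bounded_S])
  then obtain R where R: "R > 0" "\<And>x. x \<in> closure S \<Longrightarrow> norm x \<le> R" by (auto simp: bounded_pos)
  have "dist y p \<le> \<delta> * (2 * R)" if "0 < \<delta>" "p \<in> closure S" "ker \<delta> p y \<noteq> 0" for \<delta> p y
  proof -
    define z where "z = (1/\<delta>) *\<^sub>R (y - (1 - \<delta>) *\<^sub>R p)"
    have "\<rho> z \<noteq> 0" using that by (simp add: ker_def z_def)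
    then have z: "z \<in> closure S" using Cc_smoothD(5)[OF \<rho>, of z] closure_subset by auto
    have "y - p = \<delta> *\<^sub>R (z - p)" using that(1) by (simp add: z_def algebra_simps)
    then have "dist y p = \<delta> * norm (z - p)" using that(1) by (simp add: dist_norm)
    also have "\<dots> \<le> \<delta> * (2 * R)"
      using norm_triangle_ineq4[of z p] R(2)[OF z] R(2)[OF that(2)] that(1) by (intro mult_left_mono) auto
    finally show ?thesis .
  qed
  then show thesis using that[of "2 * R"] R(1) by simp
qed

text \<open>Convergence is uniform up to the closure, by uniform continuity on a compact set. This
  reaches the diagonal, which belongs to the boundary of both triangles.\<close>

lemma mol_uniform_limit:
  assumes f: "continuous_on (closure S) f" and fB: "LinfB S f B" and e: "e > 0"
  obtains d where "d > 0" "\<And>\<delta> p. 0 < \<delta> \<Longrightarrow> \<delta> \<le> 1 \<Longrightarrow> \<delta> < d \<Longrightarrow> p \<in> closure S \<Longrightarrow> cmod (mol \<delta> f p - f p) \<le> e"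
proof -
  obtain D where D: "D > 0" "\<And>\<delta> p y. 0 < \<delta> \<Longrightarrow> p \<in> closure S \<Longrightarrow> ker \<delta> p y \<noteq> 0 \<Longrightarrow> dist y p \<le> \<delta> * D"
    by (rule ker_near) blast
  have "uniformly_continuous_on (closure S) f"
    using bounded_S by (intro compact_uniformly_continuous[OF f]) (simp add: compact_closure)
  then obtain h where h: "h > 0" "\<And>x y. x \<in> closure S \<Longrightarrow> y \<in> closure S \<Longrightarrow> dist y x < h \<Longrightarrow> dist (f y) (f x) < e"
    using e unfolding uniformly_continuous_on_def by metis
  show thesis
  proof (rule that[of "h / D"])
    show "h / D > 0" using h D by simp
    fix \<delta> p assume a: "0 < \<delta>" "\<delta> \<le> 1" "\<delta> < h / D" "p \<in> closure S"
    show "cmod (mol \<delta> f p - f p) \<le> e"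
    proof (rule mol_diff_bound[OF fB a(4) a(1,2)], unfold lebesgue_on_integral_eq(4)[OF open_S], rule AE_I2, intro impI)
      fix y assume y: "y \<in> S" "ker \<delta> p y \<noteq> 0"
      have "dist y p \<le> \<delta> * D" by (rule D(2)[OF a(1,4) y(2)])
      also have "\<dots> < h" using a(3) D(1) by (simp add: pos_less_divide_eq)
      finally have "dist (f y) (f p) < e" using a(4) y(1) closure_subset by (intro h(2)) auto
      then show "cmod (f y - f p) \<le> e" by (simp add: dist_norm)
    qed
  qed
qed

text \<open>The kernel depends on y - (1 - \<delta>) p, so differentiating in p is -(1 - \<delta>)
  times differentiating in y, and as a function of y the kernel is a test function on S. The weak
  derivative of f thus becomes a classical one of its mollification at every point of the closure,
  with the factor 1 - \<delta>.\<close>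

lemma mol_has_derivative:
  assumes w: "has_weak_deriv S w f g" and f: "LinfB S f B" and \<delta>: "0 < \<delta>" "\<delta> \<le> 1" and pr: "p + r *\<^sub>R w \<in> closure S"
  shows "((\<lambda>r. mol \<delta> f (p + r *\<^sub>R w)) has_vector_derivative (1 - \<delta>) *\<^sub>R mol \<delta> g (p + r *\<^sub>R w)) (at r)"
proof -
  define n where "n = DIM('a)"
  define z where "z r y = (1/\<delta>) *\<^sub>R (y - (1 - \<delta>) *\<^sub>R (p + r *\<^sub>R w))" for r y
  define k' where "k' r y = frechet_derivative \<rho> (at (z r y)) (- ((1 - \<delta>) / \<delta>) *\<^sub>R w) / \<delta> ^ n" for r y
  let ?k = "\<lambda>r. ker \<delta> (p + r *\<^sub>R w)"
  obtain K where K: "\<And>p y. \<bar>ker \<delta> p y\<bar> \<le> K" by (rule ker_bound[OF \<delta>(1)]) blast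
  note d\<rho> = Cc_smooth_deriv[OF \<rho>, of "- ((1 - \<delta>) / \<delta>) *\<^sub>R w"]
  obtain L0 where L0: "\<And>x. \<bar>frechet_derivative \<rho> (at x) (- ((1 - \<delta>) / \<delta>) *\<^sub>R w)\<bar> \<le> L0"
    by (rule Cc_smooth_bounded[OF d\<rho>]) auto
  have d: "((\<lambda>r. ?k r y) has_real_derivative k' r y) (at r)" for r y
  proof -
    have "((\<lambda>r. z r y) has_derivative (\<lambda>h. h *\<^sub>R (- ((1 - \<delta>) / \<delta>) *\<^sub>R w))) (at r)"
    proof -
      have z: "z r y = (1/\<delta>) *\<^sub>R (y - (1 - \<delta>) *\<^sub>R p) + r *\<^sub>R (- ((1 - \<delta>) / \<delta>) *\<^sub>R w)" for r
        by (simp add: z_def scaleR_diff_right scaleR_add_right divide_inverse mult_ac)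
      show ?thesis
        unfolding z using \<delta>(1) by (auto intro!: derivative_eq_intros)
    qed
    from has_derivative_compose[OF this Cc_smoothD(4)[OF \<rho>]]
    have "((\<lambda>r. \<rho> (z r y)) has_derivative (\<lambda>h. frechet_derivative \<rho> (at (z r y)) (h *\<^sub>R (- ((1 - \<delta>) / \<delta>) *\<^sub>R w)))) (at r)" .
    moreover have "frechet_derivative \<rho> (at (z r y)) (h *\<^sub>R (- ((1 - \<delta>) / \<delta>) *\<^sub>R w)) = frechet_derivative \<rho> (at (z r y)) (- ((1 - \<delta>) / \<delta>) *\<^sub>R w) * h" for h
      using linear_scale[OF has_derivative_linear[OF Cc_smoothD(4)[OF \<rho>]], of "z r y" h "- ((1 - \<delta>) / \<delta>) *\<^sub>R w"]
      by (simp only: real_scaleR_def mult.commute)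
    ultimately have "((\<lambda>r. \<rho> (z r y)) has_real_derivative frechet_derivative \<rho> (at (z r y)) (- ((1 - \<delta>) / \<delta>) *\<^sub>R w)) (at r)"
      unfolding has_field_derivative_def by simp
    from DERIV_cdivide[OF this, of "\<delta> ^ n"] show ?thesis
      by (simp only: ker_def z_def k'_def n_def)
  qed
  have "((\<lambda>r. LINT y|lebesgue_on S. ?k r y *\<^sub>R f y) has_vector_derivative (LINT y|lebesgue_on S. k' r y *\<^sub>R f y)) (at r)"
  proof (rule integral_has_vector_derivative[OF LinfB_integrable[OF open_S bounded_S f] ker_lebesgue K d])
    show "\<bar>k' r y\<bar> \<le> L0 / \<delta> ^ n" for r y
      using L0 \<delta>(1) by (auto simp: k'_def abs_divide intro!: divide_right_mono)
    have "k' r \<in> borel_measurable borel"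
    proof -
      have [measurable]: "(\<lambda>x. frechet_derivative \<rho> (at x) (- ((1 - \<delta>) / \<delta>) *\<^sub>R w)) \<in> borel_measurable borel"
        by (rule Cc_smooth_borel[OF d\<rho>])
      show ?thesis unfolding k'_def z_def by measurable
    qed
    then show "k' r \<in> borel_measurable (lebesgue_on S)"
      by (rule measurable_restrict_space1[OF borel_imp_lebesgue_measurable])
  qed
  moreover have "(LINT y|lebesgue_on S. k' r y *\<^sub>R f y) = (1 - \<delta>) *\<^sub>R mol \<delta> g (p + r *\<^sub>R w)"
  proof -
    have fd: "frechet_derivative (?k r) (at y) w = frechet_derivative \<rho> (at (z r y)) ((1 / \<delta>) *\<^sub>R w) / \<delta> ^ n" for y
    proof -
      have "((\<lambda>y. z r y) has_derivative (\<lambda>h. (1/\<delta>) *\<^sub>R h)) (at y)"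
        unfolding z_def by (auto intro!: derivative_eq_intros)
      from has_derivative_compose[OF this Cc_smoothD(4)[OF \<rho>]]
      have "((\<lambda>y. \<rho> (z r y) * (1 / \<delta> ^ n)) has_derivative (\<lambda>h. frechet_derivative \<rho> (at (z r y)) ((1/\<delta>) *\<^sub>R h) * (1 / \<delta> ^ n))) (at y)"
        by (rule has_derivative_mult_left)
      moreover have "(\<lambda>y. \<rho> (z r y) * (1 / \<delta> ^ n)) = ?k r"
        by (simp add: fun_eq_iff ker_def z_def n_def)
      ultimately show ?thesis by (simp add: frechet_derivative_eqI)
    qed
    \<comment> \<open>Chain rule in both variables: the argument of \<rho> contains p with the
      factor -(1 - \<delta>) / \<delta> and y with the factor 1 / \<delta>.\<close>
    have "k' r y = - (1 - \<delta>) * frechet_derivative (?k r) (at y) w" for y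
    proof -
      note lin = has_derivative_linear[OF Cc_smoothD(4)[OF \<rho>, of "z r y"]]
      show ?thesis unfolding fd k'_def
        using linear_scale[OF lin, of "- ((1 - \<delta>) / \<delta>)" w] linear_scale[OF lin, of "1 / \<delta>" w]
        by (simp add: minus_divide_left minus_mult_left)
    qed
    then have "(LINT y|lebesgue_on S. k' r y *\<^sub>R f y) = (LINT y|lebesgue_on S. (- (1 - \<delta>)) *\<^sub>R (frechet_derivative (?k r) (at y) w *\<^sub>R f y))"
      by (simp only: scaleR_scaleR)
    also have "\<dots> = (- (1 - \<delta>)) *\<^sub>R (LINT y|lebesgue_on S. frechet_derivative (?k r) (at y) w *\<^sub>R f y)"
      by (rule integral_scaleR_right)
    also have "(LINT y|lebesgue_on S. frechet_derivative (?k r) (at y) w *\<^sub>R f y) = - mol \<delta> g (p + r *\<^sub>R w)"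
      unfolding mol_def by (rule has_weak_derivD(3)[OF w ker_Cc_smooth[OF pr \<delta>]])
    finally show ?thesis by (simp add: scaleR_diff_left)
  qed
  ultimately show ?thesis by (simp add: mol_def)
qed

text \<open>Continuity holds on the whole space, also where the kernel no longer has its support in
  S, so that Borel measurability and the fundamental theorem can be used without reference to
  S.\<close>

lemma mol_continuous:
  assumes f: "LinfB S f B" and \<delta>: "0 < \<delta>"
  shows "continuous_on UNIV (mol \<delta> f)"
proof -
  obtain K where K: "\<And>p y. \<bar>ker \<delta> p y\<bar> \<le> K" by (rule ker_bound[OF \<delta>]) blast
  note fi = LinfB_integrable[OF open_S bounded_S f]
  have "continuous (at p) (mol \<delta> f)" for p
    unfolding continuous_at_sequentially comp_def
  proof (intro allI impI)
    fix X assume X: "X \<longlonglongrightarrow> p"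
    show "(\<lambda>n. mol \<delta> f (X n)) \<longlonglongrightarrow> mol \<delta> f p"
      unfolding mol_def
    proof (rule integral_dominated_convergence[where w="\<lambda>y. K * cmod (f y)"])
      show "AE y in lebesgue_on S. (\<lambda>n. ker \<delta> (X n) y *\<^sub>R f y) \<longlonglongrightarrow> ker \<delta> p y *\<^sub>R f y"
      proof (rule AE_I2)
        fix y
        have "isCont \<rho> x" for x using Cc_smoothD(2)[OF \<rho>] by (simp add: continuous_on_eq_continuous_at)
        then have "(\<lambda>n. \<rho> ((1/\<delta>) *\<^sub>R (y - (1 - \<delta>) *\<^sub>R X n))) \<longlonglongrightarrow> \<rho> ((1/\<delta>) *\<^sub>R (y - (1 - \<delta>) *\<^sub>R p))"
          by (rule isCont_tendsto_compose) (intro tendsto_intros X)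
        then show "(\<lambda>n. ker \<delta> (X n) y *\<^sub>R f y) \<longlonglongrightarrow> ker \<delta> p y *\<^sub>R f y"
          unfolding ker_def using \<delta> by (intro tendsto_intros) auto
      qed
      show "AE y in lebesgue_on S. norm (ker \<delta> (X n) y *\<^sub>R f y) \<le> K * cmod (f y)" for n
        unfolding norm_scaleR by (rule AE_I2, rule mult_right_mono) (use K in auto)
      show "(\<lambda>y. ker \<delta> p y *\<^sub>R f y) \<in> borel_measurable (lebesgue_on S)" "(\<lambda>y. ker \<delta> (X n) y *\<^sub>R f y) \<in> borel_measurable (lebesgue_on S)" for n
        using ker_lebesgue fi by (auto intro!: borel_measurable_scaleR)
    qed (use fi in simp)
  qed
  then show ?thesis by (simp add: continuous_on_eq_continuous_at)
qed

text \<open>By Fubini the averaging is moved onto the test function: J is the integral of \<phi>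
  against the kernel in p. It converges to \<phi> pointwise and boundedly, so f itself enters only
  through its integrability.\<close>

lemma mol_weak_limit:
  assumes f: "LinfB S f B" and \<phi>: "\<phi> \<in> Cc_smooth S"
    and \<delta>: "\<And>n. 0 < \<delta> n" "\<And>n. \<delta> n < 1" "\<delta> \<longlonglongrightarrow> 0"
  shows "(\<lambda>n. LINT p|lebesgue_on S. \<phi> p *\<^sub>R mol (\<delta> n) f p) \<longlonglongrightarrow> (LINT y|lebesgue_on S. (\<phi> y :: real) *\<^sub>R f y)"
proof -
  define f0 where "f0 = (\<lambda>x. indicator S x *\<^sub>R f x)"
  have fi: "integrable lebesgue f0"
    using LinfB_integrable[OF open_S bounded_S f] unfolding lebesgue_on_integral_eq(2)[OF open_S] f0_def .
  obtain g where g[measurable]: "g \<in> borel_measurable borel" and fg: "AE x in lborel. f0 x = g x"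
    by (rule lebesgue_borel_version[OF borel_measurable_integrable[OF fi]])
  have gi: "integrable lborel g"
    using integrable_cong_AE_imp[OF fi borel_imp_lebesgue_measurable[OF g]] AE_completion[OF fg] g
    by (subst (asm) integrable_completion) auto
  have [measurable]: "\<phi> \<in> borel_measurable borel" by (rule Cc_smooth_borel[OF \<phi>])
  obtain B\<phi> where B\<phi>: "B\<phi> > 0" "\<And>x. \<bar>\<phi> x\<bar> \<le> B\<phi>" by (rule Cc_smooth_bounded[OF \<phi>]) auto
  \<comment> \<open>Passage from Lebesgue integrals over S to Borel integrals over the whole space,
    where Fubini applies.\<close>
  have transfer: "(LINT y|lebesgue_on S. k y *\<^sub>R f y) = (LINT y|lborel. k y *\<^sub>R g y)" if [measurable]: "k \<in> borel_measurable borel" for k :: "'a \<Rightarrow> real"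
  proof -
    have "(LINT y|lebesgue_on S. k y *\<^sub>R f y) = (LINT y|lebesgue. k y *\<^sub>R f0 y)"
      unfolding lebesgue_on_integral_eq(1)[OF open_S] f0_def by (simp only: scaleR_scaleR mult.commute)
    also have "\<dots> = (LINT y|lebesgue. k y *\<^sub>R g y)"
    proof (rule integral_cong_AE)
      show "AE y in lebesgue. k y *\<^sub>R f0 y = k y *\<^sub>R g y"
        using AE_completion[OF fg] by eventually_elim simp
      show "(\<lambda>y. k y *\<^sub>R f0 y) \<in> borel_measurable lebesgue"
        by (rule borel_measurable_scaleR[OF borel_imp_lebesgue_measurable[OF that] borel_measurable_integrable[OF fi]])
      show "(\<lambda>y. k y *\<^sub>R g y) \<in> borel_measurable lebesgue"
        by (rule borel_imp_lebesgue_measurable) measurable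
    qed
    also have "\<dots> = (LINT y|lborel. k y *\<^sub>R g y)" by (rule integral_completion) measurable
    finally show ?thesis .
  qed
  have kb: "ker d p \<in> borel_measurable borel" for d p by (rule ker_borel)
  have molg: "mol d f p = (LINT y|lborel. ker d p y *\<^sub>R g y)" for d p
    unfolding mol_def by (rule transfer[OF kb])
  define J where "J d y = (LINT p|lborel. \<phi> p * ker d p y)" for d y
  have \<phi>i: "integrable lborel \<phi>"
  proof -
    have "integrable (lebesgue_on S) (\<lambda>x. \<phi> x *\<^sub>R (1::complex))"
      by (rule Cc_smooth_mult_integrable[OF open_S _ \<phi>]) (auto simp: L1_loc_def absolutely_integrable_on_const lmeasurable_compact)
    then have "integrable lebesgue (\<lambda>x. indicator S x *\<^sub>R (\<phi> x *\<^sub>R (1::complex)))"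
      unfolding lebesgue_on_integral_eq(2)[OF open_S] .
    also have "(\<lambda>x. indicator S x *\<^sub>R (\<phi> x *\<^sub>R (1::complex))) = (\<lambda>x. of_real (\<phi> x))"
      using Cc_smoothD(5)[OF \<phi>] by (auto simp: fun_eq_iff scaleR_conv_of_real split: split_indicator)
    finally have "integrable lebesgue \<phi>" by (simp only: complex_of_real_integrable_eq)
    then show ?thesis by (subst (asm) integrable_completion) auto
  qed
  have eq: "(LINT p|lebesgue_on S. \<phi> p *\<^sub>R mol d f p) = (LINT y|lborel. J d y *\<^sub>R g y)" if d: "d > 0" for d
  proof -
    obtain K where K: "\<And>p y. \<bar>ker d p y\<bar> \<le> K" by (rule ker_bound[OF d]) blast
    have mm[measurable]: "mol d f \<in> borel_measurable borel"
      by (rule borel_measurable_continuous_onI[OF mol_continuous[OF f d]])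
    have [measurable]: "(\<lambda>q. ker d (fst q) (snd q)) \<in> borel_measurable (borel \<Otimes>\<^sub>M borel)" by (rule ker_measurable)
    have pint: "integrable (lborel \<Otimes>\<^sub>M lborel) (\<lambda>(p, y). (\<phi> p * ker d p y) *\<^sub>R g y)"
    proof (rule Bochner_Integration.integrable_bound)
      have "integrable (lborel \<Otimes>\<^sub>M lborel) (\<lambda>(p, y). \<phi> p *\<^sub>R g y)"
        using \<phi>i gi by (intro lborel_pair.Fubini_integrable) auto
      then show "integrable (lborel \<Otimes>\<^sub>M lborel) (\<lambda>q. K *\<^sub>R (case q of (p, y) \<Rightarrow> \<phi> p *\<^sub>R g y))"
        by (rule integrable_scaleR_right)
      show "AE q in lborel \<Otimes>\<^sub>M lborel. norm (case q of (p, y) \<Rightarrow> (\<phi> p * ker d p y) *\<^sub>R g y) \<le> norm (K *\<^sub>R (case q of (p, y) \<Rightarrow> \<phi> p *\<^sub>R g y))"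
      proof (rule AE_I2)
        fix q :: "'a \<times> 'a"
        obtain p y where q: "q = (p, y)" by (cases q)
        have "\<bar>\<phi> p\<bar> * \<bar>ker d p y\<bar> * cmod (g y) \<le> \<bar>\<phi> p\<bar> * \<bar>K\<bar> * cmod (g y)"
          using K[of p y] by (intro mult_right_mono mult_left_mono) auto
        then show "norm (case q of (p, y) \<Rightarrow> (\<phi> p * ker d p y) *\<^sub>R g y) \<le> norm (K *\<^sub>R (case q of (p, y) \<Rightarrow> \<phi> p *\<^sub>R g y))"
          by (simp add: q abs_mult mult_ac)
      qed
      show "(\<lambda>(p, y). (\<phi> p * ker d p y) *\<^sub>R g y) \<in> borel_measurable (lborel \<Otimes>\<^sub>M lborel)"
        unfolding ker_def by measurable
    qed
    have "indicator S p *\<^sub>R (\<phi> p *\<^sub>R mol d f p) = \<phi> p *\<^sub>R mol d f p" for p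
      using Cc_smoothD(5)[OF \<phi>, of p] by (auto split: split_indicator)
    then have "(LINT p|lebesgue_on S. \<phi> p *\<^sub>R mol d f p) = (LINT p|lebesgue. \<phi> p *\<^sub>R mol d f p)"
      unfolding lebesgue_on_integral_eq(1)[OF open_S] by (simp only:)
    also have "\<dots> = (LINT p|lborel. \<phi> p *\<^sub>R mol d f p)" by (rule integral_completion) measurable
    also have "\<dots> = (LINT p|lborel. (LINT y|lborel. (\<phi> p * ker d p y) *\<^sub>R g y))"
      unfolding molg integral_scaleR_right[symmetric] by simp
    also have "\<dots> = (LINT y|lborel. (LINT p|lborel. (\<phi> p * ker d p y) *\<^sub>R g y))"
      by (rule lborel_pair.Fubini_integral[OF pint, symmetric])
    also have "\<dots> = (LINT y|lborel. J d y *\<^sub>R g y)"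
    proof (intro Bochner_Integration.integral_cong refl)
      fix y
      have "integrable lborel (\<lambda>p. \<phi> p * ker d p y)"
      proof (rule Bochner_Integration.integrable_bound)
        show "integrable lborel (\<lambda>p. K * \<phi> p)" using \<phi>i by simp
        show "AE p in lborel. norm (\<phi> p * ker d p y) \<le> norm (K * \<phi> p)"
        proof (rule AE_I2)
          fix p
          have "\<bar>\<phi> p\<bar> * \<bar>ker d p y\<bar> \<le> \<bar>\<phi> p\<bar> * \<bar>K\<bar>"
            using K[of p y] by (intro mult_left_mono) auto
          then show "norm (\<phi> p * ker d p y) \<le> norm (K * \<phi> p)" by (simp add: abs_mult mult.commute)
        qed
        show "(\<lambda>p. \<phi> p * ker d p y) \<in> borel_measurable lborel"
          unfolding ker_def by measurable
      qed
      then show "(LINT p|lborel. (\<phi> p * ker d p y) *\<^sub>R g y) = J d y *\<^sub>R g y"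
        unfolding J_def by (rule integral_scaleR_left)
    qed
    finally show ?thesis .
  qed
  \<comment> \<open>The relation y = (1 - d) p + d z is solved for p, giving p = (y - d z) / (1 -
    d); the Jacobian and the normalisation of the kernel leave 1 / (1 - d) to the power of the
    dimension.\<close>
  have Jz: "J d y = (1 / (1 - d)) ^ DIM('a) * (LINT z|lborel. \<phi> ((1 / (1 - d)) *\<^sub>R (y - d *\<^sub>R z)) * \<rho> z)" if d: "0 < d" "d < 1" for d y
  proof -
    have "J d y = \<bar>- (d / (1 - d))\<bar> ^ DIM('a) *\<^sub>R (LINT z|lborel. \<phi> ((1 / (1 - d)) *\<^sub>R y + (- (d / (1 - d))) *\<^sub>R z) * ker d ((1 / (1 - d)) *\<^sub>R y + (- (d / (1 - d))) *\<^sub>R z) y)"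
      unfolding J_def
    proof (rule lborel_integral_affine)
      show "(\<lambda>p. \<phi> p * ker d p y) \<in> borel_measurable borel" unfolding ker_def by measurable
    qed (use d in simp)
    also have "(\<lambda>z. \<phi> ((1 / (1 - d)) *\<^sub>R y + (- (d / (1 - d))) *\<^sub>R z) * ker d ((1 / (1 - d)) *\<^sub>R y + (- (d / (1 - d))) *\<^sub>R z) y)
       = (\<lambda>z. \<phi> ((1 / (1 - d)) *\<^sub>R (y - d *\<^sub>R z)) * \<rho> z / d ^ DIM('a))"
    proof
      fix z
      have 1: "(1 / (1 - d)) *\<^sub>R y + (- (d / (1 - d))) *\<^sub>R z = (1 / (1 - d)) *\<^sub>R (y - d *\<^sub>R z)"
        by (simp add: scaleR_diff_right)
      have "(1 / d) *\<^sub>R (y - (1 - d) *\<^sub>R ((1 / (1 - d)) *\<^sub>R (y - d *\<^sub>R z))) = z"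
        using d by simp
      then show "\<phi> ((1 / (1 - d)) *\<^sub>R y + (- (d / (1 - d))) *\<^sub>R z) * ker d ((1 / (1 - d)) *\<^sub>R y + (- (d / (1 - d))) *\<^sub>R z) y
         = \<phi> ((1 / (1 - d)) *\<^sub>R (y - d *\<^sub>R z)) * \<rho> z / d ^ DIM('a)"
        unfolding 1 ker_def by simp
    qed
    finally show ?thesis using d by (simp add: power_divide abs_minus_cancel)
  qed
  have \<rho>i: "integrable lborel \<rho>"
    using \<rho>_int not_integrable_integral_eq[of lborel \<rho>] by fastforce
  have \<phi>c: "isCont \<phi> x" for x using Cc_smoothD(2)[OF \<phi>] by (simp add: continuous_on_eq_continuous_at)
  have c1: "(\<lambda>n. 1 / (1 - \<delta> n)) \<longlonglongrightarrow> 1 / (1 - 0)" by (intro tendsto_intros \<delta>(3)) simp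
  have Jlim: "(\<lambda>n. J (\<delta> n) y) \<longlonglongrightarrow> \<phi> y" for y
  proof -
    have "(\<lambda>n. LINT z|lborel. \<phi> ((1 / (1 - \<delta> n)) *\<^sub>R (y - \<delta> n *\<^sub>R z)) * \<rho> z) \<longlonglongrightarrow> (LINT z|lborel. \<phi> y * \<rho> z)"
    proof (rule integral_dominated_convergence[where w="\<lambda>z. B\<phi> * \<rho> z"])
      show "AE z in lborel. (\<lambda>n. \<phi> ((1 / (1 - \<delta> n)) *\<^sub>R (y - \<delta> n *\<^sub>R z)) * \<rho> z) \<longlonglongrightarrow> \<phi> y * \<rho> z"
      proof (rule AE_I2)
        fix z
        have "(\<lambda>n. (1 / (1 - \<delta> n)) *\<^sub>R (y - \<delta> n *\<^sub>R z)) \<longlonglongrightarrow> (1 / (1 - 0)) *\<^sub>R (y - 0 *\<^sub>R z)"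
          by (intro tendsto_scaleR c1 tendsto_diff tendsto_const \<delta>(3))
        then have "(\<lambda>n. \<phi> ((1 / (1 - \<delta> n)) *\<^sub>R (y - \<delta> n *\<^sub>R z))) \<longlonglongrightarrow> \<phi> y"
          by (intro isCont_tendsto_compose[OF \<phi>c]) simp
        then show "(\<lambda>n. \<phi> ((1 / (1 - \<delta> n)) *\<^sub>R (y - \<delta> n *\<^sub>R z)) * \<rho> z) \<longlonglongrightarrow> \<phi> y * \<rho> z"
          by (intro tendsto_mult tendsto_const)
      qed
      show "AE z in lborel. norm (\<phi> ((1 / (1 - \<delta> n)) *\<^sub>R (y - \<delta> n *\<^sub>R z)) * \<rho> z) \<le> B\<phi> * \<rho> z" for n
        using B\<phi>(2) \<rho>_nonneg by (auto simp: abs_mult intro!: mult_right_mono)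
    qed (use \<rho>i in auto)
    then have "(\<lambda>n. (1 / (1 - \<delta> n)) ^ DIM('a) * (LINT z|lborel. \<phi> ((1 / (1 - \<delta> n)) *\<^sub>R (y - \<delta> n *\<^sub>R z)) * \<rho> z))
       \<longlonglongrightarrow> (1 / (1 - 0)) ^ DIM('a) * (LINT z|lborel. \<phi> y * \<rho> z)"
      by (intro tendsto_mult tendsto_power c1)
    then show ?thesis using \<rho>_int by (simp add: Jz[OF \<delta>(1,2)])
  qed
  \<comment> \<open>The factor in front of the integral is bounded only away from d = 1, hence the
    restriction to \<delta> n < 1/2.\<close>
  obtain N where N: "\<And>n. n \<ge> N \<Longrightarrow> \<delta> n < 1/2"
    using order_tendstoD(2)[OF \<delta>(3), of "1/2"] by (auto simp: eventually_sequentially)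
  have Jb: "\<bar>J (\<delta> n) y\<bar> \<le> 2 ^ DIM('a) * B\<phi>" if n: "n \<ge> N" for n y
  proof -
    let ?I = "LINT z|lborel. \<phi> ((1 / (1 - \<delta> n)) *\<^sub>R (y - \<delta> n *\<^sub>R z)) * \<rho> z"
    have "\<bar>?I\<bar> \<le> (LINT z|lborel. norm (\<phi> ((1 / (1 - \<delta> n)) *\<^sub>R (y - \<delta> n *\<^sub>R z)) * \<rho> z))"
      using integral_norm_bound[of lborel "\<lambda>z. \<phi> ((1 / (1 - \<delta> n)) *\<^sub>R (y - \<delta> n *\<^sub>R z)) * \<rho> z"] by simp
    also have "\<dots> \<le> (LINT z|lborel. B\<phi> * \<rho> z)"
      using B\<phi> \<rho>_nonneg \<rho>i by (intro integral_mono_AE') (auto simp: abs_mult intro!: mult_right_mono)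
    also have "\<dots> = B\<phi>" using \<rho>_int by simp
    finally have I: "\<bar>?I\<bar> \<le> B\<phi>" .
    have "(1 / (1 - \<delta> n)) \<le> 2" using N[OF n] by (simp add: field_simps)
    then have "(1 / (1 - \<delta> n)) ^ DIM('a) \<le> 2 ^ DIM('a)" using \<delta>(2)[of n] by (intro power_mono) auto
    then show ?thesis
      unfolding Jz[OF \<delta>(1,2)] abs_mult using I \<delta>(2)[of n] B\<phi>(1) by (intro mult_mono) auto
  qed
  have Jm[measurable]: "J d \<in> borel_measurable borel" for d
    unfolding J_def ker_def by measurable
  have "(\<lambda>n. LINT y|lborel. J (\<delta> (n + N)) y *\<^sub>R g y) \<longlonglongrightarrow> (LINT y|lborel. \<phi> y *\<^sub>R g y)"
  proof (rule integral_dominated_convergence[where w="\<lambda>y. 2 ^ DIM('a) * B\<phi> * cmod (g y)"])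
    show "AE y in lborel. (\<lambda>n. J (\<delta> (n + N)) y *\<^sub>R g y) \<longlonglongrightarrow> \<phi> y *\<^sub>R g y"
      by (intro AE_I2 tendsto_scaleR tendsto_const LIMSEQ_ignore_initial_segment Jlim)
    show "AE y in lborel. norm (J (\<delta> (n + N)) y *\<^sub>R g y) \<le> 2 ^ DIM('a) * B\<phi> * cmod (g y)" for n
      unfolding norm_scaleR by (rule AE_I2, rule mult_right_mono) (use Jb in auto)
  qed (use gi in auto)
  then have "(\<lambda>n. LINT y|lborel. J (\<delta> n) y *\<^sub>R g y) \<longlonglongrightarrow> (LINT y|lborel. \<phi> y *\<^sub>R g y)"
    by (rule LIMSEQ_offset)
  then show ?thesis
    unfolding eq[OF \<delta>(1)] using transfer[of \<phi>] by simp
qed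

end

section \<open>Continuous representatives and traces\<close>

text \<open>A bump on a closed box inside S, normalised. Its integral is positive because the bump
  is positive on a nonempty open set.\<close>

lemma mollifier_exists:
  fixes S :: "'a::euclidean_space set"
  assumes S: "open S" "convex S" "bounded S" "S \<noteq> {}"
  obtains \<rho> where "mollifier S \<rho>"
proof -
  obtain x where "x \<in> S" using S(4) by auto
  then obtain a b where ab: "x \<in> box a b" "cbox a b \<subseteq> S"
    using open_contains_cbox[OF S(1)] by metis
  let ?b = "box_bump 0 a b"
  have b: "?b \<in> Cc_smooth S" by (rule box_bump_Cc_smooth[OF ab(2)])
  have bm[measurable]: "?b \<in> borel_measurable borel" by (rule Cc_smooth_borel[OF b])
  have bi: "integrable lborel ?b"
  proof (rule Bochner_Integration.integrable_bound)
    show "integrable lborel (indicator (cbox a b) :: 'a \<Rightarrow> real)"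
      using emeasure_lborel_cbox_finite[of a b] by (simp add: integrable_indicator_iff less_top)
    show "AE y in lborel. norm (?b y) \<le> norm (indicator (cbox a b) y :: real)"
    proof (rule AE_I2)
      fix y
      show "norm (?b y) \<le> norm (indicator (cbox a b) y :: real)"
        using box_bump_bounds[of 0 a b y] box_bump_pos[of 0 a b y] box_subset_cbox[of a b]
        by (cases "y \<in> cbox a b") auto
    qed
  qed measurable
  define c where "c = (LINT y|lborel. ?b y)"
  have "c \<noteq> 0"
  proof
    assume "c = 0"
    then have "AE y in lborel. ?b y = 0"
      unfolding c_def using integral_nonneg_eq_0_iff_AE[OF bi AE_I2[OF box_bump_bounds(1)]] by blast
    then have "AE y in lborel. y \<notin> box a b"
      by eventually_elim (simp add: box_bump_pos[of 0 a b, symmetric])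
    then have "AE y in lebesgue. y \<notin> box a b" by (rule AE_completion)
    then have "box a b \<in> null_sets lebesgue" by (simp add: AE_iff_null_sets)
    then show False using ab(1) open_not_negligible[OF open_box, of a b] by (auto simp: negligible_iff_null_sets)
  qed
  moreover have "c \<ge> 0" unfolding c_def by (rule integral_nonneg_AE[OF AE_I2[OF box_bump_bounds(1)]])
  ultimately have c: "c > 0" by simp
  have "mollifier S (\<lambda>y. (1 / c) *\<^sub>R ?b y)"
  proof
    show "(\<lambda>y. (1 / c) *\<^sub>R ?b y) \<in> Cc_smooth S" by (rule Cc_smooth_scaleR[OF times_cont_diff_const b])
    show "(LINT y|lborel. (1 / c) *\<^sub>R ?b y) = 1" using c by (simp add: c_def)
    show "(1 / c) *\<^sub>R ?b y \<ge> 0" for y using c box_bump_bounds(1)[of 0 a b y] by simp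
  qed (use S in auto)
  then show thesis by (rule that)
qed

lemma L1_loc_sum_scaleR:
  assumes "finite I" "\<And>i. i \<in> I \<Longrightarrow> g i \<in> L1_loc S"
  shows "(\<lambda>x. \<Sum>i\<in>I. c i *\<^sub>R g i x) \<in> L1_loc S"
  unfolding L1_loc_def
proof (intro CollectI allI impI)
  fix C assume C: "compact C \<and> C \<subseteq> S"
  show "(\<lambda>x. \<Sum>i\<in>I. c i *\<^sub>R g i x) absolutely_integrable_on C"
    using assms C by (intro absolutely_integrable_sum) (auto simp: L1_loc_def intro: absolutely_integrable_scaleR_left)
qed

text \<open>The spaces provide derivatives along basis vectors only. Other directions enter twice:
  along the segment between two points, and along the diagonal of the square.\<close>

lemma has_weak_deriv_direction:
  fixes f :: "'a::euclidean_space \<Rightarrow> complex"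
  assumes S: "open S" and w: "\<And>i. i \<in> Basis \<Longrightarrow> has_weak_deriv S i f (g i)"
  shows "has_weak_deriv S w f (\<lambda>x. \<Sum>i\<in>Basis. (w \<bullet> i) *\<^sub>R g i x)"
  unfolding has_weak_deriv_def
proof (intro conjI allI impI)
  obtain i :: 'a where "i \<in> Basis" using nonempty_Basis by blast
  from has_weak_derivD(1)[OF w[OF this]] show f: "f \<in> L1_loc S" .
  have gL: "g i \<in> L1_loc S" if "i \<in> Basis" for i by (rule has_weak_derivD(2)[OF w[OF that]])
  show "(\<lambda>x. \<Sum>i\<in>Basis. (w \<bullet> i) *\<^sub>R g i x) \<in> L1_loc S"
    by (rule L1_loc_sum_scaleR[OF finite_Basis gL])
  fix \<phi> :: "'a \<Rightarrow> real" assume \<phi>: "\<phi> \<in> Cc_smooth S"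
  have fd: "frechet_derivative \<phi> (at x) w = (\<Sum>i\<in>Basis. (w \<bullet> i) * frechet_derivative \<phi> (at x) i)" for x
  proof -
    note lin = has_derivative_linear[OF Cc_smoothD(4)[OF \<phi>], of x]
    have "frechet_derivative \<phi> (at x) w = frechet_derivative \<phi> (at x) (\<Sum>i\<in>Basis. (w \<bullet> i) *\<^sub>R i)"
      by (simp add: euclidean_representation)
    also have "\<dots> = (\<Sum>i\<in>Basis. (w \<bullet> i) * frechet_derivative \<phi> (at x) i)"
      by (simp add: linear_sum[OF lin] linear_scale[OF lin])
    finally show ?thesis .
  qed
  have i1: "integrable (lebesgue_on S) (\<lambda>x. (w \<bullet> i) *\<^sub>R (frechet_derivative \<phi> (at x) i *\<^sub>R f x))" for i
    by (rule integrable_scaleR_right[OF Cc_smooth_mult_integrable[OF S f Cc_smooth_deriv[OF \<phi>]]])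
  have i2: "integrable (lebesgue_on S) (\<lambda>x. (w \<bullet> i) *\<^sub>R (\<phi> x *\<^sub>R g i x))" if "i \<in> Basis" for i
    by (rule integrable_scaleR_right[OF Cc_smooth_mult_integrable[OF S gL[OF that] \<phi>]])
  have "(LINT x|lebesgue_on S. frechet_derivative \<phi> (at x) w *\<^sub>R f x) = (LINT x|lebesgue_on S. (\<Sum>i\<in>Basis. (w \<bullet> i) *\<^sub>R (frechet_derivative \<phi> (at x) i *\<^sub>R f x)))"
    unfolding fd by (simp add: scaleR_sum_left)
  also have "\<dots> = (\<Sum>i\<in>Basis. LINT x|lebesgue_on S. (w \<bullet> i) *\<^sub>R (frechet_derivative \<phi> (at x) i *\<^sub>R f x))"
    by (rule Bochner_Integration.integral_sum[OF i1])
  also have "\<dots> = (\<Sum>i\<in>Basis. - (LINT x|lebesgue_on S. (w \<bullet> i) *\<^sub>R (\<phi> x *\<^sub>R g i x)))"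
    unfolding integral_scaleR_right by (intro sum.cong refl) (simp add: has_weak_derivD(3)[OF w \<phi>])
  also have "\<dots> = - (\<Sum>i\<in>Basis. LINT x|lebesgue_on S. (w \<bullet> i) *\<^sub>R (\<phi> x *\<^sub>R g i x))"
    by (rule sum_negf)
  also have "(\<Sum>i\<in>Basis. LINT x|lebesgue_on S. (w \<bullet> i) *\<^sub>R (\<phi> x *\<^sub>R g i x)) = (LINT x|lebesgue_on S. (\<Sum>i\<in>Basis. (w \<bullet> i) *\<^sub>R (\<phi> x *\<^sub>R g i x)))"
    by (rule Bochner_Integration.integral_sum[OF i2, symmetric])
  also have "(\<lambda>x. \<Sum>i\<in>Basis. (w \<bullet> i) *\<^sub>R (\<phi> x *\<^sub>R g i x)) = (\<lambda>x. \<phi> x *\<^sub>R (\<Sum>i\<in>Basis. (w \<bullet> i) *\<^sub>R g i x))"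
    by (simp add: scaleR_sum_right mult.commute)
  finally show "(LINT x|lebesgue_on S. frechet_derivative \<phi> (at x) w *\<^sub>R f x) = - (LINT x|lebesgue_on S. \<phi> x *\<^sub>R (\<Sum>i\<in>Basis. (w \<bullet> i) *\<^sub>R g i x))" .
qed

lemma LinfB_sum_direction:
  assumes g: "\<And>i. i \<in> Basis \<Longrightarrow> LinfB S (g i) (B i)"
  shows "LinfB S (\<lambda>x. \<Sum>i\<in>Basis. (w \<bullet> i) *\<^sub>R g i x) (norm w * (\<Sum>i\<in>Basis. B i))"
  unfolding LinfB_def
proof (intro conjI)
  show "(\<lambda>x. \<Sum>i\<in>Basis. (w \<bullet> i) *\<^sub>R g i x) \<in> borel_measurable (lebesgue_on S)"
    using g by (intro borel_measurable_sum borel_measurable_scaleR borel_measurable_const) (auto simp: LinfB_def)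
  show "0 \<le> norm w * (\<Sum>i\<in>Basis. B i)"
    using g by (intro mult_nonneg_nonneg sum_nonneg) (auto simp: LinfB_def)
  have "AE x in lebesgue_on S. \<forall>i\<in>Basis. cmod (g i x) \<le> B i"
    by (rule AE_finite_allI) (use g in \<open>auto simp: LinfB_def\<close>)
  then show "AE x in lebesgue_on S. cmod (\<Sum>i\<in>Basis. (w \<bullet> i) *\<^sub>R g i x) \<le> norm w * (\<Sum>i\<in>Basis. B i)"
  proof eventually_elim
    case (elim x)
    have "cmod (\<Sum>i\<in>Basis. (w \<bullet> i) *\<^sub>R g i x) \<le> (\<Sum>i\<in>Basis. norm w * B i)"
    proof (rule sum_norm_le)
      fix i :: 'a assume i: "i \<in> Basis"
      show "cmod ((w \<bullet> i) *\<^sub>R g i x) \<le> norm w * B i"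
        unfolding norm_scaleR using elim i Basis_le_norm[OF i, of w] by (intro mult_mono) auto
    qed
    then show ?case by (simp add: sum_distrib_left)
  qed
qed

text \<open>Mean value theorem along the segment from p to q, which stays in the closure by
  convexity. The constant is independent of \<delta>, so the mollifications are
  equicontinuous.\<close>

lemma (in mollifier) mol_Lipschitz:
  assumes f: "LinfB S f B" and w: "\<And>i. i \<in> Basis \<Longrightarrow> has_weak_deriv S i f (g i)" and g: "\<And>i. i \<in> Basis \<Longrightarrow> LinfB S (g i) (L i)"
    and \<delta>: "0 < \<delta>" "\<delta> \<le> 1" and pq: "p \<in> closure S" "q \<in> closure S"
  shows "cmod (mol \<delta> f q - mol \<delta> f p) \<le> norm (q - p) * (\<Sum>i\<in>Basis. L i)"
proof -
  let ?w = "q - p" and ?\<gamma> = "\<lambda>r. mol \<delta> f (p + r *\<^sub>R (q - p))"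
  let ?g = "\<lambda>x. \<Sum>i\<in>Basis. (?w \<bullet> i) *\<^sub>R g i x"
  have in_cl: "p + r *\<^sub>R ?w \<in> closure S" if "0 \<le> r" "r \<le> 1" for r
  proof -
    have "(1 - r) *\<^sub>R p + r *\<^sub>R q \<in> closure S"
      using convex_closure[OF convex_S] pq that by (intro convexD_alt) auto
    then show ?thesis by (simp add: algebra_simps)
  qed
  have "\<exists>r\<in>{0<..<1}. norm (?\<gamma> 1 - ?\<gamma> 0) \<le> norm ((1 - 0) *\<^sub>R ((1 - \<delta>) *\<^sub>R mol \<delta> ?g (p + r *\<^sub>R ?w)))"
  proof (rule mvt_general[where f'="\<lambda>r h. h *\<^sub>R ((1 - \<delta>) *\<^sub>R mol \<delta> ?g (p + r *\<^sub>R ?w))"])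
    show "continuous_on {0..1} ?\<gamma>"
      by (rule continuous_on_compose2[OF mol_continuous[OF f \<delta>(1)]]) (auto intro!: continuous_intros)
    show "(?\<gamma> has_derivative (\<lambda>h. h *\<^sub>R ((1 - \<delta>) *\<^sub>R mol \<delta> ?g (p + r *\<^sub>R ?w)))) (at r)" if "0 < r" "r < 1" for r
      using mol_has_derivative[OF has_weak_deriv_direction[OF open_S w] f \<delta> in_cl] that
      unfolding has_vector_derivative_def by auto
  qed simp
  then obtain r where r: "0 < r" "r < 1" "norm (?\<gamma> 1 - ?\<gamma> 0) \<le> norm ((1 - \<delta>) *\<^sub>R mol \<delta> ?g (p + r *\<^sub>R ?w))"
    by auto
  have "norm ((1 - \<delta>) *\<^sub>R mol \<delta> ?g (p + r *\<^sub>R ?w)) \<le> 1 * (norm ?w * (\<Sum>i\<in>Basis. L i))"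
    unfolding norm_scaleR using \<delta> r in_cl[of r]
    by (intro mult_mono mol_bound[OF LinfB_sum_direction[OF g]]) auto
  with r(3) show ?thesis by simp
qed

text \<open>Arzela-Ascoli: the mollifications are uniformly bounded and share a Lipschitz constant,
  so a subsequence converges uniformly on the compact closure. The limit has the same integrals as f
  against test functions, hence equals f almost everywhere.\<close>

lemma (in mollifier) cont_rep_exists:
  assumes f: "f \<in> Linf S" and w: "\<And>i. i \<in> Basis \<Longrightarrow> \<exists>g\<in>Linf S. has_weak_deriv S i f g"
  obtains F where "continuous_on (closure S) F" "AE x in lebesgue_on S. F x = f x"
proof -
  obtain g where g: "\<And>i. i \<in> Basis \<Longrightarrow> g i \<in> Linf S" "\<And>i. i \<in> Basis \<Longrightarrow> has_weak_deriv S i f (g i)"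
    using w by metis
  define B where "B = max 0 (Linf_norm S f)"
  define L where "L i = max 0 (Linf_norm S (g i))" for i
  have fB: "LinfB S f B" unfolding B_def by (rule Linf_norm_bound[OF f])
  have gL: "LinfB S (g i) (L i)" if "i \<in> Basis" for i unfolding L_def by (rule Linf_norm_bound[OF g(1)[OF that]])
  \<comment> \<open>Adding 1 keeps the divisor of e positive.\<close>
  let ?L = "(\<Sum>i\<in>Basis. L i) + 1"
  have L0: "(\<Sum>i\<in>Basis. L i) \<ge> 0" by (intro sum_nonneg) (auto simp: L_def)
  \<comment> \<open>The sequence starts at 1/2, so 1 - \<delta> n never vanishes.\<close>
  define \<delta> where "\<delta> n = 1 / real (Suc (Suc n))" for n
  have \<delta>: "0 < \<delta> n" "\<delta> n < 1" "\<delta> n \<le> 1" for n by (auto simp: \<delta>_def)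
  have \<delta>0: "\<delta> \<longlonglongrightarrow> 0" unfolding \<delta>_def by (intro LIMSEQ_Suc[OF LIMSEQ_Suc[OF lim_1_over_n]])
  obtain F k where F: "continuous_on (closure S) F" and k: "strict_mono (k :: nat \<Rightarrow> nat)"
    and lim: "\<And>e. 0 < e \<Longrightarrow> \<exists>N. \<forall>n x. n \<ge> N \<and> x \<in> closure S \<longrightarrow> cmod (mol (\<delta> (k n)) f x - F x) < e"
  proof (rule Arzela_Ascoli[of "closure S" "\<lambda>n. mol (\<delta> n) f" B])
    show "compact (closure S)" using bounded_S by (simp add: compact_closure)
    show "cmod (mol (\<delta> n) f x) \<le> B" if "x \<in> closure S" for n x
      by (rule mol_bound[OF fB that \<delta>(1,3)])
    show "\<exists>d>0. \<forall>n y. y \<in> closure S \<and> norm (x - y) < d \<longrightarrow> cmod (mol (\<delta> n) f x - mol (\<delta> n) f y) < e"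
      if x: "x \<in> closure S" and e: "0 < e" for x e
    proof (intro exI[of _ "e / ?L"] conjI allI impI)
      show "0 < e / ?L" using e L0 by simp
      fix n y assume y: "y \<in> closure S \<and> norm (x - y) < e / ?L"
      have "cmod (mol (\<delta> n) f x - mol (\<delta> n) f y) \<le> norm (x - y) * (\<Sum>i\<in>Basis. L i)"
        by (rule mol_Lipschitz[OF fB g(2) gL \<delta>(1,3)]) (use x y in auto)
      also have "\<dots> \<le> norm (x - y) * ?L" by (rule mult_left_mono) auto
      also have "\<dots> < e" using y L0 by (simp add: pos_less_divide_eq)
      finally show "cmod (mol (\<delta> n) f x - mol (\<delta> n) f y) < e" .
    qed
  qed blast
  have limF: "(\<lambda>n. mol (\<delta> (k n)) f x) \<longlonglongrightarrow> F x" if "x \<in> closure S" for x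
    unfolding LIMSEQ_iff using lim that by blast
  have FB: "cmod (F x) \<le> B" if "x \<in> closure S" for x
    by (rule LIMSEQ_le_const2[OF tendsto_norm[OF limF[OF that]]]) (use mol_bound[OF fB that \<delta>(1,3)] in blast)
  have Fc: "continuous_on S F" by (rule continuous_on_subset[OF F closure_subset])
  have Fm: "F \<in> borel_measurable (lebesgue_on S)"
    using Fc open_S by (intro continuous_imp_measurable_on_sets_lebesgue) auto
  have FL: "LinfB S F B"
    unfolding LinfB_def
  proof (intro conjI Fm)
    show "AE x in lebesgue_on S. cmod (F x) \<le> B"
      unfolding lebesgue_on_integral_eq(4)[OF open_S] using FB closure_subset by (intro AE_I2) auto
  qed (simp add: B_def)
  have L1: "h \<in> L1_loc S" if "LinfB S h C" for h C
    unfolding L1_loc_def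
  proof (intro CollectI allI impI)
    fix D assume D: "compact D \<and> D \<subseteq> S"
    have "integrable lebesgue (\<lambda>x. indicator S x *\<^sub>R h x)"
      using LinfB_integrable[OF open_S bounded_S that] unfolding lebesgue_on_integral_eq(2)[OF open_S] .
    moreover have "D \<in> sets lebesgue" using D by (simp add: lmeasurable_compact fmeasurableD)
    ultimately have "integrable lebesgue (\<lambda>x. indicator D x *\<^sub>R (indicator S x *\<^sub>R h x))"
      by (rule integrable_mult_indicator[rotated])
    also have "(\<lambda>x. indicator D x *\<^sub>R (indicator S x *\<^sub>R h x)) = (\<lambda>x. indicator D x *\<^sub>R h x)"
      using D by (intro ext) (auto split: split_indicator)
    finally show "h absolutely_integrable_on D" by (simp add: set_integrable_def)
  qed
  have "AE x in lebesgue_on S. F x - f x = 0"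
  proof (rule fundamental_lemma[OF open_S L1_loc_diff[OF L1[OF FL] L1[OF fB]]])
    fix \<phi> :: "'a \<Rightarrow> real" assume \<phi>: "\<phi> \<in> Cc_smooth S"
    have "(\<lambda>n. LINT p|lebesgue_on S. \<phi> p *\<^sub>R mol (\<delta> (k n)) f p) \<longlonglongrightarrow> (LINT y|lebesgue_on S. \<phi> y *\<^sub>R f y)"
      using LIMSEQ_subseq_LIMSEQ[OF mol_weak_limit[OF fB \<phi> \<delta>(1,2) \<delta>0] k] by (simp add: comp_def)
    moreover have "(\<lambda>n. LINT p|lebesgue_on S. \<phi> p *\<^sub>R mol (\<delta> (k n)) f p) \<longlonglongrightarrow> (LINT y|lebesgue_on S. \<phi> y *\<^sub>R F y)"
    proof (rule integral_dominated_convergence[where w="\<lambda>x. \<bar>\<phi> x\<bar> * B"])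
      have \<phi>m: "\<phi> \<in> borel_measurable (lebesgue_on S)"
        by (rule measurable_restrict_space1[OF borel_imp_lebesgue_measurable[OF Cc_smooth_borel[OF \<phi>]]])
      have mm: "mol (\<delta> n) f \<in> borel_measurable (lebesgue_on S)" for n
        by (rule measurable_restrict_space1[OF borel_imp_lebesgue_measurable[OF borel_measurable_continuous_onI[OF mol_continuous[OF fB \<delta>(1)]]]])
      show "(\<lambda>y. \<phi> y *\<^sub>R F y) \<in> borel_measurable (lebesgue_on S)" using \<phi>m Fm by (rule borel_measurable_scaleR)
      show "(\<lambda>p. \<phi> p *\<^sub>R mol (\<delta> (k n)) f p) \<in> borel_measurable (lebesgue_on S)" for n using \<phi>m mm by (rule borel_measurable_scaleR)
      have "LinfB S (\<lambda>_. 1) 1" by (simp add: LinfB_def)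
      from integrable_norm[OF Cc_smooth_mult_integrable[OF open_S L1[OF this] \<phi>]]
      show "integrable (lebesgue_on S) (\<lambda>x. \<bar>\<phi> x\<bar> * B)" by simp
      show "AE p in lebesgue_on S. (\<lambda>n. \<phi> p *\<^sub>R mol (\<delta> (k n)) f p) \<longlonglongrightarrow> \<phi> p *\<^sub>R F p"
        unfolding lebesgue_on_integral_eq(4)[OF open_S]
        using limF closure_subset by (intro AE_I2 impI tendsto_scaleR tendsto_const) auto
      show "AE p in lebesgue_on S. norm (\<phi> p *\<^sub>R mol (\<delta> (k n)) f p) \<le> \<bar>\<phi> p\<bar> * B" for n
        unfolding lebesgue_on_integral_eq(4)[OF open_S] norm_scaleR
        using mol_bound[OF fB _ \<delta>(1,3)] closure_subset by (intro AE_I2 impI mult_left_mono) auto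
    qed
    ultimately have "(LINT y|lebesgue_on S. \<phi> y *\<^sub>R f y) = (LINT y|lebesgue_on S. \<phi> y *\<^sub>R F y)"
      by (rule LIMSEQ_unique)
    then show "(LINT x|lebesgue_on S. \<phi> x *\<^sub>R (F x - f x)) = 0"
      using Cc_smooth_mult_integrable[OF open_S L1[OF FL] \<phi>] Cc_smooth_mult_integrable[OF open_S L1[OF fB] \<phi>]
      by (simp add: scaleR_diff_right)
  qed
  then have "AE x in lebesgue_on S. F x = f x" by eventually_elim simp
  with F show thesis by (rule that)
qed

text \<open>The set in S where F and G differ is open and null, hence empty; continuity carries the
  equality to the closure.\<close>

lemma continuous_AE_eq:
  fixes F G :: "'a::euclidean_space \<Rightarrow> complex"
  assumes S: "open S" and F: "continuous_on (closure S) F" and G: "continuous_on (closure S) G"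
    and eq: "AE x in lebesgue_on S. F x = G x" and p: "p \<in> closure S"
  shows "F p = G p"
proof -
  have c: "continuous_on (closure S) (\<lambda>x. F x - G x)" by (intro continuous_intros F G)
  let ?U = "{x \<in> S. F x - G x \<in> - {0}}"
  have "open ?U"
    using continuous_open_preimage[OF continuous_on_subset[OF c closure_subset] S, of "- {0}"]
    by (simp add: vimage_def Int_def open_Compl)
  moreover have "negligible ?U"
  proof -
    have "AE x in lebesgue. x \<notin> ?U"
      using eq unfolding lebesgue_on_integral_eq(4)[OF S] by eventually_elim auto
    then show ?thesis
      unfolding negligible_iff_null_sets using \<open>open ?U\<close> by (subst (asm) AE_iff_null_sets[symmetric]) auto
  qed
  ultimately have "?U = {}" using open_not_negligible by blast
  then have "F x - G x = 0" if "x \<in> S" for x using that by auto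
  then have "F p - G p = 0" by (rule continuous_constant_on_closure[OF c _ p])
  then show ?thesis by simp
qed

text \<open>By uniqueness any continuous representative evaluates the description in
  \<open>bdry_trace\<close>, so traces can be read off from the one at hand.\<close>

lemma bdry_trace_eq:
  assumes S: "open S" and F: "continuous_on (closure S) F" "AE x in lebesgue_on S. F x = f x" and p: "p \<in> closure S"
  shows "bdry_trace S f p = F p"
  unfolding bdry_trace_def
proof (rule the_equality)
  show "\<exists>g. continuous_on (closure S) g \<and> (AE x in lebesgue_on S. g x = f x) \<and> g p = F p" using F by blast
  fix z assume "\<exists>g. continuous_on (closure S) g \<and> (AE x in lebesgue_on S. g x = f x) \<and> g p = z"
  then obtain g where g: "continuous_on (closure S) g" "AE x in lebesgue_on S. g x = f x" "g p = z" by blast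
  have "AE x in lebesgue_on S. g x = F x" using g(2) F(2) by eventually_elim simp
  from continuous_AE_eq[OF S g(1) F(1) this p] g(3) show "z = F p" by simp
qed

section \<open>The two triangles\<close>

lemma lebesgue_measurable_AE_cong:
  fixes f g :: "'a::euclidean_space \<Rightarrow> 'b::topological_space"
  assumes g: "g \<in> borel_measurable lebesgue" and eq: "AE x in lebesgue. f x = g x"
  shows "f \<in> borel_measurable lebesgue"
proof (rule measurableI)
  obtain N where N: "N \<in> null_sets lebesgue" "{x. f x \<noteq> g x} \<subseteq> N"
    using eq by (auto simp: eventually_ae_filter)
  fix A :: "'b set" assume A: "A \<in> sets borel"
  have "f -` A \<inter> space lebesgue = (g -` A \<inter> space lebesgue - N) \<union> (f -` A \<inter> N)"
    using N(2) by auto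
  moreover have "f -` A \<inter> N \<in> null_sets lebesgue"
    by (rule null_sets_completion_subset[OF _ N(1)]) auto
  ultimately show "f -` A \<inter> space lebesgue \<in> sets lebesgue"
    using sets.Un[OF sets.Diff[OF measurable_sets[OF g A] null_setsD2[OF N(1)]] null_setsD2] by (simp only:)
qed simp

lemma lebesgue_on_measurable_AE_cong:
  fixes f g :: "'a::euclidean_space \<Rightarrow> complex"
  assumes S: "open S" and g: "g \<in> borel_measurable (lebesgue_on S)" and eq: "AE x in lebesgue_on S. f x = g x"
  shows "f \<in> borel_measurable (lebesgue_on S)"
proof -
  have "AE x in lebesgue. indicator S x *\<^sub>R f x = indicator S x *\<^sub>R g x"
    using eq unfolding lebesgue_on_integral_eq(4)[OF S] by eventually_elim (auto split: split_indicator)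
  with g show ?thesis
    unfolding lebesgue_on_integral_eq(3)[OF S] by (rule lebesgue_measurable_AE_cong)
qed

text \<open>The inner derivative in \<open>d12_norm\<close> is a chosen representative, which agrees
  only almost everywhere with the one whose derivative is known.\<close>

lemma has_weak_deriv_cong:
  fixes f :: "'a::euclidean_space \<Rightarrow> complex"
  assumes S: "open S" and w: "has_weak_deriv S v f g" and f': "f' \<in> L1_loc S" and eq: "AE x in lebesgue_on S. f x = f' x"
  shows "has_weak_deriv S v f' g"
  unfolding has_weak_deriv_def
proof (intro conjI allI impI f' has_weak_derivD(2)[OF w])
  fix \<phi> :: "'a \<Rightarrow> real" assume \<phi>: "\<phi> \<in> Cc_smooth S"
  note d\<phi> = Cc_smooth_deriv[OF \<phi>, of v]
  have "(LINT x|lebesgue_on S. frechet_derivative \<phi> (at x) v *\<^sub>R f' x) = (LINT x|lebesgue_on S. frechet_derivative \<phi> (at x) v *\<^sub>R f x)"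
  proof (rule integral_cong_AE)
    show "(\<lambda>x. frechet_derivative \<phi> (at x) v *\<^sub>R f x) \<in> borel_measurable (lebesgue_on S)"
      using Cc_smooth_mult_integrable[OF S has_weak_derivD(1)[OF w] d\<phi>] by auto
    show "(\<lambda>x. frechet_derivative \<phi> (at x) v *\<^sub>R f' x) \<in> borel_measurable (lebesgue_on S)"
      using Cc_smooth_mult_integrable[OF S f' d\<phi>] by auto
    show "AE x in lebesgue_on S. frechet_derivative \<phi> (at x) v *\<^sub>R f' x = frechet_derivative \<phi> (at x) v *\<^sub>R f x"
      using eq by eventually_elim simp
  qed
  then show "(LINT x|lebesgue_on S. frechet_derivative \<phi> (at x) v *\<^sub>R f' x) = - (LINT x|lebesgue_on S. \<phi> x *\<^sub>R g x)"
    using has_weak_derivD(3)[OF w \<phi>] by simp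
qed

text \<open>A compact set in the union of disjoint open sets splits into two compact pieces, so a
  test function restricted to A and extended by 0 stays smooth and compactly supported.\<close>

lemma Cc_smooth_restrict_component:
  fixes \<phi> :: "'a::euclidean_space \<Rightarrow> 'b::real_normed_vector"
  assumes A: "open A" and B: "open B" and AB: "A \<inter> B = {}" and \<phi>: "\<phi> \<in> Cc_smooth (A \<union> B)"
  shows "(\<lambda>x. if x \<in> A then \<phi> x else 0) \<in> Cc_smooth A"
    "frechet_derivative (\<lambda>x. if x \<in> A then \<phi> x else 0) (at x) v = (if x \<in> A then frechet_derivative \<phi> (at x) v else 0)"
proof -
  have D: "((\<lambda>x. if x \<in> A then \<psi> x else 0) has_derivative (if x \<in> A then frechet_derivative \<psi> (at x) else (\<lambda>v. 0))) (at x)"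
    if \<psi>: "\<psi> \<in> Cc_smooth (A \<union> B)" for \<psi> :: "'a \<Rightarrow> 'b" and x
  proof (cases "x \<in> A")
    case True
    have "((\<lambda>x. if x \<in> A then \<psi> x else 0) has_derivative frechet_derivative \<psi> (at x)) (at x)"
      by (rule has_derivative_transform_within_open[OF Cc_smoothD(4)[OF \<psi>] A True]) simp
    then show ?thesis using True by simp
  next
    case False
    obtain C where C: "compact C" "C \<subseteq> A \<union> B" "\<And>x. x \<notin> C \<Longrightarrow> \<psi> x = 0"
      by (rule Cc_smooth_supportE[OF \<psi>]) blast
    have "((\<lambda>x. if x \<in> A then \<psi> x else 0) has_derivative (\<lambda>v. 0)) (at x)"
    proof (rule has_derivative_transform_within_open)
      show "((\<lambda>x. 0) has_derivative (\<lambda>v. 0)) (at x)" by simp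
      show "open (- (C - B))" using C(1) B by (intro open_Compl closed_Diff compact_imp_closed)
      show "x \<in> - (C - B)" using False C(2) by auto
      show "0 = (if y \<in> A then \<psi> y else 0)" if "y \<in> - (C - B)" for y
        using that C(3)[of y] AB by (cases "y \<in> A") auto
    qed
    then show ?thesis using False by simp
  qed
  show fd: "frechet_derivative (\<lambda>x. if x \<in> A then \<phi> x else 0) (at x) v = (if x \<in> A then frechet_derivative \<phi> (at x) v else 0)"
    unfolding frechet_derivative_eqI[OF D[OF \<phi>]] by simp
  obtain C where C: "compact C" "C \<subseteq> A \<union> B" "\<And>x. x \<notin> C \<Longrightarrow> \<phi> x = 0"
    by (rule Cc_smooth_supportE[OF \<phi>]) blast
  show "(\<lambda>x. if x \<in> A then \<phi> x else 0) \<in> Cc_smooth A"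
  proof (rule Cc_smooth_supportI)
    show "compact (C - B)" using C(1) B by (rule compact_diff)
    show "C - B \<subseteq> A" using C(2) by auto
    show "(if y \<in> A then \<phi> y else 0) = 0" if "y \<notin> C - B" for y using that C(3)[of y] AB by auto
    show "times_cont_diff k (\<lambda>x. if x \<in> A then \<phi> x else 0)" for k
    \<comment> \<open>The restrictions of all test functions form a class closed under directional
      derivatives.\<close>
    proof (rule times_cont_diff_class[where F="(\<lambda>\<psi> x. if x \<in> A then \<psi> x else 0) ` Cc_smooth (A \<union> B)"])
      fix f :: "'a \<Rightarrow> 'b" assume "f \<in> (\<lambda>\<psi> x. if x \<in> A then \<psi> x else 0) ` Cc_smooth (A \<union> B)"
      then obtain \<psi> where \<psi>: "\<psi> \<in> Cc_smooth (A \<union> B)" and f: "f = (\<lambda>x. if x \<in> A then \<psi> x else 0)" by auto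
      have "(\<lambda>x. frechet_derivative f (at x) v) = (\<lambda>x. if x \<in> A then frechet_derivative \<psi> (at x) v else 0)" for v
        unfolding f frechet_derivative_eqI[OF D[OF \<psi>]] by auto
      then have "(\<lambda>x. frechet_derivative f (at x) v) \<in> (\<lambda>\<psi> x. if x \<in> A then \<psi> x else 0) ` Cc_smooth (A \<union> B)" for v
        using Cc_smooth_deriv[OF \<psi>, of v] by (auto intro: image_eqI[where x="\<lambda>x. frechet_derivative \<psi> (at x) v"])
      moreover have "f differentiable at x" for x
        unfolding f differentiable_def by (rule exI, rule D[OF \<psi>, of x])
      ultimately show "(\<forall>x. f differentiable at x) \<and> (\<forall>v. (\<lambda>x. frechet_derivative f (at x) v) \<in> (\<lambda>\<psi> x. if x \<in> A then \<psi> x else 0) ` Cc_smooth (A \<union> B))"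
        by blast
    qed (use \<phi> in auto)
  qed
qed

lemma L1_loc_union:
  fixes f1 f2 :: "'a::euclidean_space \<Rightarrow> complex"
  assumes A: "open A" and B: "open B" and AB: "A \<inter> B = {}" and f: "f1 \<in> L1_loc A" "f2 \<in> L1_loc B"
  shows "(\<lambda>x. if x \<in> A then f1 x else f2 x) \<in> L1_loc (A \<union> B)"
  unfolding L1_loc_def
proof (intro CollectI allI impI)
  fix C assume C: "compact C \<and> C \<subseteq> A \<union> B"
  let ?f = "\<lambda>x. if x \<in> A then f1 x else f2 x"
  have CA: "compact (C - B)" "C - B \<subseteq> A" and CB: "compact (C - A)" "C - A \<subseteq> B"
    using C A B by (auto intro: compact_diff)
  have "integrable lebesgue (\<lambda>x. indicator (C - B) x *\<^sub>R f1 x)" "integrable lebesgue (\<lambda>x. indicator (C - A) x *\<^sub>R f2 x)"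
    using f CA CB by (auto simp: L1_loc_def set_integrable_def)
  then have "integrable lebesgue (\<lambda>x. indicator (C - B) x *\<^sub>R f1 x + indicator (C - A) x *\<^sub>R f2 x)"
    by (rule Bochner_Integration.integrable_add)
  also have "(\<lambda>x. indicator (C - B) x *\<^sub>R f1 x + indicator (C - A) x *\<^sub>R f2 x) = (\<lambda>x. indicator C x *\<^sub>R ?f x)"
    using C AB by (intro ext) (auto split: split_indicator)
  finally show "?f absolutely_integrable_on C" by (simp add: set_integrable_def)
qed

text \<open>Each test function on the union is the sum of its two restrictions, so weak derivatives
  on the pieces glue; no compatibility condition between the two sides arises.\<close>

lemma has_weak_deriv_union:
  fixes f1 f2 :: "'a::euclidean_space \<Rightarrow> complex"
  assumes A: "open A" and B: "open B" and AB: "A \<inter> B = {}"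
    and w: "has_weak_deriv A v f1 g1" "has_weak_deriv B v f2 g2"
  shows "has_weak_deriv (A \<union> B) v (\<lambda>x. if x \<in> A then f1 x else f2 x) (\<lambda>x. if x \<in> A then g1 x else g2 x)"
  unfolding has_weak_deriv_def
proof (intro conjI allI impI)
  let ?f = "\<lambda>x. if x \<in> A then f1 x else f2 x" and ?g = "\<lambda>x. if x \<in> A then g1 x else g2 x"
  show fL: "?f \<in> L1_loc (A \<union> B)" and gL: "?g \<in> L1_loc (A \<union> B)"
    by (rule L1_loc_union[OF A B AB has_weak_derivD(1)[OF w(1)] has_weak_derivD(1)[OF w(2)]])
      (rule L1_loc_union[OF A B AB has_weak_derivD(2)[OF w(1)] has_weak_derivD(2)[OF w(2)]])
  have U: "open (A \<union> B)" using A B by auto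
  fix \<phi> :: "'a \<Rightarrow> real" assume \<phi>: "\<phi> \<in> Cc_smooth (A \<union> B)"
  then have \<phi>': "\<phi> \<in> Cc_smooth (B \<union> A)" by (simp add: Un_commute)
  have BA: "B \<inter> A = {}" using AB by auto
  note a = Cc_smooth_restrict_component[OF A B AB \<phi>] and b = Cc_smooth_restrict_component[OF B A BA \<phi>']
  have split: "(LINT x|lebesgue_on (A \<union> B). k x *\<^sub>R (if x \<in> A then h1 x else h2 x))
      = (LINT x|lebesgue_on A. (if x \<in> A then k x else 0) *\<^sub>R h1 x) + (LINT x|lebesgue_on B. (if x \<in> B then k x else 0) *\<^sub>R h2 x)"
    if i1: "integrable (lebesgue_on A) (\<lambda>x. (if x \<in> A then k x else 0) *\<^sub>R h1 x)"
      and i2: "integrable (lebesgue_on B) (\<lambda>x. (if x \<in> B then k x else 0) *\<^sub>R h2 x)" for k :: "'a \<Rightarrow> real" and h1 h2 :: "'a \<Rightarrow> complex"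
  proof -
    have "(\<lambda>x. indicator (A \<union> B) x *\<^sub>R (k x *\<^sub>R (if x \<in> A then h1 x else h2 x))) =
      (\<lambda>x. indicator A x *\<^sub>R ((if x \<in> A then k x else 0) *\<^sub>R h1 x) + indicator B x *\<^sub>R ((if x \<in> B then k x else 0) *\<^sub>R h2 x))"
      using AB by (intro ext) (auto split: split_indicator)
    then show ?thesis
      using Bochner_Integration.integral_add[OF i1[unfolded lebesgue_on_integral_eq(2)[OF A]] i2[unfolded lebesgue_on_integral_eq(2)[OF B]]]
      unfolding lebesgue_on_integral_eq(1)[OF A] lebesgue_on_integral_eq(1)[OF B] lebesgue_on_integral_eq(1)[OF U] by (simp only:)
  qed
  have ia: "integrable (lebesgue_on A) (\<lambda>x. (if x \<in> A then frechet_derivative \<phi> (at x) v else 0) *\<^sub>R f1 x)"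
    using Cc_smooth_mult_integrable[OF A has_weak_derivD(1)[OF w(1)] Cc_smooth_deriv[OF a(1), of v]] unfolding a(2) .
  have ib: "integrable (lebesgue_on B) (\<lambda>x. (if x \<in> B then frechet_derivative \<phi> (at x) v else 0) *\<^sub>R f2 x)"
    using Cc_smooth_mult_integrable[OF B has_weak_derivD(1)[OF w(2)] Cc_smooth_deriv[OF b(1), of v]] unfolding b(2) .
  have "(LINT x|lebesgue_on (A \<union> B). frechet_derivative \<phi> (at x) v *\<^sub>R ?f x)
    = (LINT x|lebesgue_on A. (if x \<in> A then frechet_derivative \<phi> (at x) v else 0) *\<^sub>R f1 x)
     + (LINT x|lebesgue_on B. (if x \<in> B then frechet_derivative \<phi> (at x) v else 0) *\<^sub>R f2 x)"
    by (rule split[OF ia ib])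
  also have "\<dots> = - (LINT x|lebesgue_on A. (if x \<in> A then \<phi> x else 0) *\<^sub>R g1 x) - (LINT x|lebesgue_on B. (if x \<in> B then \<phi> x else 0) *\<^sub>R g2 x)"
    using has_weak_derivD(3)[OF w(1) a(1)] has_weak_derivD(3)[OF w(2) b(1)] unfolding a(2) b(2) by simp
  also have "\<dots> = - (LINT x|lebesgue_on (A \<union> B). \<phi> x *\<^sub>R ?g x)"
    unfolding split[OF Cc_smooth_mult_integrable[OF A has_weak_derivD(2)[OF w(1)] a(1)] Cc_smooth_mult_integrable[OF B has_weak_derivD(2)[OF w(2)] b(1)]]
    by simp
  finally show "(LINT x|lebesgue_on (A \<union> B). frechet_derivative \<phi> (at x) v *\<^sub>R ?f x) = - (LINT x|lebesgue_on (A \<union> B). \<phi> x *\<^sub>R ?g x)" .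
qed

section \<open>Geometry of the square and its triangles\<close>

lemma Delta_iff:
  "(s, t) \<in> Delta_plus T \<longleftrightarrow> 0 < s \<and> s < t \<and> t < T"
  "(s, t) \<in> Delta_minus T \<longleftrightarrow> 0 < t \<and> t < s \<and> s < T"
  "(s, t) \<in> square T \<longleftrightarrow> 0 < s \<and> s < T \<and> 0 < t \<and> t < T"
  by (auto simp: Delta_plus_def Delta_minus_def square_def)

text \<open>As intersections of open half-spaces the three sets are open and convex at once, which
  is what the mollifier asks for.\<close>

lemma Delta_halfspaces:
  "Delta_plus T = {p. (-1, 0) \<bullet> p < 0} \<inter> {p. (1, -1) \<bullet> p < 0} \<inter> {p. (0, 1) \<bullet> p < T}"
  "Delta_minus T = {p. (0, -1) \<bullet> p < 0} \<inter> {p. (-1, 1) \<bullet> p < 0} \<inter> {p. (1, 0) \<bullet> p < T}"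
  "square T = {p. (-1, 0) \<bullet> p < 0} \<inter> {p. (1, 0) \<bullet> p < T} \<inter> {p. (0, -1) \<bullet> p < 0} \<inter> {p. (0, 1) \<bullet> p < T}"
  by (auto simp: Delta_iff inner_prod_def)

lemma Delta_open_convex:
  "open (Delta_plus T)" "open (Delta_minus T)" "open (square T)"
  "convex (Delta_plus T)" "convex (Delta_minus T)" "convex (square T)"
  unfolding Delta_halfspaces by (intro open_Int convex_Int open_halfspace_lt convex_halfspace_lt)+

lemma Delta_subset_square: "Delta_plus T \<subseteq> square T" "Delta_minus T \<subseteq> square T"
  by (auto simp: Delta_plus_def Delta_minus_def)

lemma Delta_disjoint: "Delta_plus T \<inter> Delta_minus T = {}"
  by (auto simp: Delta_plus_def Delta_minus_def)

lemma square_bounded: "bounded (square T)"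
  unfolding square_def by (intro bounded_Times) auto

lemma closure_convex_combI:
  fixes S :: "'a::euclidean_space set"
  assumes "\<And>e. 0 < e \<Longrightarrow> e \<le> 1 \<Longrightarrow> (1 - e) *\<^sub>R p + e *\<^sub>R c \<in> S"
  shows "p \<in> closure S"
  unfolding closure_sequential
proof (intro exI conjI allI)
  let ?e = "\<lambda>n. 1 / real (Suc n)"
  show "(1 - ?e n) *\<^sub>R p + ?e n *\<^sub>R c \<in> S" for n by (rule assms) auto
  have "(\<lambda>n. (1 - ?e n) *\<^sub>R p + ?e n *\<^sub>R c) \<longlonglongrightarrow> (1 - 0) *\<^sub>R p + 0 *\<^sub>R c"
    by (intro tendsto_intros LIMSEQ_Suc[OF lim_1_over_n])
  then show "(\<lambda>n. (1 - ?e n) *\<^sub>R p + ?e n *\<^sub>R c) \<longlonglongrightarrow> p" by simp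
qed

lemma convex_comb_less:
  fixes a b c d e :: real
  assumes "a \<le> b" "c < d" "0 < e" "e \<le> 1"
  shows "(1 - e) * a + e * c < (1 - e) * b + e * d"
  using assms by (intro add_le_less_mono mult_left_mono mult_strict_left_mono) auto

lemma Delta_plus_closure:
  assumes T: "T > 0" and st: "0 \<le> s" "s \<le> t" "t \<le> T"
  shows "(s, t) \<in> closure (Delta_plus T)"
\<comment> \<open>Segments from a point of the closed triangle towards the centroid run inside the
  open triangle.\<close>
proof (rule closure_convex_combI[where c="(T/3, 2*T/3)"])
  fix e :: real assume e: "0 < e" "e \<le> 1"
  have "(1 - e) * 0 + e * 0 < (1 - e) * s + e * (T/3)"
    "(1 - e) * s + e * (T/3) < (1 - e) * t + e * (2*T/3)"
    "(1 - e) * t + e * (2*T/3) < (1 - e) * T + e * T"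
    using T st e by (intro convex_comb_less; simp)+
  then show "(1 - e) *\<^sub>R (s, t) + e *\<^sub>R (T/3, 2*T/3) \<in> Delta_plus T"
    by (simp add: Delta_iff algebra_simps)
qed

lemma Delta_minus_closure:
  assumes T: "T > 0" and st: "0 \<le> t" "t \<le> s" "s \<le> T"
  shows "(s, t) \<in> closure (Delta_minus T)"
proof (rule closure_convex_combI[where c="(2*T/3, T/3)"])
  fix e :: real assume e: "0 < e" "e \<le> 1"
  have "(1 - e) * 0 + e * 0 < (1 - e) * t + e * (T/3)"
    "(1 - e) * t + e * (T/3) < (1 - e) * s + e * (2*T/3)"
    "(1 - e) * s + e * (2*T/3) < (1 - e) * T + e * T"
    using T st e by (intro convex_comb_less; simp)+
  then show "(1 - e) *\<^sub>R (s, t) + e *\<^sub>R (2*T/3, T/3) \<in> Delta_minus T"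
    by (simp add: Delta_iff algebra_simps)
qed

lemma Delta_nonempty: "T > 0 \<Longrightarrow> Delta_plus T \<noteq> {}" "T > 0 \<Longrightarrow> Delta_minus T \<noteq> {}" "T > 0 \<Longrightarrow> square T \<noteq> {}"
  using Delta_plus_closure[of T 0 0] Delta_minus_closure[of T 0 0] Delta_subset_square[of T] by (auto simp: subset_empty)

lemma Basis_real_prod: "Basis = {(1, 0), (0, 1) :: real \<times> real}"
  by (auto simp: Basis_prod_def)

lemma Wkinf_1_D:
  assumes "f \<in> Wkinf (Suc 0) S"
  shows "f \<in> Linf S" "i \<in> Basis \<Longrightarrow> \<exists>g\<in>Linf S. has_weak_deriv S i f g"
  using assms by auto

lemma Wkinf_2_D:
  assumes "f \<in> Wkinf 2 S"
  shows "f \<in> Linf S" "i \<in> Basis \<Longrightarrow> \<exists>g\<in>Wkinf (Suc 0) S. has_weak_deriv S i f g"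
  using assms by (auto simp: numeral_2_eq_2)

text \<open>\<open>d12_norm\<close> refers to derivatives chosen on the union of the triangles,
  while the estimates work with hp and hm on each of them. Gluing and uniqueness identify the two
  almost everywhere, so the norm on the union bounds both.\<close>

lemma mixed_deriv_bound:
  assumes T: "T > 0"
    and wp: "has_weak_deriv (Delta_plus T) (0, 1) chi gp" "has_weak_deriv (Delta_plus T) (1, 0) gp hp" "hp \<in> Linf (Delta_plus T)"
    and wm: "has_weak_deriv (Delta_minus T) (0, 1) chi gm" "has_weak_deriv (Delta_minus T) (1, 0) gm hm" "hm \<in> Linf (Delta_minus T)"
  shows "LinfB (Delta_plus T) hp (max 0 (d12_norm T chi))" "LinfB (Delta_minus T) hm (max 0 (d12_norm T chi))"
    "d12_norm T chi \<ge> 0"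
proof -
  let ?A = "Delta_plus T" and ?B = "Delta_minus T"
  let ?S = "?A \<union> ?B"
  note oA = Delta_open_convex(1)[of T] and oB = Delta_open_convex(2)[of T]
  have oS: "open ?S" using oA oB by auto
  define g h where "g = (\<lambda>x. if x \<in> ?A then gp x else gm x)" and "h = (\<lambda>x. if x \<in> ?A then hp x else hm x)"
  have "has_weak_deriv ?S (0, 1) (\<lambda>x. if x \<in> ?A then chi x else chi x) g"
    unfolding g_def by (rule has_weak_deriv_union[OF oA oB Delta_disjoint wp(1) wm(1)])
  then have g: "has_weak_deriv ?S (0, 1) chi g" by simp
  have h: "has_weak_deriv ?S (1, 0) g h"
    unfolding g_def h_def by (rule has_weak_deriv_union[OF oA oB Delta_disjoint wp(2) wm(2)])
  note g' = weak_deriv_works[OF g]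
  have "AE x in lebesgue_on ?S. g x = d2 ?S chi x" by (rule has_weak_deriv_unique[OF oS g g']) simp
  then have "has_weak_deriv ?S (1, 0) (d2 ?S chi) h"
    by (rule has_weak_deriv_cong[OF oS h has_weak_derivD(2)[OF g']])
  note h' = weak_deriv_works[OF this]
  define H where "H = d1 ?S (d2 ?S chi)"
  have hH: "AE x in lebesgue_on ?S. h x = H x"
    unfolding H_def by (rule has_weak_deriv_unique[OF oS \<open>has_weak_deriv ?S (1, 0) (d2 ?S chi) h\<close> h']) simp
  have LB: "LinfB ?A hp (max 0 (Linf_norm ?A hp))" "LinfB ?B hm (max 0 (Linf_norm ?B hm))"
    using Linf_norm_bound wp(3) wm(3) by auto
  have hm': "h \<in> borel_measurable (lebesgue_on ?S)"
  proof -
    have "(\<lambda>x. indicator ?A x *\<^sub>R hp x + indicator ?B x *\<^sub>R hm x) \<in> borel_measurable lebesgue"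
      using LB unfolding LinfB_def lebesgue_on_integral_eq(3)[OF oA] lebesgue_on_integral_eq(3)[OF oB] by (intro borel_measurable_add) auto
    also have "(\<lambda>x. indicator ?A x *\<^sub>R hp x + indicator ?B x *\<^sub>R hm x) = (\<lambda>x. indicator ?S x *\<^sub>R h x)"
      using Delta_disjoint[of T] by (intro ext) (auto simp: h_def split: split_indicator)
    finally show ?thesis unfolding lebesgue_on_integral_eq(3)[OF oS] .
  qed
  have Hm: "H \<in> borel_measurable (lebesgue_on ?S)"
    by (rule lebesgue_on_measurable_AE_cong[OF oS hm']) (use hH in \<open>eventually_elim, simp\<close>)
  let ?C = "max (max 0 (Linf_norm ?A hp)) (max 0 (Linf_norm ?B hm))"
  have "AE x in lebesgue_on ?S. cmod (H x) \<le> ?C"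
    unfolding lebesgue_on_integral_eq(4)[OF oS]
  proof -
    have "AE x in lebesgue. x \<in> ?A \<longrightarrow> cmod (hp x) \<le> max 0 (Linf_norm ?A hp)"
      "AE x in lebesgue. x \<in> ?B \<longrightarrow> cmod (hm x) \<le> max 0 (Linf_norm ?B hm)"
      "AE x in lebesgue. x \<in> ?S \<longrightarrow> h x = H x"
      using LB hH unfolding LinfB_def lebesgue_on_integral_eq(4)[OF oA] lebesgue_on_integral_eq(4)[OF oB] lebesgue_on_integral_eq(4)[OF oS] by blast+
    then show "AE x in lebesgue. x \<in> ?S \<longrightarrow> cmod (H x) \<le> ?C"
    proof eventually_elim
      case (elim x)
      show ?case
      proof
        assume "x \<in> ?S"
        moreover from this have "x \<in> ?A \<or> x \<in> ?B \<and> x \<notin> ?A" by blast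
        ultimately have "h x = H x" "(x \<in> ?A \<and> h x = hp x) \<or> (x \<in> ?B \<and> h x = hm x)"
          using elim(3) by (auto simp: h_def)
        then show "cmod (H x) \<le> ?C" using elim(1,2) by (metis le_max_iff_disj)
      qed
    qed
  qed
  then have HL: "H \<in> Linf ?S" using Hm by (intro LinfB_imp_Linf[of _ _ ?C]) (auto simp: LinfB_def)
  have d12: "d12_norm T chi = Linf_norm ?S H" by (simp add: d12_norm_def H_def Let_def)
  have HB: "AE x in lebesgue_on ?S. cmod (H x) \<le> max 0 (d12_norm T chi)"
    using Linf_norm_bound[OF HL] unfolding d12 by (simp add: LinfB_def)
  show "LinfB ?A hp (max 0 (d12_norm T chi))"
    unfolding LinfB_def
  proof (intro conjI)
    show "AE x in lebesgue_on ?A. cmod (hp x) \<le> max 0 (d12_norm T chi)"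
      using hH HB unfolding lebesgue_on_integral_eq(4)[OF oA] lebesgue_on_integral_eq(4)[OF oS]
      by eventually_elim (auto simp: h_def)
  qed (use LB in \<open>auto simp: LinfB_def\<close>)
  show "LinfB ?B hm (max 0 (d12_norm T chi))"
    unfolding LinfB_def
  proof (intro conjI)
    show "AE x in lebesgue_on ?B. cmod (hm x) \<le> max 0 (d12_norm T chi)"
      using hH HB unfolding lebesgue_on_integral_eq(4)[OF oB] lebesgue_on_integral_eq(4)[OF oS]
    proof eventually_elim
      case (elim x)
      show ?case
      proof
        assume x: "x \<in> ?B"
        moreover from x have "x \<notin> ?A" using Delta_disjoint[of T] by blast
        ultimately show "cmod (hm x) \<le> max 0 (d12_norm T chi)" using elim by (simp add: h_def)
      qed
    qed
  qed (use LB in \<open>auto simp: LinfB_def\<close>)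
  show "d12_norm T chi \<ge> 0"
  proof (cases "Linf_norm ?S H \<ge> 0")
    case True
    then show ?thesis by (simp add: d12)
  next
    \<comment> \<open>A negative essential supremum of an absolute value would make the union of the
      triangles a null set, but it is open and nonempty.\<close>
    case False
    let ?e = "esssup (lebesgue_on ?S) (\<lambda>x. ereal (cmod (H x)))"
    have e: "?e < 0" using False by (cases ?e) (auto simp: Linf_norm_def)
    have "AE x in lebesgue_on ?S. ereal (cmod (H x)) \<le> ?e" by (rule esssup_AE)
    then have "AE x in lebesgue_on ?S. False"
      by eventually_elim (use e in \<open>auto dest: order_le_less_trans\<close>)
    then have "AE x in lebesgue. x \<notin> ?S" unfolding lebesgue_on_integral_eq(4)[OF oS] by simp
    then have "?S \<in> null_sets lebesgue" using oS by (subst (asm) AE_iff_null_sets[symmetric]) auto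
    then show ?thesis using open_not_negligible[OF oS] Delta_nonempty(1)[OF T] by (auto simp: negligible_iff_null_sets)
  qed
qed

section \<open>Superposition of cut-offs\<close>

text \<open>Fubini in the parameter y: a multiplier that is a c-weighted integral of indicators
  costs at most the uniform bound for single indicators times the L^1 norm of c.\<close>

lemma superposition_bound:
  fixes c :: "'y \<Rightarrow> complex" and W :: "'p::euclidean_space \<Rightarrow> complex" and P :: "'y \<Rightarrow> 'p \<Rightarrow> bool"
  assumes sf: "sigma_finite_measure N" and c: "integrable N c" and W: "integrable lborel W"
    and P: "{q \<in> space (N \<Otimes>\<^sub>M lborel). P (fst q) (snd q)} \<in> sets (N \<Otimes>\<^sub>M lborel)"
    and B: "\<And>y. cmod (LINT p|lborel. of_bool (P y p) * W p) \<le> B"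
  shows "cmod (LINT p|lborel. (LINT y|N. c y * of_bool (P y p)) * W p) \<le> B * (LINT y|N. cmod (c y))"
    "integrable lborel (\<lambda>p. (LINT y|N. c y * of_bool (P y p)) * W p)"
proof -
  interpret N: sigma_finite_measure N by fact
  interpret NL: pair_sigma_finite N "lborel :: 'p measure" by standard
  have [measurable]: "(\<lambda>q. of_bool (P (fst q) (snd q)) :: complex) \<in> borel_measurable (N \<Otimes>\<^sub>M lborel)"
    unfolding of_bool_def using P by (intro measurable_If) auto
  have [measurable]: "c \<in> borel_measurable N" "W \<in> borel_measurable borel" using c W by auto
  have "integrable (N \<Otimes>\<^sub>M lborel) (\<lambda>(y, p). c y * W p)"
    using c W by (intro NL.Fubini_integrable) (auto simp: norm_mult)
  then have i: "integrable (N \<Otimes>\<^sub>M lborel) (\<lambda>(y, p). c y * of_bool (P y p) * W p)"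
  proof (rule Bochner_Integration.integrable_bound)
    show "(\<lambda>(y, p). c y * of_bool (P y p) * W p) \<in> borel_measurable (N \<Otimes>\<^sub>M lborel)"
      unfolding split_beta by measurable
  qed (auto simp: norm_mult)
  have eq1: "(LINT y|N. c y * of_bool (P y p)) * W p = (LINT y|N. c y * of_bool (P y p) * W p)" for p
    by (rule integral_mult_left_zero[symmetric])
  have eq2: "(LINT p|lborel. c y * of_bool (P y p) * W p) = c y * (LINT p|lborel. of_bool (P y p) * W p)" for y
    unfolding mult.assoc by (rule integral_mult_right_zero)
  have eq: "(LINT p|lborel. (LINT y|N. c y * of_bool (P y p)) * W p) = (LINT y|N. (LINT p|lborel. c y * of_bool (P y p) * W p))"
    unfolding eq1 by (rule NL.Fubini_integral[OF i])
  show "integrable lborel (\<lambda>p. (LINT y|N. c y * of_bool (P y p)) * W p)"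
    unfolding eq1 by (rule NL.integrable_snd[OF i])
  have "cmod (LINT y|N. (LINT p|lborel. c y * of_bool (P y p) * W p)) \<le> (LINT y|N. cmod (LINT p|lborel. c y * of_bool (P y p) * W p))"
    by (rule integral_norm_bound)
  also have "\<dots> \<le> (LINT y|N. B * cmod (c y))"
  proof (rule integral_mono)
    show "integrable N (\<lambda>y. cmod (LINT p|lborel. c y * of_bool (P y p) * W p))"
      using NL.integrable_fst[OF i] by (rule integrable_norm)
    show "cmod (LINT p|lborel. c y * of_bool (P y p) * W p) \<le> B * cmod (c y)" for y
      unfolding eq2 norm_mult using B[of y] by (subst mult.commute) (rule mult_right_mono, auto)
  qed (use c in auto)
  finally show "cmod (LINT p|lborel. (LINT y|N. c y * of_bool (P y p)) * W p) \<le> B * (LINT y|N. cmod (c y))"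
    unfolding eq by simp
qed

lemma AE_lborel_fst:
  assumes "AE x in lborel. P x"
  shows "AE p in (lborel :: (real \<times> real) measure). P (fst p)"
proof -
  obtain N where N: "N \<in> null_sets lborel" "{x. \<not> P x} \<subseteq> N"
    using assms by (auto simp: eventually_ae_filter)
  have "N \<times> UNIV \<in> null_sets (lborel \<Otimes>\<^sub>M (lborel :: real measure))"
    using null_setsD1[OF N(1)] null_setsD2[OF N(1)] by (intro null_setsI) (auto simp: lborel.emeasure_pair_measure_Times)
  then have "N \<times> (UNIV :: real set) \<in> null_sets lborel" by (simp add: lborel_prod)
  then have "AE p in lborel. p \<notin> N \<times> (UNIV :: real set)" by (rule AE_not_in)
  then show ?thesis by eventually_elim (use N(2) in auto)
qed

lemma AE_lborel_snd:
  assumes "AE x in lborel. P x"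
  shows "AE p in (lborel :: (real \<times> real) measure). P (snd p)"
proof -
  obtain N where N: "N \<in> null_sets lborel" "{x. \<not> P x} \<subseteq> N"
    using assms by (auto simp: eventually_ae_filter)
  have "UNIV \<times> N \<in> null_sets ((lborel :: real measure) \<Otimes>\<^sub>M lborel)"
    using null_setsD1[OF N(1)] null_setsD2[OF N(1)] by (intro null_setsI) (auto simp: lborel.emeasure_pair_measure_Times)
  then have "(UNIV :: real set) \<times> N \<in> null_sets lborel" by (simp add: lborel_prod)
  then have "AE p in lborel. p \<notin> (UNIV :: real set) \<times> N" by (rule AE_not_in)
  then show ?thesis by eventually_elim (use N(2) in auto)
qed

lemma L2_borel_version:
  fixes u :: "'a::euclidean_space \<Rightarrow> complex"
  assumes S: "open S" and u: "u \<in> L2 S"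
  obtains u' where "u' \<in> borel_measurable borel" "AE x in lborel. indicator S x *\<^sub>R u x = u' x"
    "integrable lborel (\<lambda>x. (cmod (u' x))\<^sup>2)"
proof -
  have um: "(\<lambda>x. indicator S x *\<^sub>R u x) \<in> borel_measurable lebesgue"
    using u unfolding L2_def lebesgue_on_integral_eq(3)[OF S, symmetric] by auto
  have ui: "integrable lebesgue (\<lambda>x. indicator S x *\<^sub>R (cmod (u x))\<^sup>2)"
    using u unfolding L2_def lebesgue_on_integral_eq(2)[OF S, symmetric] by auto
  obtain u' where u': "u' \<in> borel_measurable borel" "AE x in lborel. indicator S x *\<^sub>R u x = u' x"
    by (rule lebesgue_borel_version[OF um])
  have m: "(\<lambda>x. (cmod (u' x))\<^sup>2) \<in> borel_measurable borel" using u'(1) by measurable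
  have "AE x in lebesgue. indicator S x *\<^sub>R (cmod (u x))\<^sup>2 = (cmod (u' x))\<^sup>2"
    using AE_completion[OF u'(2)]
  proof eventually_elim
    case (elim x)
    show ?case unfolding elim[symmetric] by (auto split: split_indicator)
  qed
  then have "integrable lebesgue (\<lambda>x. (cmod (u' x))\<^sup>2)"
    by (rule integrable_cong_AE_imp[OF ui borel_imp_lebesgue_measurable[OF m]])
  then have "integrable lborel (\<lambda>x. (cmod (u' x))\<^sup>2)" using m by (subst (asm) integrable_completion) auto
  with u' show thesis by (rule that)
qed

text \<open>K and the product of u(s) with conj v(t) are both square integrable over the square, so
  their product is integrable. All further estimates concern this one Borel function W and the
  multipliers in front of it.\<close>

lemma kernel_borel_version:
  assumes K: "K \<in> L2 (square T)" and u: "u \<in> L2 {0<..<T}" and v: "v \<in> L2 {0<..<T}"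
  obtains W where "integrable lborel W" "\<And>p. p \<notin> square T \<Longrightarrow> W p = 0"
    "AE p in lborel. p \<in> square T \<longrightarrow> K p * u (fst p) * cnj (v (snd p)) = W p"
proof -
  have I: "open {0<..<T}" by simp
  note sq = Delta_open_convex(3)[of T]
  obtain K' where K': "K' \<in> borel_measurable borel" "AE p in lborel. indicator (square T) p *\<^sub>R K p = K' p"
    "integrable lborel (\<lambda>p. (cmod (K' p))\<^sup>2)" by (rule L2_borel_version[OF sq K])
  obtain u' where u': "u' \<in> borel_measurable borel" "AE x in lborel. indicator {0<..<T} x *\<^sub>R u x = u' x"
    "integrable lborel (\<lambda>x. (cmod (u' x))\<^sup>2)" by (rule L2_borel_version[OF I u])
  obtain v' where v': "v' \<in> borel_measurable borel" "AE x in lborel. indicator {0<..<T} x *\<^sub>R v x = v' x"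
    "integrable lborel (\<lambda>x. (cmod (v' x))\<^sup>2)" by (rule L2_borel_version[OF I v])
  note [measurable] = K'(1) u'(1) v'(1)
  define W where "W p = indicator (square T) p *\<^sub>R (K' p * (u' (fst p) * cnj (v' (snd p))))" for p
  have [measurable]: "square T \<in> sets borel" using sq by simp
  have "(fst :: real \<times> real \<Rightarrow> real) \<in> borel_measurable borel" "(snd :: real \<times> real \<Rightarrow> real) \<in> borel_measurable borel"
    by (auto intro!: borel_measurable_continuous_onI continuous_intros)
  from measurable_compose[OF this(1) u'(1)] measurable_compose[OF this(2) v'(1)]
  have [measurable]: "(\<lambda>p :: real \<times> real. u' (fst p)) \<in> borel_measurable borel" "(\<lambda>p :: real \<times> real. v' (snd p)) \<in> borel_measurable borel" .
  have Wm: "W \<in> borel_measurable borel" unfolding W_def by measurable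
  have "integrable (lborel \<Otimes>\<^sub>M lborel) (\<lambda>(s, t). (cmod (u' s))\<^sup>2 * (cmod (v' t))\<^sup>2)"
    using u'(3) v'(3) by (intro lborel_pair.Fubini_integrable) auto
  then have uv: "integrable lborel (\<lambda>p. (cmod (u' (fst p)))\<^sup>2 * (cmod (v' (snd p)))\<^sup>2)"
    by (simp add: lborel_prod case_prod_beta')
  show thesis
  proof
    show "W p = 0" if "p \<notin> square T" for p using that by (simp add: W_def)
    show "integrable lborel W"
    proof (rule Bochner_Integration.integrable_bound)
      show "integrable lborel (\<lambda>p. (cmod (K' p))\<^sup>2 + (cmod (u' (fst p)))\<^sup>2 * (cmod (v' (snd p)))\<^sup>2)"
        using K'(3) uv by (rule Bochner_Integration.integrable_add)
      show "AE p in lborel. norm (W p) \<le> norm ((cmod (K' p))\<^sup>2 + (cmod (u' (fst p)))\<^sup>2 * (cmod (v' (snd p)))\<^sup>2)"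
      proof (rule AE_I2)
        fix p
        let ?a = "cmod (K' p)" and ?b = "cmod (u' (fst p)) * cmod (v' (snd p))"
        have "norm (W p) \<le> ?a * ?b" by (simp add: W_def norm_mult split: split_indicator)
        also have "\<dots> \<le> ?a\<^sup>2 + ?b\<^sup>2"
        proof -
          have "0 \<le> ?a * ?b" by simp
          with sum_squares_bound[of ?a ?b] show ?thesis unfolding mult.assoc by linarith
        qed
        finally show "norm (W p) \<le> norm ((cmod (K' p))\<^sup>2 + (cmod (u' (fst p)))\<^sup>2 * (cmod (v' (snd p)))\<^sup>2)"
          by (simp add: power_mult_distrib)
      qed
    qed (use Wm in simp)
    show "AE p in lborel. p \<in> square T \<longrightarrow> K p * u (fst p) * cnj (v (snd p)) = W p"
      using K'(2) AE_lborel_fst[OF u'(2)] AE_lborel_snd[OF v'(2)]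
    proof eventually_elim
      case (elim p)
      show ?case
      proof
        assume p: "p \<in> square T"
        then have "fst p \<in> {0<..<T}" "snd p \<in> {0<..<T}" by (auto simp: square_def)
        with p elim show "K p * u (fst p) * cnj (v (snd p)) = W p" by (simp add: W_def mult.assoc)
      qed
    qed
  qed
qed

text \<open>Turns a form with modified entries into an integral of a multiplier m against W: m is an
  indicator when u and v are cut off, and the continuous representative of \<chi>, split over the
  triangles, for the final form.\<close>

lemma kernel_form_eq:
  assumes W: "integrable lborel W" "\<And>p. p \<notin> square T \<Longrightarrow> W p = 0"
    and m: "m \<in> borel_measurable borel"
    and eq: "AE p in lborel. p \<in> square T \<longrightarrow> K p * u (fst p) * cnj (v (snd p)) = m p * W p"
  shows "kernel_form T K u v = (LINT p|lborel. m p * W p)"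
proof -
  note sq = Delta_open_convex(3)[of T]
  have Wm: "W \<in> borel_measurable borel" using W by auto
  have mWm: "(\<lambda>p. m p * W p) \<in> borel_measurable borel" using m Wm by measurable
  have "kernel_form T K u v = (LINT p|lebesgue_on (square T). K p * u (fst p) * cnj (v (snd p)))"
    unfolding kernel_form_def by (intro Bochner_Integration.integral_cong refl) (auto split: prod.split)
  also have "\<dots> = (LINT p|lebesgue. indicator (square T) p *\<^sub>R (K p * u (fst p) * cnj (v (snd p))))"
    by (rule lebesgue_on_integral_eq(1)[OF sq])
  also have "\<dots> = (LINT p|lebesgue. m p * W p)"
  proof -
    have AE: "AE p in lebesgue. indicator (square T) p *\<^sub>R (K p * u (fst p) * cnj (v (snd p))) = m p * W p"
      using AE_completion[OF eq] by eventually_elim (auto simp: W(2) split: split_indicator)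
    show ?thesis
      by (rule integral_cong_AE[OF lebesgue_measurable_AE_cong[OF borel_imp_lebesgue_measurable[OF mWm] AE] borel_imp_lebesgue_measurable[OF mWm] AE])
  qed
  also have "\<dots> = (LINT p|lborel. m p * W p)" by (rule integral_completion) (use mWm in simp)
  finally show ?thesis .
qed

section \<open>The multiplier as an integral over cut-off points\<close>

lemma integral_tau:
  fixes g :: "real \<Rightarrow> complex"
  assumes st: "0 \<le> s" "t \<le> T" and [measurable]: "g \<in> borel_measurable borel"
  shows "(LINT \<tau>|lborel. indicator {0..T} \<tau> *\<^sub>R g \<tau> * of_bool (s \<le> \<tau> \<and> \<tau> < t)) = (LINT \<tau>|lborel. indicator {s..t} \<tau> *\<^sub>R g \<tau>)"
proof (rule integral_cong_AE)
  have "AE \<tau> in lborel. \<tau> \<noteq> t" by (rule AE_lborel_singleton)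
  then show "AE \<tau> in lborel. indicator {0..T} \<tau> *\<^sub>R g \<tau> * of_bool (s \<le> \<tau> \<and> \<tau> < t) = indicator {s..t} \<tau> *\<^sub>R g \<tau>"
    by eventually_elim (use st in \<open>auto split: split_indicator\<close>)
qed auto

text \<open>In both orientations the inner integral runs in the first coordinate, so that it can be
  evaluated when K is the s-derivative of the t-derivative.\<close>

lemma integral_triangle:
  fixes K :: "real \<times> real \<Rightarrow> complex"
  assumes K: "continuous_on UNIV K"
  shows "integrable lborel (\<lambda>q. indicator {q. a \<le> fst q \<and> fst q \<le> snd q \<and> snd q \<le> b} q *\<^sub>R K q)"
    "(LINT q|lborel. indicator {q. a \<le> fst q \<and> fst q \<le> snd q \<and> snd q \<le> b} q *\<^sub>R K q)
     = (LINT \<tau>|lborel. indicator {a..b} \<tau> *\<^sub>R (LINT \<sigma>|lborel. indicator {a..\<tau>} \<sigma> *\<^sub>R K (\<sigma>, \<tau>)))"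
    "integrable lborel (\<lambda>q. indicator {q. a \<le> snd q \<and> snd q \<le> fst q \<and> fst q \<le> b} q *\<^sub>R K q)"
    "(LINT q|lborel. indicator {q. a \<le> snd q \<and> snd q \<le> fst q \<and> fst q \<le> b} q *\<^sub>R K q)
     = (LINT \<tau>|lborel. indicator {a..b} \<tau> *\<^sub>R (LINT \<sigma>|lborel. indicator {\<tau>..b} \<sigma> *\<^sub>R K (\<sigma>, \<tau>)))"
proof -
  have Ki: "set_integrable lborel D K" if "compact D" for D
    unfolding set_integrable_def by (rule borel_integrable_compact[OF that continuous_on_subset[OF K subset_UNIV]])
  have bd: "D \<subseteq> cbox (a, a) (b, b) \<Longrightarrow> closed D \<Longrightarrow> compact D" for D :: "(real \<times> real) set"
    using bounded_cbox bounded_subset compact_eq_bounded_closed by metis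
  let ?D1 = "{q :: real \<times> real. a \<le> fst q \<and> fst q \<le> snd q \<and> snd q \<le> b}"
  let ?D2 = "{q :: real \<times> real. a \<le> snd q \<and> snd q \<le> fst q \<and> fst q \<le> b}"
  have "compact ?D1" "compact ?D2"
    by (intro bd closed_Collect_conj closed_Collect_le continuous_intros; auto simp: cbox_Pair_eq)+
  then show i: "integrable lborel (\<lambda>q. indicator ?D1 q *\<^sub>R K q)" "integrable lborel (\<lambda>q. indicator ?D2 q *\<^sub>R K q)"
    using Ki by (simp_all add: set_integrable_def)
  have F: "(LINT q|lborel. f q) = (LINT \<tau>|lborel. (LINT \<sigma>|lborel. f (\<sigma>, \<tau>)))" if "integrable lborel f" for f :: "real \<times> real \<Rightarrow> complex"
    using lborel_pair.integral_snd[of "\<lambda>x y. f (x, y)"] that by (simp add: lborel_prod)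
  have ind1: "indicator ?D1 (\<sigma>, \<tau>) *\<^sub>R K (\<sigma>, \<tau>) = indicator {a..b} \<tau> *\<^sub>R (indicator {a..\<tau>} \<sigma> *\<^sub>R K (\<sigma>, \<tau>))"
    and ind2: "indicator ?D2 (\<sigma>, \<tau>) *\<^sub>R K (\<sigma>, \<tau>) = indicator {a..b} \<tau> *\<^sub>R (indicator {\<tau>..b} \<sigma> *\<^sub>R K (\<sigma>, \<tau>))" for \<sigma> \<tau>
    by (auto split: split_indicator)
  show "(LINT q|lborel. indicator ?D1 q *\<^sub>R K q) = (LINT \<tau>|lborel. indicator {a..b} \<tau> *\<^sub>R (LINT \<sigma>|lborel. indicator {a..\<tau>} \<sigma> *\<^sub>R K (\<sigma>, \<tau>)))"
    unfolding F[OF i(1)] ind1 integral_scaleR_right ..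
  show "(LINT q|lborel. indicator ?D2 q *\<^sub>R K q) = (LINT \<tau>|lborel. indicator {a..b} \<tau> *\<^sub>R (LINT \<sigma>|lborel. indicator {\<tau>..b} \<sigma> *\<^sub>R K (\<sigma>, \<tau>)))"
    unfolding F[OF i(2)] ind2 integral_scaleR_right ..
qed

lemma FTC_lborel:
  fixes F f :: "real \<Rightarrow> complex"
  assumes "a \<le> b" "\<And>x. a \<le> x \<Longrightarrow> x \<le> b \<Longrightarrow> (F has_vector_derivative f x) (at x)" "continuous_on {a..b} f"
  shows "(LINT x|lborel. indicator {a..b} x *\<^sub>R f x) = F b - F a"
  by (rule integral_FTC_Icc[OF assms(1) has_vector_derivative_at_within[OF assms(2)] assms(3)])

text \<open>The fundamental theorem in t expresses the left side by G(s, \<tau>); in s it replaces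
  G(s, \<tau>) by its diagonal value minus an integral of K. The factor c is the 1 - \<delta> that
  each derivative of a mollification carries, so the second term has c^2.\<close>

lemma plus_representation:
  fixes X G K :: "real \<times> real \<Rightarrow> complex" and c :: real
  assumes st: "0 \<le> s" "s \<le> t" "t \<le> T"
    and G: "continuous_on UNIV G" and K: "continuous_on UNIV K"
    and X': "\<And>s t. 0 \<le> s \<Longrightarrow> s \<le> t \<Longrightarrow> t \<le> T \<Longrightarrow> ((\<lambda>t. X (s, t)) has_vector_derivative c *\<^sub>R G (s, t)) (at t)"
    and G': "\<And>s t. 0 \<le> s \<Longrightarrow> s \<le> t \<Longrightarrow> t \<le> T \<Longrightarrow> ((\<lambda>s. G (s, t)) has_vector_derivative c *\<^sub>R K (s, t)) (at s)"
  shows "X (s, t) - X (s, s) = c *\<^sub>R (LINT \<tau>|lborel. indicator {s..t} \<tau> *\<^sub>R G (\<tau>, \<tau>))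
      - c\<^sup>2 *\<^sub>R (LINT q|lborel. indicator {q. s \<le> fst q \<and> fst q \<le> snd q \<and> snd q \<le> t} q *\<^sub>R K q)"
proof -
  have cont: "continuous_on A (\<lambda>x. H (f x, g x))" if "continuous_on UNIV H" "continuous_on A f" "continuous_on A g"
    for A f g and H :: "real \<times> real \<Rightarrow> complex"
    by (rule continuous_on_compose2[OF that(1)]) (auto intro!: continuous_intros that)
  have i: "integrable lborel (\<lambda>\<tau>. indicator {s..t} \<tau> *\<^sub>R f \<tau>)" if "continuous_on {s..t} f" for f :: "real \<Rightarrow> complex"
    using borel_integrable_atLeastAtMost'[OF that] by (simp add: set_integrable_def)
  have inner: "c *\<^sub>R (LINT \<sigma>|lborel. indicator {s..\<tau>} \<sigma> *\<^sub>R K (\<sigma>, \<tau>)) = G (\<tau>, \<tau>) - G (s, \<tau>)" if "\<tau> \<in> {s..t}" for \<tau>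
  proof -
    have "(LINT \<sigma>|lborel. indicator {s..\<tau>} \<sigma> *\<^sub>R (c *\<^sub>R K (\<sigma>, \<tau>))) = G (\<tau>, \<tau>) - G (s, \<tau>)"
      using that st by (intro FTC_lborel G') (auto intro!: continuous_intros cont K)
    then show ?thesis by (simp only: scaleR_left_commute[of _ c] integral_scaleR_right)
  qed
  have "X (s, t) - X (s, s) = (LINT \<tau>|lborel. indicator {s..t} \<tau> *\<^sub>R (c *\<^sub>R G (s, \<tau>)))"
    using st by (intro FTC_lborel[symmetric] X') (auto intro!: continuous_intros cont G)
  also have "\<dots> = c *\<^sub>R (LINT \<tau>|lborel. indicator {s..t} \<tau> *\<^sub>R G (s, \<tau>))"
    by (simp only: scaleR_left_commute[of _ c] integral_scaleR_right)
  finally have 1: "X (s, t) - X (s, s) = c *\<^sub>R (LINT \<tau>|lborel. indicator {s..t} \<tau> *\<^sub>R G (s, \<tau>))" .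
  have "c *\<^sub>R (LINT q|lborel. indicator {q. s \<le> fst q \<and> fst q \<le> snd q \<and> snd q \<le> t} q *\<^sub>R K q)
    = (LINT \<tau>|lborel. indicator {s..t} \<tau> *\<^sub>R (c *\<^sub>R (LINT \<sigma>|lborel. indicator {s..\<tau>} \<sigma> *\<^sub>R K (\<sigma>, \<tau>))))"
    unfolding integral_triangle(2)[OF K] by (simp only: scaleR_left_commute[of _ c] integral_scaleR_right)
  also have "\<dots> = (LINT \<tau>|lborel. indicator {s..t} \<tau> *\<^sub>R G (\<tau>, \<tau>) - indicator {s..t} \<tau> *\<^sub>R G (s, \<tau>))"
    by (intro Bochner_Integration.integral_cong refl) (auto simp: inner scaleR_diff_right split: split_indicator)
  also have "\<dots> = (LINT \<tau>|lborel. indicator {s..t} \<tau> *\<^sub>R G (\<tau>, \<tau>)) - (LINT \<tau>|lborel. indicator {s..t} \<tau> *\<^sub>R G (s, \<tau>))"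
    by (intro Bochner_Integration.integral_diff i cont G) (auto intro!: continuous_intros)
  finally have 2: "c *\<^sub>R (LINT q|lborel. indicator {q. s \<le> fst q \<and> fst q \<le> snd q \<and> snd q \<le> t} q *\<^sub>R K q) = \<dots>" .
  show ?thesis unfolding 1 power2_eq_square scaleR_scaleR[symmetric] 2 by (simp add: scaleR_diff_right)
qed

text \<open>The representation below the diagonal uses the derivative along the diagonal, which avoids
  commuting the mixed derivatives.\<close>

lemma minus_representation:
  fixes X G1 G2 K :: "real \<times> real \<Rightarrow> complex" and c :: real
  assumes st: "0 \<le> t" "t \<le> s" "s \<le> T"
    and G1: "continuous_on UNIV G1" and G2: "continuous_on UNIV G2" and K: "continuous_on UNIV K"
    and X': "\<And>s t. 0 \<le> t \<Longrightarrow> t \<le> s \<Longrightarrow> s \<le> T \<Longrightarrow> ((\<lambda>t. X (s, t)) has_vector_derivative c *\<^sub>R G2 (s, t)) (at t)"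
    and Xd: "\<And>t. 0 \<le> t \<Longrightarrow> t \<le> T \<Longrightarrow> ((\<lambda>t. X (t, t)) has_vector_derivative c *\<^sub>R (G1 (t, t) + G2 (t, t))) (at t)"
    and G': "\<And>s t. 0 \<le> t \<Longrightarrow> t \<le> s \<Longrightarrow> s \<le> T \<Longrightarrow> ((\<lambda>s. G2 (s, t)) has_vector_derivative c *\<^sub>R K (s, t)) (at s)"
  shows "X (s, t) - X (t, t) = c *\<^sub>R (LINT \<tau>|lborel. indicator {t..s} \<tau> *\<^sub>R G1 (\<tau>, \<tau>))
      - c\<^sup>2 *\<^sub>R (LINT q|lborel. indicator {q. t \<le> snd q \<and> snd q \<le> fst q \<and> fst q \<le> s} q *\<^sub>R K q)"
proof -
  have cont: "continuous_on A (\<lambda>x. H (f x, g x))" if "continuous_on UNIV H" "continuous_on A f" "continuous_on A g"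
    for A f g and H :: "real \<times> real \<Rightarrow> complex"
    by (rule continuous_on_compose2[OF that(1)]) (auto intro!: continuous_intros that)
  have i: "integrable lborel (\<lambda>\<tau>. indicator {t..s} \<tau> *\<^sub>R f \<tau>)" if "continuous_on {t..s} f" for f :: "real \<Rightarrow> complex"
    using borel_integrable_atLeastAtMost'[OF that] by (simp add: set_integrable_def)
  have inner: "c *\<^sub>R (LINT \<sigma>|lborel. indicator {\<tau>..s} \<sigma> *\<^sub>R K (\<sigma>, \<tau>)) = G2 (s, \<tau>) - G2 (\<tau>, \<tau>)" if "\<tau> \<in> {t..s}" for \<tau>
  proof -
    have "(LINT \<sigma>|lborel. indicator {\<tau>..s} \<sigma> *\<^sub>R (c *\<^sub>R K (\<sigma>, \<tau>))) = G2 (s, \<tau>) - G2 (\<tau>, \<tau>)"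
      using that st by (intro FTC_lborel G') (auto intro!: continuous_intros cont K)
    then show ?thesis by (simp only: scaleR_left_commute[of _ c] integral_scaleR_right)
  qed
  let ?I = "\<lambda>f. LINT \<tau>|lborel. indicator {t..s} \<tau> *\<^sub>R (f \<tau> :: complex)"
  have 1: "X (s, s) - X (s, t) = c *\<^sub>R ?I (\<lambda>\<tau>. G2 (s, \<tau>))"
  proof -
    have "X (s, s) - X (s, t) = ?I (\<lambda>\<tau>. c *\<^sub>R G2 (s, \<tau>))"
      using st by (intro FTC_lborel[symmetric] X') (auto intro!: continuous_intros cont G2)
    then show ?thesis by (simp only: scaleR_left_commute[of _ c] integral_scaleR_right)
  qed
  have 2: "X (s, s) - X (t, t) = c *\<^sub>R (?I (\<lambda>\<tau>. G1 (\<tau>, \<tau>)) + ?I (\<lambda>\<tau>. G2 (\<tau>, \<tau>)))"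
  proof -
    have "X (s, s) - X (t, t) = ?I (\<lambda>\<tau>. c *\<^sub>R (G1 (\<tau>, \<tau>) + G2 (\<tau>, \<tau>)))"
      using st by (intro FTC_lborel[where F="\<lambda>t. X (t, t)", symmetric] Xd) (auto intro!: continuous_intros cont G1 G2)
    also have "\<dots> = c *\<^sub>R (LINT \<tau>|lborel. indicator {t..s} \<tau> *\<^sub>R G1 (\<tau>, \<tau>) + indicator {t..s} \<tau> *\<^sub>R G2 (\<tau>, \<tau>))"
    proof -
      have "indicator {t..s} \<tau> *\<^sub>R (c *\<^sub>R (G1 (\<tau>, \<tau>) + G2 (\<tau>, \<tau>))) = c *\<^sub>R (indicator {t..s} \<tau> *\<^sub>R G1 (\<tau>, \<tau>) + indicator {t..s} \<tau> *\<^sub>R G2 (\<tau>, \<tau>))" for \<tau>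
        by (simp add: scaleR_add_right mult.commute)
      then show ?thesis by (simp only: integral_scaleR_right)
    qed
    also have "(LINT \<tau>|lborel. indicator {t..s} \<tau> *\<^sub>R G1 (\<tau>, \<tau>) + indicator {t..s} \<tau> *\<^sub>R G2 (\<tau>, \<tau>)) = ?I (\<lambda>\<tau>. G1 (\<tau>, \<tau>)) + ?I (\<lambda>\<tau>. G2 (\<tau>, \<tau>))"
      by (intro Bochner_Integration.integral_add i cont G1 G2) (auto intro!: continuous_intros)
    finally show ?thesis .
  qed
  have "c *\<^sub>R (LINT q|lborel. indicator {q. t \<le> snd q \<and> snd q \<le> fst q \<and> fst q \<le> s} q *\<^sub>R K q)
    = ?I (\<lambda>\<tau>. c *\<^sub>R (LINT \<sigma>|lborel. indicator {\<tau>..s} \<sigma> *\<^sub>R K (\<sigma>, \<tau>)))"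
    unfolding integral_triangle(4)[OF K] by (simp only: scaleR_left_commute[of _ c] integral_scaleR_right)
  also have "\<dots> = (LINT \<tau>|lborel. indicator {t..s} \<tau> *\<^sub>R G2 (s, \<tau>) - indicator {t..s} \<tau> *\<^sub>R G2 (\<tau>, \<tau>))"
    by (intro Bochner_Integration.integral_cong refl) (auto simp: inner scaleR_diff_right split: split_indicator)
  also have "\<dots> = ?I (\<lambda>\<tau>. G2 (s, \<tau>)) - ?I (\<lambda>\<tau>. G2 (\<tau>, \<tau>))"
    by (intro Bochner_Integration.integral_diff i cont G2) (auto intro!: continuous_intros)
  finally have 3: "c *\<^sub>R (LINT q|lborel. indicator {q. t \<le> snd q \<and> snd q \<le> fst q \<and> fst q \<le> s} q *\<^sub>R K q) = \<dots>" .
  \<comment> \<open>From (t, t) along the diagonal to (s, s), then down to (s, t); the integrals of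
    G2 along the two legs combine to the integral of K over the triangle.\<close>
  have "X (s, t) - X (t, t) = (X (s, s) - X (t, t)) - (X (s, s) - X (s, t))" by simp
  then show ?thesis unfolding 1 2 power2_eq_square scaleR_scaleR[symmetric] 3 by (simp add: algebra_simps)
qed

text \<open>Two superpositions: \<tau> runs over an interval of length T and q over a square of area
  T^2, and these are the L^1 norms of the two densities up to A and D.\<close>

lemma two_term_estimate:
  fixes c1 :: "real \<Rightarrow> complex" and c2 Z W :: "real \<times> real \<Rightarrow> complex"
  assumes T: "T > 0" and W: "integrable lborel W" "\<And>p. p \<notin> square T \<Longrightarrow> W p = 0"
    and c1: "c1 \<in> borel_measurable borel" "\<And>\<tau>. cmod (c1 \<tau>) \<le> A * indicator {0..T} \<tau>"
    and c2: "c2 \<in> borel_measurable borel" "\<And>q. cmod (c2 q) \<le> D * indicator (cbox (0, 0) (T, T)) q"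
    and P1: "{q. P1 (fst q) (snd q)} \<in> sets borel" and P2: "{q. P2 (fst q) (snd q)} \<in> sets borel"
    and B1: "\<And>\<tau>. cmod (LINT p|lborel. of_bool (P1 \<tau> p) * W p) \<le> B"
    and B2: "\<And>q. cmod (LINT p|lborel. of_bool (P2 q p) * W p) \<le> B"
    and Z: "\<And>p. p \<in> square T \<Longrightarrow> Z p = (LINT \<tau>|lborel. c1 \<tau> * of_bool (P1 \<tau> p)) - (LINT q|lborel. c2 q * of_bool (P2 q p))"
  shows "cmod (LINT p|lborel. Z p * W p) \<le> B * (T * A + T\<^sup>2 * D)"
proof -
  have B: "B \<ge> 0" using order_trans[OF norm_ge_zero B1] .
  have I: "integrable lborel (\<lambda>\<tau>. A * indicator {0..T} \<tau> :: real)" "(LINT \<tau>|lborel. A * indicator {0..T} \<tau>) = T * A"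
    using T by (auto simp: integrable_indicator_iff)
  have sq: "emeasure lborel (cbox (0, 0) (T, T)) < \<infinity>" by (rule emeasure_lborel_cbox_finite)
  have mq: "measure lborel (cbox (0, 0) (T, T)) = T\<^sup>2"
    using T by (subst measure_lborel_cbox_eq) (auto simp: Basis_real_prod power2_eq_square)
  have J: "integrable lborel (\<lambda>q. D * indicator (cbox (0, 0) (T, T)) q :: real)" "(LINT q|lborel. D * indicator (cbox (0, 0) (T, T)) q) = T\<^sup>2 * D"
    using sq mq by (auto simp: integrable_indicator_iff less_top)
  have i1: "integrable lborel c1"
    by (rule Bochner_Integration.integrable_bound[OF I(1)]) (use c1(1) in simp, rule AE_I2, use order_trans[OF c1(2) abs_ge_self] in simp)
  have i2: "integrable lborel c2"
    by (rule Bochner_Integration.integrable_bound[OF J(1)]) (use c2(1) in simp, rule AE_I2, use order_trans[OF c2(2) abs_ge_self] in simp)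
  have n1: "(LINT \<tau>|lborel. cmod (c1 \<tau>)) \<le> T * A"
    unfolding I(2)[symmetric] by (rule integral_mono[OF integrable_norm[OF i1] I(1) c1(2)])
  have n2: "(LINT q|lborel. cmod (c2 q)) \<le> T\<^sup>2 * D"
    unfolding J(2)[symmetric] by (rule integral_mono[OF integrable_norm[OF i2] J(1) c2(2)])
  have P1': "{q \<in> space (lborel \<Otimes>\<^sub>M lborel). P1 (fst q) (snd q)} \<in> sets (lborel \<Otimes>\<^sub>M lborel)"
    unfolding lborel_prod using P1 by simp
  have P2': "{q \<in> space (lborel \<Otimes>\<^sub>M lborel). P2 (fst q) (snd q)} \<in> sets (lborel \<Otimes>\<^sub>M lborel)"
    unfolding lborel_prod using P2 by simp
  note s1 = superposition_bound[OF sigma_finite_lborel i1 W(1) P1' B1]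
  note s2 = superposition_bound[OF sigma_finite_lborel i2 W(1) P2' B2]
  let ?U = "\<lambda>p. (LINT \<tau>|lborel. c1 \<tau> * of_bool (P1 \<tau> p)) * W p" and ?V = "\<lambda>p. (LINT q|lborel. c2 q * of_bool (P2 q p)) * W p"
  have "Z p * W p = ?U p - ?V p" for p
    using Z[of p] W(2)[of p] by (cases "p \<in> square T") (auto simp: left_diff_distrib)
  then have "(LINT p|lborel. Z p * W p) = (LINT p|lborel. ?U p) - (LINT p|lborel. ?V p)"
    using Bochner_Integration.integral_diff[OF s1(2) s2(2)] by simp
  then have "cmod (LINT p|lborel. Z p * W p) \<le> cmod (LINT p|lborel. ?U p) + cmod (LINT p|lborel. ?V p)"
    by (simp add: norm_triangle_ineq4)
  also have "\<dots> \<le> B * (T * A) + B * (T\<^sup>2 * D)"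
    using s1(1) s2(1) mult_left_mono[OF n1 B] mult_left_mono[OF n2 B] by linarith
  finally show ?thesis by (simp add: distrib_left)
qed

lemma borel_ineq_sets:
  fixes f g h k :: "'a::topological_space \<Rightarrow> real"
  assumes "continuous_on UNIV f" "continuous_on UNIV g" "continuous_on UNIV h" "continuous_on UNIV k"
  shows "{q. f q \<le> g q \<and> h q < k q} \<in> sets borel"
proof -
  have "closed {q. f q \<le> g q}" "open {q. h q < k q}"
    using assms by (auto intro: closed_Collect_le open_Collect_less)
  then show ?thesis by (simp add: Collect_conj_eq)
qed

text \<open>The indicator of s \<le> \<tau> < t is the pair of cut-offs with a = b = \<tau>, and
  that of s \<le> \<sigma>, \<tau> < t the pair with a = \<sigma>, b = \<tau>; hence B is assumed
  for independent a and b. The constraint \<sigma> \<le> \<tau> involves neither s nor t and is put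
  into the density c2.\<close>

lemma plus_estimate:
  fixes X G K W :: "real \<times> real \<Rightarrow> complex"
  assumes T: "T > 0" and W: "integrable lborel W" "\<And>p. p \<notin> square T \<Longrightarrow> W p = 0"
    and B: "\<And>a b. cmod (LINT p|lborel. of_bool (fst p \<le> a \<and> b < snd p) * W p) \<le> B"
    and G: "continuous_on UNIV G" "\<And>\<tau>. 0 \<le> \<tau> \<Longrightarrow> \<tau> \<le> T \<Longrightarrow> cmod (G (\<tau>, \<tau>)) \<le> A"
    and K: "continuous_on UNIV K" "\<And>\<sigma> \<tau>. 0 \<le> \<sigma> \<Longrightarrow> \<sigma> \<le> \<tau> \<Longrightarrow> \<tau> \<le> T \<Longrightarrow> cmod (K (\<sigma>, \<tau>)) \<le> D"
    and c: "0 \<le> c" "c \<le> 1"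
    and X': "\<And>s t. 0 \<le> s \<Longrightarrow> s \<le> t \<Longrightarrow> t \<le> T \<Longrightarrow> ((\<lambda>t. X (s, t)) has_vector_derivative c *\<^sub>R G (s, t)) (at t)"
    and G': "\<And>s t. 0 \<le> s \<Longrightarrow> s \<le> t \<Longrightarrow> t \<le> T \<Longrightarrow> ((\<lambda>s. G (s, t)) has_vector_derivative c *\<^sub>R K (s, t)) (at s)"
  shows "cmod (LINT p|lborel. indicator (Delta_plus T) p *\<^sub>R (X p - X (fst p, fst p)) * W p) \<le> B * (T * A + T\<^sup>2 * D)"
proof -
  let ?Tri = "\<lambda>a b. {q :: real \<times> real. a \<le> fst q \<and> fst q \<le> snd q \<and> snd q \<le> b}"
  define c1 where "c1 \<tau> = indicator {0..T} \<tau> *\<^sub>R (c *\<^sub>R G (\<tau>, \<tau>))" for \<tau>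
  define c2 where "c2 q = indicator (?Tri 0 T) q *\<^sub>R (c\<^sup>2 *\<^sub>R K q)" for q
  have D: "D \<ge> 0" using order_trans[OF norm_ge_zero K(2)[of 0 0]] T by simp
  have A: "A \<ge> 0" using order_trans[OF norm_ge_zero G(2)[of 0]] T by simp
  have Gd: "continuous_on UNIV (\<lambda>\<tau>. c *\<^sub>R G (\<tau>, \<tau>))"
    by (intro continuous_intros continuous_on_compose2[OF G(1)]) auto
  have Tri: "closed (?Tri a b)" for a b
    by (intro closed_Collect_conj closed_Collect_le continuous_intros)
  have c2sq: "c\<^sup>2 \<le> 1" using c by (simp add: power_le_one)
  show ?thesis
  proof (rule two_term_estimate[OF T W, where ?c1.0=c1 and ?c2.0=c2 and ?P1.0="\<lambda>\<tau> p. fst p \<le> \<tau> \<and> \<tau> < snd p" and ?P2.0="\<lambda>q p. fst p \<le> fst q \<and> snd q < snd p"])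
    have [measurable]: "(\<lambda>\<tau>. c *\<^sub>R G (\<tau>, \<tau>)) \<in> borel_measurable borel" by (rule borel_measurable_continuous_onI[OF Gd])
    show "c1 \<in> borel_measurable borel" unfolding c1_def by measurable
    show "cmod (c1 \<tau>) \<le> A * indicator {0..T} \<tau>" for \<tau>
      using mult_mono[OF c(2) G(2)[of \<tau>]] c A by (auto simp: c1_def split: split_indicator)
    have [measurable]: "K \<in> borel_measurable borel" by (rule borel_measurable_continuous_onI[OF K(1)])
    have [measurable]: "?Tri 0 T \<in> sets borel" using Tri by (rule borel_closed)
    show "c2 \<in> borel_measurable borel" unfolding c2_def by measurable
    show "cmod (c2 q) \<le> D * indicator (cbox (0, 0) (T, T)) q" for q
    proof (cases "q \<in> ?Tri 0 T")
      case True
      then have "q \<in> cbox (0, 0) (T, T)" by (cases q) (auto simp: cbox_Pair_eq)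
      moreover have "cmod (K q) \<le> D" using True K(2)[of "fst q" "snd q"] by simp
      ultimately show ?thesis using True mult_mono[OF c2sq, of "cmod (K q)" D] by (simp add: c2_def)
    qed (use D in \<open>simp add: c2_def\<close>)
    show "{q :: real \<times> (real \<times> real). fst (snd q) \<le> fst q \<and> fst q < snd (snd q)} \<in> sets borel"
      by (intro borel_ineq_sets continuous_intros)
    show "{q :: (real \<times> real) \<times> (real \<times> real). fst (snd q) \<le> fst (fst q) \<and> snd (fst q) < snd (snd q)} \<in> sets borel"
      by (intro borel_ineq_sets continuous_intros)
    show "cmod (LINT p|lborel. of_bool (fst p \<le> \<tau> \<and> \<tau> < snd p) * W p) \<le> B" for \<tau> by (rule B)
    show "cmod (LINT p|lborel. of_bool (fst p \<le> fst q \<and> snd q < snd p) * W p) \<le> B" for q by (rule B)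
    fix p assume p: "p \<in> square T"
    obtain s t where st: "p = (s, t)" by (cases p)
    have st': "0 < s" "s < T" "0 < t" "t < T" using p by (auto simp: st Delta_iff)
    show "indicator (Delta_plus T) p *\<^sub>R (X p - X (fst p, fst p)) =
        (LINT \<tau>|lborel. c1 \<tau> * of_bool (fst p \<le> \<tau> \<and> \<tau> < snd p)) - (LINT q|lborel. c2 q * of_bool (fst p \<le> fst q \<and> snd q < snd p))"
    proof (cases "s < t")
      case True
      have "(LINT \<tau>|lborel. c1 \<tau> * of_bool (s \<le> \<tau> \<and> \<tau> < t)) = (LINT \<tau>|lborel. indicator {s..t} \<tau> *\<^sub>R (c *\<^sub>R G (\<tau>, \<tau>)))"
        unfolding c1_def using st' by (intro integral_tau) auto
      then have 1: "(LINT \<tau>|lborel. c1 \<tau> * of_bool (s \<le> \<tau> \<and> \<tau> < t)) = c *\<^sub>R (LINT \<tau>|lborel. indicator {s..t} \<tau> *\<^sub>R G (\<tau>, \<tau>))"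
        by (simp only: scaleR_left_commute[of _ c] integral_scaleR_right)
      have "(LINT q|lborel. c2 q * of_bool (s \<le> fst q \<and> snd q < t)) = (LINT q|lborel. indicator (?Tri s t) q *\<^sub>R (c\<^sup>2 *\<^sub>R K q))"
      proof (rule integral_cong_AE)
        \<comment> \<open>The half-open condition and the closed triangle differ only on the line
          \<tau> = t, a null set.\<close>
        have "AE q :: real \<times> real in lborel. snd q \<noteq> t" by (rule AE_lborel_snd[OF AE_lborel_singleton])
        then show "AE q in lborel. c2 q * of_bool (s \<le> fst q \<and> snd q < t) = indicator (?Tri s t) q *\<^sub>R (c\<^sup>2 *\<^sub>R K q)"
          by eventually_elim (use st' in \<open>auto simp: c2_def split: split_indicator\<close>)
        have S: "{q :: real \<times> real. s \<le> fst q \<and> snd q < t} \<in> sets borel" by (intro borel_ineq_sets continuous_intros)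
        have [measurable]: "(\<lambda>q :: real \<times> real. of_bool (s \<le> fst q \<and> snd q < t) :: complex) \<in> borel_measurable borel"
          unfolding of_bool_def by (rule measurable_If) (use S in auto)
        show "(\<lambda>q. c2 q * of_bool (s \<le> fst q \<and> snd q < t)) \<in> borel_measurable lborel"
          unfolding c2_def by measurable
        have [measurable]: "?Tri s t \<in> sets borel" using Tri by (rule borel_closed)
        show "(\<lambda>q. indicator (?Tri s t) q *\<^sub>R (c\<^sup>2 *\<^sub>R K q)) \<in> borel_measurable lborel" by measurable
      qed
      then have 2: "(LINT q|lborel. c2 q * of_bool (s \<le> fst q \<and> snd q < t)) = c\<^sup>2 *\<^sub>R (LINT q|lborel. indicator (?Tri s t) q *\<^sub>R K q)"
        by (simp only: scaleR_left_commute[of _ "c\<^sup>2"] integral_scaleR_right)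
      have "X (s, t) - X (s, s) = c *\<^sub>R (LINT \<tau>|lborel. indicator {s..t} \<tau> *\<^sub>R G (\<tau>, \<tau>)) - c\<^sup>2 *\<^sub>R (LINT q|lborel. indicator (?Tri s t) q *\<^sub>R K q)"
        using st' True by (intro plus_representation[OF _ _ _ G(1) K(1) X' G']) auto
      then show ?thesis using True st' by (simp only: 1 2 st fst_conv snd_conv) (simp add: Delta_iff)
    next
      \<comment> \<open>For t \<le> s the conditions s \<le> \<tau> < t and s \<le> \<sigma> \<le>
        \<tau> < t are void, so the same two integrals also give the value 0 off the
        triangle.\<close>
      case False
      have 1: "(\<lambda>\<tau>. c1 \<tau> * of_bool (s \<le> \<tau> \<and> \<tau> < t)) = (\<lambda>_. 0)"
        using False by auto
      have 2: "(\<lambda>q. c2 q * of_bool (s \<le> fst q \<and> snd q < t)) = (\<lambda>_. 0)"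
        using False by (auto simp: c2_def fun_eq_iff split: split_indicator)
      show ?thesis unfolding st fst_conv snd_conv 1 2 using False by (simp add: Delta_iff)
    qed
  qed
qed

text \<open>The mirror image, with the lower cut-off now acting on the variable t. Two first
  derivatives occur, because the trace is that of the s-derivative G1 while K is the s-derivative of
  the t-derivative G2.\<close>

lemma minus_estimate:
  fixes X G1 G2 K W :: "real \<times> real \<Rightarrow> complex"
  assumes T: "T > 0" and W: "integrable lborel W" "\<And>p. p \<notin> square T \<Longrightarrow> W p = 0"
    and B: "\<And>a b. cmod (LINT p|lborel. of_bool (snd p \<le> a \<and> b < fst p) * W p) \<le> B"
    and G1: "continuous_on UNIV G1" "\<And>\<tau>. 0 \<le> \<tau> \<Longrightarrow> \<tau> \<le> T \<Longrightarrow> cmod (G1 (\<tau>, \<tau>)) \<le> A" and G2: "continuous_on UNIV G2"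
    and K: "continuous_on UNIV K" "\<And>\<sigma> \<tau>. 0 \<le> \<tau> \<Longrightarrow> \<tau> \<le> \<sigma> \<Longrightarrow> \<sigma> \<le> T \<Longrightarrow> cmod (K (\<sigma>, \<tau>)) \<le> D"
    and c: "0 \<le> c" "c \<le> 1"
    and X': "\<And>s t. 0 \<le> t \<Longrightarrow> t \<le> s \<Longrightarrow> s \<le> T \<Longrightarrow> ((\<lambda>t. X (s, t)) has_vector_derivative c *\<^sub>R G2 (s, t)) (at t)"
    and Xd: "\<And>t. 0 \<le> t \<Longrightarrow> t \<le> T \<Longrightarrow> ((\<lambda>t. X (t, t)) has_vector_derivative c *\<^sub>R (G1 (t, t) + G2 (t, t))) (at t)"
    and G': "\<And>s t. 0 \<le> t \<Longrightarrow> t \<le> s \<Longrightarrow> s \<le> T \<Longrightarrow> ((\<lambda>s. G2 (s, t)) has_vector_derivative c *\<^sub>R K (s, t)) (at s)"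
  shows "cmod (LINT p|lborel. indicator (Delta_minus T) p *\<^sub>R (X p - X (snd p, snd p)) * W p) \<le> B * (T * A + T\<^sup>2 * D)"
proof -
  let ?Tri = "\<lambda>a b. {q :: real \<times> real. a \<le> snd q \<and> snd q \<le> fst q \<and> fst q \<le> b}"
  define c1 where "c1 \<tau> = indicator {0..T} \<tau> *\<^sub>R (c *\<^sub>R G1 (\<tau>, \<tau>))" for \<tau>
  define c2 where "c2 q = indicator (?Tri 0 T) q *\<^sub>R (c\<^sup>2 *\<^sub>R K q)" for q
  have D: "D \<ge> 0" using order_trans[OF norm_ge_zero K(2)[of 0 0]] T by simp
  have A: "A \<ge> 0" using order_trans[OF norm_ge_zero G1(2)[of 0]] T by simp
  have Gd: "continuous_on UNIV (\<lambda>\<tau>. c *\<^sub>R G1 (\<tau>, \<tau>))"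
    by (intro continuous_intros continuous_on_compose2[OF G1(1)]) auto
  have Tri: "closed (?Tri a b)" for a b
    by (intro closed_Collect_conj closed_Collect_le continuous_intros)
  have c2sq: "c\<^sup>2 \<le> 1" using c by (simp add: power_le_one)
  show ?thesis
  proof (rule two_term_estimate[OF T W, where ?c1.0=c1 and ?c2.0=c2 and ?P1.0="\<lambda>\<tau> p. snd p \<le> \<tau> \<and> \<tau> < fst p" and ?P2.0="\<lambda>q p. snd p \<le> snd q \<and> fst q < fst p"])
    have [measurable]: "(\<lambda>\<tau>. c *\<^sub>R G1 (\<tau>, \<tau>)) \<in> borel_measurable borel" by (rule borel_measurable_continuous_onI[OF Gd])
    show "c1 \<in> borel_measurable borel" unfolding c1_def by measurable
    show "cmod (c1 \<tau>) \<le> A * indicator {0..T} \<tau>" for \<tau>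
      using mult_mono[OF c(2) G1(2)[of \<tau>]] c A by (auto simp: c1_def split: split_indicator)
    have [measurable]: "K \<in> borel_measurable borel" by (rule borel_measurable_continuous_onI[OF K(1)])
    have [measurable]: "?Tri 0 T \<in> sets borel" using Tri by (rule borel_closed)
    show "c2 \<in> borel_measurable borel" unfolding c2_def by measurable
    show "cmod (c2 q) \<le> D * indicator (cbox (0, 0) (T, T)) q" for q
    proof (cases "q \<in> ?Tri 0 T")
      case True
      then have "q \<in> cbox (0, 0) (T, T)" by (cases q) (auto simp: cbox_Pair_eq)
      moreover have "cmod (K q) \<le> D" using True K(2)[of "snd q" "fst q"] by simp
      ultimately show ?thesis using True mult_mono[OF c2sq, of "cmod (K q)" D] by (simp add: c2_def)
    qed (use D in \<open>simp add: c2_def\<close>)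
    show "{q :: real \<times> (real \<times> real). snd (snd q) \<le> fst q \<and> fst q < fst (snd q)} \<in> sets borel"
      by (intro borel_ineq_sets continuous_intros)
    show "{q :: (real \<times> real) \<times> (real \<times> real). snd (snd q) \<le> snd (fst q) \<and> fst (fst q) < fst (snd q)} \<in> sets borel"
      by (intro borel_ineq_sets continuous_intros)
    show "cmod (LINT p|lborel. of_bool (snd p \<le> \<tau> \<and> \<tau> < fst p) * W p) \<le> B" for \<tau> by (rule B)
    show "cmod (LINT p|lborel. of_bool (snd p \<le> snd q \<and> fst q < fst p) * W p) \<le> B" for q by (rule B)
    fix p assume p: "p \<in> square T"
    obtain s t where st: "p = (s, t)" by (cases p)
    have st': "0 < s" "s < T" "0 < t" "t < T" using p by (auto simp: st Delta_iff)
    show "indicator (Delta_minus T) p *\<^sub>R (X p - X (snd p, snd p)) =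
        (LINT \<tau>|lborel. c1 \<tau> * of_bool (snd p \<le> \<tau> \<and> \<tau> < fst p)) - (LINT q|lborel. c2 q * of_bool (snd p \<le> snd q \<and> fst q < fst p))"
    proof (cases "t < s")
      case True
      have "(LINT \<tau>|lborel. c1 \<tau> * of_bool (t \<le> \<tau> \<and> \<tau> < s)) = (LINT \<tau>|lborel. indicator {t..s} \<tau> *\<^sub>R (c *\<^sub>R G1 (\<tau>, \<tau>)))"
        unfolding c1_def using st' by (intro integral_tau) auto
      then have 1: "(LINT \<tau>|lborel. c1 \<tau> * of_bool (t \<le> \<tau> \<and> \<tau> < s)) = c *\<^sub>R (LINT \<tau>|lborel. indicator {t..s} \<tau> *\<^sub>R G1 (\<tau>, \<tau>))"
        by (simp only: scaleR_left_commute[of _ c] integral_scaleR_right)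
      have "(LINT q|lborel. c2 q * of_bool (t \<le> snd q \<and> fst q < s)) = (LINT q|lborel. indicator (?Tri t s) q *\<^sub>R (c\<^sup>2 *\<^sub>R K q))"
      proof (rule integral_cong_AE)
        have "AE q :: real \<times> real in lborel. fst q \<noteq> s" by (rule AE_lborel_fst[OF AE_lborel_singleton])
        then show "AE q in lborel. c2 q * of_bool (t \<le> snd q \<and> fst q < s) = indicator (?Tri t s) q *\<^sub>R (c\<^sup>2 *\<^sub>R K q)"
          by eventually_elim (use st' in \<open>auto simp: c2_def split: split_indicator\<close>)
        have S: "{q :: real \<times> real. t \<le> snd q \<and> fst q < s} \<in> sets borel" by (intro borel_ineq_sets continuous_intros)
        have [measurable]: "(\<lambda>q :: real \<times> real. of_bool (t \<le> snd q \<and> fst q < s) :: complex) \<in> borel_measurable borel"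
          unfolding of_bool_def by (rule measurable_If) (use S in auto)
        show "(\<lambda>q. c2 q * of_bool (t \<le> snd q \<and> fst q < s)) \<in> borel_measurable lborel"
          unfolding c2_def by measurable
        have [measurable]: "?Tri t s \<in> sets borel" using Tri by (rule borel_closed)
        show "(\<lambda>q. indicator (?Tri t s) q *\<^sub>R (c\<^sup>2 *\<^sub>R K q)) \<in> borel_measurable lborel" by measurable
      qed
      then have 2: "(LINT q|lborel. c2 q * of_bool (t \<le> snd q \<and> fst q < s)) = c\<^sup>2 *\<^sub>R (LINT q|lborel. indicator (?Tri t s) q *\<^sub>R K q)"
        by (simp only: scaleR_left_commute[of _ "c\<^sup>2"] integral_scaleR_right)
      have "X (s, t) - X (t, t) = c *\<^sub>R (LINT \<tau>|lborel. indicator {t..s} \<tau> *\<^sub>R G1 (\<tau>, \<tau>)) - c\<^sup>2 *\<^sub>R (LINT q|lborel. indicator (?Tri t s) q *\<^sub>R K q)"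
        using st' True by (intro minus_representation[OF _ _ _ G1(1) G2 K(1) X' Xd G']) auto
      then show ?thesis using True st' by (simp only: 1 2 st fst_conv snd_conv) (simp add: Delta_iff)
    next
      case False
      have 1: "(\<lambda>\<tau>. c1 \<tau> * of_bool (t \<le> \<tau> \<and> \<tau> < s)) = (\<lambda>_. 0)"
        using False by auto
      have 2: "(\<lambda>q. c2 q * of_bool (t \<le> snd q \<and> fst q < s)) = (\<lambda>_. 0)"
        using False by (auto simp: c2_def fun_eq_iff split: split_indicator)
      show ?thesis unfolding st fst_conv snd_conv 1 2 using False by (simp add: Delta_iff)
    qed
  qed
qed

text \<open>On the diagonal the mollified derivatives may exceed the trace bound A by a small e, and
  stay below A + e only for large n. The limit in n is therefore taken for each e, and e tends to 0
  afterwards.\<close>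

lemma tendsto_bound_estimate:
  fixes Z :: "nat \<Rightarrow> real \<times> real \<Rightarrow> complex"
  assumes S: "open S" and W: "integrable lborel W"
    and Zm: "\<And>n. Z n \<in> borel_measurable borel" and Fm: "(\<lambda>p. indicator S p *\<^sub>R F p) \<in> borel_measurable borel"
    and lim: "\<And>p. p \<in> S \<Longrightarrow> (\<lambda>n. Z n p) \<longlonglongrightarrow> F p" and C: "C \<ge> 0" "\<And>n p. p \<in> S \<Longrightarrow> cmod (Z n p) \<le> C"
    and b: "\<And>e. e > 0 \<Longrightarrow> \<forall>\<^sub>F n in sequentially. cmod (LINT p|lborel. indicator S p *\<^sub>R Z n p * W p) \<le> B * (T * (A + e) + D)"
  shows "cmod (LINT p|lborel. indicator S p *\<^sub>R F p * W p) \<le> B * (T * A + D)"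
proof -
  have [measurable]: "W \<in> borel_measurable borel" "S \<in> sets borel" "\<And>n. Z n \<in> borel_measurable borel" using W S Zm by auto
  have L: "(\<lambda>n. LINT p|lborel. indicator S p *\<^sub>R Z n p * W p) \<longlonglongrightarrow> (LINT p|lborel. indicator S p *\<^sub>R F p * W p)"
  proof (rule integral_dominated_convergence[where w="\<lambda>p. C * cmod (W p)"])
    show "(\<lambda>p. indicator S p *\<^sub>R F p * W p) \<in> borel_measurable lborel" using Fm by measurable
    show "AE p in lborel. (\<lambda>n. indicator S p *\<^sub>R Z n p * W p) \<longlonglongrightarrow> indicator S p *\<^sub>R F p * W p"
      by (rule AE_I2) (auto intro!: tendsto_mult lim split: split_indicator)
    show "AE p in lborel. norm (indicator S p *\<^sub>R Z n p * W p) \<le> C * cmod (W p)" for n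
    proof (rule AE_I2)
      fix p
      show "norm (indicator S p *\<^sub>R Z n p * W p) \<le> C * cmod (W p)"
        using C(1) C(2)[of p n] by (auto simp: norm_mult intro: mult_right_mono split: split_indicator)
    qed
  qed (use W in auto)
  have "cmod (LINT p|lborel. indicator S p *\<^sub>R F p * W p) \<le> B * (T * (A + e) + D)" if "e > 0" for e
    by (rule tendsto_upperbound[OF tendsto_norm[OF L] b[OF that]]) simp
  moreover have "((\<lambda>e. B * (T * (A + e) + D)) \<longlongrightarrow> B * (T * (A + 0) + D)) (at_right 0)"
    by (intro tendsto_intros)
  moreover have "\<forall>\<^sub>F e in at_right (0::real). e > 0" by (rule eventually_at_right_less)
  ultimately have "cmod (LINT p|lborel. indicator S p *\<^sub>R F p * W p) \<le> B * (T * (A + 0) + D)"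
    by (intro tendsto_lowerbound[where F="at_right (0::real)"]) (auto elim: eventually_mono)
  then show ?thesis by simp
qed

text \<open>The estimate for smooth multipliers is applied to the mollifications of \<chi>, g and h.
  The derivative g enters through its values on the diagonal and so comes with a continuous
  representative G; h enters through its essential bound. The difference from the diagonal value
  tends to F because F vanishes there.\<close>

lemma plus_bound:
  assumes T: "T > 0" and W: "integrable lborel W" "\<And>p. p \<notin> square T \<Longrightarrow> W p = 0"
    and B: "\<And>a b. cmod (LINT p|lborel. of_bool (fst p \<le> a \<and> b < snd p) * W p) \<le> B"
    and F: "continuous_on (closure (square T)) F" "\<And>t. t \<in> {0<..<T} \<Longrightarrow> F (t, t) = 0" "AE p in lebesgue_on (Delta_plus T). F p = chi p"
    and chi: "chi \<in> Linf (Delta_plus T)" "has_weak_deriv (Delta_plus T) (0, 1) chi g"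
    and g: "g \<in> Linf (Delta_plus T)" "continuous_on (closure (Delta_plus T)) G" "AE p in lebesgue_on (Delta_plus T). G p = g p"
      "has_weak_deriv (Delta_plus T) (1, 0) g h" and h: "LinfB (Delta_plus T) h D"
    and A: "\<And>\<tau>. 0 \<le> \<tau> \<Longrightarrow> \<tau> \<le> T \<Longrightarrow> cmod (G (\<tau>, \<tau>)) \<le> A"
  shows "cmod (LINT p|lborel. indicator (Delta_plus T) p *\<^sub>R F p * W p) \<le> B * (T * A + T\<^sup>2 * D)"
proof -
  let ?S = "Delta_plus T"
  note oS = Delta_open_convex(1)[of T]
  have bS: "bounded ?S" by (rule bounded_subset[OF square_bounded Delta_subset_square(1)])
  obtain \<rho> where "mollifier ?S \<rho>"
    by (rule mollifier_exists[OF oS Delta_open_convex(4) bS Delta_nonempty(1)[OF T]])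
  then interpret mollifier ?S \<rho> .
  have cl: "closure ?S \<subseteq> closure (square T)" by (rule closure_mono[OF Delta_subset_square(1)])
  have Fc: "continuous_on (closure ?S) F" by (rule continuous_on_subset[OF F(1) cl])
  define CB GB where "CB = max 0 (Linf_norm ?S chi)" and "GB = max 0 (Linf_norm ?S g)"
  note cB = Linf_norm_bound[OF chi(1), folded CB_def] and gB = Linf_norm_bound[OF g(1), folded GB_def]
  have FB: "LinfB ?S F CB" "LinfB ?S G GB"
  proof -
    have *: "LinfB ?S F' b" if f': "LinfB ?S f' b" and eq: "AE p in lebesgue_on ?S. F' p = f' p" for F' f' b
    proof -
      have m: "F' \<in> borel_measurable (lebesgue_on ?S)"
        by (rule lebesgue_on_measurable_AE_cong[OF oS _ eq]) (use f' in \<open>simp add: LinfB_def\<close>)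
      have "AE p in lebesgue_on ?S. cmod (f' p) \<le> b" using f' by (simp add: LinfB_def)
      with eq have "AE p in lebesgue_on ?S. cmod (F' p) \<le> b" by eventually_elim simp
      with m f' show ?thesis by (simp add: LinfB_def)
    qed
    show "LinfB ?S F CB" by (rule *[OF cB F(3)])
    show "LinfB ?S G GB" by (rule *[OF gB g(3)])
  qed
  have mF: "mol \<delta> chi p = mol \<delta> F p" and mG: "mol \<delta> g p = mol \<delta> G p" for \<delta> p
  proof -
    have m: "F \<in> borel_measurable (lebesgue_on ?S)" "G \<in> borel_measurable (lebesgue_on ?S)"
      "chi \<in> borel_measurable (lebesgue_on ?S)" "g \<in> borel_measurable (lebesgue_on ?S)"
      using FB cB gB by (auto simp: LinfB_def)
    show "mol \<delta> chi p = mol \<delta> F p" by (rule mol_cong_AE[OF m(1,3) F(3), symmetric])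
    show "mol \<delta> g p = mol \<delta> G p" by (rule mol_cong_AE[OF m(2,4) g(3), symmetric])
  qed
  define \<delta> where "\<delta> n = 1 / real (Suc (Suc n))" for n
  have \<delta>: "0 < \<delta> n" "\<delta> n < 1" "\<delta> n \<le> 1" for n by (auto simp: \<delta>_def)
  have \<delta>0: "\<delta> \<longlonglongrightarrow> 0" unfolding \<delta>_def by (intro LIMSEQ_Suc[OF LIMSEQ_Suc[OF lim_1_over_n]])
  have in_cl: "(s, t) \<in> closure ?S" if "0 \<le> s" "s \<le> t" "t \<le> T" for s t by (rule Delta_plus_closure[OF T that])
  have diag: "(fst p, fst p) \<in> closure ?S" "F (fst p, fst p) = 0" "p \<in> closure ?S" if "p \<in> ?S" for p
  proof -
    obtain s t where st: "p = (s, t)" by (cases p)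
    with that have "0 < s" "s < t" "t < T" by (auto simp: Delta_iff)
    then show "(fst p, fst p) \<in> closure ?S" "F (fst p, fst p) = 0" "p \<in> closure ?S"
      using in_cl[of s s] in_cl[of s t] F(2)[of s] by (auto simp: st)
  qed
  \<comment> \<open>Uniform convergence on the closed triangle gives the limit at the diagonal
    points as well.\<close>
  have limX: "(\<lambda>n. mol (\<delta> n) chi p) \<longlonglongrightarrow> F p" if p: "p \<in> closure ?S" for p
    unfolding LIMSEQ_iff
  proof (intro allI impI)
    fix e :: real assume e: "e > 0"
    then have "e / 2 > 0" by simp
    from mol_uniform_limit[OF Fc FB(1) this] obtain d where d: "d > 0"
      "\<And>\<delta> p. 0 < \<delta> \<Longrightarrow> \<delta> \<le> 1 \<Longrightarrow> \<delta> < d \<Longrightarrow> p \<in> closure ?S \<Longrightarrow> cmod (mol \<delta> F p - F p) \<le> e / 2" by blast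
    obtain N where "\<And>n. n \<ge> N \<Longrightarrow> \<delta> n < d"
      using order_tendstoD(2)[OF \<delta>0 d(1)] by (auto simp: eventually_sequentially)
    then show "\<exists>N. \<forall>n\<ge>N. norm (mol (\<delta> n) chi p - F p) < e"
      using d(2)[OF \<delta>(1,3) _ p] e unfolding mF by (intro exI[of _ N]) force
  qed
  show ?thesis
  proof (rule tendsto_bound_estimate[OF oS W(1), where Z="\<lambda>n p. mol (\<delta> n) chi p - mol (\<delta> n) chi (fst p, fst p)" and C="2 * CB"])
    show "0 \<le> 2 * CB" by (simp add: CB_def)
    have mc: "continuous_on UNIV (mol (\<delta> n) chi)" for n by (rule mol_continuous[OF cB \<delta>(1)])
    show "(\<lambda>p. mol (\<delta> n) chi p - mol (\<delta> n) chi (fst p, fst p)) \<in> borel_measurable borel" for n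
      by (intro borel_measurable_continuous_onI continuous_intros mc continuous_on_compose2[OF mc]) auto
    show "(\<lambda>p. indicator ?S p *\<^sub>R F p) \<in> borel_measurable borel"
      by (rule borel_measurable_continuous_on_indicator[OF _ continuous_on_subset[OF Fc closure_subset]]) (use oS in auto)
    show "(\<lambda>n. mol (\<delta> n) chi p - mol (\<delta> n) chi (fst p, fst p)) \<longlonglongrightarrow> F p" if "p \<in> ?S" for p
      using tendsto_diff[OF limX[OF diag(3)[OF that]] limX[OF diag(1)[OF that]]] diag(2)[OF that] by simp
    show "cmod (mol (\<delta> n) chi p - mol (\<delta> n) chi (fst p, fst p)) \<le> 2 * CB" if "p \<in> ?S" for n p
      using norm_triangle_ineq4[of "mol (\<delta> n) chi p" "mol (\<delta> n) chi (fst p, fst p)"]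
        mol_bound[OF cB diag(3)[OF that] \<delta>(1,3), of n] mol_bound[OF cB diag(1)[OF that] \<delta>(1,3), of n] by linarith
    fix e :: real assume e: "e > 0"
    \<comment> \<open>For small \<delta> the mollified g is within e of G on the closed triangle, so
      its diagonal values are at most A + e.\<close>
    from mol_uniform_limit[OF g(2) FB(2) this] obtain d where d: "d > 0"
      "\<And>\<delta> p. 0 < \<delta> \<Longrightarrow> \<delta> \<le> 1 \<Longrightarrow> \<delta> < d \<Longrightarrow> p \<in> closure ?S \<Longrightarrow> cmod (mol \<delta> G p - G p) \<le> e" by blast
    show "\<forall>\<^sub>F n in sequentially. cmod (LINT p|lborel. indicator ?S p *\<^sub>R (mol (\<delta> n) chi p - mol (\<delta> n) chi (fst p, fst p)) * W p) \<le> B * (T * (A + e) + T\<^sup>2 * D)"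
      using order_tendstoD(2)[OF \<delta>0 d(1)]
    proof eventually_elim
      case (elim n)
      show ?case
      proof (rule plus_estimate[OF T W B mol_continuous[OF gB \<delta>(1)[of n]] _ mol_continuous[OF h \<delta>(1)[of n]], where c="1 - \<delta> n"])
        show "cmod (mol (\<delta> n) g (\<tau>, \<tau>)) \<le> A + e" if "0 \<le> \<tau>" "\<tau> \<le> T" for \<tau>
          using d(2)[OF \<delta>(1,3) elim in_cl[of \<tau> \<tau>]] A[OF that] that norm_triangle_sub[of "mol (\<delta> n) G (\<tau>, \<tau>)" "G (\<tau>, \<tau>)"]
          unfolding mG by simp
        show "cmod (mol (\<delta> n) h (\<sigma>, \<tau>)) \<le> D" if "0 \<le> \<sigma>" "\<sigma> \<le> \<tau>" "\<tau> \<le> T" for \<sigma> \<tau>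
          by (rule mol_bound[OF h in_cl[OF that] \<delta>(1,3)])
        show "((\<lambda>t. mol (\<delta> n) chi (s, t)) has_vector_derivative (1 - \<delta> n) *\<^sub>R mol (\<delta> n) g (s, t)) (at t)" if "0 \<le> s" "s \<le> t" "t \<le> T" for s t
          using mol_has_derivative[OF chi(2) cB \<delta>(1,3), of "(s, 0)" t n] in_cl[OF that] by simp
        show "((\<lambda>s. mol (\<delta> n) g (s, t)) has_vector_derivative (1 - \<delta> n) *\<^sub>R mol (\<delta> n) h (s, t)) (at s)" if "0 \<le> s" "s \<le> t" "t \<le> T" for s t
          using mol_has_derivative[OF g(4) gB \<delta>(1,3), of "(0, t)" s n] in_cl[OF that] by simp
      qed (use \<delta>[of n] in auto)
    qed
  qed
qed

text \<open>As above the diagonal, with one addition: the t-derivative g2 is mollified as well, and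
  the derivative along the diagonal is the one in direction (1, 1).\<close>

lemma minus_bound:
  assumes T: "T > 0" and W: "integrable lborel W" "\<And>p. p \<notin> square T \<Longrightarrow> W p = 0"
    and B: "\<And>a b. cmod (LINT p|lborel. of_bool (snd p \<le> a \<and> b < fst p) * W p) \<le> B"
    and F: "continuous_on (closure (square T)) F" "\<And>t. t \<in> {0<..<T} \<Longrightarrow> F (t, t) = 0" "AE p in lebesgue_on (Delta_minus T). F p = chi p"
    and chi: "chi \<in> Linf (Delta_minus T)" "has_weak_deriv (Delta_minus T) (1, 0) chi g" "has_weak_deriv (Delta_minus T) (0, 1) chi g2"
    and g: "g \<in> Linf (Delta_minus T)" "continuous_on (closure (Delta_minus T)) G" "AE p in lebesgue_on (Delta_minus T). G p = g p"
    and g2: "g2 \<in> Linf (Delta_minus T)" "has_weak_deriv (Delta_minus T) (1, 0) g2 h" and h: "LinfB (Delta_minus T) h D"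
    and A: "\<And>\<tau>. 0 \<le> \<tau> \<Longrightarrow> \<tau> \<le> T \<Longrightarrow> cmod (G (\<tau>, \<tau>)) \<le> A"
  shows "cmod (LINT p|lborel. indicator (Delta_minus T) p *\<^sub>R F p * W p) \<le> B * (T * A + T\<^sup>2 * D)"
proof -
  let ?S = "Delta_minus T"
  note oS = Delta_open_convex(2)[of T]
  have bS: "bounded ?S" by (rule bounded_subset[OF square_bounded Delta_subset_square(2)])
  obtain \<rho> where "mollifier ?S \<rho>"
    by (rule mollifier_exists[OF oS Delta_open_convex(5) bS Delta_nonempty(2)[OF T]])
  then interpret mollifier ?S \<rho> .
  have cl: "closure ?S \<subseteq> closure (square T)" by (rule closure_mono[OF Delta_subset_square(2)])
  have Fc: "continuous_on (closure ?S) F" by (rule continuous_on_subset[OF F(1) cl])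
  define CB GB where "CB = max 0 (Linf_norm ?S chi)" and "GB = max 0 (Linf_norm ?S g)"
  note cB = Linf_norm_bound[OF chi(1), folded CB_def] and gB = Linf_norm_bound[OF g(1), folded GB_def]
  note g2B = Linf_norm_bound[OF g2(1)]
  have FB: "LinfB ?S F CB" "LinfB ?S G GB"
  proof -
    have *: "LinfB ?S F' b" if f': "LinfB ?S f' b" and eq: "AE p in lebesgue_on ?S. F' p = f' p" for F' f' b
    proof -
      have m: "F' \<in> borel_measurable (lebesgue_on ?S)"
        by (rule lebesgue_on_measurable_AE_cong[OF oS _ eq]) (use f' in \<open>simp add: LinfB_def\<close>)
      have "AE p in lebesgue_on ?S. cmod (f' p) \<le> b" using f' by (simp add: LinfB_def)
      with eq have "AE p in lebesgue_on ?S. cmod (F' p) \<le> b" by eventually_elim simp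
      with m f' show ?thesis by (simp add: LinfB_def)
    qed
    show "LinfB ?S F CB" by (rule *[OF cB F(3)])
    show "LinfB ?S G GB" by (rule *[OF gB g(3)])
  qed
  have mF: "mol \<delta> chi p = mol \<delta> F p" and mG: "mol \<delta> g p = mol \<delta> G p" for \<delta> p
  proof -
    have m: "F \<in> borel_measurable (lebesgue_on ?S)" "G \<in> borel_measurable (lebesgue_on ?S)"
      "chi \<in> borel_measurable (lebesgue_on ?S)" "g \<in> borel_measurable (lebesgue_on ?S)"
      using FB cB gB by (auto simp: LinfB_def)
    show "mol \<delta> chi p = mol \<delta> F p" by (rule mol_cong_AE[OF m(1,3) F(3), symmetric])
    show "mol \<delta> g p = mol \<delta> G p" by (rule mol_cong_AE[OF m(2,4) g(3), symmetric])
  qed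
  define \<delta> where "\<delta> n = 1 / real (Suc (Suc n))" for n
  have \<delta>: "0 < \<delta> n" "\<delta> n < 1" "\<delta> n \<le> 1" for n by (auto simp: \<delta>_def)
  have \<delta>0: "\<delta> \<longlonglongrightarrow> 0" unfolding \<delta>_def by (intro LIMSEQ_Suc[OF LIMSEQ_Suc[OF lim_1_over_n]])
  have in_cl: "(s, t) \<in> closure ?S" if "0 \<le> t" "t \<le> s" "s \<le> T" for t s by (rule Delta_minus_closure[OF T that])
  have diag: "(snd p, snd p) \<in> closure ?S" "F (snd p, snd p) = 0" "p \<in> closure ?S" if "p \<in> ?S" for p
  proof -
    obtain s t where st: "p = (s, t)" by (cases p)
    with that have "0 < t" "t < s" "s < T" by (auto simp: Delta_iff)
    then show "(snd p, snd p) \<in> closure ?S" "F (snd p, snd p) = 0" "p \<in> closure ?S"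
      using in_cl[of t t] in_cl[of t s] F(2)[of t] by (auto simp: st)
  qed
  have limX: "(\<lambda>n. mol (\<delta> n) chi p) \<longlonglongrightarrow> F p" if p: "p \<in> closure ?S" for p
    unfolding LIMSEQ_iff
  proof (intro allI impI)
    fix e :: real assume e: "e > 0"
    then have "e / 2 > 0" by simp
    from mol_uniform_limit[OF Fc FB(1) this] obtain d where d: "d > 0"
      "\<And>\<delta> p. 0 < \<delta> \<Longrightarrow> \<delta> \<le> 1 \<Longrightarrow> \<delta> < d \<Longrightarrow> p \<in> closure ?S \<Longrightarrow> cmod (mol \<delta> F p - F p) \<le> e / 2" by blast
    obtain N where "\<And>n. n \<ge> N \<Longrightarrow> \<delta> n < d"
      using order_tendstoD(2)[OF \<delta>0 d(1)] by (auto simp: eventually_sequentially)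
    then show "\<exists>N. \<forall>n\<ge>N. norm (mol (\<delta> n) chi p - F p) < e"
      using d(2)[OF \<delta>(1,3) _ p] e unfolding mF by (intro exI[of _ N]) force
  qed
  show ?thesis
  proof (rule tendsto_bound_estimate[OF oS W(1), where Z="\<lambda>n p. mol (\<delta> n) chi p - mol (\<delta> n) chi (snd p, snd p)" and C="2 * CB"])
    show "0 \<le> 2 * CB" by (simp add: CB_def)
    have mc: "continuous_on UNIV (mol (\<delta> n) chi)" for n by (rule mol_continuous[OF cB \<delta>(1)])
    show "(\<lambda>p. mol (\<delta> n) chi p - mol (\<delta> n) chi (snd p, snd p)) \<in> borel_measurable borel" for n
      by (intro borel_measurable_continuous_onI continuous_intros mc continuous_on_compose2[OF mc]) auto
    show "(\<lambda>p. indicator ?S p *\<^sub>R F p) \<in> borel_measurable borel"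
      by (rule borel_measurable_continuous_on_indicator[OF _ continuous_on_subset[OF Fc closure_subset]]) (use oS in auto)
    show "(\<lambda>n. mol (\<delta> n) chi p - mol (\<delta> n) chi (snd p, snd p)) \<longlonglongrightarrow> F p" if "p \<in> ?S" for p
      using tendsto_diff[OF limX[OF diag(3)[OF that]] limX[OF diag(1)[OF that]]] diag(2)[OF that] by simp
    show "cmod (mol (\<delta> n) chi p - mol (\<delta> n) chi (snd p, snd p)) \<le> 2 * CB" if "p \<in> ?S" for n p
      using norm_triangle_ineq4[of "mol (\<delta> n) chi p" "mol (\<delta> n) chi (snd p, snd p)"]
        mol_bound[OF cB diag(3)[OF that] \<delta>(1,3), of n] mol_bound[OF cB diag(1)[OF that] \<delta>(1,3), of n] by linarith
    fix e :: real assume e: "e > 0"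
    from mol_uniform_limit[OF g(2) FB(2) this] obtain d where d: "d > 0"
      "\<And>\<delta> p. 0 < \<delta> \<Longrightarrow> \<delta> \<le> 1 \<Longrightarrow> \<delta> < d \<Longrightarrow> p \<in> closure ?S \<Longrightarrow> cmod (mol \<delta> G p - G p) \<le> e" by blast
    show "\<forall>\<^sub>F n in sequentially. cmod (LINT p|lborel. indicator ?S p *\<^sub>R (mol (\<delta> n) chi p - mol (\<delta> n) chi (snd p, snd p)) * W p) \<le> B * (T * (A + e) + T\<^sup>2 * D)"
      using order_tendstoD(2)[OF \<delta>0 d(1)]
    proof eventually_elim
      case (elim n)
      show ?case
      proof (rule minus_estimate[OF T W B mol_continuous[OF gB \<delta>(1)[of n]] _ mol_continuous[OF g2B \<delta>(1)[of n]] mol_continuous[OF h \<delta>(1)[of n]], where c="1 - \<delta> n"])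
        show "cmod (mol (\<delta> n) g (\<tau>, \<tau>)) \<le> A + e" if "0 \<le> \<tau>" "\<tau> \<le> T" for \<tau>
          using d(2)[OF \<delta>(1,3) elim in_cl[of \<tau> \<tau>]] A[OF that] that norm_triangle_sub[of "mol (\<delta> n) G (\<tau>, \<tau>)" "G (\<tau>, \<tau>)"]
          unfolding mG by simp
        show "cmod (mol (\<delta> n) h (\<sigma>, \<tau>)) \<le> D" if "0 \<le> \<tau>" "\<tau> \<le> \<sigma>" "\<sigma> \<le> T" for \<sigma> \<tau>
          by (rule mol_bound[OF h in_cl[OF that] \<delta>(1,3)])
        show "((\<lambda>t. mol (\<delta> n) chi (s, t)) has_vector_derivative (1 - \<delta> n) *\<^sub>R mol (\<delta> n) g2 (s, t)) (at t)" if "0 \<le> t" "t \<le> s" "s \<le> T" for s t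
          using mol_has_derivative[OF chi(3) cB \<delta>(1,3), of "(s, 0)" t n] in_cl[OF that] by simp
        show "((\<lambda>s. mol (\<delta> n) g2 (s, t)) has_vector_derivative (1 - \<delta> n) *\<^sub>R mol (\<delta> n) h (s, t)) (at s)" if "0 \<le> t" "t \<le> s" "s \<le> T" for s t
          using mol_has_derivative[OF g2(2) g2B \<delta>(1,3), of "(0, t)" s n] in_cl[OF that] by simp
        show "((\<lambda>t. mol (\<delta> n) chi (t, t)) has_vector_derivative (1 - \<delta> n) *\<^sub>R (mol (\<delta> n) g (t, t) + mol (\<delta> n) g2 (t, t))) (at t)" if "0 \<le> t" "t \<le> T" for t
        proof -
          \<comment> \<open>The two partial derivatives as one family over the basis, from which the
            derivative in direction (1, 1) is assembled.\<close>
          define gg where "gg i = (if i = (1, 0) then g else g2)" for i :: "real \<times> real"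
          have "has_weak_deriv ?S (1, 1) chi (\<lambda>x. \<Sum>i\<in>Basis. ((1, 1) \<bullet> i) *\<^sub>R gg i x)"
            by (rule has_weak_deriv_direction[OF oS]) (use chi(2,3) in \<open>auto simp: gg_def Basis_real_prod\<close>)
          then have w: "has_weak_deriv ?S (1, 1) chi (\<lambda>x. g x + g2 x)"
            by (simp add: Basis_real_prod gg_def)
          have "mol (\<delta> n) (\<lambda>x. g x + g2 x) p = mol (\<delta> n) g p + mol (\<delta> n) g2 p" for p
            unfolding mol_def using mol_integrand_integrable[OF gB \<delta>(1)[of n], of p] mol_integrand_integrable[OF g2B \<delta>(1)[of n], of p]
            by (simp add: scaleR_add_right)
          with mol_has_derivative[OF w cB \<delta>(1,3), of "(0, 0)" t n] in_cl[OF that(1) order_refl that(2)]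
          show ?thesis by simp
        qed
      qed (use \<delta>[of n] in auto)
    qed
  qed
qed

section \<open>The bound for the form\<close>

lemma AE_off_diagonal: "AE p :: real \<times> real in lborel. fst p \<noteq> snd p"
proof -
  have "negligible {p :: real \<times> real. (1, -1) \<bullet> p = 0}"
    by (rule negligible_hyperplane) (simp add: zero_prod_def)
  then have "{p :: real \<times> real. (1, -1) \<bullet> p = 0} \<in> null_sets lebesgue"
    by (simp add: negligible_iff_null_sets)
  then have "AE p :: real \<times> real in lebesgue. p \<notin> {p. (1, -1) \<bullet> p = 0}" by (rule AE_not_in)
  then have "AE p :: real \<times> real in lebesgue. fst p \<noteq> snd p"
    by eventually_elim (auto simp: inner_prod_def)
  then show ?thesis unfolding AE_completion_iff .
qed

lemma Wkinf_1_cont_rep: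
  fixes S :: "'a::euclidean_space set"
  assumes S: "open S" "convex S" "bounded S" "S \<noteq> {}" and f: "f \<in> Wkinf (Suc 0) S"
  obtains F where "continuous_on (closure S) F" "AE x in lebesgue_on S. F x = f x"
proof -
  obtain \<rho> where "mollifier S \<rho>" by (rule mollifier_exists[OF S])
  then interpret mollifier S \<rho> .
  show thesis by (rule cont_rep_exists[OF Wkinf_1_D(1)[OF f] Wkinf_1_D(2)[OF f]]) (use that in blast)+
qed

text \<open>A real supremum dominates its members only over a set that is bounded above; the bound
  comes from continuity of G on the compact closure.\<close>

lemma trace_sup:
  assumes S: "open S" "bounded S" and G: "continuous_on (closure S) G" "AE x in lebesgue_on S. G x = f x"
    and cl: "\<And>t. t \<in> {0..T} \<Longrightarrow> (t, t) \<in> closure S" and t: "t \<in> {0..T}"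
  shows "cmod (G (t, t)) \<le> (SUP t\<in>{0..T}. cmod (bdry_trace S f (t, t)))"
proof -
  have tr: "bdry_trace S f (t, t) = G (t, t)" if "t \<in> {0..T}" for t
    by (rule bdry_trace_eq[OF S(1) G cl[OF that]])
  have "bounded (G ` closure S)"
    using S(2) by (intro compact_imp_bounded compact_continuous_image[OF G(1)]) (simp add: compact_closure)
  then obtain C where C: "\<And>x. x \<in> closure S \<Longrightarrow> cmod (G x) \<le> C" by (auto simp: bounded_iff)
  have "bdd_above ((\<lambda>t. cmod (bdry_trace S f (t, t))) ` {0..T})"
    using C cl by (intro bdd_aboveI2[of _ _ C]) (simp add: tr)
  from cSUP_upper[OF t this] show ?thesis by (simp add: tr[OF t])
qed

text \<open>Cutting off u and v multiplies W by an indicator and does not leave the space, so the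
  assumed bound on the form controls all these indicators by one constant B. The two triangles then
  contribute separately, the diagonal being a null set.\<close>

lemma kernel_form_bound:
  assumes \<nu>: "\<bar>\<nu>\<bar> < 1/2" and T: "T > 0" and K: "K \<in> L2 (square T)" and CK: "CK \<ge> 0"
    and bound: "\<And>u v. u \<in> L2_Htilde \<nu> T \<Longrightarrow> v \<in> L2_Htilde \<nu> T \<Longrightarrow>
          cmod (kernel_form T K u v) \<le> CK * Htilde_norm \<nu> T u * Htilde_norm \<nu> T v"
    and chi: "chi \<in> Wkinf 1 (square T)" "\<And>t. t \<in> {0<..<T} \<Longrightarrow> bdry_trace (square T) chi (t, t) = 0"
    and chip: "chi \<in> Wkinf 2 (Delta_plus T)" and chim: "chi \<in> Wkinf 2 (Delta_minus T)"
    and u: "u \<in> L2_Htilde \<nu> T" and v: "v \<in> L2_Htilde \<nu> T"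
  shows "cmod (kernel_form T (\<lambda>p. chi p * K p) u v)
     \<le> T * CK * (8 * (cut_const \<nu> + 1)\<^sup>2) * (M_chi T chi + T * d12_norm T chi) * Htilde_norm \<nu> T u * Htilde_norm \<nu> T v"
proof -
  let ?u = "Htilde_norm \<nu> T u" and ?v = "Htilde_norm \<nu> T v"
  have nn: "Htilde_norm \<nu> T f \<ge> 0" for f by (simp add: Htilde_norm_def H_norm_nonneg)
  have uL: "u \<in> L2 {0<..<T}" and vL: "v \<in> L2 {0<..<T}" using u v by (auto simp: L2_Htilde_def)
  obtain W where W: "integrable lborel W" "\<And>p. p \<notin> square T \<Longrightarrow> W p = 0"
    and KW: "AE p in lborel. p \<in> square T \<longrightarrow> K p * u (fst p) * cnj (v (snd p)) = W p"
    by (rule kernel_borel_version[OF K uL vL]) blast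
  let ?cc = "cut_const \<nu>"
  have cc: "?cc \<ge> 0" by (rule cut_const_nonneg)
  \<comment> \<open>The factor 2(?cc + 1) covers either kind of cut-off; the product of two such
    factors is 4 (?cc + 1)^2.\<close>
  define B where "B = CK * (2 * (?cc + 1) * ?u) * (2 * (?cc + 1) * ?v)"
  have restr: "cmod (LINT p|lborel. of_bool (P (fst p) \<and> Q (snd p)) * W p) \<le> B"
    if PQ: "{p :: real \<times> real. P (fst p) \<and> Q (snd p)} \<in> sets borel"
      and eq: "\<And>s. u' s = (if P s then u s else 0)" "\<And>t. v' t = (if Q t then v t else 0)"
      and u': "u' \<in> L2_Htilde \<nu> T" "Htilde_norm \<nu> T u' \<le> 2 * (?cc + 1) * ?u"
      and v': "v' \<in> L2_Htilde \<nu> T" "Htilde_norm \<nu> T v' \<le> 2 * (?cc + 1) * ?v" for P Q u' v'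
  proof -
    \<comment> \<open>The form of the cut-off functions is the integral of the product indicator
      against W, which transfers the assumed bound to indicators.\<close>
    have "kernel_form T K u' v' = (LINT p|lborel. of_bool (P (fst p) \<and> Q (snd p)) * W p)"
    proof (rule kernel_form_eq[OF W])
      show "(\<lambda>p. of_bool (P (fst p) \<and> Q (snd p)) :: complex) \<in> borel_measurable borel"
        unfolding of_bool_def by (rule measurable_If) (use PQ in auto)
      show "AE p in lborel. p \<in> square T \<longrightarrow> K p * u' (fst p) * cnj (v' (snd p)) = of_bool (P (fst p) \<and> Q (snd p)) * W p"
        using KW by eventually_elim (auto simp: eq)
    qed
    then have "cmod (LINT p|lborel. of_bool (P (fst p) \<and> Q (snd p)) * W p) \<le> CK * Htilde_norm \<nu> T u' * Htilde_norm \<nu> T v'"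
      using bound[OF u'(1) v'(1)] by simp
    also have "\<dots> \<le> B"
      unfolding B_def using u'(2) v'(2) CK nn cc by (intro mult_mono) auto
    finally show ?thesis .
  qed
  have above: "Htilde_norm \<nu> T (cut_above \<tau> f) \<le> 2 * (?cc + 1) * Htilde_norm \<nu> T f" if "f \<in> L2_Htilde \<nu> T" for f \<tau>
    by (rule order_trans[OF L2_Htilde_cut_above(2)[OF that T \<nu>] mult_right_mono]) (use cc nn in auto)
  have Bp: "cmod (LINT p|lborel. of_bool (fst p \<le> a \<and> b < snd p) * W p) \<le> B" for a b
  proof (rule restr[where u'="cut_below a u" and v'="cut_above b v" and P="\<lambda>s. s \<le> a" and Q="\<lambda>t. b < t"])
    show "{p :: real \<times> real. fst p \<le> a \<and> b < snd p} \<in> sets borel" by (intro borel_ineq_sets continuous_intros)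
  qed (simp_all only: cut_below_def cut_above_def L2_Htilde_cut_below[OF u T \<nu>] L2_Htilde_cut_above(1)[OF v T \<nu>] above[OF v])
  \<comment> \<open>Below the diagonal the roles are exchanged: u keeps its part above b, and v its
    part up to a.\<close>
  have Bm: "cmod (LINT p|lborel. of_bool (snd p \<le> a \<and> b < fst p) * W p) \<le> B" for a b
  proof -
    have "cmod (LINT p|lborel. of_bool (b < fst p \<and> snd p \<le> a) * W p) \<le> B"
    proof (rule restr[where u'="cut_above b u" and v'="cut_below a v" and P="\<lambda>s. b < s" and Q="\<lambda>t. t \<le> a"])
      have "{p :: real \<times> real. snd p \<le> a \<and> b < fst p} \<in> sets borel" by (intro borel_ineq_sets continuous_intros)
      then show "{p :: real \<times> real. b < fst p \<and> snd p \<le> a} \<in> sets borel" by (simp add: conj_commute)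
    qed (simp_all only: cut_below_def cut_above_def L2_Htilde_cut_below[OF v T \<nu>] L2_Htilde_cut_above(1)[OF u T \<nu>] above[OF u])
    then show ?thesis by (simp add: conj_commute)
  qed
  let ?P = "Delta_plus T" and ?M = "Delta_minus T"
  note o = Delta_open_convex[of T] and ne = Delta_nonempty[OF T]
  have b: "bounded ?P" "bounded ?M"
    by (rule bounded_subset[OF square_bounded Delta_subset_square(1)], rule bounded_subset[OF square_bounded Delta_subset_square(2)])
  have "chi \<in> Wkinf (Suc 0) (square T)" using chi(1) by simp
  then obtain F where F: "continuous_on (closure (square T)) F" "AE p in lebesgue_on (square T). F p = chi p"
    by (rule Wkinf_1_cont_rep[OF o(3,6) square_bounded ne(3)])
  \<comment> \<open>Vanishing on the diagonal is assumed for traces; the continuous representative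
    inherits it pointwise.\<close>
  have F0: "F (t, t) = 0" if "t \<in> {0<..<T}" for t
  proof -
    have "(t, t) \<in> closure (square T)" using that closure_subset[of "square T"] by (auto simp: Delta_iff)
    from bdry_trace_eq[OF o(3) F this] chi(2)[OF that] show ?thesis by simp
  qed
  have FP: "AE p in lebesgue_on ?P. F p = chi p" "AE p in lebesgue_on ?M. F p = chi p"
    using F(2) Delta_subset_square[of T] unfolding lebesgue_on_integral_eq(4)[OF o(1)] lebesgue_on_integral_eq(4)[OF o(2)] lebesgue_on_integral_eq(4)[OF o(3)]
    by (auto elim!: eventually_mono)
  have E: "(1, 0) \<in> (Basis :: (real \<times> real) set)" "(0, 1) \<in> (Basis :: (real \<times> real) set)"
    by (auto simp: Basis_real_prod)
  obtain gp where gp: "gp \<in> Wkinf (Suc 0) ?P" "has_weak_deriv ?P (0, 1) chi gp" using Wkinf_2_D(2)[OF chip E(2)] by blast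
  obtain hp where hp: "hp \<in> Linf ?P" "has_weak_deriv ?P (1, 0) gp hp" using Wkinf_1_D(2)[OF gp(1) E(1)] by blast
  \<comment> \<open>Below the diagonal the trace concerns the s-derivative g1, whereas the mixed
    derivative comes from the t-derivative gm, in the order of \<open>d12_norm\<close>.\<close>
  obtain g1 where g1: "g1 \<in> Wkinf (Suc 0) ?M" "has_weak_deriv ?M (1, 0) chi g1" using Wkinf_2_D(2)[OF chim E(1)] by blast
  obtain gm where gm: "gm \<in> Wkinf (Suc 0) ?M" "has_weak_deriv ?M (0, 1) chi gm" using Wkinf_2_D(2)[OF chim E(2)] by blast
  obtain hm where hm: "hm \<in> Linf ?M" "has_weak_deriv ?M (1, 0) gm hm" using Wkinf_1_D(2)[OF gm(1) E(1)] by blast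
  note mix = mixed_deriv_bound[OF T gp(2) hp(2,1) gm(2) hm(2,1)]
  let ?D = "d12_norm T chi"
  have D: "LinfB ?P hp ?D" "LinfB ?M hm ?D" using mix by (simp_all add: max_absorb2)
  obtain Gp where Gp: "continuous_on (closure ?P) Gp" "AE p in lebesgue_on ?P. Gp p = gp p"
    by (rule Wkinf_1_cont_rep[OF o(1,4) b(1) ne(1) gp(1)])
  obtain Gm where Gm: "continuous_on (closure ?M) Gm" "AE p in lebesgue_on ?M. Gm p = g1 p"
    by (rule Wkinf_1_cont_rep[OF o(2,5) b(2) ne(2) g1(1)])
  define Ap where "Ap = (SUP t\<in>{0..T}. cmod (bdry_trace ?P (d2 ?P chi) (t, t)))"
  define Am where "Am = (SUP t\<in>{0..T}. cmod (bdry_trace ?M (d1 ?M chi) (t, t)))"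
  have M: "M_chi T chi = Ap + Am" by (simp add: M_chi_def Ap_def Am_def)
  have Ap: "cmod (Gp (t, t)) \<le> Ap" if "0 \<le> t" "t \<le> T" for t
    unfolding Ap_def
  proof (rule trace_sup[OF o(1) b(1) Gp(1)])
    have "AE p in lebesgue_on ?P. gp p = d2 ?P chi p"
      by (rule has_weak_deriv_unique[OF o(1) gp(2) weak_deriv_works[OF gp(2)]]) simp
    with Gp(2) show "AE p in lebesgue_on ?P. Gp p = d2 ?P chi p" by eventually_elim simp
  qed (use that Delta_plus_closure[OF T] in auto)
  have Am: "cmod (Gm (t, t)) \<le> Am" if "0 \<le> t" "t \<le> T" for t
    unfolding Am_def
  proof (rule trace_sup[OF o(2) b(2) Gm(1)])
    have "AE p in lebesgue_on ?M. g1 p = d1 ?M chi p"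
      by (rule has_weak_deriv_unique[OF o(2) g1(2) weak_deriv_works[OF g1(2)]]) simp
    with Gm(2) show "AE p in lebesgue_on ?M. Gm p = d1 ?M chi p" by eventually_elim simp
  qed (use that Delta_minus_closure[OF T] in auto)
  let ?Ip = "\<lambda>p. indicator ?P p *\<^sub>R F p" and ?Im = "\<lambda>p. indicator ?M p *\<^sub>R F p"
  have plus: "cmod (LINT p|lborel. ?Ip p * W p) \<le> B * (T * Ap + T\<^sup>2 * ?D)"
    by (rule plus_bound[OF T W Bp F(1) F0 FP(1) Wkinf_2_D(1)[OF chip] gp(2) Wkinf_1_D(1)[OF gp(1)] Gp hp(2) D(1) Ap])
  have minus: "cmod (LINT p|lborel. ?Im p * W p) \<le> B * (T * Am + T\<^sup>2 * ?D)"
    by (rule minus_bound[OF T W Bm F(1) F0 FP(2) Wkinf_2_D(1)[OF chim] g1(2) gm(2) Wkinf_1_D(1)[OF g1(1)] Gm Wkinf_1_D(1)[OF gm(1)] hm(2) D(2) Am])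
  have mI: "?Ip \<in> borel_measurable borel" "?Im \<in> borel_measurable borel"
  proof -
    have "continuous_on ?P F" "continuous_on ?M F"
      by (rule continuous_on_subset[OF F(1) order_trans[OF Delta_subset_square(1) closure_subset]],
          rule continuous_on_subset[OF F(1) order_trans[OF Delta_subset_square(2) closure_subset]])
    then show "?Ip \<in> borel_measurable borel" "?Im \<in> borel_measurable borel"
      using o by (auto intro!: borel_measurable_continuous_on_indicator)
  qed
  \<comment> \<open>F is bounded on the compact closure, so both pieces are integrable against W and
    the integral splits.\<close>
  obtain CF where CF: "CF \<ge> 0" "\<And>p. p \<in> closure (square T) \<Longrightarrow> cmod (F p) \<le> CF"
  proof -
    have "bounded (F ` closure (square T))"
      using square_bounded by (intro compact_imp_bounded compact_continuous_image[OF F(1)]) (simp add: compact_closure)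
    then obtain C where C: "C > 0" "\<forall>x\<in>F ` closure (square T). cmod x \<le> C" unfolding bounded_pos by blast
    show thesis by (rule that[of C]) (use C in auto)
  qed
  have int: "integrable lborel (\<lambda>p. indicator S p *\<^sub>R F p * W p)"
    if S: "(\<lambda>p. indicator S p *\<^sub>R F p) \<in> borel_measurable borel" "S \<subseteq> square T" for S
  proof (rule Bochner_Integration.integrable_bound)
    show "integrable lborel (\<lambda>p. CF *\<^sub>R W p)" using W(1) by simp
    show "(\<lambda>p. indicator S p *\<^sub>R F p * W p) \<in> borel_measurable lborel" using S(1) W(1) by (intro borel_measurable_times) auto
    show "AE p in lborel. norm (indicator S p *\<^sub>R F p * W p) \<le> norm (CF *\<^sub>R W p)"
    proof (rule AE_I2)
      fix p
      show "norm (indicator S p *\<^sub>R F p * W p) \<le> norm (CF *\<^sub>R W p)"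
        using CF(1) CF(2)[of p] S(2) closure_subset[of "square T"]
        by (auto simp: norm_mult intro!: mult_right_mono split: split_indicator)
    qed
  qed
  have "kernel_form T (\<lambda>p. chi p * K p) u v = (LINT p|lborel. (?Ip p + ?Im p) * W p)"
  proof (rule kernel_form_eq[OF W])
    show "(\<lambda>p. ?Ip p + ?Im p) \<in> borel_measurable borel" using mI by (rule borel_measurable_add)
    have "AE p in lborel. p \<in> square T \<longrightarrow> F p = chi p"
      using F(2) unfolding lebesgue_on_integral_eq(4)[OF o(3)] AE_completion_iff .
    with KW AE_off_diagonal
    show "AE p in lborel. p \<in> square T \<longrightarrow> chi p * K p * u (fst p) * cnj (v (snd p)) = (?Ip p + ?Im p) * W p"
    proof eventually_elim
      case (elim p)
      show ?case
      proof
        assume p: "p \<in> square T"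
        obtain s t where st: "p = (s, t)" by (cases p)
        have "s < t \<or> t < s" using elim(2) by (auto simp: st)
        then have "p \<in> ?P \<and> p \<notin> ?M \<or> p \<in> ?M \<and> p \<notin> ?P"
          using p by (auto simp: st Delta_iff)
        then have sum: "?Ip p + ?Im p = F p" by (elim disjE conjE) simp_all
        have KWp: "K p * u (fst p) * cnj (v (snd p)) = W p" using elim(1) p by blast
        have Fp: "F p = chi p" using elim(3) p by blast
        have "chi p * K p * u (fst p) * cnj (v (snd p)) = chi p * (K p * u (fst p) * cnj (v (snd p)))"
          by (simp only: mult.assoc)
        also have "\<dots> = (?Ip p + ?Im p) * W p" unfolding sum unfolding KWp Fp ..
        finally show "chi p * K p * u (fst p) * cnj (v (snd p)) = (?Ip p + ?Im p) * W p" .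
      qed
    qed
  qed
  also have "\<dots> = (LINT p|lborel. ?Ip p * W p) + (LINT p|lborel. ?Im p * W p)"
    unfolding distrib_right
    by (rule Bochner_Integration.integral_add[OF int[OF mI(1) Delta_subset_square(1)] int[OF mI(2) Delta_subset_square(2)]])
  finally have "cmod (kernel_form T (\<lambda>p. chi p * K p) u v) \<le> cmod (LINT p|lborel. ?Ip p * W p) + cmod (LINT p|lborel. ?Im p * W p)"
    by (simp only: norm_triangle_ineq)
  also have "\<dots> \<le> B * (T * Ap + T\<^sup>2 * ?D) + B * (T * Am + T\<^sup>2 * ?D)"
    by (rule add_mono[OF plus minus])
  also have "\<dots> = B * T * (M_chi T chi + T * (2 * ?D))"
    by (simp add: M power2_eq_square algebra_simps)
  \<comment> \<open>Each triangle was charged with the full norm of the mixed derivative; bounding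
    the trace part by twice itself extracts the common factor 2.\<close>
  also have "\<dots> \<le> B * T * (2 * (M_chi T chi + T * ?D))"
  proof (rule mult_left_mono)
    have "Ap \<ge> 0" "Am \<ge> 0"
      using order_trans[OF norm_ge_zero Ap[of 0]] order_trans[OF norm_ge_zero Am[of 0]] T by auto
    then show "M_chi T chi + T * (2 * ?D) \<le> 2 * (M_chi T chi + T * ?D)" by (simp add: M)
    show "0 \<le> B * T" unfolding B_def using CK cc nn T by (intro mult_nonneg_nonneg) auto
  qed
  also have "\<dots> = T * CK * (8 * (?cc + 1)\<^sup>2) * (M_chi T chi + T * ?D) * ?u * ?v"
    unfolding B_def power2_eq_square by algebra
  finally show ?thesis .
qed

theorem proposition5p4:
  fixes \<nu> :: real
  assumes "- (1/2) < \<nu>" and "\<nu> < 1/2"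
  shows "\<exists>C\<^sub>\<nu>::real. C\<^sub>\<nu> > 0 \<and>
    (\<forall>(T::real) (K::real \<times> real \<Rightarrow> complex) (C\<^sub>K::real) (chi::real \<times> real \<Rightarrow> complex).
       T > 0 \<longrightarrow>
       K \<in> L2 (square T) \<longrightarrow>
       (\<forall>u \<in> L2_Htilde \<nu> T. \<forall>v \<in> L2_Htilde \<nu> T.
          cmod (kernel_form T K u v) \<le> C\<^sub>K * Htilde_norm \<nu> T u * Htilde_norm \<nu> T v) \<longrightarrow>
       chi \<in> Wkinf 1 (square T) \<longrightarrow>
       (\<forall>t \<in> {0<..<T}. bdry_trace (square T) chi (t, t) = 0) \<longrightarrow>
       chi \<in> Wkinf 2 (Delta_plus T) \<longrightarrow>
       chi \<in> Wkinf 2 (Delta_minus T) \<longrightarrow>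
       (\<forall>u \<in> L2_Htilde \<nu> T. \<forall>v \<in> L2_Htilde \<nu> T.
          cmod (kernel_form T (\<lambda>p. chi p * K p) u v)
            \<le> T * C\<^sub>K * C\<^sub>\<nu> * (M_chi T chi + T * d12_norm T chi)
               * Htilde_norm \<nu> T u * Htilde_norm \<nu> T v))"
proof (intro exI[of _ "8 * (cut_const \<nu> + 1)\<^sup>2"] conjI allI impI ballI)
  show "8 * (cut_const \<nu> + 1)\<^sup>2 > 0"
    using cut_const_nonneg[of \<nu>] by simp
  fix T CK :: real and K chi u v
  assume T: "T > 0" and K: "K \<in> L2 (square T)"
    and bound: "\<forall>u\<in>L2_Htilde \<nu> T. \<forall>v\<in>L2_Htilde \<nu> T.
        cmod (kernel_form T K u v) \<le> CK * Htilde_norm \<nu> T u * Htilde_norm \<nu> T v"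
    and chi: "chi \<in> Wkinf 1 (square T)" "\<forall>t\<in>{0<..<T}. bdry_trace (square T) chi (t, t) = 0"
      "chi \<in> Wkinf 2 (Delta_plus T)" "chi \<in> Wkinf 2 (Delta_minus T)"
    and u: "u \<in> L2_Htilde \<nu> T" and v: "v \<in> L2_Htilde \<nu> T"
  have nn: "Htilde_norm \<nu> T f \<ge> 0" for f by (simp add: Htilde_norm_def H_norm_nonneg)
  \<comment> \<open>The given constant may be negative, while the estimates multiply by a
    nonnegative one, so its positive part is used first.\<close>
  have "cmod (kernel_form T K u v) \<le> max 0 CK * Htilde_norm \<nu> T u * Htilde_norm \<nu> T v"
    if "u \<in> L2_Htilde \<nu> T" "v \<in> L2_Htilde \<nu> T" for u v
  proof -
    have "CK * Htilde_norm \<nu> T u * Htilde_norm \<nu> T v \<le> max 0 CK * Htilde_norm \<nu> T u * Htilde_norm \<nu> T v"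
      by (intro mult_right_mono nn) simp
    with bound that show ?thesis by (meson order_trans)
  qed
  from kernel_form_bound[OF _ T K _ this chi(1) _ chi(3,4) u v] assms chi(2)
  have main: "cmod (kernel_form T (\<lambda>p. chi p * K p) u v)
     \<le> T * max 0 CK * (8 * (cut_const \<nu> + 1)\<^sup>2) * (M_chi T chi + T * d12_norm T chi) * Htilde_norm \<nu> T u * Htilde_norm \<nu> T v"
    by auto
  show "cmod (kernel_form T (\<lambda>p. chi p * K p) u v)
     \<le> T * CK * (8 * (cut_const \<nu> + 1)\<^sup>2) * (M_chi T chi + T * d12_norm T chi) * Htilde_norm \<nu> T u * Htilde_norm \<nu> T v"
  proof (cases "CK \<ge> 0")
    case True
    then show ?thesis using main by (simp add: max_absorb2)
  next
    case False
    \<comment> \<open>With v = u in the hypothesis, a negative constant forces the norm of u to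
      vanish, and then the right side is 0 for either constant.\<close>
    have "0 \<le> CK * Htilde_norm \<nu> T u * Htilde_norm \<nu> T u"
      using order_trans[OF norm_ge_zero] bound u by blast
    then have "Htilde_norm \<nu> T u = 0"
      using False nn[of u] by (auto simp: zero_le_mult_iff)
    then show ?thesis using main by simp
  qed
qed

end
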